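(* Let $d\ge1$, $\nu\in[-1/2,\infty)^d$ and $1<p<\infty$. The operators $\mathfrak{R}_\nu^i$ and $(\mathfrak{R}_\nu^M)^i$, $i=1,\dots,d$, extend uniquely to bounded linear operators on $L^p(d\eta_\nu)$. Moreover, $$\Big\|\big|\big(\mathfrak{R}_\nu^1,\dots,\mathfrak{R}_\nu^d\big)\big|_{\ell^2}\Big\|_{L^p(d\eta_\nu)\to L^p(d\eta_\nu)}\le 48(p^*-1),$$ $$\Big\|\big|\big((\mathfrak{R}_\nu^M)^1,\dots,(\mathfrak{R}_\nu^M)^d\big)\big|_{\ell^2}\Big\|_{L^p(d\eta_\nu)\to L^p(d\eta_\nu)}\le 48(p^*-1),$$ where $p^*=\max(p,p/(p-1))$.
   Context: One-dimensional objects: for $\nu>-1$ let $J_\nu$ be the Bessel function of the first kind of order $\nu$ on $(0,\infty)$, with successive positive zeros $0<\lambda_{1,\nu}<\lambda_{2,\nu}<\dots$. For $n\ge1$ and $x\in(0,1)$ set $$\phi_n^\nu(x)=\frac{\sqrt2}{|J_{\nu+1}(\lambda_{n,\nu})|}x^{-\nu}J_\nu(\lambda_{n,\nu}x),\qquad \varphi_n^\nu(x)=\frac{\phi_n^\nu(x)}{\phi_1^\nu(x)},\qquad d\eta_\nu(x)=x^{2\nu+1}[\phi_1^\nu(x)]^2dx.$$ The system $\{\varphi_n^\nu:n\ge1\}$ is an orthonormal basis of $L^2((0,1),d\eta_\nu)$. Multi-dimensional objects: for $\nu=(\nu_1,\dots,\nu_d)\in(-1,\infty)^d$, $\eta_\nu=\eta_{\nu_1}\otimes\dots\otimes\eta_{\nu_d}$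 is the product measure on $(0,1)^d$, $L^p(d\eta_\nu)=L^p((0,1)^d,d\eta_\nu)$, and $\varphi_n^\nu=\varphi_{n_1}^{\nu_1}\otimes\dots\otimes\varphi_{n_d}^{\nu_d}$ for $n=(n_1,\dots,n_d)\in\{1,2,\dots\}^d$; this is an orthonormal basis of $L^2(d\eta_\nu)$. Let $d_{\nu_i}=\partial/\partial x_i$. For $i=1,\dots,d$ the Riesz transforms are defined initially on $L^2(d\eta_\nu)$ (where they are contractions) by $$\mathfrak{R}_\nu^i f=\sum_{n}\Big(\sum_{j=1}^d\lambda_{n_j,\nu_j}^2\Big)^{-1/2}\langle f,\varphi_n^\nu\rangle_{d\eta_\nu}\,d_{\nu_i}\varphi_n^\nu,$$ $$(\mathfrak{R}_\nu^M)^i f=\sum_{n\ne(1,\dots,1)}\Big(\sum_{j=1}^d\big(\lambda_{n_j,\nu_j}^2-\lambda_{1,\nu_j}^2\big)\Big)^{-1/2}\langle f,\varphi_n^\nu\rangle_{d\eta_\nu}\,d_{\nu_i}\varphi_n^\nu,$$ the sums being over $n\in\{1,2,\dots\}^d$. The symbol $|(T^1,\dots,T^d)|_{\ell^2}$ denotes the operator $f\mapsto\big(\sum_{i=1}^d|T^if|^2\big)^{1/2}$, and its $L^p\to L^p$ norm is the smallest constant $C$ such that $\big\|\big(\sum_{i}|T^if|^2\big)^{1/2}\big\|_{L^p}\le C\|f\|_{L^p}$ for all $f\in L^p$. *)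

theory Defs
  imports "HOL-Analysis.Analysis"
begin

text \<open>Only used for \<open>\<nu> > -1\<close> and \<open>x > 0\<close>.\<close>
definition bessel_J :: "real \<Rightarrow> real \<Rightarrow> real" where
  "bessel_J \<nu> x =
     (\<Sum>m. (-1) ^ m / (fact m * Gamma (real m + \<nu> + 1)) * (x / 2) powr (2 * real m + \<nu>))"

text \<open>For \<open>n \<ge> 1\<close> this is the \<open>n\<close>-th positive zero; the value \<open>0\<close> at index \<open>0\<close>
  is only the starting point of the recursion and is not itself counted as a zero.\<close>
primrec bessel_zero :: "real \<Rightarrow> nat \<Rightarrow> real" where
  "bessel_zero \<nu> 0 = 0"
| "bessel_zero \<nu> (Suc n) = (LEAST x. bessel_zero \<nu> n < x \<and> bessel_J \<nu> x = 0)"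

definition bessel_phi :: "real \<Rightarrow> nat \<Rightarrow> real \<Rightarrow> real" where
  "bessel_phi \<nu> n x =
     sqrt 2 / \<bar>bessel_J (\<nu> + 1) (bessel_zero \<nu> n)\<bar> * x powr (-\<nu>) * bessel_J \<nu> (bessel_zero \<nu> n * x)"

definition bessel_varphi :: "real \<Rightarrow> nat \<Rightarrow> real \<Rightarrow> real" where
  "bessel_varphi \<nu> n x = bessel_phi \<nu> n x / bessel_phi \<nu> 1 x"

definition bessel_eta :: "real \<Rightarrow> real measure" where
  "bessel_eta \<nu> = density (restrict_space lborel {0<..<1})
     (\<lambda>x. ennreal (x powr (2 * \<nu> + 1) * (bessel_phi \<nu> 1 x)\<^sup>2))"

text \<open>Elements of \<open>L\<^sup>p\<close> are represented by functions, and all identities between them are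
  stated almost everywhere.\<close>
definition Lp :: "real \<Rightarrow> 'a measure \<Rightarrow> ('a \<Rightarrow> 'b::{real_normed_vector,second_countable_topology}) set" where
  "Lp p M = {f \<in> borel_measurable M. integrable M (\<lambda>x. norm (f x) powr p)}"

definition Lp_norm :: "real \<Rightarrow> 'a measure \<Rightarrow> ('a \<Rightarrow> 'b::{real_normed_vector,second_countable_topology}) \<Rightarrow> real" where
  "Lp_norm p M f = (LINT x|M. norm (f x) powr p) powr (1 / p)"

definition bounded_linear_Lp ::
  "real \<Rightarrow> 'a measure \<Rightarrow> (('a \<Rightarrow> complex) \<Rightarrow> ('a \<Rightarrow> complex)) \<Rightarrow> bool" where
  "bounded_linear_Lp p M T \<longleftrightarrow>
     (\<forall>f\<in>Lp p M. T f \<in> Lp p M) \<and>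
     (\<forall>f\<in>Lp p M. \<forall>g\<in>Lp p M. AE x in M. T (\<lambda>y. f y + g y) x = T f x + T g x) \<and>
     (\<forall>c. \<forall>f\<in>Lp p M. AE x in M. T (\<lambda>y. c * f y) x = c * T f x) \<and>
     (\<exists>C. \<forall>f\<in>Lp p M. Lp_norm p M (T f) \<le> C * Lp_norm p M f)"

text \<open>\<open>R\<close> is an operator given on \<open>L\<^sup>2\<close>; \<open>T\<close> extends it from \<open>L\<^sup>2 \<inter> L\<^sup>p\<close> to \<open>L\<^sup>p\<close>.\<close>
definition Lp_extension ::
  "real \<Rightarrow> 'a measure \<Rightarrow> (('a \<Rightarrow> complex) \<Rightarrow> ('a \<Rightarrow> complex)) \<Rightarrow> (('a \<Rightarrow> complex) \<Rightarrow> ('a \<Rightarrow> complex)) \<Rightarrow> bool" where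
  "Lp_extension p M R T \<longleftrightarrow>
     bounded_linear_Lp p M T \<and> (\<forall>f \<in> Lp 2 M \<inter> Lp p M. AE x in M. T f x = R f x)"

definition extends_uniquely_Lp ::
  "real \<Rightarrow> 'a measure \<Rightarrow> (('a \<Rightarrow> complex) \<Rightarrow> ('a \<Rightarrow> complex)) \<Rightarrow> bool" where
  "extends_uniquely_Lp p M R \<longleftrightarrow>
     (\<exists>T. Lp_extension p M R T \<and>
       (\<forall>T'. Lp_extension p M R T' \<longrightarrow> (\<forall>f\<in>Lp p M. AE x in M. T' f x = T f x)))"

definition l2_vec :: "('d::finite \<Rightarrow> ('a \<Rightarrow> complex) \<Rightarrow> ('a \<Rightarrow> complex)) \<Rightarrow> ('a \<Rightarrow> complex) \<Rightarrow> 'a \<Rightarrow> real" where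
  "l2_vec T f x = sqrt (\<Sum>i\<in>UNIV. (cmod (T i f x))\<^sup>2)"

text \<open>The value is \<open>\<infinity>\<close> if no finite constant is admissible.\<close>
definition Lp_op_norm :: "real \<Rightarrow> 'a measure \<Rightarrow> (('a \<Rightarrow> complex) \<Rightarrow> ('a \<Rightarrow> real)) \<Rightarrow> ennreal" where
  "Lp_op_norm p M S = Inf {ennreal C | C. 0 \<le> C \<and>
     (\<forall>f\<in>Lp p M. S f \<in> Lp p M \<and> Lp_norm p M (S f) \<le> C * Lp_norm p M f)}"

text \<open>Unconditional convergence of a series in \<open>L\<^sup>2\<close>.\<close>
definition has_L2_sum :: "'a measure \<Rightarrow> ('n \<Rightarrow> 'a \<Rightarrow> complex) \<Rightarrow> 'n set \<Rightarrow> ('a \<Rightarrow> complex) \<Rightarrow> bool" where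
  "has_L2_sum M u A g \<longleftrightarrow>
     (\<forall>n\<in>A. u n \<in> Lp 2 M) \<and> g \<in> Lp 2 M \<and>
     ((\<lambda>F. Lp_norm 2 M (\<lambda>x. (\<Sum>n\<in>F. u n x) - g x)) \<longlongrightarrow> 0) (finite_subsets_at_top A)"

text \<open>The sum is determined up to almost everywhere equality; a representative is chosen.\<close>
definition L2_sum :: "'a measure \<Rightarrow> ('n \<Rightarrow> 'a \<Rightarrow> complex) \<Rightarrow> 'n set \<Rightarrow> ('a \<Rightarrow> complex)" where
  "L2_sum M u A = (SOME g. has_L2_sum M u A g)"

text \<open>The dimension \<open>d\<close> is the cardinality of the finite index type \<open>'d\<close>.\<close>
definition eta_prod :: "('d::finite \<Rightarrow> real) \<Rightarrow> ('d \<Rightarrow> real) measure" where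
  "eta_prod \<nu> = (\<Pi>\<^sub>M i\<in>UNIV. bessel_eta (\<nu> i))"

definition varphi_prod :: "('d::finite \<Rightarrow> real) \<Rightarrow> ('d \<Rightarrow> nat) \<Rightarrow> ('d \<Rightarrow> real) \<Rightarrow> real" where
  "varphi_prod \<nu> n x = (\<Prod>i\<in>UNIV. bessel_varphi (\<nu> i) (n i) (x i))"

definition multi_indices :: "('d::finite \<Rightarrow> nat) set" where
  "multi_indices = {n. \<forall>i. 1 \<le> n i}"

definition partial_deriv :: "'d \<Rightarrow> (('d \<Rightarrow> real) \<Rightarrow> real) \<Rightarrow> ('d \<Rightarrow> real) \<Rightarrow> real" where
  "partial_deriv i F x = deriv (\<lambda>t. F (x(i := t))) (x i)"

definition fourier_coeff :: "('d::finite \<Rightarrow> real) \<Rightarrow> (('d \<Rightarrow> real) \<Rightarrow> complex) \<Rightarrow> ('d \<Rightarrow> nat) \<Rightarrow> complex" where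
  "fourier_coeff \<nu> f n = (LINT x|eta_prod \<nu>. f x * complex_of_real (varphi_prod \<nu> n x))"

definition riesz :: "('d::finite \<Rightarrow> real) \<Rightarrow> 'd \<Rightarrow> (('d \<Rightarrow> real) \<Rightarrow> complex) \<Rightarrow> ('d \<Rightarrow> real) \<Rightarrow> complex" where
  "riesz \<nu> i f = L2_sum (eta_prod \<nu>)
     (\<lambda>n x. complex_of_real ((\<Sum>j\<in>UNIV. (bessel_zero (\<nu> j) (n j))\<^sup>2) powr (-1/2)) *
            fourier_coeff \<nu> f n * complex_of_real (partial_deriv i (varphi_prod \<nu> n) x))
     multi_indices"

definition riesz_M :: "('d::finite \<Rightarrow> real) \<Rightarrow> 'd \<Rightarrow> (('d \<Rightarrow> real) \<Rightarrow> complex) \<Rightarrow> ('d \<Rightarrow> real) \<Rightarrow> complex" where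
  "riesz_M \<nu> i f = L2_sum (eta_prod \<nu>)
     (\<lambda>n x. complex_of_real
              ((\<Sum>j\<in>UNIV. (bessel_zero (\<nu> j) (n j))\<^sup>2 - (bessel_zero (\<nu> j) 1)\<^sup>2) powr (-1/2)) *
            fourier_coeff \<nu> f n * complex_of_real (partial_deriv i (varphi_prod \<nu> n) x))
     (multi_indices - {\<lambda>_. 1})"

end

theory Submission
 imports Defs "HOL-Probability.Probability"
begin

text \<open>Bellman function method. On \<open>(0, 1)\<close> the functions \<open>f\<^sub>n = \<phi>\<^sub>n / \<phi>\<^sub>1\<close> satisfy
 \<open>f'' + om f' + L\<^sub>n f = 0\<close>, where \<open>w = x powr (2 \<nu> + 1) * \<phi>\<^sub>1\<^sup>2\<close>, \<open>om = w' / w\<close> and \<open>L\<^sub>n = \<lambda>\<^sub>n\<^sup>2 - \<lambda>\<^sub>1\<^sup>2\<close>,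
 and the derivatives satisfy the same equation with the additional potential \<open>V = - om'\<close>. The condition
 \<open>\<nu> \<ge> - 1 / 2\<close> enters only through \<open>V \<ge> 0\<close>. Both Riesz transforms are of the form
 \<open>f \<mapsto> \<partial>\<^sub>i (a + L)\<^sup>-\<^sup>1\<^sup>/\<^sup>2 f\<close> with \<open>a \<ge> 0\<close>. Expand \<open>f\<close> in the \<open>f\<^sub>n\<close> and \<open>g\<^sub>i\<close> in the \<open>\<partial>\<^sub>i f\<^sub>n\<close>, let \<open>u\<close> and \<open>v\<^sub>i\<close>
 be the Poisson extensions of \<open>f\<close> and \<open>g\<^sub>i\<close> to \<open>t > 0\<close>, and let \<open>b(t)\<close> be the integral of \<open>B(\<bar>u\<bar>\<^sup>2, \<bar>v\<bar>\<^sup>2)\<close> for a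
 Bellman function \<open>B\<close> adapted to \<open>L\<^sup>p \<times> L\<^sup>q\<close>. The convexity of \<open>B\<close> bounds \<open>b''\<close> from below by
 the integrand of a \<open>t\<close>-integral that represents the pairing of the Riesz vector of \<open>f\<close> with \<open>g\<close>, so this
 pairing is dominated by \<open>b(0)\<close>; duality then gives the bound \<open>18 (p\<^sup>* - 1)\<close>.\<close>

section \<open>The Bellman function\<close>

text \<open>Two obstacles shape the proof. The Bellman function of Nazarov and Treil is not smooth
  at the origin and grows faster than quadratically, while finite sums of modes approximate in L^2
  only. So a shift \<open>\<epsilon>\<close> keeps both arguments positive and a cap
  \<open>k\<close> makes the growth linear in the squared moduli; finite sums, L^2 and L^p are
  treated in this order, and both parameters tend to 0 only after L^2 has been reached. Secondly,
  completeness has to be proved, for the modes and for their derivatives. It rests on counting: mode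
  N + 1 has exactly N interior zeros, so a nontrivial combination of a given function and the first
  N modes vanishes at all of them, and a ground state argument on the nodal intervals gives a
  Poincare inequality with constant \<open>L (Suc N)\<close>. The Bellman function is built for p
  \<ge> 2; below 2 its arguments are exchanged and the conjugate exponent takes over. With p the
  larger exponent and g = 1 / (p - 1), the form bound has \<kappa> = g / 8, the embedding reads g /
  16 times the pairing \<le> 1 + g / 11 for unit norms, and 16 + 16 / 11 \<le> 18.\<close>

lemma weight_product_form_bound:
 fixes a b A D T T1 T2 p q X Y \<xi> \<zeta> :: real
 assumes pos: "0 < a" "0 < b" "0 < A" "0 < D" "0 < T" and p: "2 \<le> p" and q: "1 \<le> q" "q \<le> 2"
  and T1: "0 \<le> T1" "T1 * (A + D) \<le> T" and T2: "- (1 + 1 / p) * T1 \<le> T2 * (A + D)"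
  and Ta: "T * a \<le> A + D" and \<xi>: "\<xi>^2 \<le> 4 * a * X" and \<zeta>: "\<zeta>^2 \<le> 4 * b * Y"
  and Na: "Na = p / 2 * A / a" and Naa: "Naa = p / 2 * (p / 2 - 1) * A / a^2"
  and Nb: "Nb = q / 2 * D / b" and Nbb: "Nbb = q / 2 * (q / 2 - 1) * D / b^2"
 shows "T * X - 11 / 2 * q^2 * (D / b) * Y \<le>
  2 * (T + a * T1 * Na) * X + 2 * (a * T1 * Nb) * Y + (2 * T1 * Na + a * (T2 * Na^2 + T1 * Naa)) * \<xi>^2
  + 2 * (T1 * Nb + a * T2 * Na * Nb) * \<xi> * \<zeta> + a * (T2 * Nb^2 + T1 * Nbb) * \<zeta>^2"
proof -
 \<comment> \<open>The expression is the Hessian form of a * T(N) with N = A + D. Below,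
   \<open>x\<close>, \<open>y\<close> and \<open>x + y\<close> are the increments of
   \<open>A\<close>, \<open>D\<close> and \<open>N\<close> that belong to increments
   \<open>\<xi>\<close>, \<open>\<zeta>\<close> of the arguments.\<close>
 define N where "N = A + D"
 have N: "0 < N" using pos by (simp add: N_def)
 define x where "x = Na * \<xi>"
 define y where "y = Nb * \<zeta>"
 define k where "k = 1 + 1 / p"
 have k: "1 \<le> k" "k \<le> 3 / 2" "k \<le> 1 + 3 / p" using p by (auto simp: k_def field_simps)
 have X0: "\<xi>^2 / (4 * a) \<le> X" and Y0: "\<zeta>^2 / (4 * b) \<le> Y"
  using \<xi> \<zeta> pos by (auto simp: field_simps)
 have NN: "Na \<ge> 0" "Nb \<ge> 0" using pos p q by (auto simp: Na Nb)
 have split: "2 * (T + a * T1 * Na) * X + 2 * (a * T1 * Nb) * Y + (2 * T1 * Na + a * (T2 * Na^2 + T1 * Naa)) * \<xi>^2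
  + 2 * (T1 * Nb + a * T2 * Na * Nb) * \<xi> * \<zeta> + a * (T2 * Nb^2 + T1 * Nbb) * \<zeta>^2
  = 2 * T * X + T1 * (2 * a * Na * X + (2 * Na + a * Naa) * \<xi>^2 + (2 * a * Nb * Y + a * Nbb * \<zeta>^2) + 2 * \<xi> * y)
   + a * T2 * (x + y)^2" unfolding x_def y_def by algebra
 \<comment> \<open>Exact evaluation at the smallest admissible \<open>X\<close> gives the
   coefficient 1 + 3 / p. It exceeds \<open>k\<close> = 1 + 1 / p, the multiple of \<open>T1\<close>
   by which \<open>T2\<close> may be negative.\<close>
 have e1: "2 * a * Na * X + (2 * Na + a * Naa) * \<xi>^2 \<ge> a * k * x^2 / A"
 proof -
  have "2 * a * Na * (\<xi>^2 / (4 * a)) + (2 * Na + a * Naa) * \<xi>^2 = (a * (1 + 3 / p) * x^2 / A)"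
   unfolding x_def Na Naa using pos p by (simp add: field_simps power2_eq_square)
  moreover have "2 * a * Na * (\<xi>^2 / (4 * a)) \<le> 2 * a * Na * X" using X0 pos NN by (intro mult_left_mono) auto
  moreover have "a * k * x^2 / A \<le> a * (1 + 3 / p) * x^2 / A"
   using k pos by (intro divide_right_mono mult_right_mono mult_left_mono) auto
  ultimately show ?thesis by linarith
 qed
 have e2: "2 * a * Nb * Y + a * Nbb * \<zeta>^2 \<ge> 0"
 proof -
  have "2 * a * Nb * (\<zeta>^2 / (4 * b)) + a * Nbb * \<zeta>^2 = a * q * D * (q - 1) * \<zeta>^2 / (4 * b^2)"
   unfolding Nb Nbb using pos by (simp add: field_simps power2_eq_square)
  moreover have "\<dots> \<ge> 0" using pos q by simp
  moreover have "2 * a * Nb * (\<zeta>^2 / (4 * b)) \<le> 2 * a * Nb * Y"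
   using Y0 pos NN by (intro mult_left_mono) auto
  ultimately show ?thesis by linarith
 qed
 \<comment> \<open>\<open>T2\<close> is multiplied by \<open>(x + y)^2\<close>. The splitting
   charges the share of \<open>A\<close> to \<open>e1\<close> and leaves the share of
   \<open>D\<close> to \<open>e5\<close>.\<close>
 have cs: "(x + y)^2 / N \<le> x^2 / A + y^2 / D"
 proof -
  have "x^2 / A + y^2 / D - (x + y)^2 / N = (D * x - A * y)^2 / (A * D * N)"
   using pos N unfolding N_def by (simp add: field_simps power2_eq_square)
  moreover have "\<dots> \<ge> 0" using pos N by simp
  ultimately show ?thesis by linarith
 qed
 have e3: "a * T2 * (x + y)^2 \<ge> - (T1 * (a * k * x^2 / A)) - T1 * (a * k * y^2 / D)"
 proof -
  have "- k * T1 / N \<le> T2" using T2 N unfolding N_def k_def by (simp add: field_simps)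
  hence "a * T2 * (x + y)^2 \<ge> a * (- k * T1 / N) * (x + y)^2"
   using pos by (intro mult_right_mono mult_left_mono) auto
  moreover have "a * (- k * T1 / N) * (x + y)^2 = - (a * k * T1 * ((x + y)^2 / N))" by simp
  moreover have "a * k * T1 * ((x + y)^2 / N) \<le> a * k * T1 * (x^2 / A + y^2 / D)"
   using cs pos k T1 by (intro mult_left_mono) auto
  ultimately show ?thesis by (simp add: algebra_simps)
 qed
 define z where "z = y^2 / D"
 have z: "0 \<le> z" "z \<le> q^2 * (D / b) * Y"
 proof -
  show "0 \<le> z" using pos by (simp add: z_def)
  have "z = q^2 * (D / b) * (\<zeta>^2 / (4 * b))"
   unfolding z_def y_def Nb using pos by (simp add: field_simps power2_eq_square)
  also have "\<dots> \<le> q^2 * (D / b) * Y" using Y0 pos by (intro mult_left_mono) auto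
  finally show "z \<le> q^2 * (D / b) * Y" .
 qed
 have TN: "T1 \<le> T / N" using T1 N unfolding N_def by (simp add: field_simps)
 have TaN: "T * (a / N) \<le> 1" using Ta N unfolding N_def by (simp add: field_simps)
 \<comment> \<open>The mixed term consumes one of the two copies of \<open>T * X\<close> and costs 4
   z. Together with the 3 / 2 z of \<open>e5\<close> this is the factor 11 / 2 of the claim.\<close>
 have e4: "T1 * (2 * \<xi> * y) \<ge> - T * X - 4 * z"
 proof -
  have "0 \<le> T / (4 * a) * (\<xi> + 4 * a * y / N)^2" using pos by simp
  also have "\<dots> = T * (\<xi>^2 / (4 * a)) + 2 * (T / N) * \<xi> * y + 4 * (T * (a / N)) * (y^2 / N)"
   using pos N by (simp add: field_simps power2_eq_square)
  finally have 1: "2 * (T / N) * \<xi> * y \<ge> - (T * (\<xi>^2 / (4 * a))) - 4 * (T * (a / N)) * (y^2 / N)" by linarith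
  have "0 \<le> T / (4 * a) * (\<xi> - 4 * a * y / N)^2" using pos by simp
  also have "\<dots> = T * (\<xi>^2 / (4 * a)) - 2 * (T / N) * \<xi> * y + 4 * (T * (a / N)) * (y^2 / N)"
   using pos N by (simp add: field_simps power2_eq_square)
  finally have "\<bar>2 * (T / N) * \<xi> * y\<bar> \<le> T * (\<xi>^2 / (4 * a)) + 4 * (T * (a / N)) * (y^2 / N)"
   using 1 by linarith
  moreover have "\<bar>T1 * (2 * \<xi> * y)\<bar> \<le> \<bar>2 * (T / N) * \<xi> * y\<bar>"
  proof -
   have "\<bar>T1 * (2 * \<xi> * y)\<bar> = T1 * \<bar>2 * \<xi> * y\<bar>" using T1 by (simp add: abs_mult)
   also have "\<dots> \<le> (T / N) * \<bar>2 * \<xi> * y\<bar>" by (intro mult_right_mono TN) auto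
   also have "\<dots> = \<bar>2 * (T / N) * \<xi> * y\<bar>" using pos N by (simp add: abs_mult)
   finally show ?thesis .
  qed
  moreover have "T * (\<xi>^2 / (4 * a)) \<le> T * X" using X0 pos by (intro mult_left_mono) auto
  moreover have "(T * (a / N)) * (y^2 / N) \<le> 1 * z"
   unfolding z_def using TaN pos N by (intro mult_mono divide_left_mono) (auto simp: N_def)
  ultimately show ?thesis by linarith
 qed
 have e5: "T1 * (a * k * y^2 / D) \<le> 3 / 2 * z"
 proof -
  have "T1 * (a * k * y^2 / D) = (T1 * a) * (k * z)" by (simp add: z_def)
  also have "\<dots> \<le> 1 * (3 / 2 * z)"
  proof (intro mult_mono)
   have "T1 * a \<le> (T / N) * a" using TN pos by (intro mult_right_mono) auto
   thus "T1 * a \<le> 1" using TaN by simp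
  qed (use k z in \<open>auto intro!: mult_right_mono\<close>)
  finally show ?thesis by simp
 qed
 have e6: "T1 * (2 * a * Na * X + (2 * Na + a * Naa) * \<xi>^2 + (2 * a * Nb * Y + a * Nbb * \<zeta>^2) + 2 * \<xi> * y)
  \<ge> T1 * (a * k * x^2 / A) + T1 * (2 * \<xi> * y)"
  unfolding distrib_left[symmetric] using e1 e2 T1 by (intro mult_left_mono) auto
 show ?thesis unfolding split using e3 e4 e5 e6 z by linarith
qed

abbreviation continuous_pos :: "(real \<Rightarrow> real \<Rightarrow> real) \<Rightarrow> bool" where
 "continuous_pos f \<equiv> continuous_on ({0<..} \<times> {0<..}) (\<lambda>(a, b). f a b)"

text \<open>The arguments stand for \<epsilon> + |u|^2 and \<epsilon> + |v|^2, \<open>X\<close> and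
  \<open>Y\<close> for squared derivatives of u and v, \<open>\<xi>\<close> and
  \<open>\<zeta>\<close> for the derivatives of the arguments; the side conditions of
  \<open>form\<close> are then Cauchy-Schwarz. The ratio \<open>r\<close> depends on the point but
  not on the direction, so that the forms of several directions can be added before the inequality
  of the means is applied. Derivatives are stated as chain rules along curves because B is only ever
  differentiated along t or along one coordinate.\<close>

locale bellman =
 fixes \<kappa> :: real and B Ba Bb Baa Bab Bbb :: "real \<Rightarrow> real \<Rightarrow> real"
 assumes kappa_pos: "0 < \<kappa>"
  and nonneg: "\<And>a b. 0 < a \<Longrightarrow> 0 < b \<Longrightarrow> 0 \<le> B a b"
   "\<And>a b. 0 < a \<Longrightarrow> 0 < b \<Longrightarrow> 0 \<le> Ba a b"
   "\<And>a b. 0 < a \<Longrightarrow> 0 < b \<Longrightarrow> 0 \<le> Bb a b"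
  and form: "\<And>a b. 0 < a \<Longrightarrow> 0 < b \<Longrightarrow> \<exists>r>0. \<forall>\<xi> \<zeta> X Y. \<xi>\<^sup>2 \<le> 4 * a * X \<longrightarrow> \<zeta>\<^sup>2 \<le> 4 * b * Y \<longrightarrow>
   \<kappa> * (r * X + Y / r) \<le> 2 * Ba a b * X + 2 * Bb a b * Y + Baa a b * \<xi>^2 + 2 * Bab a b * \<xi> * \<zeta> + Bbb a b * \<zeta>^2"
  and deriv: "\<And>f g f' g' s. DERIV f s :> f' \<Longrightarrow> DERIV g s :> g' \<Longrightarrow> 0 < f s \<Longrightarrow> 0 < g s \<Longrightarrow>
    DERIV (\<lambda>s. B (f s) (g s)) s :> Ba (f s) (g s) * f' + Bb (f s) (g s) * g'"
   "\<And>f g f' g' s. DERIV f s :> f' \<Longrightarrow> DERIV g s :> g' \<Longrightarrow> 0 < f s \<Longrightarrow> 0 < g s \<Longrightarrow>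
    DERIV (\<lambda>s. Ba (f s) (g s)) s :> Baa (f s) (g s) * f' + Bab (f s) (g s) * g'"
   "\<And>f g f' g' s. DERIV f s :> f' \<Longrightarrow> DERIV g s :> g' \<Longrightarrow> 0 < f s \<Longrightarrow> 0 < g s \<Longrightarrow>
    DERIV (\<lambda>s. Bb (f s) (g s)) s :> Bab (f s) (g s) * f' + Bbb (f s) (g s) * g'"
  and cont: "continuous_pos B" "continuous_pos Ba" "continuous_pos Bb" "continuous_pos Baa" "continuous_pos Bab" "continuous_pos Bbb"

text \<open>Exchanging the arguments turns \<open>r\<close> into \<open>1 / r\<close>. Exponents
  below 2 are reached in this way.\<close>

lemma (in bellman) flip: "bellman \<kappa> (\<lambda>a b. B b a) (\<lambda>a b. Bb b a) (\<lambda>a b. Ba b a) (\<lambda>a b. Bbb b a) (\<lambda>a b. Bab b a) (\<lambda>a b. Baa b a)"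
proof
 show "0 < \<kappa>" by (rule kappa_pos)
 fix a b :: real assume ab: "0 < a" "0 < b"
 obtain r where r: "r > 0" and *: "\<And>\<xi> \<zeta> X Y. \<xi>\<^sup>2 \<le> 4 * b * X \<Longrightarrow> \<zeta>\<^sup>2 \<le> 4 * a * Y \<Longrightarrow>
   \<kappa> * (r * X + Y / r) \<le> 2 * Ba b a * X + 2 * Bb b a * Y + Baa b a * \<xi>^2 + 2 * Bab b a * \<xi> * \<zeta> + Bbb b a * \<zeta>^2"
  using form[OF ab(2,1)] by auto
 show "\<exists>r>0. \<forall>\<xi> \<zeta> X Y. \<xi>\<^sup>2 \<le> 4 * a * X \<longrightarrow> \<zeta>\<^sup>2 \<le> 4 * b * Y \<longrightarrow>
   \<kappa> * (r * X + Y / r) \<le> 2 * Bb b a * X + 2 * Ba b a * Y + Bbb b a * \<xi>^2 + 2 * Bab b a * \<xi> * \<zeta> + Baa b a * \<zeta>^2"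
 proof (intro exI[of _ "1 / r"] conjI allI impI)
  fix \<xi> \<zeta> X Y :: real assume "\<xi>^2 \<le> 4 * a * X" "\<zeta>^2 \<le> 4 * b * Y"
  from *[OF this(2,1)] show "\<kappa> * (1 / r * X + Y / (1 / r)) \<le> 2 * Bb b a * X + 2 * Ba b a * Y + Bbb b a * \<xi>^2 + 2 * Bab b a * \<xi> * \<zeta> + Baa b a * \<zeta>^2"
   using r by (simp add: algebra_simps)
 qed (use r in auto)
 show "0 \<le> B b a" "0 \<le> Bb b a" "0 \<le> Ba b a" using nonneg ab by auto
next
 fix f g :: "real \<Rightarrow> real" and f' g' s :: real
 assume a: "DERIV f s :> f'" "DERIV g s :> g'" "0 < f s" "0 < g s"
 show "DERIV (\<lambda>s. B (g s) (f s)) s :> Bb (g s) (f s) * f' + Ba (g s) (f s) * g'"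
  using deriv(1)[OF a(2,1,4,3)] by (simp add: add.commute)
 show "DERIV (\<lambda>s. Bb (g s) (f s)) s :> Bbb (g s) (f s) * f' + Bab (g s) (f s) * g'"
  using deriv(3)[OF a(2,1,4,3)] by (simp add: add.commute)
 show "DERIV (\<lambda>s. Ba (g s) (f s)) s :> Bab (g s) (f s) * f' + Baa (g s) (f s) * g'"
  using deriv(2)[OF a(2,1,4,3)] by (simp add: add.commute)
next
 have sw: "continuous_pos (\<lambda>a b. f b a)" if "continuous_pos f" for f
 proof -
  have "continuous_on ({0<..} \<times> {0<..}) ((\<lambda>(a, b). f a b) \<circ> prod.swap)"
   by (intro continuous_on_compose continuous_on_subset[OF that]) (auto intro: continuous_on_swap)
  thus ?thesis by (simp add: comp_def case_prod_beta)
 qed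
 show "continuous_pos (\<lambda>a b. B b a)" "continuous_pos (\<lambda>a b. Bb b a)" "continuous_pos (\<lambda>a b. Ba b a)"
  "continuous_pos (\<lambda>a b. Bbb b a)" "continuous_pos (\<lambda>a b. Bab b a)" "continuous_pos (\<lambda>a b. Baa b a)"
  by (rule sw[OF cont(1)] sw[OF cont(3)] sw[OF cont(2)] sw[OF cont(6)] sw[OF cont(5)] sw[OF cont(4)])+
qed

text \<open>For k = 0 this is N powr (1 - 2 / p). With N = |u|^p + |v|^q the product of |u|^2 and
  this weight behaves like |u|^p where |u|^p dominates and like |u|^2 |v|^(2 - q) elsewhere: a
  smooth substitute for the two branches of the function of Nazarov and Treil.\<close>

definition pw_T :: "real \<Rightarrow> real \<Rightarrow> real \<Rightarrow> real" where
 "pw_T p k N = (N powr (- 1 / p) + k) powr (2 - p)"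
definition pw_T1 :: "real \<Rightarrow> real \<Rightarrow> real \<Rightarrow> real" where
 "pw_T1 p k N = (1 - 2 / p) * N powr (- 1 / p - 1) * (N powr (- 1 / p) + k) powr (1 - p)"
definition pw_T2 :: "real \<Rightarrow> real \<Rightarrow> real \<Rightarrow> real" where
 "pw_T2 p k N = (1 - 2 / p) * ((- 1 / p - 1) * N powr (- 1 / p - 2) * (N powr (- 1 / p) + k) powr (1 - p)
  + (1 - 1 / p) * (N powr (- 1 / p - 1))^2 * (N powr (- 1 / p) + k) powr (- p))"

lemma pw_T_deriv:
 assumes "0 < N" "0 < k" "2 \<le> p"
 shows "DERIV (pw_T p k) N :> pw_T1 p k N"
  and "DERIV (pw_T1 p k) N :> pw_T2 p k N"
proof -
 have u: "DERIV (\<lambda>N. N powr (- 1 / p) + k) N :> (- 1 / p) * N powr (- 1 / p - 1)"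
  using assms by (auto intro!: derivative_eq_intros has_real_derivative_powr)
 have u0: "N powr (- 1 / p) + k > 0" using assms by (intro add_nonneg_pos) auto
 have up: "DERIV (\<lambda>N. (N powr (- 1 / p) + k) powr r) N :> r * (N powr (- 1 / p) + k) powr (r - 1) * ((- 1 / p) * N powr (- 1 / p - 1))" for r
  using DERIV_chain2[OF has_real_derivative_powr[OF u0] u] by simp
 show "DERIV (pw_T p k) N :> pw_T1 p k N" unfolding pw_T_def[abs_def] pw_T1_def
  by (rule DERIV_cong[OF up]) (use assms in \<open>simp add: field_simps\<close>)
 have up1: "DERIV (\<lambda>N. N powr (- 1 / p - 1)) N :> (- 1 / p - 1) * N powr (- 1 / p - 2)"
  using has_real_derivative_powr[OF assms(1), of "- 1 / p - 1"] by (simp add: algebra_simps)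
 have a: "1 - p - 1 = - p" by simp
 have c: "(1 - p) * x * (- 1 / p * y) = (1 - 1 / p) * (x * y)" for x y using assms by (simp add: field_simps)
 show "DERIV (pw_T1 p k) N :> pw_T2 p k N" unfolding pw_T1_def[abs_def] pw_T2_def mult.assoc
  apply (rule DERIV_cong[OF DERIV_cmult[OF DERIV_mult[OF up1 up]]])
  unfolding a c by (simp add: algebra_simps power2_eq_square)
qed

text \<open>The first four facts feed \<open>weight_product_form_bound\<close>. With u the base of
  the power they rest on \<open>N powr (- 1 / p) \<le> u\<close> and on the sign of the second
  summand of \<open>pw_T2\<close>; the last two compare u with each of its summands.\<close>

lemma pw_T_bounds:
 assumes N: "0 < N" and k: "0 < k" and p: "2 \<le> p"
 shows "0 < pw_T p k N" "0 \<le> pw_T1 p k N" "pw_T1 p k N * N \<le> pw_T p k N"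
  "- (1 + 1 / p) * pw_T1 p k N \<le> pw_T2 p k N * N"
  "pw_T p k N \<le> N powr ((p - 2) / p)" "pw_T p k N \<le> k powr (2 - p)"
proof -
 define u where "u = N powr (- 1 / p) + k"
 have u0: "u > 0" using N k unfolding u_def by (intro add_nonneg_pos) auto
 have uN: "N powr (- 1 / p) \<le> u" using k by (simp add: u_def)
 show "0 < pw_T p k N" using u0 by (simp add: pw_T_def u_def)
 show T1: "0 \<le> pw_T1 p k N" using p by (simp add: pw_T1_def)
 have "pw_T1 p k N * N = (1 - 2 / p) * (N powr (- 1 / p) * u powr (1 - p))"
  using N by (simp add: pw_T1_def u_def powr_diff)
 also have "\<dots> \<le> 1 * (u * u powr (1 - p))" using p uN u0 by (intro mult_mono) auto
 also have "\<dots> = u powr (2 - p)" using u0 by (simp add: powr_mult_base)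
 finally show "pw_T1 p k N * N \<le> pw_T p k N" by (simp add: pw_T_def u_def)
 have "pw_T2 p k N * N = - (1 + 1 / p) * pw_T1 p k N + (1 - 2 / p) * ((1 - 1 / p) * (N powr (- 1 / p - 1))^2 * u powr (- p)) * N"
 proof -
  have "N powr (- 1 / p - 2) * N = N powr (- 1 / p - 1)" using N by (simp add: powr_diff power2_eq_square)
  moreover have "pw_T2 p k N * N = (1 - 2 / p) * ((- 1 / p - 1) * (N powr (- 1 / p - 2) * N) * u powr (1 - p)
   + (1 - 1 / p) * (N powr (- 1 / p - 1))^2 * u powr (- p) * N)" by (simp add: pw_T2_def u_def algebra_simps)
  ultimately show ?thesis by (simp add: pw_T1_def u_def algebra_simps diff_divide_distrib add_divide_distrib)
 qed
 moreover have "(1 - 2 / p) * ((1 - 1 / p) * (N powr (- 1 / p - 1))^2 * u powr (- p)) * N \<ge> 0"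
  using p N by (intro mult_nonneg_nonneg) auto
 ultimately show "- (1 + 1 / p) * pw_T1 p k N \<le> pw_T2 p k N * N" by linarith
 have "u powr (2 - p) \<le> (N powr (- 1 / p)) powr (2 - p)" using p N uN by (intro powr_mono2') auto
 also have "\<dots> = N powr ((p - 2) / p)" proof -
  have "- 1 / p * (2 - p) = (p - 2) / p" using p by (simp add: field_simps)
  thus ?thesis by (simp only: powr_powr)
 qed
 finally show "pw_T p k N \<le> N powr ((p - 2) / p)" by (simp add: pw_T_def u_def)
 have "u powr (2 - p) \<le> k powr (2 - p)" using p k by (intro powr_mono2') (auto simp: u_def)
 thus "pw_T p k N \<le> k powr (2 - p)" by (simp add: pw_T_def u_def)
qed

lemma pw_T_le:
 assumes N: "0 < N" "a powr (p / 2) \<le> N" and a: "0 < a" and k: "0 < k" and p: "2 \<le> p"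
 shows "pw_T p k N * a \<le> N"
proof -
 have "a = (a powr (p / 2)) powr (2 / p)" using a p by (simp add: powr_powr)
 also have "\<dots> \<le> N powr (2 / p)" using p a N by (intro powr_mono2) auto
 finally have "pw_T p k N * a \<le> N powr ((p - 2) / p) * N powr (2 / p)"
  using pw_T_bounds(5)[OF N(1) k p] a by (intro mult_mono) auto
 also have "\<dots> = N powr 1" unfolding powr_add[symmetric] using p by (simp add: field_simps)
 finally show ?thesis using N by simp
qed

text \<open>For k = 0 this is b powr ((1 + g) / 2) with g = 1 / (p - 1), that is |v|^q for the
  conjugate exponent q = 1 + g. The cap is placed so that the function is b times a weight W whose
  reciprocal is dominated by \<open>pw_T\<close>.\<close>

definition pw_D :: "real \<Rightarrow> real \<Rightarrow> real \<Rightarrow> real" where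
 "pw_D p k b = b * (b powr (- (1 / (p - 1)) / 2) + k) powr (p - 2)"
definition pw_D1 :: "real \<Rightarrow> real \<Rightarrow> real \<Rightarrow> real" where
 "pw_D1 p k b = (b powr (- (1 / (p - 1)) / 2) + k) powr (p - 2)
  - (1 - 1 / (p - 1)) / 2 * b powr (- (1 / (p - 1)) / 2) * (b powr (- (1 / (p - 1)) / 2) + k) powr (p - 3)"
definition pw_D2 :: "real \<Rightarrow> real \<Rightarrow> real \<Rightarrow> real" where
 "pw_D2 p k b = (1 - 1 / (p - 1)) / 4 * (1 / b) * ((1 / (p - 1) - 2) * b powr (- (1 / (p - 1)) / 2) * (b powr (- (1 / (p - 1)) / 2) + k) powr (p - 3)
  + (1 - 2 / (p - 1)) * (b powr (- (1 / (p - 1)) / 2))^2 * (b powr (- (1 / (p - 1)) / 2) + k) powr (p - 4))"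

lemma pw_D_eq:
 fixes b k p :: real
 assumes b: "0 < b" and k: "0 \<le> k" and p: "2 \<le> p"
 shows "pw_D p k b = b powr ((1 + 1 / (p - 1)) / 2) * (1 + k * b powr (1 / (p - 1) / 2)) powr (p - 2)"
proof -
 define g where "g = 1 / (p - 1)"
 have g: "g * (p - 2) = 1 - g" using p by (simp add: g_def field_simps)
 have s: "b powr (- g / 2) + k = b powr (- g / 2) * (1 + k * b powr (g / 2))"
  using b by (simp add: algebra_simps powr_add[symmetric])
 have "b * (b powr (- g / 2)) powr (p - 2) = b powr 1 * b powr (- g / 2 * (p - 2))" using b by (simp add: powr_powr)
 also have "\<dots> = b powr ((1 + g) / 2)" unfolding powr_add[symmetric] using g by (simp add: algebra_simps add_divide_distrib diff_divide_distrib)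
 finally have "b * (b powr (- g / 2)) powr (p - 2) = b powr ((1 + g) / 2)" .
 moreover have "pw_D p k b = b * (b powr (- g / 2)) powr (p - 2) * (1 + k * b powr (g / 2)) powr (p - 2)"
 proof -
  have "pw_D p k b = b * (b powr (- g / 2) + k) powr (p - 2)" by (simp add: pw_D_def g_def)
  also have "(b powr (- g / 2) + k) powr (p - 2) = (b powr (- g / 2)) powr (p - 2) * (1 + k * b powr (g / 2)) powr (p - 2)"
   unfolding s by (simp add: powr_mult)
  finally show ?thesis by simp
 qed
 ultimately show ?thesis by (simp add: g_def)
qed

lemma pw_D_deriv:
 assumes "0 < b" "0 < k" "2 \<le> p"
 shows "DERIV (pw_D p k) b :> pw_D1 p k b"
  and "DERIV (pw_D1 p k) b :> pw_D2 p k b"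
proof -
 define g where "g = 1 / (p - 1)"
 have g: "(p - 2) * g = 1 - g" "(p - 3) * g = 1 - 2 * g" using assms by (auto simp: g_def field_simps)
 define s where "s = b powr (- g / 2)"
 have s: "DERIV (\<lambda>b. b powr (- g / 2)) b :> - (g / 2) * s / b"
  by (rule DERIV_cong[OF has_real_derivative_powr]) (use assms in \<open>auto simp: s_def powr_diff\<close>)
 have u: "DERIV (\<lambda>b. b powr (- g / 2) + k) b :> - (g / 2) * s / b"
  using DERIV_add[OF s DERIV_const[of k]] by simp
 have u0: "b powr (- g / 2) + k > 0" using assms by (intro add_nonneg_pos) auto
 define U where "U = b powr (- g / 2) + k"
 have up: "DERIV (\<lambda>b. (b powr (- g / 2) + k) powr r) b :> r * U powr (r - 1) * (- (g / 2) * s / b)" for r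
  using DERIV_chain2[OF has_real_derivative_powr[OF u0] u] by (simp add: U_def)
 have g0: "- (1 / (p - 1)) / 2 = - g / 2" by (simp add: g_def)
 have D: "pw_D p k = (\<lambda>b. b * (b powr (- g / 2) + k) powr (p - 2))"
  and D1: "pw_D1 p k = (\<lambda>b. (b powr (- g / 2) + k) powr (p - 2) - (1 - g) / 2 * b powr (- g / 2) * (b powr (- g / 2) + k) powr (p - 3))"
  and D2: "pw_D2 p k b = (1 - g) / 4 * (1 / b) * ((g - 2) * s * U powr (p - 3) + (1 - 2 * g) * s^2 * U powr (p - 4))"
  unfolding pw_D_def[abs_def] pw_D1_def[abs_def] pw_D2_def g0 by (simp_all add: g_def U_def s_def)
 have q: "p - 2 - 1 = p - 3" "p - 3 - 1 = p - 4" by simp_all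
 have e1: "(p - 2) * (g * x) = (1 - g) * x" and e2: "(p - 3) * (g * x) = (1 - 2 * g) * x" for x
  using g by (simp_all add: mult.assoc[symmetric])
 have "1 * U powr (p - 2) + ((p - 2) * U powr (p - 2 - 1) * (- (g / 2) * s / b)) * b
   = U powr (p - 2) - ((p - 2) * (g * (s * U powr (p - 3) / 2)))" using assms q by (simp add: field_simps)
 thus "DERIV (pw_D p k) b :> pw_D1 p k b" unfolding D D1 e1
  by (intro DERIV_cong[OF DERIV_mult[OF DERIV_ident up]])  (simp add: U_def s_def algebra_simps)
 have "(p - 2) * U powr (p - 2 - 1) * (- (g / 2) * s / b) - ((0 * s + - (g / 2) * s / b * ((1 - g) / 2)) * U powr (p - 3)
   + (p - 3) * U powr (p - 3 - 1) * (- (g / 2) * s / b) * ((1 - g) / 2 * s))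
  = - ((p - 2) * (g * (U powr (p - 3) * s / b / 2))) + g * s / b * (1 - g) / 4 * U powr (p - 3)
   + (p - 3) * (g * (U powr (p - 4) * s / b * ((1 - g) / 4 * s)))" using assms q by (simp add: field_simps)
 also have "\<dots> = pw_D2 p k b" unfolding e1 e2 D2 using assms by (simp add: field_simps power2_eq_square)
 finally show "DERIV (pw_D1 p k) b :> pw_D2 p k b" unfolding D1
  by (intro DERIV_cong[OF DERIV_diff[OF up DERIV_mult[OF DERIV_mult[OF DERIV_const s] up]]]) (simp add: U_def s_def)
qed

text \<open>For the fourth claim: where \<open>pw_D2\<close> is negative the worst case is \<zeta>^2
  = 4 b Y, and the form becomes W Y times a quadratic polynomial in r = s / U, the share of the
  uncapped summand. Its smallest value on r \<le> 1 is taken at r = 1 and equals (1 + g) g = q (q -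
  1), the value for the pure power.\<close>

lemma pw_D_bounds:
 fixes b k p :: real
 assumes b: "0 < b" and k: "0 < k" and p: "2 \<le> p"
 defines "g \<equiv> 1 / (p - 1)"
 defines "W \<equiv> (b powr (- g / 2) + k) powr (p - 2)"
 shows "0 < W" "0 \<le> pw_D1 p k b" "pw_D p k b = b * W"
  "\<And>\<zeta> Y. \<zeta>\<^sup>2 \<le> 4 * b * Y \<Longrightarrow> (1 + g) * g * W * Y \<le> 2 * pw_D1 p k b * Y + pw_D2 p k b * \<zeta>^2"
  "b powr ((1 + g) / 2) / b \<le> W"
proof -
 have g: "0 < g" "g \<le> 1" using p by (auto simp: g_def)
 have g2: "(p - 2) * g = 1 - g" using p by (auto simp: g_def field_simps)
 define s where "s = b powr (- g / 2)"
 define U where "U = s + k"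
 define r where "r = s / U"
 have s0: "s > 0" using b by (simp add: s_def)
 hence U0: "U > 0" using k by (simp add: U_def)
 have r: "0 < r" "r \<le> 1" using s0 U0 k by (auto simp: r_def U_def)
 show W: "0 < W" using U0 by (simp add: W_def U_def s_def)
 show DW: "pw_D p k b = b * W" by (simp add: pw_D_def W_def g_def)
 have g0: "- (1 / (p - 1)) / 2 = - g / 2" by (simp add: g_def)
 have D1: "pw_D1 p k b = W * (1 - (1 - g) * r / 2)"
  and D2: "pw_D2 p k b = W / b * (1 - g) / 4 * ((g - 2) * r + (1 - 2 * g) * r^2)"
 proof -
  have e1: "s * U powr (p - 3) = W * r" and e2: "s^2 * U powr (p - 4) = W * r^2"
  proof -
   have WU: "W = U powr (p - 2)" by (simp add: W_def U_def s_def)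
   have "U powr (p - 3) = W / U" using U0 powr_diff[of U "p - 2" 1] by (simp add: WU)
   moreover have "U powr (p - 4) = W / U^2" using U0 powr_diff[of U "p - 2" 2] by (simp add: WU)
   ultimately show "s * U powr (p - 3) = W * r" "s^2 * U powr (p - 4) = W * r^2"
    by (simp_all add: r_def power_divide)
  qed
  have "pw_D1 p k b = W - (1 - g) / 2 * (s * U powr (p - 3))"
   unfolding pw_D1_def g0 by (simp add: W_def U_def s_def g_def)
  thus "pw_D1 p k b = W * (1 - (1 - g) * r / 2)" unfolding e1 by (simp add: algebra_simps)
  have "pw_D2 p k b = (1 - g) / 4 * (1 / b) * ((g - 2) * (s * U powr (p - 3)) + (1 - 2 * g) * (s^2 * U powr (p - 4)))"
   unfolding pw_D2_def g0 by (simp add: U_def s_def g_def)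
  thus "pw_D2 p k b = W / b * (1 - g) / 4 * ((g - 2) * r + (1 - 2 * g) * r^2)"
   unfolding e1 e2 by (simp add: field_simps)
 qed
 have gr: "(1 - g) * r \<le> 1 * 1" using g r by (intro mult_mono) auto
 show "0 \<le> pw_D1 p k b" unfolding D1 using W gr by (intro mult_nonneg_nonneg) auto
 \<comment> \<open>Equality holds at r = 1, hence the factor 1 - r in the difference.\<close>
 have m: "(3 - g) * r - (1 - 2 * g) * r^2 \<le> 2 + g"
 proof -
  have "2 + g - ((3 - g) * r - (1 - 2 * g) * r^2) = (1 - r) * ((2 + g) - (1 - 2 * g) * r)"
   by (simp add: algebra_simps power2_eq_square)
  moreover have "(1 - 2 * g) * r \<le> 1 * 1"
  proof (cases "1 - 2 * g \<ge> 0")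
   case True thus ?thesis using g r by (intro mult_mono) auto
  next
   case False
   hence "(1 - 2 * g) * r \<le> 0" using r by (intro mult_nonpos_nonneg) auto
   thus ?thesis by simp
  qed
  ultimately show ?thesis using r g by (smt (verit) mult_nonneg_nonneg)
 qed
 fix \<zeta> Y :: real assume z: "\<zeta>^2 \<le> 4 * b * Y"
 have Y0: "Y \<ge> 0"
 proof -
  have "0 \<le> \<zeta>^2" by simp
  hence "0 \<le> 4 * b * Y" using z by linarith
  thus ?thesis using b by (simp add: zero_le_mult_iff)
 qed
 show "(1 + g) * g * W * Y \<le> 2 * pw_D1 p k b * Y + pw_D2 p k b * \<zeta>^2"
 proof (cases "pw_D2 p k b \<ge> 0")
  case True
  have "(1 + g) * g \<le> 2 * (1 - (1 - g) * r / 2)"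
  proof -
   have "(1 - g) * r \<le> (1 - g) * 1" using g r by (intro mult_left_mono) auto
   moreover have "(1 + g) * g \<le> (1 + g) * 1" using g by (intro mult_left_mono) auto
   ultimately show ?thesis by simp
  qed
  hence "W * ((1 + g) * g) \<le> W * (2 * (1 - (1 - g) * r / 2))" using W by (intro mult_left_mono) auto
  hence "(W * ((1 + g) * g)) * Y \<le> (W * (2 * (1 - (1 - g) * r / 2))) * Y" using Y0 by (intro mult_right_mono)
  moreover have "pw_D2 p k b * \<zeta>^2 \<ge> 0" using True by simp
  ultimately show ?thesis unfolding D1 by (simp add: algebra_simps)
 next
  case False
  hence "pw_D2 p k b * (4 * b * Y) \<le> pw_D2 p k b * \<zeta>^2" using z by (intro mult_left_mono_neg) auto
  moreover have "pw_D2 p k b * (4 * b * Y) = W * ((1 - g) * ((g - 2) * r + (1 - 2 * g) * r^2)) * Y"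
   unfolding D2 using b by simp
  moreover have "(1 + g) * g \<le> 2 * (1 - (1 - g) * r / 2) + (1 - g) * ((g - 2) * r + (1 - 2 * g) * r^2)"
  proof -
   have "(1 - g) * ((3 - g) * r - (1 - 2 * g) * r^2) \<le> (1 - g) * (2 + g)"
    using m g by (intro mult_left_mono) auto
   thus ?thesis by (simp add: field_simps power2_eq_square)
  qed
  hence "(W * ((1 + g) * g)) * Y \<le> W * (2 * (1 - (1 - g) * r / 2) + (1 - g) * ((g - 2) * r + (1 - 2 * g) * r^2)) * Y"
   using Y0 W by (intro mult_right_mono mult_left_mono) auto
  ultimately show ?thesis unfolding D1 by (simp add: algebra_simps)
 qed
next
 have g: "0 < g" "g \<le> 1" using p by (auto simp: g_def)
 have g2: "(p - 2) * g = 1 - g" using p by (auto simp: g_def field_simps)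
 have pd: "b powr (x - 1) = b powr x / b" for x using b by (simp add: powr_diff)
 have "b powr ((1 + g) / 2) / b = b powr ((1 + g) / 2 - 1)" by (rule pd[symmetric])
 also have "(1 + g) / 2 - 1 = (- g / 2) * (p - 2)" using g2 by (simp add: field_simps)
 also have "b powr \<dots> = (b powr (- g / 2)) powr (p - 2)" by (simp add: powr_powr)
 also have "\<dots> \<le> W" unfolding W_def using p k by (intro powr_mono2) auto
 finally show "b powr ((1 + g) / 2) / b \<le> W" .
qed

text \<open>For b \<ge> 1 the capped base is at most 1 + k. For b < 1 the form of
  \<open>pw_D_eq\<close> is used, in which no negative power of b is left.\<close>

lemma pw_D_le:
 assumes b: "0 < b" and k: "0 < k" and p: "2 \<le> p"
 shows "pw_D p k b \<le> (1 + k) powr (p - 2) * (1 + b)"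
proof -
 define g where "g = 1 / (p - 1)"
 have g: "0 < g" using p by (simp add: g_def)
 have "\<exists>c v. pw_D p k b = c * v powr (p - 2) \<and> 0 \<le> c \<and> c \<le> 1 + b \<and> 0 \<le> v \<and> v \<le> 1 + k"
 proof (cases "b \<ge> 1")
  case True
  hence "b powr (- g / 2) \<le> b powr 0" using g by (intro powr_mono) auto
  thus ?thesis using b k by (intro exI[of _ b] exI[of _ "b powr (- g / 2) + k"]) (simp add: pw_D_def g_def)
 next
  case False
  hence "b powr (g / 2) \<le> 1" "b powr ((1 + g) / 2) \<le> 1" using b g by (auto intro!: powr_le1)
  thus ?thesis using b k pw_D_eq[OF b less_imp_le[OF k] p]
   by (intro exI[of _ "b powr ((1 + g) / 2)"] exI[of _ "1 + k * b powr (g / 2)"]) (simp add: g_def)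
 qed
 then obtain c v where cv: "pw_D p k b = c * v powr (p - 2)" "0 \<le> c" "c \<le> 1 + b" "0 \<le> v" "v \<le> 1 + k" by blast
 have "c * v powr (p - 2) \<le> (1 + b) * (1 + k) powr (p - 2)" using cv b p by (intro mult_mono powr_mono2) auto
 thus ?thesis unfolding cv(1) by (simp only: mult.commute)
qed

text \<open>The first variable plays the role of \<open>\<bar>f\<bar>\<^sup>2\<close> with exponent \<open>p \<ge> 2\<close>, the second
 that of \<open>\<bar>g\<bar>\<^sup>2\<close> with the conjugate exponent \<open>q = 1 + g\<close>. The parameter \<open>k > 0\<close> caps the weights,
 so that the function grows only quadratically and \<open>L\<^sup>2\<close> approximation suffices.\<close>
lemma bellman_function:
 fixes p k :: real
 assumes p: "2 \<le> p" and k: "0 < k"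
 defines "g \<equiv> 1 / (p - 1)"
 defines "N \<equiv> \<lambda>a b. a powr (p / 2) + b powr ((1 + g) / 2)"
 shows "\<exists>Ba Bb Baa Bab Bbb. bellman (g / 8) (\<lambda>a b. pw_D p k b + g / 22 * (a * pw_T p k (N a b))) Ba Bb Baa Bab Bbb"
proof -
 define q where "q = 1 + g"
 define d where "d = g / 22"
 have g: "0 < g" "g \<le> 1" using p by (auto simp: g_def)
 have q: "1 \<le> q" "q \<le> 2" using g by (auto simp: q_def)
 define Na where "Na = (\<lambda>a. p / 2 * a powr (p / 2 - 1))"
 define Naa where "Naa = (\<lambda>a. p / 2 * (p / 2 - 1) * a powr (p / 2 - 2))"
 define Nb where "Nb = (\<lambda>b. q / 2 * b powr (q / 2 - 1))"
 define Nbb where "Nbb = (\<lambda>b. q / 2 * (q / 2 - 1) * b powr (q / 2 - 2))"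
 define T where "T = (\<lambda>a b. pw_T p k (N a b))"
 define T1 where "T1 = (\<lambda>a b. pw_T1 p k (N a b))"
 define T2 where "T2 = (\<lambda>a b. pw_T2 p k (N a b))"
 define Ba where "Ba = (\<lambda>a b. d * (T a b + a * T1 a b * Na a))"
 define Bb where "Bb = (\<lambda>a b. pw_D1 p k b + d * (a * T1 a b * Nb b))"
 define Baa where "Baa = (\<lambda>a b. d * (2 * T1 a b * Na a + a * (T2 a b * (Na a)^2 + T1 a b * Naa a)))"
 define Bab where "Bab = (\<lambda>a b. d * (T1 a b * Nb b + a * T2 a b * Na a * Nb b))"
 define Bbb where "Bbb = (\<lambda>a b. pw_D2 p k b + d * (a * (T2 a b * (Nb b)^2 + T1 a b * Nbb b)))"
 have Npos: "0 < N a b" if "0 < a" "0 < b" for a b using that by (simp add: N_def add_pos_pos)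
 have derivN: "DERIV (\<lambda>s. N (f s) (h s)) s :> (Na (f s) * f' + Nb (h s) * h')"
  if "DERIV f s :> f'" "DERIV h s :> h'" "0 < f s" "0 < h s" for f h f' h' s unfolding N_def Na_def Nb_def q_def
  by (intro DERIV_add DERIV_chain2[OF has_real_derivative_powr that(1)] DERIV_chain2[OF has_real_derivative_powr that(2)] that)
 have derivT: "DERIV (\<lambda>s. T (f s) (h s)) s :> T1 (f s) (h s) * (Na (f s) * f' + Nb (h s) * h')"
  "DERIV (\<lambda>s. T1 (f s) (h s)) s :> T2 (f s) (h s) * (Na (f s) * f' + Nb (h s) * h')"
  if "DERIV f s :> f'" "DERIV h s :> h'" "0 < f s" "0 < h s" for f h f' h' s unfolding T_def T1_def T2_def
  using DERIV_chain2[OF pw_T_deriv(1) derivN[OF that]] DERIV_chain2[OF pw_T_deriv(2) derivN[OF that]]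
   Npos[OF that(3,4)] p k by auto
 have derivNa: "DERIV (\<lambda>s. Na (f s)) s :> Naa (f s) * f'"
  if "DERIV f s :> f'" "0 < f s" for f f' s unfolding Na_def Naa_def
  by (rule DERIV_cong[OF DERIV_cmult[OF DERIV_chain2[OF has_real_derivative_powr that(1)]]]) (use that in simp_all)
 have derivNb: "DERIV (\<lambda>s. Nb (f s)) s :> Nbb (f s) * f'"
  if "DERIV f s :> f'" "0 < f s" for f f' s unfolding Nb_def Nbb_def
  by (rule DERIV_cong[OF DERIV_cmult[OF DERIV_chain2[OF has_real_derivative_powr that(1)]]]) (use that in simp_all)
 have derivD: "DERIV (\<lambda>s. pw_D p k (f s)) s :> pw_D1 p k (f s) * f'"
  "DERIV (\<lambda>s. pw_D1 p k (f s)) s :> pw_D2 p k (f s) * f'"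
  if "DERIV f s :> f'" "0 < f s" for f f' s
  using DERIV_chain2[OF pw_D_deriv(1) that(1)] DERIV_chain2[OF pw_D_deriv(2) that(1)] that p k by auto
 let ?Q = "{0<..} \<times> {0<..} :: (real \<times> real) set"
 have cN: "continuous_on ?Q (\<lambda>x. N (fst x) (snd x))"
  unfolding N_def by (intro continuous_intros) auto
 have Upos: "N a b powr r + k \<noteq> 0" "b powr r + k \<noteq> 0" for a b r
  using k by (metis add_nonneg_pos less_irrefl powr_ge_zero)+
 have cT: "continuous_on ?Q (\<lambda>x. T (fst x) (snd x))"
  "continuous_on ?Q (\<lambda>x. T1 (fst x) (snd x))"
  "continuous_on ?Q (\<lambda>x. T2 (fst x) (snd x))"
  unfolding T_def T1_def T2_def pw_T_def pw_T1_def pw_T2_def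
  using Npos Upos by (intro continuous_intros cN; fastforce)+
 have cNa: "continuous_on ?Q (\<lambda>x. Na (fst x))" "continuous_on ?Q (\<lambda>x. Naa (fst x))"
  "continuous_on ?Q (\<lambda>x. Nb (snd x))" "continuous_on ?Q (\<lambda>x. Nbb (snd x))"
  unfolding Na_def Naa_def Nb_def Nbb_def by (intro continuous_intros; force)+
 have cD: "continuous_on ?Q (\<lambda>x. pw_D p k (snd x))" "continuous_on ?Q (\<lambda>x. pw_D1 p k (snd x))"
  "continuous_on ?Q (\<lambda>x. pw_D2 p k (snd x))"
  unfolding pw_D_def pw_D1_def pw_D2_def using Upos by (intro continuous_intros; force)+
 have "bellman (g / 8) (\<lambda>a b. pw_D p k b + d * (a * T a b)) Ba Bb Baa Bab Bbb"
 proof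
  show "0 < g / 8" using g by simp
  fix a b :: real assume ab: "0 < a" "0 < b"
  note D = pw_D_bounds[OF ab(2) k p, folded g_def]
  note Tb = pw_T_bounds[OF Npos[OF ab] k p, folded T_def T1_def T2_def]
  define W where "W = (b powr (- g / 2) + k) powr (p - 2)"
  have W: "W > 0" using D(1) by (simp add: W_def)
  have NN: "Na a \<ge> 0" "Nb b \<ge> 0" using p q by (auto simp: Na_def Nb_def)
  show "0 \<le> pw_D p k b + d * (a * T a b)" using D(1,3) Tb(1) ab g by (simp add: d_def T_def)
  show "0 \<le> Ba a b" unfolding Ba_def d_def using g NN Tb(1,2) ab
   by (intro mult_nonneg_nonneg add_nonneg_nonneg) (auto simp: T_def T1_def)
  show "0 \<le> Bb a b" unfolding Bb_def d_def using g NN Tb(1,2) ab D(2)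
   by (intro mult_nonneg_nonneg add_nonneg_nonneg) (auto simp: T_def T1_def)
  have Nab: "N a b = a powr (p / 2) + b powr (q / 2)" by (simp add: N_def q_def)
  have Ta: "T a b * a \<le> N a b" unfolding T_def using ab by (intro pw_T_le p k Npos) (auto simp: N_def)
  \<comment> \<open>\<open>T\<close> and \<open>1 / W\<close> are the same negative power of two
    capped bases, and the base in \<open>T\<close> is the smaller one because \<open>N a b\<close>
    exceeds its second summand.\<close>
  have TW: "1 / W \<le> T a b"
  proof -
   have "b powr ((1 + g) / 2) \<le> N a b" using ab by (simp add: N_def)
   hence "N a b powr (- 1 / p) \<le> (b powr ((1 + g) / 2)) powr (- 1 / p)" using ab p by (intro powr_mono2') auto
   also have "\<dots> = b powr (- g / 2)"
   proof -
    have "(1 + g) / 2 * (- 1 / p) = - g / 2" using p by (simp add: g_def field_simps)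
    thus ?thesis by (simp only: powr_powr)
   qed
   finally have "(b powr (- g / 2) + k) powr (2 - p) \<le> T a b"
    unfolding T_def pw_T_def using p k by (intro powr_mono2') (auto intro: add_nonneg_pos)
   moreover have "(b powr (- g / 2) + k) powr (2 - p) = 1 / W"
    unfolding W_def using powr_minus_divide[of "b powr (- g / 2) + k" "p - 2"] by simp
   ultimately show ?thesis by simp
  qed
  show "\<exists>r>0. \<forall>\<xi> \<zeta> X Y. \<xi>\<^sup>2 \<le> 4 * a * X \<longrightarrow> \<zeta>\<^sup>2 \<le> 4 * b * Y \<longrightarrow>
   g / 8 * (r * X + Y / r) \<le> 2 * Ba a b * X + 2 * Bb a b * Y + Baa a b * \<xi>^2 + 2 * Bab a b * \<xi> * \<zeta> + Bbb a b * \<zeta>^2"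
  \<comment> \<open>The witness solves \<open>g / 8 * r = (g / 22) / W\<close>, the coefficient of
    \<open>X\<close> that \<open>TW\<close> provides. On the other side \<open>g / 8 / r\<close>
    equals 11 / 32 * g * W, which stays below q * g * W / 2.\<close>
  proof (intro exI[of _ "4 / (11 * W)"] conjI allI impI)
   fix \<xi> \<zeta> X Y :: real assume z: "\<xi>^2 \<le> 4 * a * X" "\<zeta>^2 \<le> 4 * b * Y"
   have XY: "X \<ge> 0" "Y \<ge> 0"
    using z ab by (smt (verit) mult_neg_pos mult_pos_pos zero_le_power2 mult_pos_neg)+
   have 1: "q * g * W * Y \<le> 2 * pw_D1 p k b * Y + pw_D2 p k b * \<zeta>^2"
    using D(4)[OF z(2)] by (simp add: W_def q_def)
   have 2: "T a b * X - 11 / 2 * q^2 * (b powr (q / 2) / b) * Y \<le>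
    2 * (T a b + a * T1 a b * Na a) * X + 2 * (a * T1 a b * Nb b) * Y + (2 * T1 a b * Na a + a * (T2 a b * (Na a)^2 + T1 a b * Naa a)) * \<xi>^2
  + 2 * (T1 a b * Nb b + a * T2 a b * Na a * Nb b) * \<xi> * \<zeta> + a * (T2 a b * (Nb b)^2 + T1 a b * Nbb b) * \<zeta>^2"
   proof (rule weight_product_form_bound[where A = "a powr (p / 2)" and p = p])
    show "T1 a b * (a powr (p / 2) + b powr (q / 2)) \<le> T a b" using Tb(3) by (simp add: Nab T_def T1_def)
    show "- (1 + 1 / p) * T1 a b \<le> T2 a b * (a powr (p / 2) + b powr (q / 2))"
     using Tb(4) by (simp add: Nab T2_def T1_def)
    show "T a b * a \<le> a powr (p / 2) + b powr (q / 2)" using Ta by (simp add: Nab)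
    show "Na a = p / 2 * a powr (p / 2) / a" "Naa a = p / 2 * (p / 2 - 1) * a powr (p / 2) / a^2"
     "Nb b = q / 2 * b powr (q / 2) / b" "Nbb b = q / 2 * (q / 2 - 1) * b powr (q / 2) / b^2"
     using ab by (simp_all add: Na_def Naa_def Nb_def Nbb_def powr_diff)
   qed (use ab Tb(1,2) p q z in \<open>auto simp: T_def T1_def\<close>)
   \<comment> \<open>This fixes the factor 1 / 22 in \<open>d\<close>: the loss 11 / 2 * q^2 then
     uses up at most half of the form of \<open>pw_D\<close>, because q \<le> 2.\<close>
   have 3: "d * (11 / 2 * q^2 * (b powr (q / 2) / b) * Y) \<le> q * g * W * Y / 2"
   proof -
    have "b powr (q / 2) / b \<le> W" using D(5) by (simp add: W_def q_def)
    hence "d * (11 / 2 * q^2 * (b powr (q / 2) / b) * Y) \<le> d * (11 / 2 * q^2 * W * Y)"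
     using XY g by (intro mult_left_mono mult_right_mono) (auto simp: d_def)
    also have "\<dots> = (q * g * W * Y) * (q / 4)" by (simp add: d_def power2_eq_square)
    also have "\<dots> \<le> (q * g * W * Y) * (1 / 2)" using XY g q W by (intro mult_left_mono) auto
    finally show ?thesis by simp
   qed
   have 4: "g / 8 * (4 / (11 * W) * X) \<le> d * (T a b * X)"
   proof -
    have "g / 8 * (4 / (11 * W) * X) = d * ((1 / W) * X)" by (simp add: d_def)
    also have "\<dots> \<le> d * (T a b * X)" using TW XY g by (intro mult_left_mono mult_right_mono) (auto simp: d_def)
    finally show ?thesis .
   qed
   have 5: "g / 8 * (Y / (4 / (11 * W))) \<le> q * g * W * Y / 2"
   proof -
    have "(g * W * Y) * (11 / 32) \<le> (g * W * Y) * (q / 2)" using XY g q W by (intro mult_left_mono) auto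
    thus ?thesis by (simp add: field_simps)
   qed
   define E where "E = 2 * (T a b + a * T1 a b * Na a) * X + 2 * (a * T1 a b * Nb b) * Y + (2 * T1 a b * Na a + a * (T2 a b * (Na a)^2 + T1 a b * Naa a)) * \<xi>^2
  + 2 * (T1 a b * Nb b + a * T2 a b * Na a * Nb b) * \<xi> * \<zeta> + a * (T2 a b * (Nb b)^2 + T1 a b * Nbb b) * \<zeta>^2"
   have "d * (T a b * X) - d * (11 / 2 * q^2 * (b powr (q / 2) / b) * Y) \<le> d * E"
    using mult_left_mono[OF 2, of d] g unfolding E_def right_diff_distrib[of d] by (simp add: d_def)
   hence "g / 8 * (4 / (11 * W) * X + Y / (4 / (11 * W))) \<le> (2 * pw_D1 p k b * Y + pw_D2 p k b * \<zeta>^2) + d * E"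
    unfolding distrib_left[of "g / 8"] using 1 3 4 5 by linarith
   thus "g / 8 * (4 / (11 * W) * X + Y / (4 / (11 * W))) \<le>
    2 * Ba a b * X + 2 * Bb a b * Y + Baa a b * \<xi>^2 + 2 * Bab a b * \<xi> * \<zeta> + Bbb a b * \<zeta>^2"
    unfolding Ba_def Bb_def Baa_def Bab_def Bbb_def E_def by (simp add: algebra_simps)
  qed (use W in simp)
 next
  fix f h :: "real \<Rightarrow> real" and f' h' s :: real
  assume a: "DERIV f s :> f'" "DERIV h s :> h'" "0 < f s" "0 < h s"
  note dT = derivT[OF a]
  show "DERIV (\<lambda>s. pw_D p k (h s) + d * (f s * T (f s) (h s))) s :> Ba (f s) (h s) * f' + Bb (f s) (h s) * h'"
   unfolding Ba_def Bb_def by (rule derivative_eq_intros derivD dT a refl)+ (simp add: algebra_simps)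
  show "DERIV (\<lambda>s. Ba (f s) (h s)) s :> Baa (f s) (h s) * f' + Bab (f s) (h s) * h'"
   unfolding Ba_def Baa_def Bab_def
   by (rule derivative_eq_intros dT derivNa a refl)+ (simp add: algebra_simps power2_eq_square)
  show "DERIV (\<lambda>s. Bb (f s) (h s)) s :> Bab (f s) (h s) * f' + Bbb (f s) (h s) * h'"
   unfolding Bb_def Bbb_def Bab_def
   by (rule derivative_eq_intros dT derivNb derivD a refl)+ (simp add: algebra_simps power2_eq_square)
 qed (unfold Ba_def Bb_def Baa_def Bab_def Bbb_def case_prod_beta, (intro continuous_intros cT cNa cD)+)
 thus ?thesis unfolding d_def T_def by blast
qed

section \<open>Sturm--Liouville modes on the unit interval\<close>

definition unit_density :: "(real \<Rightarrow> real) \<Rightarrow> real measure" where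
 "unit_density w = density (restrict_space lborel {0<..<1}) (\<lambda>x. ennreal (w x))"

lemma space_unit_density [simp]: "space (unit_density w) = {0<..<1}"
 by (simp add: unit_density_def space_restrict_space)

lemma sets_unit_density [measurable_cong]: "sets (unit_density w) = sets (restrict_space borel {0<..<1})"
 unfolding unit_density_def sets_density by (rule sets_restrict_space_cong) simp

lemma borel_measurable_unit_density_iff:
 fixes h :: "real \<Rightarrow> 'a::real_normed_vector"
 shows "h \<in> borel_measurable (unit_density w) \<longleftrightarrow> (\<lambda>x. indicator {0<..<1} x *\<^sub>R h x) \<in> borel_measurable borel"
proof -
 have "h \<in> borel_measurable (unit_density w) \<longleftrightarrow> h \<in> borel_measurable (restrict_space borel {0<..<1})"
  by (simp only: measurable_cong_sets[OF sets_unit_density refl])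
 thus ?thesis by (subst (asm) borel_measurable_restrict_space_iff) auto
qed

lemma measurable_unit_density_continuous:
 fixes h :: "real \<Rightarrow> 'a::real_normed_vector"
 assumes "continuous_on {0<..<1} h" shows "h \<in> borel_measurable (unit_density w)"
 unfolding measurable_cong_sets[OF sets_unit_density refl] by (rule borel_measurable_continuous_on_restrict[OF assms])

text \<open>At the endpoints \<open>om\<close> may blow up to first and \<open>V\<close> to second
  order. These are the rates that are absorbed when \<open>om\<close> multiplies a function, and
  \<open>V\<close> the square of a function, vanishing there to first order.\<close>

locale weighted_interval =
 fixes w om V :: "real \<Rightarrow> real"
 assumes w_pos: "\<And>x. 0 < x \<Longrightarrow> x < 1 \<Longrightarrow> 0 < w x"
  and w_bdd: "\<exists>C. \<forall>x\<in>{0<..<1}. w x \<le> C"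
  and w_deriv: "\<And>x. 0 < x \<Longrightarrow> x < 1 \<Longrightarrow> DERIV w x :> om x * w x"
  and om_deriv: "\<And>x. 0 < x \<Longrightarrow> x < 1 \<Longrightarrow> DERIV om x :> - V x"
  and V_nonneg: "\<And>x. 0 < x \<Longrightarrow> x < 1 \<Longrightarrow> 0 \<le> V x"
  and V_cont: "continuous_on {0<..<1} V"
  and om_bdd: "\<exists>C. \<forall>x\<in>{0<..<1}. \<bar>om x\<bar> * (x * (1 - x)) \<le> C"
  and V_bdd: "\<exists>C. \<forall>x\<in>{0<..<1}. V x * (x * (1 - x))^2 \<le> C"
begin

lemma cont_w: "continuous_on {0<..<1} w" and cont_om: "continuous_on {0<..<1} om"
 by (auto intro!: continuous_at_imp_continuous_on DERIV_isCont w_deriv om_deriv)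

lemma w_meas: "(\<lambda>x. indicator {0<..<1} x *\<^sub>R w x) \<in> borel_measurable borel"
 using measurable_unit_density_continuous[OF cont_w] unfolding borel_measurable_unit_density_iff .

lemma integrable_iff_lborel:
 fixes h :: "real \<Rightarrow> real"
 assumes "h \<in> borel_measurable (unit_density w)"
 shows "integrable (unit_density w) h \<longleftrightarrow> integrable lborel (\<lambda>x. indicator {0<..<1} x * (w x * h x))"
  and "integral\<^sup>L (unit_density w) h = (LINT x|lborel. indicator {0<..<1} x * (w x * h x))"
proof -
 have wm: "w \<in> borel_measurable (restrict_space lborel {0<..<1})"
  using borel_measurable_continuous_on_restrict[OF cont_w]
  by (subst measurable_cong_sets[OF _ refl]) (auto intro!: sets_restrict_space_cong)
 have hm: "h \<in> borel_measurable (restrict_space lborel {0<..<1})" using assms unfolding unit_density_def by simp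
 have nn: "AE x in restrict_space lborel {0<..<1}. 0 \<le> w x"
  by (rule AE_I2) (auto simp: space_restrict_space intro: less_imp_le w_pos)
 have "integrable (unit_density w) h \<longleftrightarrow> integrable (restrict_space lborel {0<..<1}) (\<lambda>x. w x *\<^sub>R h x)"
  unfolding unit_density_def by (rule integrable_density[OF hm wm nn])
 also have "\<dots> \<longleftrightarrow> integrable lborel (\<lambda>x. indicator {0<..<1} x *\<^sub>R (w x *\<^sub>R h x))"
  by (rule integrable_restrict_space) simp
 finally show "integrable (unit_density w) h \<longleftrightarrow> integrable lborel (\<lambda>x. indicator {0<..<1} x * (w x * h x))" by simp
 have "integral\<^sup>L (unit_density w) h = integral\<^sup>L (restrict_space lborel {0<..<1}) (\<lambda>x. w x *\<^sub>R h x)"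
  unfolding unit_density_def by (rule integral_density[OF hm wm nn])
 also have "\<dots> = (LINT x|lborel. indicator {0<..<1} x *\<^sub>R (w x *\<^sub>R h x))"
  by (rule integral_restrict_space) simp
 finally show "integral\<^sup>L (unit_density w) h = (LINT x|lborel. indicator {0<..<1} x * (w x * h x))" by simp
qed

lemma integrable_bounded:
 fixes h :: "real \<Rightarrow> real"
 assumes h: "h \<in> borel_measurable (unit_density w)" and bd: "\<And>x. x \<in> {0<..<1} \<Longrightarrow> \<bar>h x\<bar> \<le> C"
 shows "integrable (unit_density w) h" "integrable lborel (\<lambda>x. indicator {0<..<1} x * (w x * h x))"
proof -
 obtain D where D: "\<And>x. x \<in> {0<..<1} \<Longrightarrow> w x \<le> D" using w_bdd by blast
 show 1: "integrable lborel (\<lambda>x. indicator {0<..<1} x * (w x * h x))"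
 proof (rule Bochner_Integration.integrable_bound)
  show "integrable lborel (\<lambda>x. indicator {0<..<1::real} x * (D * C))" by simp
  have "(\<lambda>x. (indicator {0<..<1} x *\<^sub>R w x) * (indicator {0<..<1} x *\<^sub>R h x)) \<in> borel_measurable borel"
   using w_meas h unfolding borel_measurable_unit_density_iff by measurable
  also have "(\<lambda>x. (indicator {0<..<1} x *\<^sub>R w x) * (indicator {0<..<1} x *\<^sub>R h x)) = (\<lambda>x. indicator {0<..<1} x * (w x * h x))"
   by (auto simp: indicator_def)
  finally show "(\<lambda>x. indicator {0<..<1} x * (w x * h x)) \<in> borel_measurable lborel" by simp
  show "AE x in lborel. norm (indicator {0<..<1} x * (w x * h x)) \<le> norm (indicator {0<..<1} x * (D * C))"
  proof (rule AE_I2)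
   fix x :: real
   show "norm (indicator {0<..<1} x * (w x * h x)) \<le> norm (indicator {0<..<1} x * (D * C))"
   proof (cases "x \<in> {0<..<1}")
    case True
    hence "w x * \<bar>h x\<bar> \<le> D * C" using D bd w_pos[of x] by (intro mult_mono) (auto intro: order_trans less_imp_le)
    moreover have "0 \<le> w x * \<bar>h x\<bar>" using w_pos[of x] True by auto
    ultimately show ?thesis using True w_pos[of x] abs_ge_self[of "D * C"] by (simp add: abs_mult)
   qed auto
  qed
 qed
 thus "integrable (unit_density w) h" by (simp add: integrable_iff_lborel(1)[OF h])
qed

lemma integral_has_integral:
 fixes h :: "real \<Rightarrow> real"
 assumes "integrable (unit_density w) h"
 shows "((\<lambda>x. w x * h x) has_integral integral\<^sup>L (unit_density w) h) {0<..<1}"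
proof -
 have hm: "h \<in> borel_measurable (unit_density w)" using assms by auto
 have "integrable lborel (\<lambda>x. indicator {0<..<1} x * (w x * h x))"
  using integrable_iff_lborel(1)[OF hm] assms by simp
 from has_integral_integral_lborel[OF this]
 have "((\<lambda>x. if x \<in> {0<..<1} then w x * h x else 0) has_integral integral\<^sup>L (unit_density w) h) UNIV"
  unfolding integrable_iff_lborel(2)[OF hm, symmetric] by (rule has_integral_eq[rotated]) (auto simp: indicator_def)
 thus ?thesis by (subst (asm) has_integral_restrict_UNIV)
qed

text \<open>With the gauge integral, integrability of F' is part of the conclusion. This matters in
  the ground state argument, where F' contains the square of a quotient by a mode for which no bound
  is at hand; \<open>S\<close> is there the set of zeros of this mode.\<close>

lemma ftc_finite:
 fixes F F' :: "real \<Rightarrow> real"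
 assumes fin: "finite S"
  and d: "\<And>x. 0 < x \<Longrightarrow> x < 1 \<Longrightarrow> x \<notin> S \<Longrightarrow> DERIV F x :> F' x"
  and c: "\<And>x. x \<in> S \<Longrightarrow> 0 < x \<Longrightarrow> x < 1 \<Longrightarrow> isCont F x"
  and lim: "(F \<longlongrightarrow> 0) (at_right 0)" "(F \<longlongrightarrow> 0) (at_left 1)"
 shows "(F' has_integral 0) {0<..<1}"
proof -
 define G where "G = (\<lambda>x. if 0 < x \<and> x < 1 then F x else 0)"
 have eq: "eventually (\<lambda>y. F y = G y) (nhds x)" if "0 < x" "x < 1" for x
  using eventually_nhds_in_open[of "{0<..<1}" x] that by (auto simp: G_def elim!: eventually_mono)
 have inner: "isCont G x" if x: "0 < x" "x < 1" for x
 proof -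
  have "isCont F x" using d[OF x] c[OF _ x] DERIV_isCont by blast
  thus ?thesis using isCont_cong[OF eq[OF x]] by simp
 qed
 have "continuous_on {0..1} G" unfolding continuous_on_def
 proof
  fix x :: real assume "x \<in> {0..1}"
  then consider "x = 0" | "x = 1" | "0 < x" "x < 1" by fastforce
  thus "(G \<longlongrightarrow> G x) (at x within {0..1})"
  proof cases
   case 1
   have "(G \<longlongrightarrow> 0) (at_right 0)" by (rule Lim_transform_eventually[OF lim(1)])
     (auto simp: eventually_at_right[of 0 1] G_def intro!: exI[of _ 1])
   thus ?thesis using 1 by (simp add: at_within_Icc_at_right G_def)
  next
   case 2
   have "(G \<longlongrightarrow> 0) (at_left 1)" by (rule Lim_transform_eventually[OF lim(2)])
     (auto simp: eventually_at_left[of 0 1] G_def intro!: exI[of _ 0])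
   thus ?thesis using 2 by (simp add: at_within_Icc_at_left G_def)
  next
   case 3
   thus ?thesis using inner[of x] by (simp add: isCont_def tendsto_within_subset at_within_Icc_at)
  qed
 qed
 moreover have "(G has_vector_derivative F' x) (at x)" if "x \<in> {0<..<1} - S" for x
 proof -
  have "DERIV F x :> F' x" using d that by auto
  hence "DERIV G x :> F' x" using DERIV_cong_ev[OF refl eq refl, of x] that by auto
  thus ?thesis by (simp add: has_real_derivative_iff_has_vector_derivative)
 qed
 ultimately have "(F' has_integral (G 1 - G 0)) {0..1}"
  using fin by (intro fundamental_theorem_of_calculus_interior_strong[where S = S]) auto
 thus ?thesis by (simp add: G_def has_integral_Icc_iff_Ioo)
qed

lemma integral_eq_0_ftc:
 fixes F K :: "real \<Rightarrow> real"
 assumes d: "\<And>x. 0 < x \<Longrightarrow> x < 1 \<Longrightarrow> DERIV F x :> w x * K x"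
  and lim: "(F \<longlongrightarrow> 0) (at_right 0)" "(F \<longlongrightarrow> 0) (at_left 1)"
  and K: "integrable (unit_density w) K"
 shows "integral\<^sup>L (unit_density w) K = 0"
 using has_integral_unique[OF integral_has_integral[OF K] ftc_finite[where S = "{}", OF _ d _ lim]] by simp

lemma boundary_tendsto_0:
 fixes F :: "real \<Rightarrow> real"
 assumes "\<And>x. 0 < x \<Longrightarrow> x < 1 \<Longrightarrow> \<bar>F x\<bar> \<le> C * (x * (1 - x))"
 shows "(F \<longlongrightarrow> 0) (at_right 0)" "(F \<longlongrightarrow> 0) (at_left 1)"
proof -
 have a: "((\<lambda>x::real. C * (x * (1 - x))) \<longlongrightarrow> C * (0 * (1 - 0))) (at_right 0)"
  "((\<lambda>x::real. C * (x * (1 - x))) \<longlongrightarrow> C * (1 * (1 - 1))) (at_left 1)"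
  by (intro tendsto_intros)+
 show "(F \<longlongrightarrow> 0) (at_right 0)" by (rule Lim_null_comparison[OF _ a(1)[simplified]])
   (auto simp: eventually_at_right[of 0 1] intro!: exI[of _ 1] assms)
 show "(F \<longlongrightarrow> 0) (at_left 1)" by (rule Lim_null_comparison[OF _ a(2)[simplified]])
   (auto simp: eventually_at_left[of 0 1] intro!: exI[of _ 0] assms)
qed

end

text \<open>The number of zeros, their simplicity and the nonzero limits at both ends drive the
  completeness proof. Since \<open>f'\<close> vanishes at both ends, no flux crosses the boundary
  and test functions may be nonzero there.\<close>

locale weighted_modes = weighted_interval w om V for w om V :: "real \<Rightarrow> real" +
 fixes f f' :: "nat \<Rightarrow> real \<Rightarrow> real" and L :: "nat \<Rightarrow> real"
 assumes f_deriv: "\<And>n x. 1 \<le> n \<Longrightarrow> 0 < x \<Longrightarrow> x < 1 \<Longrightarrow> DERIV (f n) x :> f' n x"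
  and f'_deriv: "\<And>n x. 1 \<le> n \<Longrightarrow> 0 < x \<Longrightarrow> x < 1 \<Longrightarrow> DERIV (f' n) x :> - om x * f' n x - L n * f n x"
  and f_bdd: "\<And>n. 1 \<le> n \<Longrightarrow> \<exists>C. \<forall>x\<in>{0<..<1}. \<bar>f n x\<bar> \<le> C"
  and f'_bdd: "\<And>n. 1 \<le> n \<Longrightarrow> \<exists>C. \<forall>x\<in>{0<..<1}. \<bar>f' n x\<bar> \<le> C * (x * (1 - x))"
  and f_norm: "\<And>n. 1 \<le> n \<Longrightarrow> ((\<lambda>x. w x * (f n x)^2) has_integral 1) {0<..<1}"
  and f_1: "\<And>x. 0 < x \<Longrightarrow> x < 1 \<Longrightarrow> f 1 x = 1"
  and L_1: "L 1 = 0"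
  and L_mono: "\<And>m n. 1 \<le> m \<Longrightarrow> m < n \<Longrightarrow> L m < L n"
  and L_top: "filterlim L at_top sequentially"
  and f_zeros: "\<And>n. finite {x \<in> {0<..<1}. f (Suc n) x = 0}" "\<And>n. card {x \<in> {0<..<1}. f (Suc n) x = 0} = n"
  and f_simple: "\<And>n x. 1 \<le> n \<Longrightarrow> 0 < x \<Longrightarrow> x < 1 \<Longrightarrow> f n x = 0 \<Longrightarrow> f' n x \<noteq> 0"
  and f_ends: "\<And>n. 1 \<le> n \<Longrightarrow> \<exists>l. l \<noteq> 0 \<and> (f n \<longlongrightarrow> l) (at_right 0)"
   "\<And>n. 1 \<le> n \<Longrightarrow> \<exists>l. l \<noteq> 0 \<and> (f n \<longlongrightarrow> l) (at_left 1)"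
begin

abbreviation "M \<equiv> unit_density w"

lemma cont_f: "1 \<le> n \<Longrightarrow> continuous_on {0<..<1} (f n)" and cont_f': "1 \<le> n \<Longrightarrow> continuous_on {0<..<1} (f' n)"
 by (auto intro!: continuous_at_imp_continuous_on DERIV_isCont f_deriv f'_deriv)

lemma meas_f [measurable (raw)]: "1 \<le> n \<Longrightarrow> f n \<in> borel_measurable M"
 and meas_f' [measurable (raw)]: "1 \<le> n \<Longrightarrow> f' n \<in> borel_measurable M"
 by (auto intro!: measurable_unit_density_continuous cont_f cont_f')

lemma f'_bdd': assumes "1 \<le> n" shows "\<exists>C. \<forall>x\<in>{0<..<1}. \<bar>f' n x\<bar> \<le> C"
proof -
 obtain C where C: "\<And>x. x \<in> {0<..<1} \<Longrightarrow> \<bar>f' n x\<bar> \<le> C * (x * (1 - x))" using f'_bdd[OF assms] by blast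
 have "\<bar>f' n x\<bar> \<le> \<bar>C\<bar>" if x: "x \<in> {0<..<1}" for x
 proof -
  have "x * (1 - x) \<le> 1 * 1" using x by (intro mult_mono) auto
  hence "C * (x * (1 - x)) \<le> \<bar>C\<bar> * 1" using x by (intro mult_mono) auto
  thus ?thesis using C[OF x] by simp
 qed
 thus ?thesis by blast
qed

lemma f'_1: "0 < x \<Longrightarrow> x < 1 \<Longrightarrow> f' 1 x = 0"
proof -
 assume x: "0 < x" "x < 1"
 have "DERIV (f 1) x :> 0"
  by (rule has_field_derivative_transform_within_open[OF DERIV_const[of 1], where S = "{0<..<1}"]) (use x f_1 in auto)
 thus "f' 1 x = 0" using f_deriv[OF _ x, of 1] DERIV_unique by auto
qed

lemma integrable_f_f: assumes "1 \<le> n" "1 \<le> m"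
 shows "integrable M (\<lambda>x. f n x * f m x)" "integrable M (\<lambda>x. f' n x * f' m x)"
proof -
 obtain C D where "\<And>x. x \<in> {0<..<1} \<Longrightarrow> \<bar>f n x\<bar> \<le> C" "\<And>x. x \<in> {0<..<1} \<Longrightarrow> \<bar>f m x\<bar> \<le> D"
  using f_bdd assms by meson
 hence "\<And>x. x \<in> {0<..<1} \<Longrightarrow> \<bar>f n x * f m x\<bar> \<le> C * D"
  unfolding abs_mult by (intro mult_mono) (auto intro: order_trans[OF abs_ge_zero])
 thus "integrable M (\<lambda>x. f n x * f m x)" using assms by (intro integrable_bounded) auto
 obtain C D where "\<And>x. x \<in> {0<..<1} \<Longrightarrow> \<bar>f' n x\<bar> \<le> C" "\<And>x. x \<in> {0<..<1} \<Longrightarrow> \<bar>f' m x\<bar> \<le> D"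
  using f'_bdd' assms by meson
 hence "\<And>x. x \<in> {0<..<1} \<Longrightarrow> \<bar>f' n x * f' m x\<bar> \<le> C * D"
  unfolding abs_mult by (intro mult_mono) (auto intro: order_trans[OF abs_ge_zero])
 thus "integrable M (\<lambda>x. f' n x * f' m x)" using assms by (intro integrable_bounded) auto
qed

text \<open>Integrate \<open>(w f'\<^sub>n g)'\<close>.\<close>
lemma weak_form:
 assumes n: "1 \<le> n" and g: "\<And>x. 0 < x \<Longrightarrow> x < 1 \<Longrightarrow> DERIV g x :> g' x"
  and g'm: "g' \<in> borel_measurable M"
  and gb: "\<And>x. x \<in> {0<..<1} \<Longrightarrow> \<bar>g x\<bar> \<le> C" and g'b: "\<And>x. x \<in> {0<..<1} \<Longrightarrow> \<bar>g' x\<bar> \<le> C'"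
 shows "(LINT x|M. g' x * f' n x) = L n * (LINT x|M. g x * f n x)"
  "integrable M (\<lambda>x. g' x * f' n x)" "integrable M (\<lambda>x. g x * f n x)"
proof -
 have gm: "g \<in> borel_measurable M"
  by (intro measurable_unit_density_continuous continuous_at_imp_continuous_on) (auto intro: DERIV_isCont[OF g])
 obtain A where A: "\<And>x. x \<in> {0<..<1} \<Longrightarrow> \<bar>f n x\<bar> \<le> A" using f_bdd[OF n] by blast
 obtain A' where A': "\<And>x. x \<in> {0<..<1} \<Longrightarrow> \<bar>f' n x\<bar> \<le> A'" using f'_bdd'[OF n] by blast
 obtain B where B: "\<And>x. x \<in> {0<..<1} \<Longrightarrow> \<bar>f' n x\<bar> \<le> B * (x * (1 - x))" using f'_bdd[OF n] by blast
 obtain D where D: "\<And>x. x \<in> {0<..<1} \<Longrightarrow> w x \<le> D" using w_bdd by blast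
 have "\<bar>g' x * f' n x\<bar> \<le> C' * A'" if "x \<in> {0<..<1}" for x
  unfolding abs_mult using that g'b A' by (intro mult_mono) (auto intro: order_trans[OF abs_ge_zero])
 thus i1: "integrable M (\<lambda>x. g' x * f' n x)" using n g'm by (intro integrable_bounded) auto
 have "\<bar>g x * f n x\<bar> \<le> C * A" if "x \<in> {0<..<1}" for x
  unfolding abs_mult using that gb A by (intro mult_mono) (auto intro: order_trans[OF abs_ge_zero])
 thus i2: "integrable M (\<lambda>x. g x * f n x)" using n gm by (intro integrable_bounded) auto
 have "integral\<^sup>L M (\<lambda>x. g' x * f' n x - L n * (g x * f n x)) = 0"
 proof (rule integral_eq_0_ftc)
  fix x :: real assume x: "0 < x" "x < 1"
  show "DERIV (\<lambda>x. w x * f' n x * g x) x :> w x * (g' x * f' n x - L n * (g x * f n x))"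
   by (rule derivative_eq_intros w_deriv f'_deriv g x n refl)+ (simp add: algebra_simps)
 next
  have "\<bar>w x * f' n x * g x\<bar> \<le> (D * B * C) * (x * (1 - x))" if x: "0 < x" "x < 1" for x
  proof -
   have "\<bar>w x * f' n x * g x\<bar> = w x * \<bar>f' n x\<bar> * \<bar>g x\<bar>" using w_pos[OF x] by (simp add: abs_mult)
   also have "\<dots> \<le> D * (B * (x * (1 - x))) * C"
   proof -
    have "0 \<le> D" "0 \<le> B * (x * (1 - x))" using x D[of x] B[of x] w_pos[OF x] by auto
    thus ?thesis using x D[of x] B[of x] gb[of x] by (intro mult_mono) auto
   qed
   finally show ?thesis by (simp add: algebra_simps)
  qed
  from boundary_tendsto_0[OF this] show "((\<lambda>x. w x * f' n x * g x) \<longlongrightarrow> 0) (at_right 0)" "((\<lambda>x. w x * f' n x * g x) \<longlongrightarrow> 0) (at_left 1)"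
   by blast+
  show "integrable M (\<lambda>x. g' x * f' n x - L n * (g x * f n x))"
   by (rule Bochner_Integration.integrable_diff[OF i1 integrable_mult_right[OF i2]])
 qed
 moreover have "integral\<^sup>L M (\<lambda>x. g' x * f' n x - L n * (g x * f n x)) = (LINT x|M. g' x * f' n x) - L n * (LINT x|M. g x * f n x)"
  by (subst Bochner_Integration.integral_diff[OF i1 integrable_mult_right[OF i2]]) (simp only: integral_mult_right_zero)
 ultimately show "(LINT x|M. g' x * f' n x) = L n * (LINT x|M. g x * f n x)" by linarith
qed

lemma weak_form_modes:
 assumes "1 \<le> n" "1 \<le> m"
 shows "(LINT x|M. f' m x * f' n x) = L n * (LINT x|M. f m x * f n x)"
proof -
 obtain C where C: "\<And>x. x \<in> {0<..<1} \<Longrightarrow> \<bar>f m x\<bar> \<le> C" using f_bdd[OF assms(2)] by blast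
 obtain D where D: "\<And>x. x \<in> {0<..<1} \<Longrightarrow> \<bar>f' m x\<bar> \<le> D" using f'_bdd'[OF assms(2)] by blast
 show ?thesis by (rule weak_form(1)[OF assms(1) f_deriv[OF assms(2)] meas_f'[OF assms(2)] C D])
qed

text \<open>The weak form is symmetric in the two modes, and their eigenvalues differ.\<close>

lemma orthonormal_f:
 assumes "1 \<le> n" "1 \<le> m"
 shows "(LINT x|M. f n x * f m x) = (if n = m then 1 else 0)"
proof (cases "n = m")
 case True
 have "((\<lambda>x. w x * (f n x * f n x)) has_integral (LINT x|M. f n x * f n x)) {0<..<1}"
  using integral_has_integral[OF integrable_f_f(1)[of n n]] assms by simp
 thus ?thesis using f_norm[of n] assms True has_integral_unique by (auto simp: power2_eq_square)
next
 case False
 have "L n * (LINT x|M. f n x * f m x) = L m * (LINT x|M. f n x * f m x)"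
  using weak_form_modes[OF assms] weak_form_modes[OF assms(2,1)] by (simp add: mult.commute)
 moreover have "L n \<noteq> L m" using L_mono[of n m] L_mono[of m n] assms False by (metis less_irrefl nat_neq_iff)
 ultimately show ?thesis using False by simp
qed

lemma orthonormal_f':
 assumes "1 \<le> n" "1 \<le> m"
 shows "(LINT x|M. f' n x * f' m x) = (if n = m then L n else 0)"
 using weak_form_modes[OF assms(2,1)] orthonormal_f[OF assms] by simp

text \<open>The ground state is the constant 1 and is normalized.\<close>

lemma prob_space_M: "prob_space M"
proof (rule prob_spaceI)
 have nn: "AE x in M. 0 \<le> (1::real)" by simp
 have "integrable M (\<lambda>x. f 1 x * f 1 x)" by (rule integrable_f_f) auto
 hence i: "integrable M (\<lambda>x. 1::real)"
  by (rule Bochner_Integration.integrable_cong[THEN iffD1, rotated 2]) (auto simp: f_1[unfolded One_nat_def])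
 have "(LINT x|M. f 1 x * f 1 x) = (LINT x|M. 1)"
  by (rule Bochner_Integration.integral_cong) (auto simp: f_1[unfolded One_nat_def])
 hence "(LINT x|M. 1::real) = 1" using orthonormal_f[of 1 1] by simp
 moreover have "(\<integral>\<^sup>+x. ennreal 1 \<partial>M) = ennreal (LINT x|M. 1)"
  using i by (intro nn_integral_eq_integral) auto
 ultimately show "emeasure M (space M) = 1" by simp
qed

lemma L_nonneg: "1 \<le> n \<Longrightarrow> 0 \<le> L n" using L_mono[of 1 n] L_1 by (cases "n = 1") auto

lemma L_pos: "2 \<le> n \<Longrightarrow> 0 < L n" using L_mono[of 1 n] L_1 by auto

end

section \<open>Completeness of the modes on the interval by counting zeros\<close>

lemma nontrivial_kernel:
 fixes A :: "'j \<Rightarrow> 'k \<Rightarrow> real"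
 assumes "finite K" "finite J" "card K < card J"
 shows "\<exists>c. (\<exists>j\<in>J. c j \<noteq> 0) \<and> (\<forall>k\<in>K. (\<Sum>j\<in>J. c j * A j k) = 0)"
 using assms
proof (induction K arbitrary: J A rule: finite_induct)
 case empty
 hence "J \<noteq> {}" by auto
 thus ?case by (intro exI[of _ "\<lambda>_. 1"]) auto
next
 case (insert k K)
 show ?case
 proof (cases "\<forall>j\<in>J. A j k = 0")
  case True
  obtain c where "\<exists>j\<in>J. c j \<noteq> 0" "\<forall>k\<in>K. (\<Sum>j\<in>J. c j * A j k) = 0"
   using insert.IH[of J A] insert.prems insert.hyps by auto
  with True show ?thesis by (intro exI[of _ c]) auto
 next
  case False
  then obtain i where i: "i \<in> J" "A i k \<noteq> 0" by blast
  define J' where "J' = J - {i}"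
  have J': "finite J'" "J = insert i J'" "i \<notin> J'" "card K < card J'"
   using insert.prems insert.hyps i by (auto simp: J'_def)
  obtain c where c: "\<exists>j\<in>J'. c j \<noteq> 0"
   "\<And>l. l \<in> K \<Longrightarrow> (\<Sum>j\<in>J'. c j * (A j l - A j k / A i k * A i l)) = 0"
   using insert.IH[OF J'(1,4), of "\<lambda>j l. A j l - A j k / A i k * A i l"] by blast
  \<comment> \<open>The value of the eliminated unknown \<open>i\<close> that solves the equation
    \<open>k\<close>.\<close>
  define t where "t = - (\<Sum>j\<in>J'. c j * A j k / A i k)"
  have eq: "(\<Sum>j\<in>J. (c(i := t)) j * A j l) = t * A i l + (\<Sum>j\<in>J'. c j * A j l)" for l
   unfolding J'(2) using J'(1,3) by (auto intro!: sum.cong)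
  show ?thesis
  proof (intro exI[of _ "c(i := t)"] conjI ballI)
   show "\<exists>j\<in>J. (c(i := t)) j \<noteq> 0" using c(1) J' by auto
   fix l assume "l \<in> insert k K"
   then consider "l = k" | "l \<in> K" by blast
   thus "(\<Sum>j\<in>J. (c(i := t)) j * A j l) = 0"
   proof cases
    case 1
    have "t * A i k = - (\<Sum>j\<in>J'. c j * A j k)" using i by (simp add: t_def sum_divide_distrib[symmetric])
    thus ?thesis unfolding eq 1 by simp
   next
    case 2
    have "t * A i l + (\<Sum>j\<in>J'. c j * A j l) = (\<Sum>j\<in>J'. c j * (A j l - A j k / A i k * A i l))"
     by (simp add: t_def sum_distrib_left sum_distrib_right right_diff_distrib sum_subtractf sum_negf mult_ac)
    thus ?thesis using c(2)[OF 2] unfolding eq by simp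
   qed
  qed
 qed
qed

lemma tendsto_quotient_at_common_zero:
 fixes F f :: "real \<Rightarrow> real"
 assumes "DERIV F z :> F'" "DERIV f z :> f'" "F z = 0" "f z = 0" "f' \<noteq> 0"
 shows "((\<lambda>x. F x / f x) \<longlongrightarrow> F' / f') (at z)"
proof -
 have "((\<lambda>x. ((F x - F z) / (x - z)) / ((f x - f z) / (x - z))) \<longlongrightarrow> F' / f') (at z)"
  using assms by (intro tendsto_divide) (auto simp: has_field_derivative_iff)
 thus ?thesis by (rule Lim_transform_eventually) (auto simp: assms eventually_at_filter)
qed

lemma integral_square_sum_orthogonal:
 fixes h :: "'j \<Rightarrow> 'a \<Rightarrow> real"
 assumes "finite J" and i: "\<And>j k. j \<in> J \<Longrightarrow> k \<in> J \<Longrightarrow> integrable M (\<lambda>x. h j x * h k x)"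
  and o: "\<And>j k. j \<in> J \<Longrightarrow> k \<in> J \<Longrightarrow> j \<noteq> k \<Longrightarrow> (LINT x|M. h j x * h k x) = 0"
 shows "(LINT x|M. (\<Sum>j\<in>J. c j * h j x)^2) = (\<Sum>j\<in>J. (c j)^2 * (LINT x|M. h j x * h j x))"
proof -
 have "(LINT x|M. (\<Sum>j\<in>J. c j * h j x)^2) = (LINT x|M. (\<Sum>j\<in>J. \<Sum>k\<in>J. (c j * c k) * (h j x * h k x)))"
  by (simp add: power2_eq_square sum_product algebra_simps)
 also have "\<dots> = (\<Sum>j\<in>J. \<Sum>k\<in>J. (c j * c k) * (LINT x|M. h j x * h k x))"
  using i by (subst Bochner_Integration.integral_sum; (intro Bochner_Integration.integrable_sum integrable_mult_right)?)
   (auto intro!: sum.cong simp: Bochner_Integration.integral_sum)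
 also have "\<dots> = (\<Sum>j\<in>J. \<Sum>k\<in>J. if k = j then (c j)\<^sup>2 * (LINT x|M. h j x * h j x) else 0)"
  using o by (intro sum.cong) (auto simp: power2_eq_square)
 finally show ?thesis using assms(1) by simp
qed

context weighted_modes
begin

lemma integrable_mult_bounded:
 fixes g h :: "real \<Rightarrow> real"
 assumes "g \<in> borel_measurable M" "h \<in> borel_measurable M"
  "\<And>x. x \<in> {0<..<1} \<Longrightarrow> \<bar>g x\<bar> \<le> C" "\<And>x. x \<in> {0<..<1} \<Longrightarrow> \<bar>h x\<bar> \<le> D"
 shows "integrable M (\<lambda>x. g x * h x)"
proof (rule integrable_bounded(1))
 show "(\<lambda>x. g x * h x) \<in> borel_measurable M" using assms by measurable
 show "\<bar>g x * h x\<bar> \<le> C * D" if "x \<in> {0<..<1}" for x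
  unfolding abs_mult using that assms(3,4) by (intro mult_mono) (auto intro: order_trans[OF abs_ge_zero])
qed

text \<open>The test functions: bounded with bounded derivative and free boundary values.\<close>

definition tame :: "(real \<Rightarrow> real) \<Rightarrow> (real \<Rightarrow> real) \<Rightarrow> bool" where
 "tame F F' \<longleftrightarrow> (\<forall>x. 0 < x \<longrightarrow> x < 1 \<longrightarrow> DERIV F x :> F' x) \<and> F' \<in> borel_measurable M \<and>
  (\<exists>C. \<forall>x\<in>{0<..<1}. \<bar>F x\<bar> \<le> C) \<and> (\<exists>C. \<forall>x\<in>{0<..<1}. \<bar>F' x\<bar> \<le> C)"

lemma tame_f: "1 \<le> n \<Longrightarrow> tame (f n) (f' n)"
 unfolding tame_def using f_deriv f_bdd f'_bdd' meas_f' by auto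

lemma tame_meas: assumes "tame F F'" shows "F \<in> borel_measurable M" "F' \<in> borel_measurable M"
proof -
 show "F \<in> borel_measurable M"
  using assms by (intro measurable_unit_density_continuous continuous_at_imp_continuous_on) (auto simp: tame_def intro: DERIV_isCont)
 show "F' \<in> borel_measurable M" using assms by (simp add: tame_def)
qed

lemma tame_integrable:
 assumes "tame F F'" "tame G G'"
 shows "integrable M (\<lambda>x. F x * G x)" "integrable M (\<lambda>x. F' x * G' x)"
 using integrable_mult_bounded[OF tame_meas(1)[OF assms(1)] tame_meas(1)[OF assms(2)]]
  integrable_mult_bounded[OF tame_meas(2)[OF assms(1)] tame_meas(2)[OF assms(2)]] assms unfolding tame_def by blast+

lemma tame_weak_form:
 assumes "tame F F'" "1 \<le> n"
 shows "(LINT x|M. F' x * f' n x) = L n * (LINT x|M. F x * f n x)"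
 using assms(1) weak_form(1)[OF assms(2)] unfolding tame_def by blast

lemma tame_lincomb:
 assumes J: "finite J" and t: "\<And>j. j \<in> J \<Longrightarrow> tame (h j) (h' j)"
 shows "tame (\<lambda>x. \<Sum>j\<in>J. c j * h j x) (\<lambda>x. \<Sum>j\<in>J. c j * h' j x)"
proof -
 have b: "\<exists>C. \<forall>x\<in>{0<..<1}. \<bar>\<Sum>j\<in>J. c j * k j x\<bar> \<le> C"
  if k: "\<And>j. j \<in> J \<Longrightarrow> \<exists>C. \<forall>x\<in>{0<..<1}. \<bar>k j x\<bar> \<le> C" for k :: "_ \<Rightarrow> real \<Rightarrow> real"
 proof -
  obtain C where C: "\<And>j x. j \<in> J \<Longrightarrow> x \<in> {0<..<1} \<Longrightarrow> \<bar>k j x\<bar> \<le> C j" using k by metis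
  have "\<bar>\<Sum>j\<in>J. c j * k j x\<bar> \<le> (\<Sum>j\<in>J. \<bar>c j\<bar> * C j)" if "x \<in> {0<..<1}" for x
   by (rule order_trans[OF sum_abs]) (auto intro!: sum_mono mult_left_mono C that simp: abs_mult)
  thus ?thesis by blast
 qed
 show ?thesis unfolding tame_def
 proof (intro conjI allI impI)
  fix x :: real assume x: "0 < x" "x < 1"
  show "DERIV (\<lambda>x. \<Sum>j\<in>J. c j * h j x) x :> (\<Sum>j\<in>J. c j * h' j x)"
   using t x by (intro DERIV_sum DERIV_cmult) (auto simp: tame_def)
 next
  show "(\<lambda>x. \<Sum>j\<in>J. c j * h' j x) \<in> borel_measurable M"
   using tame_meas(2)[OF t] by (intro borel_measurable_sum borel_measurable_times) auto
 qed (use t in \<open>auto intro!: b simp: tame_def\<close>)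
qed

text \<open>With \<open>f\<^sub>n\<close> as ground state on each of its nodal intervals:
 \<open>(w F\<^sup>2 f'\<^sub>n / f\<^sub>n)' \<le> w (F'\<^sup>2 - L\<^sub>n F\<^sup>2)\<close>, and the left-hand side integrates to 0.\<close>
lemma poincare_vanishing:
 assumes n: "1 \<le> n" and t: "tame F F'"
  and z: "\<And>x. 0 < x \<Longrightarrow> x < 1 \<Longrightarrow> f n x = 0 \<Longrightarrow> F x = 0"
 shows "L n * (LINT x|M. F x * F x) \<le> (LINT x|M. F' x * F' x)"
proof -
 define R where "R = (\<lambda>x. F x * F x * w x * f' n x / f n x)"
 define S where "S = {x \<in> {0<..<1}. f n x = 0}"
 have S: "finite S" using f_zeros(1)[of "n - 1"] n by (simp add: S_def)
 have dF: "DERIV F x :> F' x" if "0 < x" "x < 1" for x using t that by (simp add: tame_def)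
 obtain C where C: "\<And>x. x \<in> {0<..<1} \<Longrightarrow> \<bar>F x\<bar> \<le> C" using t unfolding tame_def by blast
 obtain B where B: "\<And>x. x \<in> {0<..<1} \<Longrightarrow> \<bar>f' n x\<bar> \<le> B * (x * (1 - x))" using f'_bdd[OF n] by blast
 obtain D where D: "\<And>x. x \<in> {0<..<1} \<Longrightarrow> w x \<le> D" using w_bdd by blast
 have lim: "((\<lambda>x. F x * F x * w x * f' n x) \<longlongrightarrow> 0) (at_right 0)" "((\<lambda>x. F x * F x * w x * f' n x) \<longlongrightarrow> 0) (at_left 1)"
 proof -
  have "\<bar>F x * F x * w x * f' n x\<bar> \<le> (C * C * D * B) * (x * (1 - x))" if x: "0 < x" "x < 1" for x
  proof -
   have "0 \<le> C" "0 \<le> D" "0 \<le> B * (x * (1 - x))" using x C[of x] D[of x] B[of x] w_pos[OF x] by auto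
   hence "\<bar>F x\<bar> * \<bar>F x\<bar> * w x * \<bar>f' n x\<bar> \<le> C * C * D * (B * (x * (1 - x)))"
    using x C[of x] D[of x] B[of x] w_pos[OF x] by (intro mult_mono) auto
   thus ?thesis using w_pos[OF x] by (simp add: abs_mult algebra_simps del: abs_mult_self_eq)
  qed
  from boundary_tendsto_0[OF this] show "((\<lambda>x. F x * F x * w x * f' n x) \<longlongrightarrow> 0) (at_right 0)" "((\<lambda>x. F x * F x * w x * f' n x) \<longlongrightarrow> 0) (at_left 1)"
   by blast+
 qed
 obtain l0 l1 where l: "l0 \<noteq> 0" "(f n \<longlongrightarrow> l0) (at_right 0)" "l1 \<noteq> 0" "(f n \<longlongrightarrow> l1) (at_left 1)"
  using f_ends[OF n] by blast
 have limR: "(R \<longlongrightarrow> 0) (at_right 0)" "(R \<longlongrightarrow> 0) (at_left 1)"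
  unfolding R_def using tendsto_divide[OF lim(1) l(2,1)] tendsto_divide[OF lim(2) l(4,3)] by simp_all
 define Q where "Q = (\<lambda>x. F' x - F x * f' n x / f n x)"
 have dR: "DERIV R x :> w x * (F' x * F' x - L n * (F x * F x) - (Q x)^2)" if x: "0 < x" "x < 1" "x \<notin> S" for x
 proof -
  have nz: "f n x \<noteq> 0" using x by (simp add: S_def)
  show ?thesis unfolding R_def Q_def
   apply (rule derivative_eq_intros dF f_deriv f'_deriv w_deriv x nz n refl)+
   using nz by (simp add: field_simps power2_eq_square)
 qed
 \<comment> \<open>At a zero of \<open>f n\<close> the value of \<open>R\<close> is 0 by division by
   zero. It is also the limit: the simple zero of \<open>f n\<close> cancels one factor
   \<open>F\<close>, and the other factor \<open>F\<close> still tends to 0.\<close>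
 have cR: "isCont R z" if "z \<in> S" "0 < z" "z < 1" for z
 proof -
  have fz: "f n z = 0" "F z = 0" using that assms(3) by (auto simp: S_def)
  have q: "((\<lambda>x. F x / f n x) \<longlongrightarrow> F' z / f' n z) (at z)"
   using that n fz f_simple by (intro tendsto_quotient_at_common_zero dF f_deriv) auto
  have c: "isCont F z" "isCont w z" "isCont (f' n) z"
   using dF w_deriv f'_deriv[OF n] that by (auto intro: DERIV_isCont)
  have "((\<lambda>x. (F x / f n x) * (F x * w x * f' n x)) \<longlongrightarrow> (F' z / f' n z) * (F z * w z * f' n z)) (at z)"
   using c by (intro tendsto_mult q) (auto simp: isCont_def)
  thus ?thesis using fz by (simp add: isCont_def R_def algebra_simps)
 qed
 have h0: "((\<lambda>x. w x * (F' x * F' x - L n * (F x * F x) - (Q x)^2)) has_integral 0) {0<..<1}"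
  by (rule ftc_finite[OF S dR cR limR])
 have i: "integrable M (\<lambda>x. F' x * F' x - L n * (F x * F x))"
  using tame_integrable[OF t t] by (intro Bochner_Integration.integrable_diff integrable_mult_right)
 have "0 \<le> (LINT x|M. F' x * F' x - L n * (F x * F x))"
 proof (rule has_integral_le[OF h0 integral_has_integral[OF i]])
  fix x :: real assume "x \<in> {0<..<1}"
  hence "0 < w x" using w_pos by auto
  thus "w x * (F' x * F' x - L n * (F x * F x) - (Q x)^2) \<le> w x * (F' x * F' x - L n * (F x * F x))"
   by (intro mult_left_mono) auto
 qed
 also have "\<dots> = (LINT x|M. F' x * F' x) - L n * (LINT x|M. F x * F x)" using tame_integrable[OF t t]
  by (subst Bochner_Integration.integral_diff) (auto intro: integrable_mult_right)
 finally show ?thesis by simp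
qed

text \<open>\<open>f (Suc N)\<close> has N zeros, so some nontrivial combination of the N + 1
  functions \<open>F\<close>, \<open>f 1\<close>, ..., \<open>f N\<close> vanishes at all of them
  and \<open>poincare_vanishing\<close> applies to it. The functions are orthogonal in the mean and
  in energy, and each \<open>f j\<close> satisfies the reverse inequality strictly, since its energy
  \<open>L j\<close> is below \<open>L (Suc N)\<close>. Removing the modes leaves the inequality for
  \<open>F\<close>.\<close>

lemma poincare_orthogonal:
 assumes t: "tame F F'" and o: "\<And>j. 1 \<le> j \<Longrightarrow> j \<le> N \<Longrightarrow> (LINT x|M. F x * f j x) = 0"
 shows "L (Suc N) * (LINT x|M. F x * F x) \<le> (LINT x|M. F' x * F' x)"
proof -
 \<comment> \<open>Modes are counted from 1, so index 0 is free to carry \<open>F\<close>.\<close>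
 define h where "h = (\<lambda>j. if j = 0 then F else f j)"
 define h' where "h' = (\<lambda>j. if j = 0 then F' else f' j)"
 have th: "tame (h j) (h' j)" for j using t tame_f[of j] by (auto simp: h_def h'_def)
 obtain c where c: "\<exists>j\<in>{0..N}. c j \<noteq> 0" "\<And>x. x \<in> {x \<in> {0<..<1}. f (Suc N) x = 0} \<Longrightarrow> (\<Sum>j\<in>{0..N}. c j * h j x) = 0"
  using nontrivial_kernel[of "{x \<in> {0<..<1}. f (Suc N) x = 0}" "{0..N}" h] f_zeros[of N] by auto
 have sym: "(LINT x|M. h j x * h k x) = (LINT x|M. h k x * h j x)" "(LINT x|M. h' j x * h' k x) = (LINT x|M. h' k x * h' j x)" for j k
  by (simp_all add: mult.commute)
 have orth: "(LINT x|M. h j x * h k x) = 0" "(LINT x|M. h' j x * h' k x) = 0" if "j \<le> N" "k \<le> N" "j \<noteq> k" for j k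
 proof -
  have 0: "(LINT x|M. h 0 x * h k x) = 0" "(LINT x|M. h' 0 x * h' k x) = 0" if "1 \<le> k" "k \<le> N" for k
   using that o[OF that] tame_weak_form[OF t that(1)] by (auto simp: h_def h'_def)
  show "(LINT x|M. h j x * h k x) = 0"
  proof (cases "j = 0 \<or> k = 0")
   case True thus ?thesis using 0(1)[of k] 0(1)[of j] sym(1) that by (cases "j = 0") auto
  next
   case False thus ?thesis using that orthonormal_f[of j k] by (simp add: h_def)
  qed
  show "(LINT x|M. h' j x * h' k x) = 0"
  proof (cases "j = 0 \<or> k = 0")
   case True thus ?thesis using 0(2)[of k] 0(2)[of j] sym(2) that by (cases "j = 0") auto
  next
   case False thus ?thesis using that orthonormal_f'[of j k] by (simp add: h'_def)
  qed
 qed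
 define E where "E = (LINT x|M. F x * F x)"
 define D where "D = (LINT x|M. F' x * F' x)"
 have "L (Suc N) * (LINT x|M. (\<Sum>j\<in>{0..N}. c j * h j x) * (\<Sum>j\<in>{0..N}. c j * h j x))
  \<le> (LINT x|M. (\<Sum>j\<in>{0..N}. c j * h' j x) * (\<Sum>j\<in>{0..N}. c j * h' j x))"
  using c(2) by (intro poincare_vanishing tame_lincomb th) auto
 hence "L (Suc N) * (\<Sum>j\<in>{0..N}. (c j)^2 * (LINT x|M. h j x * h j x)) \<le> (\<Sum>j\<in>{0..N}. (c j)^2 * (LINT x|M. h' j x * h' j x))"
  unfolding power2_eq_square[symmetric]
  by (subst (asm) (1 2) integral_square_sum_orthogonal) (use orth tame_integrable[OF th th] in \<open>auto simp: power2_eq_square\<close>)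
 moreover have "{0..N} = insert 0 {1..N}" by auto
 moreover have "(\<Sum>j\<in>{1..N}. (c j)^2 * (LINT x|M. h j x * h j x)) = (\<Sum>j\<in>{1..N}. (c j)^2)"
  using orthonormal_f by (intro sum.cong) (auto simp: h_def)
 moreover have "(\<Sum>j\<in>{1..N}. (c j)^2 * (LINT x|M. h' j x * h' j x)) = (\<Sum>j\<in>{1..N}. (c j)^2 * L j)"
  using orthonormal_f' by (intro sum.cong) (auto simp: h'_def)
 ultimately have main: "L (Suc N) * ((c 0)^2 * E + (\<Sum>j\<in>{1..N}. (c j)^2)) \<le> (c 0)^2 * D + (\<Sum>j\<in>{1..N}. (c j)^2 * L j)"
  by (simp add: E_def D_def h_def h'_def)
 have le: "(c j)^2 * L j \<le> (c j)^2 * L (Suc N)" if "j \<in> {1..N}" for j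
  using L_mono[of j "Suc N"] that by (intro mult_left_mono) auto
 have sle: "(\<Sum>j\<in>{1..N}. (c j)^2 * L j) \<le> (\<Sum>j\<in>{1..N}. (c j)^2 * L (Suc N))"
  using le by (rule sum_mono)
 \<comment> \<open>Without \<open>F\<close> the combination would consist of modes with eigenvalues
   below \<open>L (Suc N)\<close>, contrary to \<open>main\<close>.\<close>
 have c0: "c 0 \<noteq> 0"
 proof
  assume 0: "c 0 = 0"
  then obtain i where i: "i \<in> {1..N}" "c i \<noteq> 0" using c(1) by (metis atLeastAtMost_iff le_0_eq not_less_eq_eq One_nat_def)
  have "(\<Sum>j\<in>{1..N}. (c j)^2 * L j) < (\<Sum>j\<in>{1..N}. (c j)^2 * L (Suc N))"
  proof (rule sum_strict_mono_ex1)
   show "\<exists>j\<in>{1..N}. (c j)^2 * L j < (c j)\<^sup>2 * L (Suc N)"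
    using i L_mono[of i "Suc N"] by (intro bexI[of _ i] mult_strict_left_mono) auto
  qed (use le in auto)
  thus False using main 0 by (simp add: sum_distrib_left mult.commute)
 qed
 have "(c 0)^2 * (L (Suc N) * E) \<le> (c 0)^2 * D"
  using main sle by (simp add: sum_distrib_left distrib_left mult.commute mult.left_commute)
 thus ?thesis using c0 by (simp add: E_def D_def)
qed

definition residual :: "(real \<Rightarrow> real) \<Rightarrow> nat \<Rightarrow> real \<Rightarrow> real" where
 "residual F N x = F x - (\<Sum>j\<in>{1..N}. (LINT y|M. F y * f j y) * f j x)"
definition residual' :: "(real \<Rightarrow> real) \<Rightarrow> (real \<Rightarrow> real) \<Rightarrow> nat \<Rightarrow> real \<Rightarrow> real" where
 "residual' F F' N x = F' x - (\<Sum>j\<in>{1..N}. (LINT y|M. F y * f j y) * f' j x)"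

lemma tame_residual:
 assumes t: "tame F F'"
 shows "tame (residual F N) (residual' F F' N)"
proof -
 define c where "c = (\<lambda>j. if j = 0 then 1 else - (LINT y|M. F y * f j y))"
 have "tame (\<lambda>x. \<Sum>j\<in>{0..N}. c j * (if j = 0 then F else f j) x) (\<lambda>x. \<Sum>j\<in>{0..N}. c j * (if j = 0 then F' else f' j) x)"
  using t tame_f by (intro tame_lincomb) auto
 moreover have "(\<Sum>j\<in>{0..N}. c j * (if j = 0 then F else f j) x) = residual F N x"
  "(\<Sum>j\<in>{0..N}. c j * (if j = 0 then F' else f' j) x) = residual' F F' N x" for x
 proof -
  have "{0..N} = insert 0 {1..N}" by auto
  thus "(\<Sum>j\<in>{0..N}. c j * (if j = 0 then F else f j) x) = residual F N x"
   "(\<Sum>j\<in>{0..N}. c j * (if j = 0 then F' else f' j) x) = residual' F F' N x"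
   unfolding residual_def residual'_def by (auto simp: c_def sum_negf[symmetric] intro!: sum.cong)
 qed
 ultimately show ?thesis by simp
qed

lemma residual_orthogonal:
 assumes t: "tame F F'" and j: "1 \<le> j" "j \<le> N"
 shows "(LINT x|M. residual F N x * f j x) = 0" "(LINT x|M. residual' F F' N x * f' j x) = 0"
proof -
 have i: "integrable M (\<lambda>x. (LINT y|M. F y * f k y) * f k x * f j x)" if "k \<in> {1..N}" for k
  using integrable_mult_right[OF integrable_f_f(1)[of k j]] that j by (simp add: mult.assoc)
 have "(LINT x|M. residual F N x * f j x) = (LINT x|M. F x * f j x - (\<Sum>k\<in>{1..N}. (LINT y|M. F y * f k y) * f k x * f j x))"
  by (simp add: residual_def left_diff_distrib sum_distrib_right)
 also have "\<dots> = (LINT x|M. F x * f j x) - (\<Sum>k\<in>{1..N}. LINT x|M. (LINT y|M. F y * f k y) * f k x * f j x)"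
  using i tame_integrable(1)[OF t tame_f[OF j(1)]]
  by (subst Bochner_Integration.integral_diff) (auto simp: Bochner_Integration.integral_sum)
 also have "(\<Sum>k\<in>{1..N}. LINT x|M. (LINT y|M. F y * f k y) * f k x * f j x)
   = (\<Sum>k\<in>{1..N}. if k = j then (LINT y|M. F y * f j y) else 0)"
  using j by (intro sum.cong refl) (auto simp: mult.assoc orthonormal_f)
 finally show 1: "(LINT x|M. residual F N x * f j x) = 0" using j by simp
 show "(LINT x|M. residual' F F' N x * f' j x) = 0" using tame_weak_form[OF tame_residual[OF t] j(1)] 1 by simp
qed

lemma residual_energy_le:
 assumes t: "tame F F'"
 shows "(LINT x|M. residual' F F' N x * residual' F F' N x) \<le> (LINT x|M. F' x * F' x)"
proof -
 define s where "s = (\<lambda>x. \<Sum>j\<in>{1..N}. (LINT y|M. F y * f j y) * f' j x)"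
 have ts: "tame (\<lambda>x. \<Sum>j\<in>{1..N}. (LINT y|M. F y * f j y) * f j x) s"
  unfolding s_def by (intro tame_lincomb tame_f) auto
 note tr = tame_residual[OF t, of N]
 note i = tame_integrable(2)[OF tr tr] tame_integrable(2)[OF tr ts] tame_integrable(2)[OF ts ts]
 have "(LINT x|M. residual' F F' N x * s x) = (\<Sum>j\<in>{1..N}. (LINT y|M. F y * f j y) * (LINT x|M. residual' F F' N x * f' j x))"
  unfolding s_def sum_distrib_left using tame_integrable(2)[OF tr tame_f]
  by (subst Bochner_Integration.integral_sum) (auto simp: mult.left_commute[of "residual' F F' N _"])
 also have "\<dots> = 0" using residual_orthogonal(2)[OF t] by simp
 finally have o: "(LINT x|M. residual' F F' N x * s x) = 0" .
 have "(LINT x|M. F' x * F' x) = (LINT x|M. residual' F F' N x * residual' F F' N x + (2 * (residual' F F' N x * s x) + s x * s x))"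
  by (rule arg_cong[of _ _ "integral\<^sup>L M"]) (simp add: fun_eq_iff residual'_def s_def algebra_simps)
 also have "\<dots> = (LINT x|M. residual' F F' N x * residual' F F' N x) + (2 * (LINT x|M. residual' F F' N x * s x) + (LINT x|M. s x * s x))"
  using i by (subst Bochner_Integration.integral_add, simp, intro Bochner_Integration.integrable_add integrable_mult_right, simp_all)
 finally show ?thesis using o by (simp add: integral_nonneg)
qed

text \<open>The Poincare constant \<open>L (Suc N)\<close> of the residual tends to infinity while
  its energy stays below that of \<open>F\<close>.\<close>

lemma residual_tendsto_0:
 assumes t: "tame F F'"
 shows "(\<lambda>N. LINT x|M. (residual F N x)^2) \<longlonglongrightarrow> 0"
proof (rule tendsto_sandwich[OF _ _ tendsto_const])
 show "\<forall>\<^sub>F N in sequentially. 0 \<le> (LINT x|M. (residual F N x)^2)" by (simp add: integral_nonneg)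
 show "\<forall>\<^sub>F N in sequentially. (LINT x|M. (residual F N x)^2) \<le> (LINT x|M. F' x * F' x) / L (Suc N)"
  using eventually_gt_at_top[of 0]
 proof eventually_elim
  case (elim N)
  have "L (Suc N) * (LINT x|M. residual F N x * residual F N x) \<le> (LINT x|M. residual' F F' N x * residual' F F' N x)"
   using residual_orthogonal(1)[OF t] by (intro poincare_orthogonal tame_residual t) auto
  also note residual_energy_le[OF t]
  finally show ?case using L_pos[of "Suc N"] elim by (simp add: power2_eq_square field_simps)
 qed
 have "filterlim (\<lambda>N. L (Suc N)) at_top sequentially" using L_top by (rule filterlim_compose) (rule filterlim_Suc)
 thus "(\<lambda>N. (LINT x|M. F' x * F' x) / L (Suc N)) \<longlonglongrightarrow> 0"
  by (intro tendsto_divide_0[OF tendsto_const] filterlim_at_top_imp_at_infinity)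
qed

text \<open>If \<open>G' = g\<close> then \<open>\<parallel>g - s\<^sub>N\<parallel>\<^sup>2 = \<langle>G - S\<^sub>N, h\<rangle>\<close> with \<open>h = -(w g)' / w\<close>, so completeness of the
 derivatives reduces to that of the modes.\<close>
lemma residual'_tendsto_0:
 assumes t: "tame G g" and tg: "tame g g'" and C: "\<And>x. 0 < x \<Longrightarrow> x < 1 \<Longrightarrow> \<bar>g x\<bar> \<le> C * (x * (1 - x))"
 shows "(\<lambda>N. LINT x|M. (residual' G g N x)^2) \<longlonglongrightarrow> 0"
proof -
 define h where "h = (\<lambda>x. om x * g x + g' x)"
 obtain B where B: "\<And>x. x \<in> {0<..<1} \<Longrightarrow> \<bar>om x\<bar> * (x * (1 - x)) \<le> B" using om_bdd by blast
 obtain C' where C': "\<And>x. x \<in> {0<..<1} \<Longrightarrow> \<bar>g' x\<bar> \<le> C'" using tg unfolding tame_def by blast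
 obtain D where D: "\<And>x. x \<in> {0<..<1} \<Longrightarrow> w x \<le> D" using w_bdd by blast
 have hm: "h \<in> borel_measurable M"
  unfolding h_def using tame_meas[OF tg] measurable_unit_density_continuous[OF cont_om] by measurable
 \<comment> \<open>The pole of \<open>om\<close> at an endpoint is cancelled by the decay of
   \<open>g\<close>.\<close>
 have hb: "\<bar>h x\<bar> \<le> B * \<bar>C\<bar> + C'" if x: "x \<in> {0<..<1}" for x
 proof -
  have "\<bar>om x * g x\<bar> \<le> \<bar>om x\<bar> * (\<bar>C\<bar> * (x * (1 - x)))"
   unfolding abs_mult using C[of x] x by (intro mult_left_mono) (auto intro: order_trans mult_right_mono)
  also have "\<dots> = (\<bar>om x\<bar> * (x * (1 - x))) * \<bar>C\<bar>" by simp
  also have "\<dots> \<le> B * \<bar>C\<bar>" using B[OF x] by (intro mult_right_mono) auto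
  finally show ?thesis using C'[OF x] unfolding h_def by linarith
 qed
 have hhi: "integrable M (\<lambda>x. h x * h x)" by (rule integrable_mult_bounded[OF hm hm hb hb])
 define K where "K = (LINT x|M. h x * h x)"
 have K0: "K \<ge> 0" by (simp add: K_def integral_nonneg)
 \<comment> \<open>The pairing of the residual with \<open>h\<close> is estimated by Young's
   inequality with a free parameter \<open>e\<close>. It is made proportional to the target accuracy
   first, and then N is chosen.\<close>
 have main: "(LINT x|M. (residual' G g N x)^2) \<le> e * K / 2 + (LINT x|M. (residual G N x)^2) / (2 * e)" if e: "e > 0" for N e
 proof -
  define r where "r = residual G N"
  define r' where "r' = residual' G g N"
  have tr: "tame r r'" unfolding r_def r'_def by (rule tame_residual[OF t])
  define s where "s = (\<lambda>x. \<Sum>j\<in>{1..N}. (LINT y|M. G y * f j y) * f' j x)"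
  have ts: "tame (\<lambda>x. \<Sum>j\<in>{1..N}. (LINT y|M. G y * f j y) * f j x) s"
   unfolding s_def by (intro tame_lincomb tame_f) auto
  have "(LINT x|M. r' x * s x) = (\<Sum>j\<in>{1..N}. (LINT y|M. G y * f j y) * (LINT x|M. r' x * f' j x))"
   unfolding s_def sum_distrib_left using tame_integrable(2)[OF tr tame_f]
   by (subst Bochner_Integration.integral_sum) (auto simp: mult.left_commute[of "r' _"])
  also have "\<dots> = 0" using residual_orthogonal(2)[OF t] by (simp add: r'_def)
  finally have o: "(LINT x|M. r' x * s x) = 0" .
  have rg: "integrable M (\<lambda>x. r' x * g x)"
   using integrable_mult_bounded[OF tame_meas(2)[OF tr] tame_meas(1)[OF tg]] tr tg unfolding tame_def by blast
  have rh: "integrable M (\<lambda>x. r x * h x)"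
   using integrable_mult_bounded[OF tame_meas(1)[OF tr] hm _ hb] tr unfolding tame_def by blast
  have rr: "integrable M (\<lambda>x. r x * r x)" by (rule tame_integrable[OF tr tr])
  have "(LINT x|M. (r' x)^2) = (LINT x|M. r' x * g x - r' x * s x)"
   by (rule arg_cong[of _ _ "integral\<^sup>L M"]) (simp add: fun_eq_iff r'_def residual'_def s_def power2_eq_square algebra_simps)
  also have "\<dots> = (LINT x|M. r' x * g x)"
   using rg tame_integrable(2)[OF tr ts] o by (subst Bochner_Integration.integral_diff) auto
  also have "\<dots> = (LINT x|M. r' x * g x + r x * h x) - (LINT x|M. r x * h x)"
   using rg rh by (subst Bochner_Integration.integral_add) auto
  also have "(LINT x|M. r' x * g x + r x * h x) = 0"
  proof (rule integral_eq_0_ftc)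
   fix x :: real assume x: "0 < x" "x < 1"
   have d: "DERIV r x :> r' x" "DERIV g x :> g' x" using tr tg x unfolding tame_def by blast+
   show "DERIV (\<lambda>x. w x * r x * g x) x :> w x * (r' x * g x + r x * h x)"
    by (rule derivative_eq_intros w_deriv d x refl)+ (simp add: h_def algebra_simps)
  next
   obtain R where R: "\<And>x. x \<in> {0<..<1} \<Longrightarrow> \<bar>r x\<bar> \<le> R" using tr unfolding tame_def by blast
   have "\<bar>w x * r x * g x\<bar> \<le> (D * R * C) * (x * (1 - x))" if x: "0 < x" "x < 1" for x
   proof -
    have "0 \<le> R" "0 \<le> D" "0 \<le> C * (x * (1 - x))" using x C[of x] D[of x] R[of x] w_pos[OF x] by auto
    hence "w x * \<bar>r x\<bar> * \<bar>g x\<bar> \<le> D * R * (C * (x * (1 - x)))"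
     using x C[of x] D[of x] R[of x] w_pos[OF x] by (intro mult_mono) auto
    thus ?thesis using w_pos[OF x] by (simp add: abs_mult algebra_simps)
   qed
   from boundary_tendsto_0[OF this] show "((\<lambda>x. w x * r x * g x) \<longlongrightarrow> 0) (at_right 0)" "((\<lambda>x. w x * r x * g x) \<longlongrightarrow> 0) (at_left 1)"
    by blast+
   show "integrable M (\<lambda>x. r' x * g x + r x * h x)" using rg rh by (rule Bochner_Integration.integrable_add)
  qed
  also have "0 - (LINT x|M. r x * h x) = (LINT x|M. - (r x * h x))" by simp
  also have "\<dots> \<le> (LINT x|M. e / 2 * (h x * h x) + 1 / (2 * e) * (r x * r x))"
  proof (rule integral_mono)
   show "integrable M (\<lambda>x. - (r x * h x))" using rh by simp
   show "integrable M (\<lambda>x. e / 2 * (h x * h x) + 1 / (2 * e) * (r x * r x))"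
    using hhi rr by (intro Bochner_Integration.integrable_add integrable_mult_right)
   fix x
   have "0 \<le> (e * h x + r x)^2 / (2 * e)" using e by simp
   also have "\<dots> = e / 2 * (h x * h x) + 1 / (2 * e) * (r x * r x) + r x * h x"
    using e by (simp add: field_simps power2_eq_square)
   finally show "- (r x * h x) \<le> e / 2 * (h x * h x) + 1 / (2 * e) * (r x * r x)" by simp
  qed
  also have "\<dots> = e / 2 * K + 1 / (2 * e) * (LINT x|M. r x * r x)"
   unfolding K_def using hhi rr by (subst Bochner_Integration.integral_add) (auto intro: integrable_mult_right)
  finally show ?thesis by (simp add: r_def r'_def power2_eq_square)
 qed
 show ?thesis
 proof (rule LIMSEQ_I)
  fix \<epsilon> :: real assume \<epsilon>: "0 < \<epsilon>"
  define e where "e = \<epsilon> / (K + 1)"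
  have e: "e > 0" "e * K < \<epsilon>" using \<epsilon> K0 by (auto simp: e_def field_simps)
  have "(\<lambda>N. LINT x|M. (residual G N x)^2) \<longlonglongrightarrow> 0" by (rule residual_tendsto_0[OF t])
  then obtain n where n: "\<And>N. N \<ge> n \<Longrightarrow> \<bar>LINT x|M. (residual G N x)^2\<bar> < \<epsilon> * e"
   using LIMSEQ_D[of _ 0 "\<epsilon> * e"] \<epsilon> e by fastforce
  show "\<exists>n. \<forall>N\<ge>n. norm ((LINT x|M. (residual' G g N x)^2) - 0) < \<epsilon>"
  proof (intro exI[of _ n] allI impI)
   fix N assume N: "N \<ge> n"
   have "(LINT x|M. (residual G N x)^2) / (2 * e) < (\<epsilon> * e) / (2 * e)"
    using n[OF N] e by (intro divide_strict_right_mono) auto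
   hence "(LINT x|M. (residual' G g N x)^2) < \<epsilon>" using main[OF e(1), of N] e by simp
   moreover have "0 \<le> (LINT x|M. (residual' G g N x)^2)" by (simp add: integral_nonneg)
   ultimately show "norm ((LINT x|M. (residual' G g N x)^2) - 0) < \<epsilon>" by simp
  qed
 qed
qed

end

section \<open>Products of modes\<close>

locale mode_family =
 fixes w om V :: "'d::finite \<Rightarrow> real \<Rightarrow> real" and f f' :: "'d \<Rightarrow> nat \<Rightarrow> real \<Rightarrow> real" and L :: "'d \<Rightarrow> nat \<Rightarrow> real"
 assumes modes: "\<And>i. weighted_modes (w i) (om i) (V i) (f i) (f' i) (L i)"
begin

sublocale m: weighted_modes "w i" "om i" "V i" "f i" "f' i" "L i" for i by (rule modes)

definition PM :: "('d \<Rightarrow> real) measure" where "PM = Pi\<^sub>M UNIV (\<lambda>i. unit_density (w i))"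

sublocale P: product_prob_space "\<lambda>i. unit_density (w i)" UNIV by (intro product_prob_spaceI m.prob_space_M)

sublocale PM: prob_space PM unfolding PM_def by (rule P.prob_space_axioms)

lemma space_PM: "space PM = {x. \<forall>i. 0 < x i \<and> x i < 1}" by (auto simp: PM_def space_PiM PiE_def)

lemma measurable_coordinate:
 assumes "g \<in> borel_measurable (unit_density (w i))"
 shows "(\<lambda>x. g (x i)) \<in> borel_measurable PM"
proof -
 have "(\<lambda>x. x i) \<in> measurable PM (unit_density (w i))"
  unfolding PM_def by (rule measurable_component_singleton) simp
 from measurable_compose[OF this assms] show ?thesis .
qed

text \<open>The index \<open>None\<close> gives the product \<open>f\<^sub>n\<close>, the index \<open>Some i\<close> its \<open>i\<close>-th partial derivative.\<close>
definition fac :: "'d option \<Rightarrow> ('d \<Rightarrow> nat) \<Rightarrow> 'd \<Rightarrow> real \<Rightarrow> real" where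
 "fac \<sigma> n j s = (if \<sigma> = Some j then f' j (n j) s else f j (n j) s)"
definition fac1 :: "'d option \<Rightarrow> ('d \<Rightarrow> nat) \<Rightarrow> 'd \<Rightarrow> real \<Rightarrow> real" where
 "fac1 \<sigma> n j s = (if \<sigma> = Some j then - om j s * f' j (n j) s - L j (n j) * f j (n j) s else f' j (n j) s)"
text \<open>Differentiating the eigenvalue equation in direction k creates the potential - om' = V;
  the functions that carry the derivative in this direction are those of index
  \<open>Some k\<close>.\<close>

definition pot :: "'d option \<Rightarrow> 'd \<Rightarrow> ('d \<Rightarrow> real) \<Rightarrow> real" where
 "pot \<sigma> k x = (if \<sigma> = Some k then V k (x k) else 0)"
definition rest :: "'d \<Rightarrow> 'd option \<Rightarrow> ('d \<Rightarrow> nat) \<Rightarrow> ('d \<Rightarrow> real) \<Rightarrow> real" where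
 "rest k \<sigma> n x = (\<Prod>j\<in>UNIV - {k}. fac \<sigma> n j (x j))"
definition H :: "'d option \<Rightarrow> ('d \<Rightarrow> nat) \<Rightarrow> ('d \<Rightarrow> real) \<Rightarrow> real" where
 "H \<sigma> n x = (\<Prod>j\<in>UNIV. fac \<sigma> n j (x j))"
definition H1 :: "'d \<Rightarrow> 'd option \<Rightarrow> ('d \<Rightarrow> nat) \<Rightarrow> ('d \<Rightarrow> real) \<Rightarrow> real" where
 "H1 k \<sigma> n x = fac1 \<sigma> n k (x k) * rest k \<sigma> n x"

definition idx :: "('d \<Rightarrow> nat) \<Rightarrow> bool" where "idx n \<longleftrightarrow> (\<forall>i. 1 \<le> n i)"

lemma H_remove: "H \<sigma> n x = fac \<sigma> n k (x k) * rest k \<sigma> n x"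
 unfolding H_def rest_def by (rule prod.remove) auto

lemma rest_upd [simp]: "rest k \<sigma> n (x(k := s)) = rest k \<sigma> n x" unfolding rest_def by (rule prod.cong) auto

lemma rest_None_Some: "rest k (Some k) n x = rest k None n x"
 unfolding rest_def by (rule prod.cong) (auto simp: fac_def)

text \<open>This links the two systems: the partial derivatives of a product of modes are the
  products of index \<open>Some i\<close>.\<close>

lemma H1_None: "H1 i None n x = H (Some i) n x"
 unfolding H1_def H_remove[of "Some i" n x i] by (simp add: fac1_def fac_def rest_None_Some)

lemma fac_deriv:
 assumes "idx n" "0 < s" "s < 1"
 shows "DERIV (fac \<sigma> n j) s :> fac1 \<sigma> n j s"
 unfolding fac_def[abs_def] fac1_def using assms m.f_deriv m.f'_deriv by (auto simp: idx_def)

lemma fac1_deriv: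
 assumes "idx n" "0 < s" "s < 1"
 shows "DERIV (fac1 \<sigma> n j) s :> - om j s * fac1 \<sigma> n j s + ((if \<sigma> = Some j then V j s else 0) - L j (n j)) * fac \<sigma> n j s"
proof (cases "\<sigma> = Some j")
 case True
 have n: "1 \<le> n j" using assms by (simp add: idx_def)
 have "DERIV (\<lambda>s. - om j s * f' j (n j) s - L j (n j) * f j (n j) s) s :> - om j s * (- om j s * f' j (n j) s - L j (n j) * f j (n j) s) + (V j s - L j (n j)) * f' j (n j) s"
  by (rule derivative_eq_intros m.f_deriv[OF n] m.f'_deriv[OF n] m.om_deriv assms refl)+ (simp add: algebra_simps)
 thus ?thesis using True by (simp add: fac_def fac1_def[abs_def])
next
 case False
 thus ?thesis unfolding fac1_def[abs_def] fac_def using assms m.f'_deriv[of "n j" s j] by (auto simp: idx_def)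
qed

lemma H_deriv:
 assumes "idx n" "0 < s" "s < 1"
 shows "DERIV (\<lambda>s. H \<sigma> n (x(k := s))) s :> H1 k \<sigma> n (x(k := s))"
 unfolding H_remove[of _ _ _ k] H1_def using DERIV_cmult_right[OF fac_deriv[OF assms], of _ _ "rest k \<sigma> n x"] by simp

text \<open>The one-dimensional equation in direction k, with the other factors as
  constants.\<close>

lemma H1_deriv:
 assumes "idx n" "0 < s" "s < 1"
 shows "DERIV (\<lambda>s. H1 k \<sigma> n (x(k := s))) s :> - om k s * H1 k \<sigma> n (x(k := s)) + (pot \<sigma> k (x(k := s)) - L k (n k)) * H \<sigma> n (x(k := s))"
 unfolding H_remove[of _ _ _ k] H1_def pot_def
 using DERIV_cmult_right[OF fac1_deriv[OF assms], of \<sigma> k "rest k \<sigma> n x"]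
 by (cases "\<sigma> = Some k") (simp_all add: algebra_simps)

lemma om_f'_bdd:
 assumes "1 \<le> n" shows "\<exists>C. \<forall>s\<in>{0<..<1}. \<bar>om j s * f' j n s\<bar> \<le> C"
proof -
 obtain B where B: "\<And>x. x \<in> {0<..<1} \<Longrightarrow> \<bar>om j x\<bar> * (x * (1 - x)) \<le> B" using m.om_bdd by blast
 obtain C where C: "\<And>x. x \<in> {0<..<1} \<Longrightarrow> \<bar>f' j n x\<bar> \<le> C * (x * (1 - x))" using m.f'_bdd[OF assms] by blast
 have "\<bar>om j x * f' j n x\<bar> \<le> B * \<bar>C\<bar>" if x: "x \<in> {0<..<1}" for x
 proof -
  have "\<bar>om j x * f' j n x\<bar> \<le> \<bar>om j x\<bar> * (\<bar>C\<bar> * (x * (1 - x)))"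
   unfolding abs_mult using C[of x] x by (intro mult_left_mono) (auto intro: order_trans mult_right_mono)
  also have "\<dots> = (\<bar>om j x\<bar> * (x * (1 - x))) * \<bar>C\<bar>" by simp
  also have "\<dots> \<le> B * \<bar>C\<bar>" using B[OF x] by (intro mult_right_mono) auto
  finally show ?thesis .
 qed
 thus ?thesis by blast
qed

lemma fac_bdd: assumes "idx n" shows "\<exists>C. \<forall>s\<in>{0<..<1}. \<bar>fac \<sigma> n j s\<bar> \<le> C"
 unfolding fac_def using assms m.f_bdd[of "n j" j] m.f'_bdd'[of "n j" j] by (cases "\<sigma> = Some j") (auto simp: idx_def)

lemma fac1_bdd: assumes "idx n" shows "\<exists>C. \<forall>s\<in>{0<..<1}. \<bar>fac1 \<sigma> n j s\<bar> \<le> C"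
proof (cases "\<sigma> = Some j")
 case True
 have n: "1 \<le> n j" using assms by (simp add: idx_def)
 obtain A where A: "\<And>x. x \<in> {0<..<1} \<Longrightarrow> \<bar>om j x * f' j (n j) x\<bar> \<le> A" using om_f'_bdd[OF n] by blast
 obtain B where B: "\<And>x. x \<in> {0<..<1} \<Longrightarrow> \<bar>f j (n j) x\<bar> \<le> B" using m.f_bdd[OF n] by blast
 have "\<bar>fac1 \<sigma> n j s\<bar> \<le> A + \<bar>L j (n j)\<bar> * B" if s: "s \<in> {0<..<1}" for s
 proof -
  have "\<bar>L j (n j) * f j (n j) s\<bar> \<le> \<bar>L j (n j)\<bar> * B" unfolding abs_mult using B[OF s] by (intro mult_left_mono) auto
  thus ?thesis using A[OF s] True by (simp add: fac1_def)
 qed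
 thus ?thesis by blast
next
 case False
 thus ?thesis using m.f'_bdd'[of "n j" j] assms by (auto simp: fac1_def idx_def)
qed

text \<open>A bound uniform in t with a prescribed profile \<open>d\<close> in space. Time runs over
  t > -1 instead of t \<ge> 0 so that derivatives in t at 0 are two-sided.\<close>

definition bnd :: "(('d \<Rightarrow> real) \<Rightarrow> real) \<Rightarrow> (real \<Rightarrow> ('d \<Rightarrow> real) \<Rightarrow> real) \<Rightarrow> bool" where
 "bnd d G \<longleftrightarrow> (\<exists>C\<ge>0. \<forall>t>-1::real. \<forall>x\<in>space PM. \<bar>G t x\<bar> \<le> C * d x)"

abbreviation "one \<equiv> (\<lambda>x::'d \<Rightarrow> real. 1::real)"
definition dd :: "'d \<Rightarrow> ('d \<Rightarrow> real) \<Rightarrow> real" where "dd k x = x k * (1 - x k)"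

lemma dd_range: assumes "x \<in> space PM" shows "0 \<le> dd k x" "dd k x \<le> 1"
proof -
 have "0 < x k" "x k < 1" using assms by (auto simp: space_PM)
 thus "0 \<le> dd k x" "dd k x \<le> 1" using mult_mono[of "x k" 1 "1 - x k" 1] by (auto simp: dd_def)
qed

lemma bndI: assumes "\<And>(t::real) x. -1 < t \<Longrightarrow> x \<in> space PM \<Longrightarrow> \<bar>G t x\<bar> \<le> C * d x" "\<And>x. x \<in> space PM \<Longrightarrow> 0 \<le> d x"
 shows "bnd d G" unfolding bnd_def
proof (intro exI[of _ "\<bar>C\<bar>"] conjI allI ballI impI)
 fix t :: real and x assume "-1 < t" "x \<in> space PM"
 thus "\<bar>G t x\<bar> \<le> \<bar>C\<bar> * d x" using assms(1)[of t x] assms(2)[of x] by (smt (verit) mult_right_mono)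
qed simp

lemma bnd_const: "bnd one (\<lambda>t x. c)" by (rule bndI[of _ "\<bar>c\<bar>"]) auto

lemma bnd_add: assumes "bnd d G" "bnd d K" shows "bnd d (\<lambda>t x. G t x + K t x)"
proof -
 obtain C D where "C \<ge> 0" "D \<ge> 0" "\<And>(t::real) x. -1 < t \<Longrightarrow> x \<in> space PM \<Longrightarrow> \<bar>G t x\<bar> \<le> C * d x"
  "\<And>(t::real) x. -1 < t \<Longrightarrow> x \<in> space PM \<Longrightarrow> \<bar>K t x\<bar> \<le> D * d x" using assms unfolding bnd_def by blast
 thus ?thesis unfolding bnd_def
  by (intro exI[of _ "C + D"]) (auto simp: distrib_right intro!: order_trans[OF abs_triangle_ineq] add_mono)
qed

lemma bnd_sum: assumes "finite J" "\<And>j. j \<in> J \<Longrightarrow> bnd d (G j)" shows "bnd d (\<lambda>t x. \<Sum>j\<in>J. G j t x)"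
 using assms
proof (induction J rule: finite_induct)
 case empty
 show ?case by (simp add: bnd_def) (intro exI[of _ 0], simp)
next
 case (insert j J)
 thus ?case using bnd_add[of d "G j" "\<lambda>t x. \<Sum>j\<in>J. G j t x"] by simp
qed

lemma bnd_mult: assumes "bnd d G" "bnd e K" shows "bnd (\<lambda>x. d x * e x) (\<lambda>t x. G t x * K t x)"
proof -
 obtain C D where *: "C \<ge> 0" "D \<ge> 0" "\<And>(t::real) x. -1 < t \<Longrightarrow> x \<in> space PM \<Longrightarrow> \<bar>G t x\<bar> \<le> C * d x"
  "\<And>(t::real) x. -1 < t \<Longrightarrow> x \<in> space PM \<Longrightarrow> \<bar>K t x\<bar> \<le> D * e x" using assms unfolding bnd_def by blast
 show ?thesis unfolding bnd_def
 proof (intro exI[of _ "C * D"] conjI allI ballI impI)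
  fix t :: real and x assume tx: "-1 < t" "x \<in> space PM"
  have "\<bar>G t x\<bar> * \<bar>K t x\<bar> \<le> (C * d x) * (D * e x)"
   using *(3,4)[OF tx] by (intro mult_mono) (auto intro: order_trans[OF abs_ge_zero])
  thus "\<bar>G t x * K t x\<bar> \<le> C * D * (d x * e x)" by (simp add: abs_mult algebra_simps)
 qed (use * in simp)
qed

lemma bnd_mult1: assumes "bnd one G" "bnd e K" shows "bnd e (\<lambda>t x. G t x * K t x)" "bnd e (\<lambda>t x. K t x * G t x)"
 using bnd_mult[OF assms] by (simp_all add: mult.commute)

lemma bnd_cmult: "bnd d G \<Longrightarrow> bnd d (\<lambda>t x. c * G t x)" using bnd_mult1(1)[OF bnd_const] .
lemma bnd_diff: "bnd d G \<Longrightarrow> bnd d K \<Longrightarrow> bnd d (\<lambda>t x. G t x - K t x)"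
 using bnd_add[of d G "\<lambda>t x. (-1) * K t x"] bnd_cmult[of d K "-1"] by simp
lemma bnd_power2: "bnd one G \<Longrightarrow> bnd one (\<lambda>t x. (G t x)^2)"
 unfolding power2_eq_square by (rule bnd_mult1)
lemma bnd_prod: "finite J \<Longrightarrow> (\<And>j. j \<in> J \<Longrightarrow> bnd one (G j)) \<Longrightarrow> bnd one (\<lambda>t x. \<Prod>j\<in>J. G j t x)"
 by (induction J rule: finite_induct) (auto intro: bnd_mult1 bnd_const)

lemma bnd_coordinate: assumes "\<exists>C. \<forall>s\<in>{0<..<1}. \<bar>g s\<bar> \<le> C" shows "bnd one (\<lambda>t x. g (x j))"
proof -
 obtain C where C: "\<And>s. s \<in> {0<..<1} \<Longrightarrow> \<bar>g s\<bar> \<le> C" using assms by blast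
 show ?thesis by (rule bndI[of _ C]) (auto simp: space_PM intro!: C)
qed

lemma bnd_rest: "idx n \<Longrightarrow> bnd one (\<lambda>t x. rest k \<sigma> n x)"
 unfolding rest_def by (intro bnd_prod bnd_coordinate fac_bdd) auto
lemma bnd_H: "idx n \<Longrightarrow> bnd one (\<lambda>t x. H \<sigma> n x)"
 unfolding H_def by (intro bnd_prod bnd_coordinate fac_bdd) auto
lemma bnd_H1: "idx n \<Longrightarrow> bnd one (\<lambda>t x. H1 k \<sigma> n x)"
 unfolding H1_def by (intro bnd_mult1 bnd_rest bnd_coordinate fac1_bdd) auto

lemma bnd_f'_dd: assumes "1 \<le> n" shows "bnd (dd k) (\<lambda>t x. f' k n (x k))"
proof -
 obtain C where C: "\<And>x. x \<in> {0<..<1} \<Longrightarrow> \<bar>f' k n x\<bar> \<le> C * (x * (1 - x))" using m.f'_bdd[OF assms] by blast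
 show ?thesis
 proof (rule bndI[of _ C])
  fix t :: real and x assume "x \<in> space PM"
  thus "\<bar>f' k n (x k)\<bar> \<le> C * dd k x" using C[of "x k"] by (auto simp: space_PM dd_def)
 qed (rule dd_range)
qed

text \<open>With \<open>bnd_H1_dd\<close> this covers all indices: in direction k either the
  function or its derivative contains a factor f' and vanishes at both ends. Hence their product
  always does, which makes all boundary terms disappear.\<close>

lemma bnd_H_dd: "idx n \<Longrightarrow> bnd (dd k) (\<lambda>t x. H (Some k) n x)"
 unfolding H_remove[of _ _ _ k] using bnd_mult1(2)[OF bnd_rest bnd_f'_dd[of "n k" k]] by (auto simp: fac_def idx_def)
lemma bnd_H1_dd: "idx n \<Longrightarrow> \<sigma> \<noteq> Some k \<Longrightarrow> bnd (dd k) (\<lambda>t x. H1 k \<sigma> n x)"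
 unfolding H1_def using bnd_mult1(2)[OF bnd_rest bnd_f'_dd[of "n k" k]] by (auto simp: fac1_def idx_def)

lemma bnd_exp: assumes "0 \<le> \<mu>" shows "bnd one (\<lambda>t x. exp (- \<mu> * t))"
proof (rule bndI[of _ "exp \<mu>"])
 fix t :: real assume "-1 < t"
 hence "- \<mu> * t \<le> \<mu>" using assms mult_left_mono[of "-t" 1 \<mu>] by simp
 thus "\<bar>exp (- \<mu> * t)\<bar> \<le> exp \<mu> * 1" by simp
qed simp

lemma meas_fac: "idx n \<Longrightarrow> fac \<sigma> n j \<in> borel_measurable (unit_density (w j))"
 unfolding fac_def[abs_def] using m.meas_f[of "n j" j] m.meas_f'[of "n j" j] by (auto simp: idx_def)
lemma meas_fac1: assumes "idx n" shows "fac1 \<sigma> n j \<in> borel_measurable (unit_density (w j))"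
proof -
 have [measurable]: "om j \<in> borel_measurable (unit_density (w j))" by (rule measurable_unit_density_continuous[OF m.cont_om])
 have [measurable]: "f j (n j) \<in> borel_measurable (unit_density (w j))" "f' j (n j) \<in> borel_measurable (unit_density (w j))"
  using m.meas_f[of "n j" j] m.meas_f'[of "n j" j] assms by (auto simp: idx_def)
 show ?thesis unfolding fac1_def[abs_def] by (cases "\<sigma> = Some j") auto
qed
lemma meas_H: "idx n \<Longrightarrow> H \<sigma> n \<in> borel_measurable PM"
 unfolding H_def[abs_def] by (intro borel_measurable_prod measurable_coordinate meas_fac)
lemma meas_H1: "idx n \<Longrightarrow> H1 k \<sigma> n \<in> borel_measurable PM"
 unfolding H1_def[abs_def] rest_def by (intro borel_measurable_times borel_measurable_prod measurable_coordinate meas_fac meas_fac1)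
lemma meas_pot: "pot \<sigma> k \<in> borel_measurable PM"
 unfolding pot_def[abs_def] using measurable_coordinate[OF measurable_unit_density_continuous[OF m.V_cont]] by auto

lemma H_orthogonal:
 assumes "idx n" "idx m"
 shows "(LINT x|PM. H \<sigma> n x * H \<sigma> m x) =
  (if n = m then (case \<sigma> of None \<Rightarrow> 1 | Some i \<Rightarrow> L i (n i)) else 0)"
  "integrable PM (\<lambda>x. H \<sigma> n x * H \<sigma> m x)"
proof -
 have 1: "1 \<le> n j" "1 \<le> m j" for j using assms by (auto simp: idx_def)
 have i: "integrable (unit_density (w j)) (\<lambda>s. fac \<sigma> n j s * fac \<sigma> m j s)" for j
  unfolding fac_def using m.integrable_f_f[OF 1, of j] by (cases "\<sigma> = Some j") simp_all
 have v: "(LINT s|unit_density (w j). fac \<sigma> n j s * fac \<sigma> m j s)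
  = (if n j = m j then (if \<sigma> = Some j then L j (n j) else 1) else 0)" for j
  unfolding fac_def using m.orthonormal_f[OF 1, of j j j] m.orthonormal_f'[OF 1, of j j j]
  by (cases "\<sigma> = Some j") simp_all
 have "(LINT x|PM. H \<sigma> n x * H \<sigma> m x) = (LINT x|Pi\<^sub>M UNIV (\<lambda>i. unit_density (w i)). (\<Prod>j\<in>UNIV. fac \<sigma> n j (x j) * fac \<sigma> m j (x j)))"
  unfolding PM_def H_def by (simp add: prod.distrib)
 also have "\<dots> = (\<Prod>j\<in>UNIV. if n j = m j then (if \<sigma> = Some j then L j (n j) else 1) else 0)"
  using i by (subst P.product_integral_prod) (auto simp: v)
 also have "\<dots> = (if n = m then (case \<sigma> of None \<Rightarrow> 1 | Some i \<Rightarrow> L i (n i)) else 0)"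
 proof (cases "n = m")
  case True
  thus ?thesis by (cases \<sigma>) (auto simp: prod.delta)
 next
  case False
  then obtain j where "n j \<noteq> m j" by blast
  thus ?thesis using False by (auto intro!: prod_zero)
 qed
 finally show "(LINT x|PM. H \<sigma> n x * H \<sigma> m x) = (if n = m then (case \<sigma> of None \<Rightarrow> 1 | Some i \<Rightarrow> L i (n i)) else 0)" .
 show "integrable PM (\<lambda>x. H \<sigma> n x * H \<sigma> m x)"
  unfolding PM_def H_def prod.distrib[symmetric] using i by (intro P.product_integrable_prod) auto
qed

lemma integrable_bnd:
 assumes "bnd one G" "G t \<in> borel_measurable PM" "-1 < t"
 shows "integrable PM (G t)"
proof -
 obtain C where "\<And>x. x \<in> space PM \<Longrightarrow> \<bar>G t x\<bar> \<le> C * 1" using assms unfolding bnd_def by blast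
 thus ?thesis using assms(2) by (intro PM.integrable_const_bound[of _ C]) auto
qed

lemma integral_section_eq_0:
 fixes G :: "('d \<Rightarrow> real) \<Rightarrow> real"
 assumes i: "integrable PM G"
  and z: "\<And>x. x \<in> space PM \<Longrightarrow> (LINT s|unit_density (w k). G (x(k := s))) = 0"
 shows "integral\<^sup>L PM G = 0"
proof -
 have U: "UNIV = insert k (UNIV - {k})" by auto
 have "integral\<^sup>L PM G = integral\<^sup>L (Pi\<^sub>M (insert k (UNIV - {k})) (\<lambda>i. unit_density (w i))) G"
  unfolding PM_def U[symmetric] ..
 also have "\<dots> = (LINT x|Pi\<^sub>M (UNIV - {k}) (\<lambda>i. unit_density (w i)). LINT s|unit_density (w k). G (x(k := s)))"
  by (rule P.product_integral_insert) (use i in \<open>auto simp: PM_def U[symmetric]\<close>)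
 also have "\<dots> = (LINT x|Pi\<^sub>M (UNIV - {k}) (\<lambda>i. unit_density (w i)). 0)"
 proof (rule Bochner_Integration.integral_cong)
  fix x assume "x \<in> space (Pi\<^sub>M (UNIV - {k}) (\<lambda>i. unit_density (w i)))"
  \<comment> \<open>The point lacks coordinate k; any value inside the interval completes it, and
    the section in direction k does not see the choice.\<close>
  hence "x(k := 1 / 2) \<in> space PM" by (auto simp: space_PM space_PiM PiE_def Pi_def)
  from z[OF this] show "(LINT s|unit_density (w k). G (x(k := s))) = 0" by simp
 qed simp
 finally show ?thesis by simp
qed

end

text \<open>By the mean value inequality on the convex set \<open>S\<close> the difference quotients
  are dominated by the constant \<open>C\<close>.\<close>

lemma (in prob_space) has_derivative_expectation:
 fixes G G' :: "real \<Rightarrow> 'a \<Rightarrow> real"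
 assumes S: "open S" "t \<in> S" "convex S"
  and d: "\<And>s x. s \<in> S \<Longrightarrow> x \<in> space M \<Longrightarrow> DERIV (\<lambda>s. G s x) s :> G' s x"
  and i: "\<And>s. s \<in> S \<Longrightarrow> integrable M (G s)"
  and b: "\<And>s x. s \<in> S \<Longrightarrow> x \<in> space M \<Longrightarrow> \<bar>G' s x\<bar> \<le> C"
  and m: "G' t \<in> borel_measurable M"
 shows "DERIV (\<lambda>s. integral\<^sup>L M (G s)) t :> integral\<^sup>L M (G' t)"
proof -
 obtain e where e: "e > 0" "ball t e \<subseteq> S" using S openE by blast
 show ?thesis unfolding has_field_derivative_iff
 proof (subst tendsto_at_iff_sequentially, intro allI impI)
  fix X :: "nat \<Rightarrow> real" assume X: "\<forall>i. X i \<in> UNIV - {t}" "X \<longlonglongrightarrow> t"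
  have ev: "\<forall>\<^sub>F n in sequentially. X n \<in> S" using topological_tendstoD[OF X(2) S(1,2)] .
  then obtain N where N: "\<And>n. n \<ge> N \<Longrightarrow> X n \<in> S" by (auto simp: eventually_sequentially)
  \<comment> \<open>Only a tail of the sequence lies in \<open>S\<close>; the shift makes every term
    admissible.\<close>
  define Y where "Y = (\<lambda>n. X (n + N))"
  have Y: "Y n \<in> S" "Y n \<noteq> t" for n using N X(1) by (auto simp: Y_def)
  have Yl: "Y \<longlonglongrightarrow> t" unfolding Y_def using X(2) by (rule LIMSEQ_ignore_initial_segment)
  have "(\<lambda>n. LINT x|M. (G (Y n) x - G t x) / (Y n - t)) \<longlonglongrightarrow> integral\<^sup>L M (G' t)"
  proof (rule integral_dominated_convergence[where w = "\<lambda>_. C"])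
   show "AE x in M. (\<lambda>n. (G (Y n) x - G t x) / (Y n - t)) \<longlonglongrightarrow> G' t x"
   proof (rule AE_I2)
    fix x assume x: "x \<in> space M"
    have "((\<lambda>s. (G s x - G t x) / (s - t)) \<longlongrightarrow> G' t x) (at t)"
     using d[OF S(2) x] by (simp add: has_field_derivative_iff)
    thus "(\<lambda>n. (G (Y n) x - G t x) / (Y n - t)) \<longlonglongrightarrow> G' t x"
     using Y(2) Yl unfolding tendsto_at_iff_sequentially comp_def by auto
   qed
   show "AE x in M. norm ((G (Y n) x - G t x) / (Y n - t)) \<le> C" for n
   proof (rule AE_I2)
    fix x assume x: "x \<in> space M"
    have "norm (G (Y n) x - G t x) \<le> C * norm (Y n - t)"
     using S Y x d b by (intro field_differentiable_bound[where S = S and f' = "\<lambda>s. G' s x"])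
      (auto intro: has_field_derivative_at_within)
    thus "norm ((G (Y n) x - G t x) / (Y n - t)) \<le> C" using Y(2)[of n] by (simp add: field_simps)
   qed
  qed (use i[OF S(2)] i[OF Y(1)] m in auto)
  moreover have "(LINT x|M. (G (Y n) x - G t x) / (Y n - t)) = (integral\<^sup>L M (G (Y n)) - integral\<^sup>L M (G t)) / (Y n - t)" for n
   by (simp only: integral_divide_zero Bochner_Integration.integral_diff[OF i[OF Y(1)] i[OF S(2)]])
  ultimately have "(\<lambda>n. (integral\<^sup>L M (G (X (n + N))) - integral\<^sup>L M (G t)) / (X (n + N) - t)) \<longlonglongrightarrow> integral\<^sup>L M (G' t)"
   by (simp only: Y_def)
  thus "((\<lambda>y. (integral\<^sup>L M (G y) - integral\<^sup>L M (G t)) / (y - t)) \<circ> X) \<longlonglongrightarrow> integral\<^sup>L M (G' t)"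
   unfolding comp_def by (rule LIMSEQ_offset)
 qed
qed

section \<open>The Poisson flow and the bilinear embedding\<close>

text \<open>A convex function that rises above its initial value has a positive slope somewhere, and
  from there on it outgrows every constant.\<close>

lemma convex_bounded_le_initial:
 fixes g g' g'' :: "real \<Rightarrow> real"
 assumes d: "\<And>t. 0 \<le> t \<Longrightarrow> DERIV g t :> g' t" "\<And>t. 0 \<le> t \<Longrightarrow> DERIV g' t :> g'' t"
  and c: "\<And>t. 0 \<le> t \<Longrightarrow> 0 \<le> g'' t" and b: "\<And>t. 0 \<le> t \<Longrightarrow> g t \<le> C" and t: "0 \<le> t"
 shows "g t \<le> g 0"
proof (rule ccontr)
 assume "\<not> g t \<le> g 0"
 hence gt: "g 0 < g t" "0 < t" using t by (auto simp: le_less)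
 obtain \<xi> where \<xi>: "0 < \<xi>" "\<xi> < t" "g t - g 0 = (t - 0) * g' \<xi>"
  using MVT2[OF gt(2), of g g'] d(1) by auto
 have m: "0 < g' \<xi>" using \<xi> gt by (metis diff_gt_0_iff_gt diff_zero zero_less_mult_pos)
 have mono: "g' \<xi> \<le> g' \<eta>" if "\<xi> \<le> \<eta>" for \<eta>
  using that \<xi>(1) by (intro DERIV_nonneg_imp_nondecreasing[of \<xi> \<eta> g']) (auto intro!: exI[of _ "g'' _"] d c)
 \<comment> \<open>At this time the line through (t, g t) with slope \<open>g' \<xi>\<close> has the
   height \<open>C + g' \<xi>\<close>, above the bound.\<close>
 define T where "T = t + (C - g t) / g' \<xi> + 1"
 have "0 \<le> (C - g t) / g' \<xi>" using b[OF t] m by simp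
 hence T: "t < T" by (simp add: T_def)
 obtain \<eta> where \<eta>: "t < \<eta>" "\<eta> < T" "g T - g t = (T - t) * g' \<eta>"
  using MVT2[OF T, of g g'] d(1) t by force
 have "(T - t) * g' \<xi> \<le> (T - t) * g' \<eta>" using T mono[of \<eta>] \<eta> \<xi> by (intro mult_left_mono) auto
 moreover have "(T - t) * g' \<xi> = C - g t + g' \<xi>" using m by (simp add: T_def field_simps)
 ultimately show False using \<eta>(3) b[of T] T t m by linarith
qed

text \<open>The data of finite sums. In an index of type \<open>'d option \<times> bool\<close> the
  first component selects the system and the second the real or imaginary part of a complex
  function, so that all flows are real. \<open>\<mu> n\<close> is the root of the eigenvalue
  \<open>a0\<close> + L, hence \<open>exp (- \<mu> n * t)\<close> is the Poisson semigroup. The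
  shift \<open>\<epsilon>\<close> keeps the arguments of \<open>B\<close> away from 0.\<close>

locale mode_flow = mode_family w om V f f' L + bellman \<kappa> B Ba Bb Baa Bab Bbb
 for w om V :: "'d::finite \<Rightarrow> real \<Rightarrow> real" and f f' :: "'d \<Rightarrow> nat \<Rightarrow> real \<Rightarrow> real" and L :: "'d \<Rightarrow> nat \<Rightarrow> real"
  and \<kappa> :: real and B Ba Bb Baa Bab Bbb :: "real \<Rightarrow> real \<Rightarrow> real" +
 fixes F :: "('d \<Rightarrow> nat) set" and \<mu> :: "('d \<Rightarrow> nat) \<Rightarrow> real" and c :: "'d option \<times> bool \<Rightarrow> ('d \<Rightarrow> nat) \<Rightarrow> real"
  and \<epsilon> a0 :: real
 assumes finF: "finite F" and F_idx: "\<And>n. n \<in> F \<Longrightarrow> idx n"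
  and mu_nonneg: "\<And>n. n \<in> F \<Longrightarrow> 0 \<le> \<mu> n" and mu_sq: "\<And>n. n \<in> F \<Longrightarrow> (\<mu> n)\<^sup>2 = a0 + (\<Sum>i\<in>UNIV. L i (n i))"
  and a0: "0 \<le> a0" and eps: "0 < \<epsilon>"
begin

definition y :: "'d option \<times> bool \<Rightarrow> real \<Rightarrow> ('d \<Rightarrow> real) \<Rightarrow> real" where
 "y q t x = (\<Sum>n\<in>F. c q n * (exp (- \<mu> n * t) * H (fst q) n x))"
definition yt :: "'d option \<times> bool \<Rightarrow> real \<Rightarrow> ('d \<Rightarrow> real) \<Rightarrow> real" where
 "yt q t x = (\<Sum>n\<in>F. (- \<mu> n * c q n) * (exp (- \<mu> n * t) * H (fst q) n x))"
definition ytt :: "'d option \<times> bool \<Rightarrow> real \<Rightarrow> ('d \<Rightarrow> real) \<Rightarrow> real" where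
 "ytt q t x = (\<Sum>n\<in>F. ((\<mu> n)^2 * c q n) * (exp (- \<mu> n * t) * H (fst q) n x))"
definition yk :: "'d \<Rightarrow> 'd option \<times> bool \<Rightarrow> real \<Rightarrow> ('d \<Rightarrow> real) \<Rightarrow> real" where
 "yk k q t x = (\<Sum>n\<in>F. c q n * (exp (- \<mu> n * t) * H1 k (fst q) n x))"
definition ly :: "'d \<Rightarrow> 'd option \<times> bool \<Rightarrow> real \<Rightarrow> ('d \<Rightarrow> real) \<Rightarrow> real" where
 "ly k q t x = (\<Sum>n\<in>F. (L k (n k) * c q n) * (exp (- \<mu> n * t) * H (fst q) n x))"

definition A :: "('d option \<times> bool) set \<Rightarrow> real \<Rightarrow> ('d \<Rightarrow> real) \<Rightarrow> real" where
 "A S t x = \<epsilon> + (\<Sum>q\<in>S. (y q t x)^2)"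
definition At where "At S t x = (\<Sum>q\<in>S. 2 * (y q t x * yt q t x))"
definition Att where "Att S t x = (\<Sum>q\<in>S. 2 * (yt q t x)^2 + 2 * (y q t x * ytt q t x))"
definition Ak where "Ak k S t x = (\<Sum>q\<in>S. 2 * (y q t x * yk k q t x))"
text \<open>There is no \<open>om\<close> here: this is Ak' + om Ak = (w Ak)' / w, the second
  derivative in divergence form.\<close>

definition Akk where "Akk k S t x = (\<Sum>q\<in>S. 2 * (yk k q t x)^2 + 2 * (pot (fst q) k x * (y q t x)^2 - y q t x * ly k q t x))"

lemma y_bnd: "bnd one (y q)" "bnd one (yt q)" "bnd one (ytt q)" "bnd one (ly k q)" "bnd one (yk k q)"
 unfolding y_def[abs_def] yt_def[abs_def] ytt_def[abs_def] ly_def[abs_def] yk_def[abs_def]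
 by (intro bnd_sum finF bnd_cmult bnd_mult1 bnd_exp mu_nonneg bnd_H bnd_H1 F_idx; assumption)+

lemma y_bnd_dd: "fst q = Some k \<Longrightarrow> bnd (dd k) (y q)" "fst q \<noteq> Some k \<Longrightarrow> bnd (dd k) (yk k q)"
proof -
 show "bnd (dd k) (y q)" if "fst q = Some k" unfolding y_def[abs_def] that
  by (intro bnd_sum finF bnd_cmult bnd_mult1(1)[OF bnd_exp] mu_nonneg bnd_H_dd F_idx; assumption)
 show "bnd (dd k) (yk k q)" if "fst q \<noteq> Some k" unfolding yk_def[abs_def]
  by (intro bnd_sum finF bnd_cmult bnd_mult1(1)[OF bnd_exp] mu_nonneg bnd_H1_dd[OF _ that] F_idx; assumption)
qed

lemma y_meas: "y q t \<in> borel_measurable PM" "yt q t \<in> borel_measurable PM" "ytt q t \<in> borel_measurable PM"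
 "ly k q t \<in> borel_measurable PM" "yk k q t \<in> borel_measurable PM"
 unfolding y_def[abs_def] yt_def[abs_def] ytt_def[abs_def] ly_def[abs_def] yk_def[abs_def]
 by (intro borel_measurable_sum borel_measurable_times borel_measurable_const meas_H meas_H1 F_idx; assumption)+

lemma y_deriv_t: "DERIV (\<lambda>t. y q t x) t :> yt q t x" "DERIV (\<lambda>t. yt q t x) t :> ytt q t x"
proof -
 have e: "DERIV (\<lambda>t. exp (- \<mu> n * t) * h) t :> - \<mu> n * (exp (- \<mu> n * t) * h)" for n h
  by (auto intro!: derivative_eq_intros)
 show "DERIV (\<lambda>t. y q t x) t :> yt q t x"
  unfolding y_def yt_def by (rule DERIV_cong[OF DERIV_sum[OF DERIV_cmult[OF e]]]) (simp add: mult_ac)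
 show "DERIV (\<lambda>t. yt q t x) t :> ytt q t x"
  unfolding yt_def ytt_def by (rule DERIV_cong[OF DERIV_sum[OF DERIV_cmult[OF e]]]) (simp add: mult_ac power2_eq_square)
qed

lemma y_deriv_k: assumes "0 < s" "s < 1"
 shows "DERIV (\<lambda>s. y q t (x(k := s))) s :> yk k q t (x(k := s))"
  "DERIV (\<lambda>s. yk k q t (x(k := s))) s :> - om k s * yk k q t (x(k := s)) + (pot (fst q) k (x(k := s)) * y q t (x(k := s)) - ly k q t (x(k := s)))"
proof -
 show "DERIV (\<lambda>s. y q t (x(k := s))) s :> yk k q t (x(k := s))"
  unfolding y_def yk_def using assms F_idx by (intro DERIV_sum DERIV_cmult H_deriv) auto
 have "DERIV (\<lambda>s. yk k q t (x(k := s))) s :> (\<Sum>n\<in>F. c q n * (exp (- \<mu> n * t) *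
  (- om k s * H1 k (fst q) n (x(k := s)) + (pot (fst q) k (x(k := s)) - L k (n k)) * H (fst q) n (x(k := s)))))"
  unfolding yk_def using assms F_idx by (intro DERIV_sum DERIV_cmult H1_deriv) auto
 thus "DERIV (\<lambda>s. yk k q t (x(k := s))) s :> - om k s * yk k q t (x(k := s)) + (pot (fst q) k (x(k := s)) * y q t (x(k := s)) - ly k q t (x(k := s)))"
  by (rule DERIV_cong)
   (simp add: y_def yk_def ly_def sum_distrib_left sum.distrib[symmetric] sum_subtractf[symmetric] algebra_simps)
qed

text \<open>The equation \<open>(\<partial>\<^sub>t\<^sup>2 + \<L>) y = (a\<^sub>0 + pot) y\<close>.\<close>
lemma y_equation:
 "ytt q t x + (\<Sum>k\<in>UNIV. pot (fst q) k x * y q t x - ly k q t x) = (a0 + (\<Sum>k\<in>UNIV. pot (fst q) k x)) * y q t x"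
proof -
 have "ytt q t x = (\<Sum>n\<in>F. a0 * (c q n * (exp (- \<mu> n * t) * H (fst q) n x)) + (\<Sum>k\<in>UNIV. (L k (n k) * c q n) * (exp (- \<mu> n * t) * H (fst q) n x)))"
  unfolding ytt_def by (rule sum.cong) (auto simp: mu_sq distrib_right sum_distrib_right mult.assoc)
 also have "\<dots> = a0 * y q t x + (\<Sum>k\<in>UNIV. ly k q t x)"
  unfolding y_def ly_def sum.distrib by (subst sum.swap) (simp add: sum_distrib_left)
 finally show ?thesis by (simp add: sum_subtractf distrib_right sum_distrib_right)
qed

lemma pot_nonneg: "x \<in> space PM \<Longrightarrow> 0 \<le> pot \<sigma> k x"
 unfolding pot_def using m.V_nonneg[of "x k" k] by (auto simp: space_PM)

lemma A_ge: "\<epsilon> \<le> A S t x" and A_pos: "0 < A S t x"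
 using eps sum_nonneg[of S "\<lambda>q. (y q t x)^2"] by (auto simp: A_def)

lemma A_deriv_t: "DERIV (\<lambda>t. A S t x) t :> At S t x" "DERIV (\<lambda>t. At S t x) t :> Att S t x"
proof -
 show "DERIV (\<lambda>t. A S t x) t :> At S t x" unfolding A_def At_def
  by (rule DERIV_cong[OF DERIV_add[OF DERIV_const DERIV_sum[OF DERIV_power[OF y_deriv_t(1)]]]]) (simp add: algebra_simps)
 show "DERIV (\<lambda>t. At S t x) t :> Att S t x" unfolding At_def Att_def
  by (rule DERIV_cong[OF DERIV_sum[OF DERIV_cmult[OF DERIV_mult[OF y_deriv_t]]]]) (simp add: algebra_simps power2_eq_square)
qed

lemma A_deriv_k: assumes s: "0 < s" "s < 1"
 shows "DERIV (\<lambda>s. A S t (x(k := s))) s :> Ak k S t (x(k := s))"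
 "DERIV (\<lambda>s. Ak k S t (x(k := s))) s :> Akk k S t (x(k := s)) - om k s * Ak k S t (x(k := s))"
proof -
 show "DERIV (\<lambda>s. A S t (x(k := s))) s :> Ak k S t (x(k := s))" unfolding A_def Ak_def
  by (rule DERIV_cong[OF DERIV_add[OF DERIV_const DERIV_sum[OF DERIV_power[OF y_deriv_k(1)[OF s]]]]]) (simp add: algebra_simps)
 show "DERIV (\<lambda>s. Ak k S t (x(k := s))) s :> Akk k S t (x(k := s)) - om k s * Ak k S t (x(k := s))"
  unfolding Ak_def Akk_def by (rule DERIV_cong[OF DERIV_sum[OF DERIV_cmult[OF DERIV_mult[OF y_deriv_k[OF s]]]]])
   (simp add: algebra_simps power2_eq_square sum_distrib_left sum.distrib[symmetric] sum_subtractf[symmetric])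
qed

text \<open>\<open>V\<close> may have a pole of second order, but it meets only components of index
  \<open>Some k\<close>, which vanish to first order in direction k.\<close>

lemma pot_y_bnd: "bnd one (\<lambda>t x. pot (fst q) k x * (y q t x)^2)"
proof (cases "fst q = Some k")
 case True
 obtain D where D: "D \<ge> 0" "\<And>(t::real) x. -1 < t \<Longrightarrow> x \<in> space PM \<Longrightarrow> \<bar>y q t x\<bar> \<le> D * dd k x"
  using y_bnd_dd(1)[OF True] unfolding bnd_def by blast
 obtain E where E: "\<And>s. s \<in> {0<..<1} \<Longrightarrow> V k s * (s * (1 - s))^2 \<le> E" using m.V_bdd by blast
 show ?thesis
 proof (rule bndI[of _ "E * D^2"])
  fix t :: real and x assume tx: "-1 < t" "x \<in> space PM"
  have V: "0 \<le> V k (x k)" "V k (x k) * (dd k x)^2 \<le> E" using m.V_nonneg E tx by (auto simp: space_PM dd_def)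
  have "(y q t x)^2 \<le> (D * dd k x)^2" using D(2)[OF tx] by (metis abs_ge_zero power2_abs power_mono)
  hence "V k (x k) * (y q t x)^2 \<le> V k (x k) * (D * dd k x)^2" using V by (intro mult_left_mono)
  also have "\<dots> = (V k (x k) * (dd k x)^2) * D^2" by (simp add: power_mult_distrib)
  also have "\<dots> \<le> E * D^2" using V by (intro mult_right_mono) auto
  finally show "\<bar>pot (fst q) k x * (y q t x)^2\<bar> \<le> E * D^2 * 1" using True V by (simp add: pot_def)
 qed simp
next
 case False
 thus ?thesis using bnd_const[of 0] by (simp add: pot_def)
qed

lemma A_bnd: "bnd one (A S)" "bnd one (At S)" "bnd one (Att S)" "bnd one (Ak k S)" "bnd one (Akk k S)"
 unfolding A_def[abs_def] At_def[abs_def] Att_def[abs_def] Ak_def[abs_def] Akk_def[abs_def]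
 by (intro bnd_add bnd_const bnd_sum finite bnd_power2 y_bnd bnd_cmult bnd_mult1 bnd_diff pot_y_bnd)+

lemma A_meas: "A S t \<in> borel_measurable PM" "At S t \<in> borel_measurable PM" "Att S t \<in> borel_measurable PM"
 "Ak k S t \<in> borel_measurable PM" "Akk k S t \<in> borel_measurable PM"
 unfolding A_def[abs_def] At_def[abs_def] Att_def[abs_def] Ak_def[abs_def] Akk_def[abs_def]
 by (intro borel_measurable_add borel_measurable_diff borel_measurable_sum borel_measurable_times borel_measurable_power
  borel_measurable_const y_meas meas_pot)+

lemma Ak_bnd_dd: "bnd (dd k) (Ak k S)"
proof -
 have "bnd (dd k) (\<lambda>t x. y q t x * yk k q t x)" for q
  using bnd_mult1[OF y_bnd(5) y_bnd_dd(1)] bnd_mult1[OF y_bnd(1) y_bnd_dd(2)] by (cases "fst q = Some k") auto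
 thus ?thesis unfolding Ak_def[abs_def] by (intro bnd_sum bnd_cmult) auto
qed

text \<open>\<open>S1\<close> collects the real and imaginary part of u, \<open>S2\<close> those of
  all components of v.\<close>

definition S1 :: "('d option \<times> bool) set" where "S1 = {None} \<times> UNIV"
definition S2 :: "('d option \<times> bool) set" where "S2 = range Some \<times> UNIV"

text \<open>The shift from below and \<open>A_bnd\<close> from above confine the arguments to a
  compact box inside the open quadrant.\<close>

lemma composite:
 assumes "continuous_pos \<Phi>"
 shows "bnd one (\<lambda>t x. \<Phi> (A S1 t x) (A S2 t x))" "(\<lambda>x. \<Phi> (A S1 t x) (A S2 t x)) \<in> borel_measurable PM"
proof -
 obtain C1 where C1: "\<And>(t::real) x. -1 < t \<Longrightarrow> x \<in> space PM \<Longrightarrow> \<bar>A S1 t x\<bar> \<le> C1 * 1"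
  using A_bnd(1)[of S1] unfolding bnd_def by blast
 obtain C2 where C2: "\<And>(t::real) x. -1 < t \<Longrightarrow> x \<in> space PM \<Longrightarrow> \<bar>A S2 t x\<bar> \<le> C2 * 1"
  using A_bnd(1)[of S2] unfolding bnd_def by blast
 have "compact ((\<lambda>(a, b). \<Phi> a b) ` ({\<epsilon>..C1} \<times> {\<epsilon>..C2}))"
  using eps by (intro compact_continuous_image compact_Times continuous_on_subset[OF assms]) auto
 hence "bounded ((\<lambda>(a, b). \<Phi> a b) ` ({\<epsilon>..C1} \<times> {\<epsilon>..C2}))" by (rule compact_imp_bounded)
 then obtain C where C: "\<And>a b. a \<in> {\<epsilon>..C1} \<Longrightarrow> b \<in> {\<epsilon>..C2} \<Longrightarrow> \<bar>\<Phi> a b\<bar> \<le> C"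
  unfolding bounded_iff by fastforce
 show "bnd one (\<lambda>t x. \<Phi> (A S1 t x) (A S2 t x))"
 proof (rule bndI[of _ C])
  fix t :: real and x assume tx: "-1 < t" "x \<in> space PM"
  show "\<bar>\<Phi> (A S1 t x) (A S2 t x)\<bar> \<le> C * 1"
   using C[of "A S1 t x" "A S2 t x"] C1[OF tx] C2[OF tx] A_ge[of S1 t x] A_ge[of S2 t x] by (simp add: abs_le_iff)
 qed simp
 have m: "(\<lambda>p. indicator ({0<..} \<times> {0<..}) p *\<^sub>R (case p of (a, b) \<Rightarrow> \<Phi> a b)) \<in> borel_measurable borel"
  by (intro borel_measurable_continuous_on_indicator assms) (auto intro!: borel_open open_Times)
 have "(\<lambda>x. (A S1 t x, A S2 t x)) \<in> borel_measurable PM" by (intro borel_measurable_Pair A_meas)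
 from measurable_compose[OF this m] show "(\<lambda>x. \<Phi> (A S1 t x) (A S2 t x)) \<in> borel_measurable PM"
  using A_pos by (simp add: indicator_def)
qed

text \<open>\<open>bt\<close> and \<open>Kt\<close> are the first two derivatives of
  \<open>b\<close> in t. \<open>Kk k\<close> is the second derivative in direction k in divergence
  form, so that w times \<open>Kk k\<close> is an exact derivative.\<close>

definition b where "b t x = B (A S1 t x) (A S2 t x)"
definition bt where "bt t x = Ba (A S1 t x) (A S2 t x) * At S1 t x + Bb (A S1 t x) (A S2 t x) * At S2 t x"
definition Kt where "Kt t x = Ba (A S1 t x) (A S2 t x) * Att S1 t x + Bb (A S1 t x) (A S2 t x) * Att S2 t x
 + Baa (A S1 t x) (A S2 t x) * (At S1 t x)^2 + 2 * (Bab (A S1 t x) (A S2 t x) * At S1 t x * At S2 t x)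
 + Bbb (A S1 t x) (A S2 t x) * (At S2 t x)^2"
definition Kk where "Kk k t x = Ba (A S1 t x) (A S2 t x) * Akk k S1 t x + Bb (A S1 t x) (A S2 t x) * Akk k S2 t x
 + Baa (A S1 t x) (A S2 t x) * (Ak k S1 t x)^2 + 2 * (Bab (A S1 t x) (A S2 t x) * Ak k S1 t x * Ak k S2 t x)
 + Bbb (A S1 t x) (A S2 t x) * (Ak k S2 t x)^2"

lemma b_bnd: "bnd one b" "bnd one bt" "bnd one Kt" "bnd one (Kk k)"
 unfolding b_def[abs_def] bt_def[abs_def] Kt_def[abs_def] Kk_def[abs_def]
 by (intro bnd_add bnd_cmult bnd_mult1 bnd_power2 A_bnd composite(1)[OF cont(1)] composite(1)[OF cont(2)] composite(1)[OF cont(3)]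
  composite(1)[OF cont(4)] composite(1)[OF cont(5)] composite(1)[OF cont(6)])+

lemma b_meas: "b t \<in> borel_measurable PM" "bt t \<in> borel_measurable PM" "Kt t \<in> borel_measurable PM" "Kk k t \<in> borel_measurable PM"
 unfolding b_def[abs_def] bt_def[abs_def] Kt_def[abs_def] Kk_def[abs_def]
 by (intro borel_measurable_add borel_measurable_times borel_measurable_power borel_measurable_const A_meas
  composite(2)[OF cont(1)] composite(2)[OF cont(2)] composite(2)[OF cont(3)]
  composite(2)[OF cont(4)] composite(2)[OF cont(5)] composite(2)[OF cont(6)])+

lemma b_integrable: assumes "-1 < t"
 shows "integrable PM (b t)" "integrable PM (bt t)" "integrable PM (Kt t)" "integrable PM (Kk k t)"
 by (intro integrable_bnd[OF _ _ assms] b_bnd b_meas)+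

lemma b_deriv: "DERIV (\<lambda>t. b t x) t :> bt t x" "DERIV (\<lambda>t. bt t x) t :> Kt t x"
proof -
 note d = A_deriv_t(1)[of S1 x t] A_deriv_t(1)[of S2 x t] A_pos A_pos
 show "DERIV (\<lambda>t. b t x) t :> bt t x" unfolding b_def bt_def by (rule deriv(1)[OF d])
 show "DERIV (\<lambda>t. bt t x) t :> Kt t x" unfolding bt_def Kt_def
  by (rule DERIV_cong[OF DERIV_add[OF DERIV_mult[OF deriv(2)[OF d] A_deriv_t(2)] DERIV_mult[OF deriv(3)[OF d] A_deriv_t(2)]]])
   (simp add: algebra_simps power2_eq_square)
qed

text \<open>In direction k the function w * \<open>Kk k\<close> is the derivative of the flux w *
  \<open>G\<close>. By \<open>Ak_bnd_dd\<close> the flux vanishes at both ends, whichever component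
  carries the singular potential.\<close>

lemma integral_Kk: assumes t: "-1 < t" shows "integral\<^sup>L PM (Kk k t) = 0"
proof (rule integral_section_eq_0[OF b_integrable(4)[OF t], of k])
 fix x assume x: "x \<in> space PM"
 have xs: "x(k := s) \<in> space PM" if "0 < s" "s < 1" for s using x that by (auto simp: space_PM)
 define G where "G = (\<lambda>x. Ba (A S1 t x) (A S2 t x) * Ak k S1 t x + Bb (A S1 t x) (A S2 t x) * Ak k S2 t x)"
 have "bnd (dd k) (\<lambda>t x. Ba (A S1 t x) (A S2 t x) * Ak k S1 t x + Bb (A S1 t x) (A S2 t x) * Ak k S2 t x)"
  by (intro bnd_add bnd_mult1 Ak_bnd_dd composite(1)[OF cont(2)] composite(1)[OF cont(3)])
 then obtain C where C: "C \<ge> 0" "\<And>x. x \<in> space PM \<Longrightarrow> \<bar>G x\<bar> \<le> C * dd k x" using t unfolding bnd_def G_def by blast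
 obtain D where D: "\<And>s. s \<in> {0<..<1} \<Longrightarrow> w k s \<le> D" using m.w_bdd by blast
 show "(LINT s|unit_density (w k). Kk k t (x(k := s))) = 0"
 proof (rule m.integral_eq_0_ftc)
  fix s :: real assume s: "0 < s" "s < 1"
  note d = A_deriv_k(1)[OF s, of S1 t x k] A_deriv_k(1)[OF s, of S2 t x k] A_pos A_pos
  have "DERIV (\<lambda>s. G (x(k := s))) s :> Kk k t (x(k := s)) - om k s * G (x(k := s))" unfolding G_def Kk_def
   by (rule DERIV_cong[OF DERIV_add[OF DERIV_mult[OF deriv(2)[OF d] A_deriv_k(2)[OF s]] DERIV_mult[OF deriv(3)[OF d] A_deriv_k(2)[OF s]]]])
    (simp add: fun_upd_def algebra_simps power2_eq_square)
  from DERIV_mult[OF m.w_deriv[OF s, of k] this]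
  show "DERIV (\<lambda>s. w k s * G (x(k := s))) s :> w k s * Kk k t (x(k := s))"
   by (rule DERIV_cong) (simp add: algebra_simps)
 next
  have "\<bar>w k s * G (x(k := s))\<bar> \<le> (D * C) * (s * (1 - s))" if s: "0 < s" "s < 1" for s
  proof -
   have "w k s * \<bar>G (x(k := s))\<bar> \<le> D * (C * (s * (1 - s)))"
    using C(2)[OF xs[OF s]] D[of s] m.w_pos[OF s, of k] s by (intro mult_mono) (auto simp: dd_def)
   thus ?thesis using m.w_pos[OF s, of k] by (simp add: abs_mult algebra_simps)
  qed
  from m.boundary_tendsto_0[OF this]
  show "((\<lambda>s. w k s * G (x(k := s))) \<longlongrightarrow> 0) (at_right 0)" "((\<lambda>s. w k s * G (x(k := s))) \<longlongrightarrow> 0) (at_left 1)" by blast+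
  obtain E where E: "\<And>x. x \<in> space PM \<Longrightarrow> \<bar>Kk k t x\<bar> \<le> E * 1" using b_bnd(4)[of k] t unfolding bnd_def by blast
  show "integrable (unit_density (w k)) (\<lambda>s. Kk k t (x(k := s)))"
  proof (rule m.integrable_bounded(1))
   show "\<bar>Kk k t (x(k := s))\<bar> \<le> E" if "s \<in> {0<..<1}" for s using E[OF xs, of s] that by simp
   have "(\<lambda>s. x(k := s)) \<in> measurable (unit_density (w k)) PM" unfolding PM_def using x
    by (intro measurable_PiM_single') (auto simp: space_PM space_PiM)
   from measurable_compose[OF this b_meas(4)] show "(\<lambda>s. Kk k t (x(k := s))) \<in> borel_measurable (unit_density (w k))" .
  qed
 qed
qed

text \<open>The product of the gradient of u with the t-derivative of v, summed over directions and
  over real and imaginary parts.\<close>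

definition Q where "Q t x = (\<Sum>i\<in>UNIV. \<Sum>r\<in>UNIV. yk i (None, r) t x * yt (Some i, r) t x)"

text \<open>The equation of the flow turns \<open>Att\<close> plus all \<open>Akk\<close> into twice
  the squared gradients plus a term of order zero. The latter is nonnegative as \<open>a0\<close>
  and V are, and it keeps its sign after multiplication by \<open>Ba\<close> or \<open>Bb\<close>.
  What remains is the Bellman form in direction t and in all directions k, with one ratio
  \<open>r\<close> for all of them; the inequality of the means then produces 2 \<kappa>
  |Q|.\<close>

lemma pointwise_lower:
 assumes x: "x \<in> space PM"
 shows "2 * \<kappa> * \<bar>Q t x\<bar> \<le> Kt t x + (\<Sum>k\<in>UNIV. Kk k t x)"
proof -
 define a where "a = A S1 t x"
 define a' where "a' = A S2 t x"
 have pos: "0 < a" "0 < a'" by (auto simp: a_def a'_def A_pos)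
 obtain r where r: "r > 0" and fm: "\<And>\<xi> \<zeta> X Y. \<xi>\<^sup>2 \<le> 4 * a * X \<Longrightarrow> \<zeta>\<^sup>2 \<le> 4 * a' * Y \<Longrightarrow>
   \<kappa> * (r * X + Y / r) \<le> 2 * Ba a a' * X + 2 * Bb a a' * Y + Baa a a' * \<xi>^2 + 2 * Bab a a' * \<xi> * \<zeta> + Bbb a a' * \<zeta>^2"
  using form[OF pos] by blast
 \<comment> \<open>This gives the side conditions of \<open>form\<close> for every direction; the
   shift only enlarges \<open>A S t x\<close>.\<close>
 have cs: "(\<Sum>q\<in>S. 2 * (y q t x * z q))^2 \<le> 4 * A S t x * (\<Sum>q\<in>S. (z q)^2)" for S z
 proof -
  have "(\<Sum>q\<in>S. 2 * (y q t x * z q))^2 = 4 * (\<Sum>q\<in>S. y q t x * z q)^2"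
   by (simp add: sum_distrib_left[symmetric] power_mult_distrib)
  also have "\<dots> \<le> 4 * ((\<Sum>q\<in>S. (y q t x)^2) * (\<Sum>q\<in>S. (z q)^2))"
   by (intro mult_left_mono Cauchy_Schwarz_ineq_sum) simp
  also have "\<dots> \<le> 4 * (A S t x * (\<Sum>q\<in>S. (z q)^2))"
   using eps by (intro mult_left_mono mult_right_mono) (auto simp: A_def intro: sum_nonneg)
  finally show ?thesis by simp
 qed
 define X where "X = (\<lambda>S. (\<Sum>q\<in>S. (yt q t x)^2) + (\<Sum>k\<in>UNIV. \<Sum>q\<in>S. (yk k q t x)^2))"
 define P where "P = (\<lambda>S. (\<Sum>q\<in>S. 2 * ((a0 + (\<Sum>k\<in>UNIV. pot (fst q) k x)) * (y q t x)^2)))"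
 have P0: "0 \<le> P S" for S
  unfolding P_def using a0 pot_nonneg[OF x] by (intro sum_nonneg mult_nonneg_nonneg add_nonneg_nonneg) auto
 have tot: "Att S t x + (\<Sum>k\<in>UNIV. Akk k S t x) = 2 * X S + P S" for S
 proof -
  have "Att S t x + (\<Sum>k\<in>UNIV. Akk k S t x) = (\<Sum>q\<in>S. 2 * (yt q t x)^2 + 2 * (y q t x * ytt q t x)
   + (\<Sum>k\<in>UNIV. 2 * (yk k q t x)^2 + 2 * (pot (fst q) k x * (y q t x)^2 - y q t x * ly k q t x)))"
   unfolding Att_def Akk_def by (subst sum.swap) (simp only: sum.distrib[symmetric])
  also have "\<dots> = (\<Sum>q\<in>S. 2 * (yt q t x)^2 + 2 * (\<Sum>k\<in>UNIV. (yk k q t x)^2)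
   + 2 * (y q t x * (ytt q t x + (\<Sum>k\<in>UNIV. pot (fst q) k x * y q t x - ly k q t x))))"
   by (rule sum.cong) (auto simp: sum.distrib sum_distrib_left sum_subtractf algebra_simps power2_eq_square)
  also have "\<dots> = 2 * X S + P S" unfolding y_equation X_def P_def
   by (simp add: sum.distrib sum_distrib_left[symmetric] power2_eq_square algebra_simps sum.swap[of _ UNIV S])
  finally show ?thesis .
 qed
 have ft: "\<kappa> * (r * (\<Sum>q\<in>S1. (yt q t x)^2) + (\<Sum>q\<in>S2. (yt q t x)^2) / r) \<le> 2 * Ba a a' * (\<Sum>q\<in>S1. (yt q t x)^2)
  + 2 * Bb a a' * (\<Sum>q\<in>S2. (yt q t x)^2) + Baa a a' * (At S1 t x)^2 + 2 * Bab a a' * At S1 t x * At S2 t x + Bbb a a' * (At S2 t x)^2"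
  by (rule fm) (auto simp: a_def a'_def At_def cs)
 have fk: "\<kappa> * (r * (\<Sum>q\<in>S1. (yk k q t x)^2) + (\<Sum>q\<in>S2. (yk k q t x)^2) / r) \<le> 2 * Ba a a' * (\<Sum>q\<in>S1. (yk k q t x)^2)
  + 2 * Bb a a' * (\<Sum>q\<in>S2. (yk k q t x)^2) + Baa a a' * (Ak k S1 t x)^2 + 2 * Bab a a' * Ak k S1 t x * Ak k S2 t x + Bbb a a' * (Ak k S2 t x)^2" for k
  by (rule fm) (auto simp: a_def a'_def Ak_def cs)
 have "\<kappa> * (r * X S1 + X S2 / r) = \<kappa> * (r * (\<Sum>q\<in>S1. (yt q t x)^2) + (\<Sum>q\<in>S2. (yt q t x)^2) / r)
  + (\<Sum>k\<in>UNIV. \<kappa> * (r * (\<Sum>q\<in>S1. (yk k q t x)^2) + (\<Sum>q\<in>S2. (yk k q t x)^2) / r))"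
  unfolding X_def by (simp add: sum.distrib sum_distrib_left sum_divide_distrib algebra_simps add_divide_distrib)
 also have "\<dots> \<le> (2 * Ba a a' * (\<Sum>q\<in>S1. (yt q t x)^2)
  + 2 * Bb a a' * (\<Sum>q\<in>S2. (yt q t x)^2) + Baa a a' * (At S1 t x)^2 + 2 * Bab a a' * At S1 t x * At S2 t x + Bbb a a' * (At S2 t x)^2)
  + (\<Sum>k\<in>UNIV. 2 * Ba a a' * (\<Sum>q\<in>S1. (yk k q t x)^2)
  + 2 * Bb a a' * (\<Sum>q\<in>S2. (yk k q t x)^2) + Baa a a' * (Ak k S1 t x)^2 + 2 * Bab a a' * Ak k S1 t x * Ak k S2 t x + Bbb a a' * (Ak k S2 t x)^2)"
  by (intro add_mono ft sum_mono fk)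
 also have "\<dots> = (Kt t x + (\<Sum>k\<in>UNIV. Kk k t x)) - Ba a a' * (Att S1 t x + (\<Sum>k\<in>UNIV. Akk k S1 t x) - 2 * X S1)
  - Bb a a' * (Att S2 t x + (\<Sum>k\<in>UNIV. Akk k S2 t x) - 2 * X S2)"
  unfolding Kt_def Kk_def a_def[symmetric] a'_def[symmetric] X_def
  by (simp add: sum.distrib sum_distrib_left algebra_simps)
 also have "\<dots> \<le> Kt t x + (\<Sum>k\<in>UNIV. Kk k t x)"
  unfolding tot using mult_nonneg_nonneg[OF nonneg(2)[OF pos] P0[of S1]] mult_nonneg_nonneg[OF nonneg(3)[OF pos] P0[of S2]] by simp
 finally have 1: "\<kappa> * (r * X S1 + X S2 / r) \<le> Kt t x + (\<Sum>k\<in>UNIV. Kk k t x)" .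
 have am: "2 * \<bar>u * v\<bar> \<le> r * u^2 + v^2 / r" for u v :: real
 proof -
  have "0 \<le> (r * \<bar>u\<bar> - \<bar>v\<bar>)^2 / r" using r by simp
  also have "\<dots> = r * u^2 + v^2 / r - 2 * \<bar>u * v\<bar>" using r by (simp add: field_simps power2_eq_square abs_mult)
  finally show ?thesis by simp
 qed
 \<comment> \<open>Only the space derivatives of u and the t-derivatives of v enter here. The
   remaining squares in \<open>X\<close> are dropped.\<close>
 have "2 * \<bar>Q t x\<bar> \<le> (\<Sum>i\<in>UNIV. \<Sum>s\<in>UNIV. 2 * \<bar>yk i (None, s) t x * yt (Some i, s) t x\<bar>)"
  unfolding Q_def sum_distrib_left[symmetric]
  by (intro mult_left_mono order_trans[OF sum_abs] sum_mono order_trans[OF sum_abs] order_refl) simp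
 also have "\<dots> \<le> (\<Sum>i\<in>UNIV. \<Sum>s\<in>UNIV. r * (yk i (None, s) t x)^2 + (yt (Some i, s) t x)^2 / r)"
  by (intro sum_mono am)
 also have "\<dots> = r * (\<Sum>k\<in>UNIV. \<Sum>q\<in>S1. (yk k q t x)^2) + (\<Sum>q\<in>S2. (yt q t x)^2) / r"
 proof -
  have S1: "S1 = Pair None ` UNIV" and S2: "S2 = (\<lambda>(i, s). (Some i, s)) ` (UNIV \<times> UNIV)"
   unfolding S1_def S2_def by force+
  have s1: "(\<Sum>q\<in>S1. g q) = (\<Sum>s\<in>UNIV. g (None, s))" for g :: "'d option \<times> bool \<Rightarrow> real"
   unfolding S1 by (subst sum.reindex) (auto simp: inj_on_def)
  have s2: "(\<Sum>q\<in>S2. g q) = (\<Sum>i\<in>UNIV. \<Sum>s\<in>UNIV. g (Some i, s))" for g :: "'d option \<times> bool \<Rightarrow> real"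
   unfolding sum.cartesian_product S2 by (subst sum.reindex) (auto simp: inj_on_def intro!: sum.cong)
  show ?thesis unfolding s1 s2 by (simp add: sum.distrib sum_distrib_left sum_divide_distrib)
 qed
 also have "\<dots> \<le> r * X S1 + X S2 / r"
  unfolding X_def using r by (intro add_mono mult_left_mono divide_right_mono) (auto intro!: sum_nonneg)
 finally have "\<kappa> * (2 * \<bar>Q t x\<bar>) \<le> \<kappa> * (r * X S1 + X S2 / r)" using kappa_pos by (intro mult_left_mono) auto
 with 1 show ?thesis by simp
qed

text \<open>\<open>Zt2\<close> is minus the integral of \<open>Q\<close>, and \<open>Zt\<close> its
  second antiderivative that decays at infinity. It takes the place of an improper t-integral, and
  \<open>Zt 0\<close> will be a quarter of the pairing. If \<mu> n = 0 the quotient has the value 0,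
  in accordance with \<open>L_zero\<close>.\<close>

definition Zt where "Zt t = (\<Sum>i\<in>UNIV. \<Sum>r\<in>UNIV. \<Sum>n\<in>F. c (None, r) n * c (Some i, r) n * L i (n i) / (4 * \<mu> n) * exp (- 2 * \<mu> n * t))"
definition Zt1 where "Zt1 t = (\<Sum>i\<in>UNIV. \<Sum>r\<in>UNIV. \<Sum>n\<in>F. - 2 * \<mu> n * (c (None, r) n * c (Some i, r) n * L i (n i) / (4 * \<mu> n)) * exp (- 2 * \<mu> n * t))"
definition Zt2 where "Zt2 t = (\<Sum>i\<in>UNIV. \<Sum>r\<in>UNIV. \<Sum>n\<in>F. c (None, r) n * c (Some i, r) n * L i (n i) * \<mu> n * exp (- 2 * \<mu> n * t))"

lemma L_zero: assumes "n \<in> F" "\<mu> n = 0" shows "L i (n i) = 0"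
proof -
 have nn: "0 \<le> L j (n j)" for j using m.L_nonneg[of "n j" j] F_idx[OF assms(1)] by (auto simp: idx_def)
 have "a0 + (\<Sum>i\<in>UNIV. L i (n i)) = 0" using mu_sq[OF assms(1)] assms(2) by simp
 hence "(\<Sum>i\<in>UNIV. L i (n i)) = 0" using a0 sum_nonneg[of UNIV "\<lambda>i. L i (n i)"] nn by fastforce
 thus ?thesis using nn by (subst (asm) sum_nonneg_eq_0_iff) auto
qed

lemma Zt_deriv: "DERIV Zt t :> Zt1 t" "DERIV Zt1 t :> Zt2 t"
proof -
 have e: "DERIV (\<lambda>t. exp (- 2 * \<mu> n * t)) t :> - 2 * \<mu> n * exp (- 2 * \<mu> n * t)" for n
  by (auto intro!: derivative_eq_intros)
 show "DERIV Zt t :> Zt1 t" unfolding Zt_def[abs_def] Zt1_def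
  by (rule DERIV_cong[OF DERIV_sum[OF DERIV_sum[OF DERIV_sum[OF DERIV_cmult[OF e]]]]]) (simp only: mult_ac)
 have z: "c (None, r) n * c (Some i, r) n * L i (n i) * \<mu> n = (2 * \<mu> n) * (2 * \<mu> n) * (c (None, r) n * c (Some i, r) n * L i (n i) / (4 * \<mu> n))"
  if "n \<in> F" for i r n using L_zero[OF that, of i] by (cases "\<mu> n = 0") simp_all
 show "DERIV Zt1 t :> Zt2 t" unfolding Zt1_def[abs_def] Zt2_def
  by (rule DERIV_cong[OF DERIV_sum[OF DERIV_sum[OF DERIV_sum[OF DERIV_cmult[OF e]]]]])
   (intro sum.cong refl, subst z, auto)
qed

lemma Zt_tendsto: "(Zt \<longlongrightarrow> 0) at_top"
proof -
 have "((\<lambda>t. C * L i (n i) / (4 * \<mu> n) * exp (- 2 * \<mu> n * t)) \<longlongrightarrow> 0) at_top" if n: "n \<in> F" for C i n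
 proof (cases "\<mu> n = 0")
  case True
  thus ?thesis by simp
 next
  case False
  hence p: "0 < 2 * \<mu> n" using mu_nonneg[OF n] by simp
  have "filterlim (\<lambda>t. 2 * \<mu> n * t) at_top at_top"
   by (rule filterlim_tendsto_pos_mult_at_top[OF tendsto_const p filterlim_ident])
  hence "filterlim (\<lambda>t. - (2 * \<mu> n * t)) at_bot at_top" by (simp add: filterlim_uminus_at_top)
  from filterlim_compose[OF exp_at_bot this] have "((\<lambda>t. exp (- 2 * \<mu> n * t)) \<longlongrightarrow> 0) at_top" by simp
  thus ?thesis by (rule tendsto_mult_right_zero)
 qed
 thus ?thesis unfolding Zt_def[abs_def] by (intro tendsto_null_sum) auto
qed

text \<open>By \<open>H1_None\<close> the gradient of u and the components of v are expanded in the
  same orthogonal systems, so only the diagonal survives. The sign is that of the t-derivative of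
  the exponential.\<close>

lemma integral_Q: "integral\<^sup>L PM (Q t) = - Zt2 t"
proof -
 have i: "integrable PM (\<lambda>x. (C * (e * H (Some i) n x)) * (C' * (e' * H (Some i) m x)))"
  and v: "(LINT x|PM. (C * (e * H (Some i) n x)) * (C' * (e' * H (Some i) m x))) = (if n = m then C * e * C' * e' * L i (n i) else 0)"
  if nm: "n \<in> F" "m \<in> F" for C e C' e' i n m
 proof -
  have eq: "(\<lambda>x. (C * (e * H (Some i) n x)) * (C' * (e' * H (Some i) m x))) = (\<lambda>x. (C * e * C' * e') * (H (Some i) n x * H (Some i) m x))"
   by (simp add: fun_eq_iff mult_ac)
  note o = H_orthogonal[OF F_idx[OF nm(1)] F_idx[OF nm(2)], of "Some i"]
  show "integrable PM (\<lambda>x. (C * (e * H (Some i) n x)) * (C' * (e' * H (Some i) m x)))"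
   unfolding eq by (rule integrable_mult_right[OF o(2)])
  show "(LINT x|PM. (C * (e * H (Some i) n x)) * (C' * (e' * H (Some i) m x))) = (if n = m then C * e * C' * e' * L i (n i) else 0)"
   unfolding eq using o(1) by simp
 qed
 have "integral\<^sup>L PM (Q t) = (LINT x|PM. (\<Sum>i\<in>UNIV. \<Sum>r\<in>UNIV. \<Sum>n\<in>F. \<Sum>m\<in>F.
  (c (None, r) n * (exp (- \<mu> n * t) * H (Some i) n x)) * ((- \<mu> m * c (Some i, r) m) * (exp (- \<mu> m * t) * H (Some i) m x))))"
  by (rule arg_cong[of _ _ "integral\<^sup>L PM"]) (simp add: fun_eq_iff Q_def yk_def yt_def H1_None sum_product)
 also have "\<dots> = (\<Sum>i\<in>UNIV. \<Sum>r\<in>UNIV. \<Sum>n\<in>F. \<Sum>m\<in>F. (LINT x|PM.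
  (c (None, r) n * (exp (- \<mu> n * t) * H (Some i) n x)) * ((- \<mu> m * c (Some i, r) m) * (exp (- \<mu> m * t) * H (Some i) m x))))"
  by (simp only: Bochner_Integration.integral_sum Bochner_Integration.integrable_sum i)
   (intro sum.cong refl Bochner_Integration.integral_sum i; assumption)
 also have "\<dots> = (\<Sum>i\<in>UNIV. \<Sum>r\<in>UNIV. \<Sum>n\<in>F. \<Sum>m\<in>F. if m = n then
  - (c (None, r) n * c (Some i, r) n * L i (n i) * \<mu> n * exp (- 2 * \<mu> n * t)) else 0)"
 proof (intro sum.cong refl)
  fix i r n m assume nm: "n \<in> F" "m \<in> F"
  have "exp (- \<mu> n * t) * exp (- \<mu> n * t) = exp (- 2 * \<mu> n * t)" by (simp flip: exp_add)
  thus "(LINT x|PM. (c (None, r) n * (exp (- \<mu> n * t) * H (Some i) n x)) * ((- \<mu> m * c (Some i, r) m) * (exp (- \<mu> m * t) * H (Some i) m x)))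
   = (if m = n then - (c (None, r) n * c (Some i, r) n * L i (n i) * \<mu> n * exp (- 2 * \<mu> n * t)) else 0)"
   unfolding v[OF nm] by (auto simp: mult_ac)
 qed
 also have "\<dots> = - Zt2 t" using finF by (simp add: Zt2_def sum_negf)
 finally show ?thesis .
qed

text \<open>The difference \<open>g\<close> of the two sides, as a function of t, is convex by
  \<open>pointwise_lower\<close> and bounded above, hence never exceeds its initial value. Since the
  integral of \<open>b\<close> is nonnegative and \<open>Zt\<close> tends to 0, letting t tend to
  infinity gives 0 \<le> g 0.\<close>

theorem bilinear_embedding: "2 * \<kappa> * Zt 0 \<le> integral\<^sup>L PM (b 0)"
proof -
 have dI: "DERIV (\<lambda>t. integral\<^sup>L PM (b t)) t :> integral\<^sup>L PM (bt t)"
   "DERIV (\<lambda>t. integral\<^sup>L PM (bt t)) t :> integral\<^sup>L PM (Kt t)" if t: "0 \<le> t" for t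
 proof -
  have S: "open {-1::real<..}" "t \<in> {-1<..}" "convex {-1::real<..}" using t by auto
  obtain C where C: "\<And>t x. -1 < t \<Longrightarrow> x \<in> space PM \<Longrightarrow> \<bar>bt t x\<bar> \<le> C * 1" using b_bnd(2) unfolding bnd_def by blast
  obtain D where D: "\<And>t x. -1 < t \<Longrightarrow> x \<in> space PM \<Longrightarrow> \<bar>Kt t x\<bar> \<le> D * 1" using b_bnd(3) unfolding bnd_def by blast
  show "DERIV (\<lambda>t. integral\<^sup>L PM (b t)) t :> integral\<^sup>L PM (bt t)"
  proof (rule PM.has_derivative_expectation[OF S, where G = b and G' = bt])
   show "DERIV (\<lambda>t. b t x) s :> bt s x" for s x by (rule b_deriv(1))
   show "integrable PM (b s)" if "s \<in> {-1<..}" for s using that by (intro b_integrable(1)) (simp only: greaterThan_iff)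
   show "\<bar>bt s x\<bar> \<le> C" if "s \<in> {-1<..}" "x \<in> space PM" for s x using C[of s x] that by (simp only: greaterThan_iff mult_1_right)
  qed (rule b_meas(2))
  show "DERIV (\<lambda>t. integral\<^sup>L PM (bt t)) t :> integral\<^sup>L PM (Kt t)"
  proof (rule PM.has_derivative_expectation[OF S, where G = bt and G' = Kt])
   show "DERIV (\<lambda>t. bt t x) s :> Kt s x" for s x by (rule b_deriv(2))
   show "integrable PM (bt s)" if "s \<in> {-1<..}" for s using that by (intro b_integrable(2)) (simp only: greaterThan_iff)
   show "\<bar>Kt s x\<bar> \<le> D" if "s \<in> {-1<..}" "x \<in> space PM" for s x using D[of s x] that by (simp only: greaterThan_iff mult_1_right)
  qed (rule b_meas(3))
 qed
 define g where "g = (\<lambda>t. integral\<^sup>L PM (b t) - 2 * \<kappa> * Zt t)"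
 have g1: "DERIV g t :> integral\<^sup>L PM (bt t) - 2 * \<kappa> * Zt1 t"
  and g2: "DERIV (\<lambda>t. integral\<^sup>L PM (bt t) - 2 * \<kappa> * Zt1 t) t :> integral\<^sup>L PM (Kt t) - 2 * \<kappa> * Zt2 t"
  if "0 \<le> t" for t unfolding g_def by (intro DERIV_diff DERIV_cmult Zt_deriv dI that)+
 have g3: "0 \<le> integral\<^sup>L PM (Kt t) - 2 * \<kappa> * Zt2 t" if t: "0 \<le> t" for t
 proof -
  have t1: "-1 < t" using t by simp
  have iq: "integrable PM (Q t)" unfolding Q_def[abs_def]
   by (rule integrable_bnd[OF _ _ t1, of "\<lambda>t x. \<Sum>i\<in>UNIV. \<Sum>r\<in>UNIV. yk i (None, r) t x * yt (Some i, r) t x"])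
    (intro bnd_sum bnd_mult1 y_bnd finite borel_measurable_sum borel_measurable_times y_meas)+
  have "2 * \<kappa> * Zt2 t = (LINT x|PM. 2 * \<kappa> * (- Q t x))" using integral_Q[of t] by simp
  also have "\<dots> \<le> (LINT x|PM. Kt t x + (\<Sum>k\<in>UNIV. Kk k t x))"
  proof (rule integral_mono)
   fix x assume x: "x \<in> space PM"
   have "2 * \<kappa> * (- Q t x) \<le> 2 * \<kappa> * \<bar>Q t x\<bar>" using kappa_pos by (intro mult_left_mono) auto
   thus "2 * \<kappa> * (- Q t x) \<le> Kt t x + (\<Sum>k\<in>UNIV. Kk k t x)" using pointwise_lower[OF x, of t] by linarith
  qed (use iq b_integrable[OF t1] in auto)
  also have "\<dots> = integral\<^sup>L PM (Kt t) + (\<Sum>k\<in>UNIV. integral\<^sup>L PM (Kk k t))"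
   using b_integrable[OF t1] by (simp add: Bochner_Integration.integral_sum)
  finally show ?thesis using integral_Kk[OF t1] by simp
 qed
 have b0: "0 \<le> integral\<^sup>L PM (b t)" for t
  unfolding b_def by (intro Bochner_Integration.integral_nonneg nonneg(1) A_pos)
 obtain C where C: "\<And>t x. -1 < t \<Longrightarrow> x \<in> space PM \<Longrightarrow> \<bar>b t x\<bar> \<le> C * 1" using b_bnd(1) unfolding bnd_def by blast
 have bC: "integral\<^sup>L PM (b t) \<le> C" if "0 \<le> t" for t
 proof -
  have "integral\<^sup>L PM (b t) \<le> (LINT x|PM. C)"
   using C[of t] that b_integrable[of t] by (intro integral_mono) (auto simp: abs_le_iff)
  also have "\<dots> = C" by (simp only: lebesgue_integral_const PM.prob_space scaleR_one)
  finally show ?thesis .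
 qed
 define D where "D = (\<Sum>i\<in>UNIV. \<Sum>r\<in>(UNIV::bool set). \<Sum>n\<in>F. \<bar>c (None, r) n * c (Some i, r) n * L i (n i) / (4 * \<mu> n)\<bar>)"
 have ZD: "\<bar>Zt t\<bar> \<le> D" if t: "0 \<le> t" for t
 proof -
  have e: "\<bar>C * exp (- 2 * \<mu> n * t)\<bar> \<le> \<bar>C\<bar>" if "n \<in> F" for C n
  proof -
   have "0 \<le> \<mu> n * t" using mu_nonneg[OF that] t by simp
   hence "- (2 * (\<mu> n * t)) \<le> 0" by linarith
   hence "- 2 * \<mu> n * t \<le> 0" by (simp only: mult_minus_left mult.assoc)
   hence "exp (- 2 * \<mu> n * t) \<le> 1" by (simp only: exp_le_one_iff)
   hence "\<bar>C\<bar> * exp (- 2 * \<mu> n * t) \<le> \<bar>C\<bar> * 1" by (intro mult_left_mono) auto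
   thus ?thesis by (simp add: abs_mult)
  qed
  have "\<bar>Zt t\<bar> \<le> (\<Sum>i\<in>UNIV. \<Sum>r\<in>UNIV. \<Sum>n\<in>F. \<bar>c (None, r) n * c (Some i, r) n * L i (n i) / (4 * \<mu> n) * exp (- 2 * \<mu> n * t)\<bar>)"
   unfolding Zt_def by (rule order_trans[OF sum_abs sum_mono[OF order_trans[OF sum_abs sum_mono[OF sum_abs]]]])
  also have "\<dots> \<le> D" unfolding D_def by (rule sum_mono[OF sum_mono[OF sum_mono[OF e]]])
  finally show ?thesis .
 qed
 have geq: "g t = integral\<^sup>L PM (b t) - 2 * \<kappa> * Zt t" for t by (simp only: g_def)
 have gC: "g t \<le> C + 2 * \<kappa> * D" if "0 \<le> t" for t
 proof -
  have "- Zt t \<le> D" using ZD[OF that] by linarith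
  hence "2 * \<kappa> * (- Zt t) \<le> 2 * \<kappa> * D" by (rule mult_left_mono) (use kappa_pos in linarith)
  thus ?thesis unfolding geq using bC[OF that] by linarith
 qed
 have gle: "g t \<le> g 0" if "0 \<le> t" for t
  by (rule convex_bounded_le_initial[where g = g and g' = "\<lambda>t. integral\<^sup>L PM (bt t) - 2 * \<kappa> * Zt1 t"
   and g'' = "\<lambda>t. integral\<^sup>L PM (Kt t) - 2 * \<kappa> * Zt2 t", OF g1 g2 g3 gC that])
 have le: "- (2 * \<kappa> * Zt t) \<le> g 0" if "0 \<le> t" for t
  using b0[of t] gle[OF that] unfolding geq[of t] by linarith
 have "((\<lambda>t. - (2 * \<kappa> * Zt t)) \<longlongrightarrow> - (2 * \<kappa> * 0)) at_top"
  by (intro tendsto_intros Zt_tendsto)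
 hence "- (2 * \<kappa> * 0) \<le> g 0"
  by (rule tendsto_upperbound) (auto intro: eventually_mono[OF eventually_ge_at_top[of 0]] le)
 thus ?thesis unfolding geq by simp
qed

end

section \<open>Completeness of the product systems\<close>

text \<open>Membership in the L^2 closure of the linear span of \<open>E\<close> over
  \<open>I\<close>.\<close>

definition L2_approx :: "'a measure \<Rightarrow> ('n \<Rightarrow> 'a \<Rightarrow> real) \<Rightarrow> 'n set \<Rightarrow> ('a \<Rightarrow> real) \<Rightarrow> bool" where
 "L2_approx M E I f \<longleftrightarrow> f \<in> borel_measurable M \<and> integrable M (\<lambda>x. (f x)^2) \<and>
  (\<forall>e>0. \<exists>F a. finite F \<and> F \<subseteq> I \<and> (LINT x|M. (f x - (\<Sum>n\<in>F. a n * E n x))^2) < e)"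

lemma integrable_square_add:
 fixes f g :: "'a \<Rightarrow> real"
 assumes [measurable]: "f \<in> borel_measurable M" "g \<in> borel_measurable M"
  and i: "integrable M (\<lambda>x. (f x)^2)" "integrable M (\<lambda>x. (g x)^2)"
 shows "integrable M (\<lambda>x. (f x + g x)^2)"
  and "(LINT x|M. (f x + g x)^2) \<le> 2 * (LINT x|M. (f x)^2) + 2 * (LINT x|M. (g x)^2)"
proof -
 have le: "(u + v)^2 \<le> 2 * u^2 + 2 * v^2" for u v :: real
  using zero_le_power2[of "u - v"] by (simp add: power2_eq_square algebra_simps)
 have i2: "integrable M (\<lambda>x. 2 * (f x)^2 + 2 * (g x)^2)"
  using i by (intro Bochner_Integration.integrable_add integrable_mult_right)
 show 1: "integrable M (\<lambda>x. (f x + g x)^2)"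
  by (rule Bochner_Integration.integrable_bound[OF i2]) (auto intro!: AE_I2 order_trans[OF le])
 have "(LINT x|M. (f x + g x)^2) \<le> (LINT x|M. 2 * (f x)^2 + 2 * (g x)^2)" by (rule integral_mono[OF 1 i2 le])
 also have "\<dots> = 2 * (LINT x|M. (f x)^2) + 2 * (LINT x|M. (g x)^2)"
  using i by (subst Bochner_Integration.integral_add) (auto intro: integrable_mult_right)
 finally show "(LINT x|M. (f x + g x)^2) \<le> 2 * (LINT x|M. (f x)^2) + 2 * (LINT x|M. (g x)^2)" .
qed

lemma integrable_square_diff:
 fixes f g :: "'a \<Rightarrow> real"
 assumes "f \<in> borel_measurable M" "g \<in> borel_measurable M"
  and "integrable M (\<lambda>x. (f x)^2)" "integrable M (\<lambda>x. (g x)^2)"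
 shows "integrable M (\<lambda>x. (f x - g x)^2)"
 using integrable_square_add(1)[of f M "\<lambda>x. - g x"] assms by simp

locale L2_family =
 fixes M :: "'a measure" and E :: "'n \<Rightarrow> 'a \<Rightarrow> real" and I :: "'n set"
 assumes E_meas: "\<And>n. n \<in> I \<Longrightarrow> E n \<in> borel_measurable M"
  and E_L2: "\<And>n. n \<in> I \<Longrightarrow> integrable M (\<lambda>x. (E n x)^2)"
begin

lemma L2_lincomb:
 assumes "finite F" "F \<subseteq> I"
 shows "(\<lambda>x. \<Sum>n\<in>F. a n * E n x) \<in> borel_measurable M" "integrable M (\<lambda>x. (\<Sum>n\<in>F. a n * E n x)^2)"
proof -
 have m: "(\<lambda>x. \<Sum>n\<in>F. a n * E n x) \<in> borel_measurable M" if "F \<subseteq> I" for F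
  using E_meas that by (intro borel_measurable_sum borel_measurable_times) auto
 show "(\<lambda>x. \<Sum>n\<in>F. a n * E n x) \<in> borel_measurable M" by (rule m) (rule assms)
 show "integrable M (\<lambda>x. (\<Sum>n\<in>F. a n * E n x)^2)" using assms
 proof (induction F rule: finite_induct)
  case (insert n F)
  have "integrable M (\<lambda>x. (a n * E n x + (\<Sum>n\<in>F. a n * E n x))^2)"
   using insert E_meas E_L2 m[of F] by (intro integrable_square_add) (auto simp: power_mult_distrib)
  thus ?case using insert by simp
 qed simp
qed

lemma L2_approx_closed:
 assumes f: "f \<in> borel_measurable M" "integrable M (\<lambda>x. (f x)^2)"
  and *: "\<And>e. 0 < e \<Longrightarrow> \<exists>g. L2_approx M E I g \<and> (LINT x|M. (f x - g x)^2) < e"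
 shows "L2_approx M E I f" unfolding L2_approx_def
proof (intro conjI f allI impI)
 fix e :: real assume e: "0 < e"
 obtain g where g: "L2_approx M E I g" "(LINT x|M. (f x - g x)^2) < e / 4" using *[of "e / 4"] e by auto
 obtain F a where F: "finite F" "F \<subseteq> I" "(LINT x|M. (g x - (\<Sum>n\<in>F. a n * E n x))^2) < e / 4"
  using g(1) e unfolding L2_approx_def by (meson divide_pos_pos zero_less_numeral)
 have gm: "g \<in> borel_measurable M" "integrable M (\<lambda>x. (g x)^2)" using g(1) by (auto simp: L2_approx_def)
 note l = L2_lincomb[OF F(1,2), of a]
 have "(LINT x|M. ((f x - g x) + (g x - (\<Sum>n\<in>F. a n * E n x)))^2)
  \<le> 2 * (LINT x|M. (f x - g x)^2) + 2 * (LINT x|M. (g x - (\<Sum>n\<in>F. a n * E n x))^2)"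
  using f gm l by (intro integrable_square_add integrable_square_diff) auto
 thus "\<exists>F a. finite F \<and> F \<subseteq> I \<and> (LINT x|M. (f x - (\<Sum>n\<in>F. a n * E n x))^2) < e"
  using F g(2) by (intro exI[of _ F] exI[of _ a]) auto
qed

lemma L2_approx_E: assumes "n \<in> I" shows "L2_approx M E I (E n)"
 unfolding L2_approx_def using E_meas[OF assms] E_L2[OF assms]
 by (auto intro!: exI[of _ "{n}"] exI[of _ "\<lambda>_. 1"] assms)

lemma L2_approx_zero: "L2_approx M E I (\<lambda>x. 0)" unfolding L2_approx_def by (auto intro!: exI[of _ "{}"])

lemma L2_approx_add:
 assumes "L2_approx M E I f" "L2_approx M E I g" shows "L2_approx M E I (\<lambda>x. f x + g x)"
 unfolding L2_approx_def
proof (intro conjI allI impI)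
 have m: "f \<in> borel_measurable M" "g \<in> borel_measurable M" "integrable M (\<lambda>x. (f x)^2)" "integrable M (\<lambda>x. (g x)^2)"
  using assms by (auto simp: L2_approx_def)
 show "(\<lambda>x. f x + g x) \<in> borel_measurable M" using m by auto
 show "integrable M (\<lambda>x. (f x + g x)^2)" by (rule integrable_square_add[OF m])
 fix e :: real assume e: "0 < e"
 hence e4: "0 < e / 4" by simp
 obtain F a where F: "finite F" "F \<subseteq> I" "(LINT x|M. (f x - (\<Sum>n\<in>F. a n * E n x))^2) < e / 4"
  using assms(1) e4 unfolding L2_approx_def by blast
 obtain G b where G: "finite G" "G \<subseteq> I" "(LINT x|M. (g x - (\<Sum>n\<in>G. b n * E n x))^2) < e / 4"
  using assms(2) e4 unfolding L2_approx_def by blast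
 define c where "c = (\<lambda>n. (if n \<in> F then a n else 0) + (if n \<in> G then b n else 0))"
 have "(\<Sum>n\<in>F \<union> G. c n * E n x) = (\<Sum>n\<in>F. a n * E n x) + (\<Sum>n\<in>G. b n * E n x)" for x
 proof -
  have "(\<Sum>n\<in>F \<union> G. c n * E n x) = (\<Sum>n\<in>F \<union> G. if n \<in> F then a n * E n x else 0) + (\<Sum>n\<in>F \<union> G. if n \<in> G then b n * E n x else 0)"
   unfolding sum.distrib[symmetric] by (rule sum.cong) (auto simp: c_def distrib_right)
  also have "\<dots> = (\<Sum>n\<in>F. a n * E n x) + (\<Sum>n\<in>G. b n * E n x)"
   using F(1) G(1) by (simp add: sum.inter_restrict[symmetric] Int_absorb1 Int_absorb2)
  finally show ?thesis .
 qed
 hence "(LINT x|M. (f x + g x - (\<Sum>n\<in>F \<union> G. c n * E n x))^2)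
  = (LINT x|M. ((f x - (\<Sum>n\<in>F. a n * E n x)) + (g x - (\<Sum>n\<in>G. b n * E n x)))^2)"
  by (simp add: algebra_simps)
 also have "\<dots> \<le> 2 * (LINT x|M. (f x - (\<Sum>n\<in>F. a n * E n x))^2) + 2 * (LINT x|M. (g x - (\<Sum>n\<in>G. b n * E n x))^2)"
  using m L2_lincomb[OF F(1,2)] L2_lincomb[OF G(1,2)] by (intro integrable_square_add integrable_square_diff) auto
 finally show "\<exists>F a. finite F \<and> F \<subseteq> I \<and> (LINT x|M. (f x + g x - (\<Sum>n\<in>F. a n * E n x))^2) < e"
  using F G by (intro exI[of _ "F \<union> G"] exI[of _ c]) auto
qed

lemma L2_approx_cmult:
 assumes "L2_approx M E I f" shows "L2_approx M E I (\<lambda>x. c * f x)"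
proof (cases "c = 0")
 case True
 thus ?thesis using L2_approx_zero by simp
next
 case False
 show ?thesis unfolding L2_approx_def
 proof (intro conjI allI impI)
  show "(\<lambda>x. c * f x) \<in> borel_measurable M" "integrable M (\<lambda>x. (c * f x)^2)"
   using assms by (auto simp: L2_approx_def power_mult_distrib)
  fix e :: real assume e: "0 < e"
  hence "0 < e / c^2" using False by simp
  then obtain F a where F: "finite F" "F \<subseteq> I" "(LINT x|M. (f x - (\<Sum>n\<in>F. a n * E n x))^2) < e / c^2"
   using assms unfolding L2_approx_def by blast
  have "(LINT x|M. (c * f x - (\<Sum>n\<in>F. (c * a n) * E n x))^2) = (LINT x|M. c\<^sup>2 * (f x - (\<Sum>n\<in>F. a n * E n x))^2)"
   by (simp add: sum_distrib_left[symmetric] mult.assoc right_diff_distrib[symmetric] power_mult_distrib)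
  also have "\<dots> < e" using F(3) False by (simp add: field_simps)
  finally show "\<exists>F a. finite F \<and> F \<subseteq> I \<and> (LINT x|M. (c * f x - (\<Sum>n\<in>F. a n * E n x))^2) < e"
   using F by (intro exI[of _ F] exI[of _ "\<lambda>n. c * a n"]) auto
 qed
qed

lemma L2_approx_sum:
 assumes "finite J" "\<And>j. j \<in> J \<Longrightarrow> L2_approx M E I (g j)" shows "L2_approx M E I (\<lambda>x. \<Sum>j\<in>J. g j x)"
 using assms by (induction J rule: finite_induct) (auto intro: L2_approx_zero L2_approx_add)

lemma L2_approx_dominated:
 fixes s :: "nat \<Rightarrow> 'a \<Rightarrow> real"
 assumes f: "f \<in> borel_measurable M" "integrable M (\<lambda>x. (f x)^2)"
  and s: "\<And>k. L2_approx M E I (s k)" "\<And>x. x \<in> space M \<Longrightarrow> (\<lambda>k. s k x) \<longlonglongrightarrow> f x"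
  and g: "integrable M g" "\<And>k x. x \<in> space M \<Longrightarrow> (f x - s k x)\<^sup>2 \<le> g x"
 shows "L2_approx M E I f"
proof (rule L2_approx_closed[OF f])
 fix e :: real assume e: "0 < e"
 have sm: "s k \<in> borel_measurable M" for k using s(1) by (simp add: L2_approx_def)
 have "(\<lambda>k. LINT x|M. (f x - s k x)^2) \<longlonglongrightarrow> (LINT x|M. 0)"
 proof (rule integral_dominated_convergence[OF _ _ g(1)])
  show "AE x in M. (\<lambda>k. (f x - s k x)^2) \<longlonglongrightarrow> 0"
   using s(2) by (intro AE_I2) (auto intro!: tendsto_eq_intros)
  show "AE x in M. norm ((f x - s k x)^2) \<le> g x" for k using g(2) by (intro AE_I2) auto
 qed (use sm f in auto)
 hence "\<forall>\<^sub>F k in sequentially. (LINT x|M. (f x - s k x)^2) < e" using e by (intro order_tendstoD) auto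
 thus "\<exists>g. L2_approx M E I g \<and> (LINT x|M. (f x - g x)^2) < e"
  using s(1) by (auto simp: eventually_sequentially)
qed

end

locale L2_family_prob = L2_family + prob_space M
begin

text \<open>The sets with approximable indicator form a Dynkin system: complements by linearity,
  disjoint unions by dominated convergence.\<close>

lemma L2_approx_sets:
 assumes G: "Int_stable G" "G \<subseteq> Pow (space M)" "sets M = sigma_sets (space M) G" "space M \<in> G"
  and ind: "\<And>A. A \<in> G \<Longrightarrow> L2_approx M E I (indicator A)"
  and A: "A \<in> sets M"
 shows "L2_approx M E I (indicator A)"
proof -
 have "A \<in> sigma_sets (space M) G" using A G(3) by simp
 with G(1,2) show ?thesis
 proof (induction rule: sigma_sets_induct_disjoint)
  case (compl A)
  have "L2_approx M E I (\<lambda>x. indicator (space M) x + (-1) * indicator A x)"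
   by (intro L2_approx_add L2_approx_cmult ind G(4) compl)
  moreover have "indicator (space M) x + (-1) * indicator A x = (indicator (space M - A) x :: real)" for x
   using sets.sets_into_space[of A M] compl(1) G(3) by (auto simp: indicator_def)
  ultimately show ?case by (metis (no_types, lifting) ext)
 next
  case (union A)
  have Am: "A i \<in> sets M" for i using union(2) G(3) by auto
  have part: "(\<Sum>i\<in>{..<k}. indicator (A i) x :: real) = indicator (\<Union>i<k. A i) x" for k x
   using union(1) by (subst indicator_UN_disjoint) (auto simp: disjoint_family_on_def)
  show ?case
  proof (rule L2_approx_dominated)
   show "indicator (\<Union>i. A i) \<in> borel_measurable M" using Am by auto
   show "integrable M (\<lambda>x. (indicator (\<Union>i. A i) x :: real)^2)"
    using Am by (intro integrable_const_bound[of _ 1]) (auto simp: indicator_def)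
   show "L2_approx M E I (\<lambda>x. \<Sum>i\<in>{..<k}. indicator (A i) x)" for k
    by (intro L2_approx_sum union) auto
   show "(\<lambda>k. \<Sum>i\<in>{..<k}. indicator (A i) x :: real) \<longlonglongrightarrow> indicator (\<Union>i. A i) x" for x
    unfolding part by (rule LIMSEQ_indicator_UN)
   show "integrable M (\<lambda>x. 1 :: real)" by simp
   show "(indicator (\<Union>i. A i) x - (\<Sum>i\<in>{..<k}. indicator (A i) x :: real))^2 \<le> 1" for k x
   proof -
    show ?thesis unfolding part by (auto simp: indicator_def)
   qed
  qed
 qed (use ind L2_approx_zero in \<open>auto simp: indicator_def[abs_def]\<close>)
qed

text \<open>Linearity leads from indicators to simple functions, dominated convergence from these to
  f.\<close>

lemma L2_approx_total:
 assumes ind: "\<And>A. A \<in> sets M \<Longrightarrow> L2_approx M E I (indicator A)"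
  and f: "f \<in> borel_measurable M" "integrable M (\<lambda>x. (f x)^2)"
 shows "L2_approx M E I f"
proof -
 obtain s where s: "\<And>i. simple_function M (s i)" "\<And>x. x \<in> space M \<Longrightarrow> (\<lambda>i. s i x) \<longlonglongrightarrow> f x"
  "\<And>i x. x \<in> space M \<Longrightarrow> dist (s i x) 0 \<le> 2 * dist (f x) 0"
  using borel_measurable_implies_sequence_metric[OF f(1), of 0] by blast
 have app: "L2_approx M E I (s k)" for k
 proof -
  have "L2_approx M E I (\<lambda>x. \<Sum>y\<in>s k ` space M. y * indicator (s k -` {y} \<inter> space M) x)"
   using s(1)[of k] by (intro L2_approx_sum L2_approx_cmult ind) (auto simp: simple_function_def)
  moreover have "(\<Sum>y\<in>s k ` space M. y * indicator (s k -` {y} \<inter> space M) x) = s k x" if "x \<in> space M" for x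
  proof -
   have "(\<Sum>y\<in>s k ` space M. y * indicator (s k -` {y} \<inter> space M) x) = (\<Sum>y\<in>s k ` space M. if y = s k x then y else 0)"
    using that by (intro sum.cong) (auto simp: indicator_def)
   thus ?thesis using s(1)[of k] that by (simp add: simple_function_def)
  qed
  ultimately show ?thesis unfolding L2_approx_def
   by (simp cong: measurable_cong Bochner_Integration.integrable_cong Bochner_Integration.integral_cong)
 qed
 show ?thesis
 proof (rule L2_approx_dominated[OF f app s(2)])
  show "integrable M (\<lambda>x. 9 * (f x)^2)" using f(2) by simp
  fix k x assume x: "x \<in> space M"
  have "\<bar>f x - s k x\<bar> \<le> 3 * \<bar>f x\<bar>" using s(3)[OF x, of k] by (simp add: dist_real_def)
  hence "\<bar>f x - s k x\<bar>\<^sup>2 \<le> (3 * \<bar>f x\<bar>)^2" by (intro power_mono) auto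
  thus "(f x - s k x)^2 \<le> 9 * (f x)^2" by (simp add: power_mult_distrib)
 qed auto
qed

end

section \<open>Indicators of intervals as limits of tame functions\<close>

context weighted_modes
begin

lemma sets_M_generated:
 "sets M = sigma_sets {0<..<1} ((\<inter>) {0<..<1::real} ` range greaterThan)"
proof -
 have "sets (borel :: real measure) = sigma_sets UNIV (range greaterThan)"
  by (subst borel_Ioi) (simp add: sets_measure_of)
 moreover have "{0<..<1::real} \<in> sigma_sets UNIV (range greaterThan)" unfolding calculation[symmetric] by simp
 ultimately show ?thesis unfolding sets_unit_density sets_restrict_space by (simp add: sigma_sets_Int)
qed

text \<open>The square makes the positive part continuously differentiable. The factor 1 - x, and x
  - a with a \<ge> 0, give the decay of order x (1 - x) at both ends that
  \<open>residual'_tendsto_0\<close> asks for.\<close>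

definition ramp :: "real \<Rightarrow> real \<Rightarrow> real" where "ramp a x = (max 0 ((x - a) * (1 - x)))^2"
definition ramp' :: "real \<Rightarrow> real \<Rightarrow> real" where "ramp' a x = 2 * max 0 ((x - a) * (1 - x)) * (1 + a - 2 * x)"

lemma max_power2_deriv: "DERIV (\<lambda>z::real. (max 0 z)^2) z :> 2 * max 0 z"
proof -
 consider "z > 0" | "z < 0" | "z = 0" by linarith
 thus ?thesis
 proof cases
  case 1
  have "DERIV (\<lambda>z::real. z\<^sup>2) z :> 2 * max 0 z" using 1 by (auto intro!: derivative_eq_intros)
  thus ?thesis by (rule has_field_derivative_transform_within_open[where S = "{0<..}"]) (use 1 in auto)
 next
  case 2
  have "DERIV (\<lambda>z::real. 0) z :> 2 * max 0 z" using 2 by auto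
  thus ?thesis by (rule has_field_derivative_transform_within_open[where S = "{..<0}"]) (use 2 in auto)
 next
  case 3
  have "((\<lambda>h::real. (max 0 h)^2 / h) \<longlongrightarrow> 0) (at 0)"
  proof (rule Lim_null_comparison[OF _ tendsto_norm_zero[OF tendsto_ident_at]])
   show "\<forall>\<^sub>F h in at 0. norm ((max 0 h)^2 / h) \<le> norm (h::real)"
    by (auto simp: max_def power2_eq_square intro!: always_eventually)
  qed
  thus ?thesis using 3 by (simp add: has_field_derivative_iff)
 qed
qed

lemma ramp_deriv: "DERIV (ramp a) x :> ramp' a x"
proof -
 have "DERIV (\<lambda>x. (x - a) * (1 - x)) x :> 1 + a - 2 * x"
  by (auto intro!: derivative_eq_intros simp: algebra_simps)
 from DERIV_chain2[OF max_power2_deriv this] show ?thesis unfolding ramp_def[abs_def] ramp'_def .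
qed

text \<open>\<open>m r / (1 + m r)\<close> tends to the indicator of \<open>(a, 1)\<close> for \<open>r = ramp a\<close>.\<close>
definition bump :: "real \<Rightarrow> nat \<Rightarrow> real \<Rightarrow> real" where "bump a m x = real m * ramp a x / (1 + real m * ramp a x)"
definition bump' :: "real \<Rightarrow> nat \<Rightarrow> real \<Rightarrow> real" where "bump' a m x = real m * ramp' a x / (1 + real m * ramp a x)^2"

lemma bump_facts:
 assumes a: "0 \<le> a" "a < 1"
 shows "DERIV (bump a m) x :> bump' a m x"
  and "0 \<le> bump a m x" "bump a m x \<le> 1"
  and "0 < x \<Longrightarrow> x < 1 \<Longrightarrow> \<bar>bump a m x\<bar> \<le> real m * (x * (1 - x))"
  and "0 < x \<Longrightarrow> x < 1 \<Longrightarrow> \<bar>bump' a m x\<bar> \<le> real m * 4"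
  and "continuous_on UNIV (bump' a m)"
  and "0 < x \<Longrightarrow> x < 1 \<Longrightarrow> (\<lambda>m. bump a m x) \<longlonglongrightarrow> indicator {a<..<1} x"
proof -
 have r0: "0 \<le> ramp a x" for x by (simp add: ramp_def)
 have p: "0 < 1 + real m * ramp a x" for m x using r0[of x] by (simp add: add_pos_nonneg)
 show "DERIV (bump a m) x :> bump' a m x" unfolding bump_def[abs_def] bump'_def
  by (rule derivative_eq_intros ramp_deriv refl)+ (use p[of m x] in \<open>auto simp: field_simps power2_eq_square\<close>)
 show b0: "0 \<le> bump a m x" and "bump a m x \<le> 1" for m x using r0[of x] p[of m x] by (auto simp: bump_def)
 have z: "max 0 ((x - a) * (1 - x)) \<le> x * (1 - x)" "x * (1 - x) \<le> 1" "0 \<le> x * (1 - x)" if "0 < x" "x < 1" for x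
 proof -
  have "(x - a) * (1 - x) \<le> x * (1 - x)" using that a by (intro mult_right_mono) auto
  thus "max 0 ((x - a) * (1 - x)) \<le> x * (1 - x)" using that by simp
  show "x * (1 - x) \<le> 1" using mult_mono[of x 1 "1 - x" 1] that by simp
  show "0 \<le> x * (1 - x)" using that by simp
 qed
 have d1: "bump a m x \<le> real m * ramp a x" for m x
  using p[of m x] r0[of x] by (simp add: bump_def divide_le_eq algebra_simps)
 show "\<bar>bump a m x\<bar> \<le> real m * (x * (1 - x))" if "0 < x" "x < 1"
 proof -
  have "ramp a x \<le> (x * (1 - x)) * 1" unfolding ramp_def power2_eq_square
   using z[OF that] by (intro mult_mono) auto
  hence "real m * ramp a x \<le> real m * (x * (1 - x))" by (intro mult_left_mono) auto
  thus ?thesis using d1[of m x] b0[of m x] by simp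
 qed
 show "\<bar>bump' a m x\<bar> \<le> real m * 4" if x: "0 < x" "x < 1"
 proof -
  have "\<bar>1 + a - 2 * x\<bar> \<le> 2" using x a by (simp add: abs_le_iff)
  hence "\<bar>ramp' a x\<bar> \<le> 2 * 1 * 2" unfolding ramp'_def abs_mult using z[OF x] by (intro mult_mono) auto
  hence 1: "real m * \<bar>ramp' a x\<bar> \<le> real m * 4" by (intro mult_left_mono) auto
  have "1 \<le> 1 + real m * ramp a x" using r0[of x] by simp
  hence "1 \<le> (1 + real m * ramp a x)^2" by (rule one_le_power)
  hence "real m * \<bar>ramp' a x\<bar> / (1 + real m * ramp a x)^2 \<le> real m * \<bar>ramp' a x\<bar> / 1"
   by (intro divide_left_mono) auto
  thus ?thesis using 1 by (simp add: bump'_def abs_mult)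
 qed
 have cr: "continuous_on UNIV (ramp a)" "continuous_on UNIV (ramp' a)"
  unfolding ramp_def ramp'_def by (intro continuous_intros)+
 have "(1 + real m * ramp a x)^2 \<noteq> 0" for x using p[of m x] by simp
 thus "continuous_on UNIV (bump' a m)" unfolding bump'_def by (intro continuous_intros cr) auto
 show "(\<lambda>m. bump a m x) \<longlonglongrightarrow> indicator {a<..<1} x" if x: "0 < x" "x < 1"
 proof (cases "a < x")
  case True
  hence r: "ramp a x > 0" using x by (simp add: ramp_def)
  have "(\<lambda>m. 1 - 1 / (1 + real m * ramp a x)) \<longlonglongrightarrow> 1 - 0"
  proof (intro tendsto_diff tendsto_const)
   have "filterlim (\<lambda>m. 1 + ramp a x * real m) at_top sequentially"
    by (intro filterlim_tendsto_add_at_top[OF tendsto_const] filterlim_tendsto_pos_mult_at_top[OF tendsto_const r] filterlim_real_sequentially)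
   thus "(\<lambda>m. 1 / (1 + real m * ramp a x)) \<longlonglongrightarrow> 0"
    by (intro tendsto_divide_0[OF tendsto_const] filterlim_at_top_imp_at_infinity) (simp add: mult.commute)
  qed
  moreover have "1 - 1 / (1 + real m * ramp a x) = bump a m x" for m
   using p[of m x] by (simp add: bump_def field_simps)
  ultimately show ?thesis using True x by simp
 next
  case False
  hence "(x - a) * (1 - x) \<le> 0" using x by (intro mult_nonpos_nonneg) auto
  hence "ramp a x = 0" by (simp add: ramp_def)
  thus ?thesis using False by (simp add: bump_def)
 qed
qed

lemma tame_bump: assumes a: "0 \<le> a" "a < 1" shows "tame (bump a m) (bump' a m)" unfolding tame_def
proof (intro conjI allI impI)
 show "DERIV (bump a m) x :> bump' a m x" for x by (rule bump_facts(1)[OF a])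
 show "bump' a m \<in> borel_measurable M"
  by (rule measurable_unit_density_continuous[OF continuous_on_subset[OF bump_facts(6)[OF a]]]) simp
 have "\<bar>bump a m x\<bar> \<le> 1" for x using bump_facts(2,3)[OF a, of m x] by (simp only: abs_of_nonneg)
 thus "\<exists>C. \<forall>x\<in>{0<..<1}. \<bar>bump a m x\<bar> \<le> C" by blast
 have "\<bar>bump' a m x\<bar> \<le> real m * 4" if "x \<in> {0<..<1}" for x using bump_facts(5)[OF a, of x m] that by simp
 thus "\<exists>C. \<forall>x\<in>{0<..<1}. \<bar>bump' a m x\<bar> \<le> C" by blast
qed

text \<open>Completeness of the derivatives is proved for functions that are themselves derivatives;
  bumps become such functions here.\<close>

lemma ex_antiderivative:
 assumes "tame g g'" "continuous_on UNIV g"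
 shows "\<exists>G. tame G g"
proof -
 have "continuous_on {0..1} g" by (rule continuous_on_subset[OF assms(2)]) simp
 from antiderivative_continuous[OF this]
 obtain G where G: "\<And>x. x \<in> {0..1} \<Longrightarrow> (G has_vector_derivative g x) (at x within {0..1})" by blast
 have "continuous_on {0..1} G"
  unfolding continuous_on_eq_continuous_within by (intro ballI has_vector_derivative_continuous[OF G])
 hence "compact (G ` {0..1})" by (intro compact_continuous_image) auto
 from compact_imp_bounded[OF this] obtain C where C: "\<forall>y\<in>G ` {0..1}. norm y \<le> C" unfolding bounded_iff ..
 have "tame G g" unfolding tame_def
 proof (intro conjI allI impI)
  fix x :: real assume "0 < x" "x < 1"
  thus "DERIV G x :> g x" using G[of x] by (simp add: has_real_derivative_iff_has_vector_derivative at_within_Icc_at)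
 next
  show "g \<in> borel_measurable M" by (rule tame_meas(1)[OF assms(1)])
  show "\<exists>C. \<forall>x\<in>{0<..<1}. \<bar>G x\<bar> \<le> C" using C by (intro exI[of _ C]) auto
  show "\<exists>C. \<forall>x\<in>{0<..<1}. \<bar>g x\<bar> \<le> C" using assms(1) unfolding tame_def by blast
 qed
 thus ?thesis by blast
qed

text \<open>\<open>b\<close> selects the modes or their derivatives. The intervals (a, 1) generate
  the sets and are stable under intersection, and their indicators are limits of bumps.\<close>

lemma total_sets:
 assumes A: "A \<in> sets M"
 shows "L2_approx M (if b then f' else f) {1..} (indicator A)"
proof -
 interpret prob_space M by (rule prob_space_M)
 interpret L2_family_prob M "if b then f' else f" "{1..}"
 proof
  fix n :: nat assume n: "n \<in> {1..}"
  thus "(if b then f' else f) n \<in> borel_measurable M" by auto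
  show "integrable M (\<lambda>x. ((if b then f' else f) n x)^2)"
   using integrable_f_f[of n n] n by (auto simp: power2_eq_square)
 qed
 have app: "L2_approx M (if b then f' else f) {1..} (bump a m)" if a: "0 \<le> a" "a < 1" for a m
  unfolding L2_approx_def
 proof (intro conjI allI impI)
  note t = tame_bump[OF a, of m]
  show "bump a m \<in> borel_measurable M" by (rule tame_meas[OF t])
  show "integrable M (\<lambda>x. (bump a m x)^2)" using tame_integrable(1)[OF t t] by (simp add: power2_eq_square)
  fix e :: real assume e: "0 < e"
  have "continuous_on UNIV (bump a m)"
   using bump_facts(1)[OF a] by (intro continuous_at_imp_continuous_on) (auto intro: DERIV_isCont)
  then obtain G where G: "tame G (bump a m)" using ex_antiderivative[OF t] by blast
  have l: "(\<lambda>N. LINT x|M. (residual (bump a m) N x)^2) \<longlonglongrightarrow> 0"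
   "(\<lambda>N. LINT x|M. (residual' G (bump a m) N x)^2) \<longlonglongrightarrow> 0"
   using residual_tendsto_0[OF t] residual'_tendsto_0[OF G t bump_facts(4)[OF a]] by auto
  obtain N where N: "(LINT x|M. (residual (bump a m) N x)^2) < e" "(LINT x|M. (residual' G (bump a m) N x)^2) < e"
   using eventually_conj[OF order_tendstoD(2)[OF l(1) e] order_tendstoD(2)[OF l(2) e]]
   by (auto simp: eventually_sequentially)
  show "\<exists>F c. finite F \<and> F \<subseteq> {1..} \<and> (LINT x|M. (bump a m x - (\<Sum>n\<in>F. c n * (if b then f' else f) n x))^2) < e"
  proof (cases b)
   case True
   thus ?thesis using N(2) unfolding residual'_def
    by (intro exI[of _ "{1..N}"] exI[of _ "\<lambda>j. LINT y|M. G y * f j y"]) auto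
  next
   case False
   thus ?thesis using N(1) unfolding residual_def
    by (intro exI[of _ "{1..N}"] exI[of _ "\<lambda>j. LINT y|M. bump a m y * f j y"]) auto
  qed
 qed
 show ?thesis
 proof (rule L2_approx_sets[where G = "(\<inter>) {0<..<1::real} ` range greaterThan"])
  show "Int_stable ((\<inter>) {0<..<1::real} ` range greaterThan)"
  proof (rule Int_stableI, clarify)
   fix a b :: real
   have "{0<..<1} \<inter> {a<..} \<inter> ({0<..<1} \<inter> {b<..}) = {0<..<1} \<inter> {max a b<..}" by auto
   thus "{0<..<1} \<inter> {a<..} \<inter> ({0<..<1} \<inter> {b<..}) \<in> (\<inter>) {0<..<1} ` range greaterThan" by blast
  qed
  have "{0<..<1::real} = {0<..<1} \<inter> {0<..}" by auto
  thus "space M \<in> (\<inter>) {0<..<1::real} ` range greaterThan" by (metis image_eqI rangeI space_unit_density)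
  fix A assume "A \<in> (\<inter>) {0<..<1::real} ` range greaterThan"
  then obtain a where a: "A = {0<..<1} \<inter> {a<..}" and AM: "A \<in> sets M"
   unfolding sets_M_generated by (auto intro: sigma_sets.Basic)
  show "L2_approx M (if b then f' else f) {1..} (indicator A)"
  proof (cases "a < 1")
   case True
   \<comment> \<open>A half line starting below 0 has the same trace on the unit interval as the one
     starting at 0.\<close>
   define a' where "a' = max a 0"
   have a': "0 \<le> a'" "a' < 1" and A: "A = {a'<..<1}" using True a by (auto simp: a'_def)
   show ?thesis
   proof (rule L2_approx_dominated[OF _ _ app[OF a']])
    show "indicator A \<in> borel_measurable M" "integrable M (\<lambda>x. (indicator A x :: real)^2)"
     using AM by (auto intro!: integrable_const_bound[of _ 1] borel_measurable_indicator simp: indicator_def)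
    show "(\<lambda>k. bump a' k x) \<longlonglongrightarrow> indicator A x" if "x \<in> space M" for x
     unfolding A using bump_facts(7)[OF a'] that by simp
    show "(indicator A x - bump a' k x)^2 \<le> 1" for k x
     using bump_facts(2,3)[OF a', of k x] by (auto simp: indicator_def abs_square_le_1)
   qed simp
  next
   case False
   hence "A = {}" using a by auto
   thus ?thesis using L2_approx_zero by (simp add: indicator_def[abs_def])
  qed
 qed (use A sets_M_generated in auto)
qed

end

section \<open>From one coordinate to the product\<close>

context mode_family
begin

lemma H_family: "L2_family_prob PM (H \<sigma>) (Collect idx)"
proof
 fix n assume n: "n \<in> Collect idx"
 thus "H \<sigma> n \<in> borel_measurable PM" by (auto intro: meas_H)
 show "integrable PM (\<lambda>x. (H \<sigma> n x)^2)" using H_orthogonal(2)[of n n] n by (simp add: power2_eq_square)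
qed

text \<open>A hybrid: indicators of the sides of a box in the coordinates of \<open>S\<close>, modes
  in the others.\<close>

definition mix :: "'d set \<Rightarrow> ('d \<Rightarrow> real set) \<Rightarrow> 'd option \<Rightarrow> ('d \<Rightarrow> nat) \<Rightarrow> ('d \<Rightarrow> real) \<Rightarrow> real" where
 "mix S A \<sigma> n x = (\<Prod>j\<in>UNIV. if j \<in> S then indicator (A j) (x j) else fac \<sigma> n j (x j))"

text \<open>Coordinates are exchanged one at a time. Expanding the indicator in coordinate i into
  one-dimensional modes leads to hybrids with one indicator less, and the squared error is the
  one-dimensional one times the fixed squared norms of the other factors.\<close>

lemma total_mix:
 assumes A: "\<And>j. A j \<in> sets (unit_density (w j))" and n: "idx n"
 shows "L2_approx PM (H \<sigma>) (Collect idx) (mix S A \<sigma> n)"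
proof -
 interpret H: L2_family_prob PM "H \<sigma>" "Collect idx" by (rule H_family)
 have "finite S" by simp
 thus ?thesis using n
 proof (induction S arbitrary: n rule: finite_induct)
  case empty
  thus ?case using H.L2_approx_E[of n] by (simp add: mix_def[abs_def] H_def[abs_def])
 next
  case (insert i S)
  define e where "e = (if \<sigma> = Some i then f' i else f i)"
  define g where "g = (\<lambda>j s. if j \<in> S then indicator (A j) s else fac \<sigma> n j s)"
  have gm: "g j \<in> borel_measurable (unit_density (w j))" for j
   unfolding g_def using A meas_fac[OF insert.prems] by auto
  have gi: "integrable (unit_density (w j)) (\<lambda>s. (g j s)^2)" for j
  proof (cases "j \<in> S")
   case True
   thus ?thesis using A[of j]
    by (intro finite_measure.integrable_const_bound[OF prob_space.finite_measure[OF m.prob_space_M], of _ 1])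
     (auto simp: g_def indicator_def intro!: borel_measurable_indicator)
  next
   case False
   thus ?thesis using m.integrable_f_f[of "n j" "n j" j] insert.prems
    by (cases "\<sigma> = Some j") (auto simp: g_def fac_def idx_def power2_eq_square)
  qed
  define C where "C = (\<Prod>j\<in>UNIV - {i}. LINT s|unit_density (w j). (g j s)^2)"
  have C0: "0 \<le> C" unfolding C_def by (intro prod_nonneg) (auto intro: Bochner_Integration.integral_nonneg)
  have split: "mix (insert i S) A \<sigma> n x = indicator (A i) (x i) * (\<Prod>j\<in>UNIV - {i}. g j (x j))"
   "mix S A \<sigma> (n(i := k)) x = e k (x i) * (\<Prod>j\<in>UNIV - {i}. g j (x j))" for x k
  proof -
   show "mix (insert i S) A \<sigma> n x = indicator (A i) (x i) * (\<Prod>j\<in>UNIV - {i}. g j (x j))"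
    unfolding mix_def by (subst prod.remove[of _ i]) (auto simp: g_def intro!: prod.cong)
   have 1: "(\<Prod>j\<in>UNIV - {i}. if j \<in> S then indicator (A j) (x j) else fac \<sigma> (n(i := k)) j (x j)) = (\<Prod>j\<in>UNIV - {i}. g j (x j))"
    by (rule prod.cong) (auto simp: g_def fac_def)
   have 2: "(if i \<in> S then indicator (A i) (x i) else fac \<sigma> (n(i := k)) i (x i)) = e k (x i)"
    using insert.hyps by (simp add: fac_def e_def)
   show "mix S A \<sigma> (n(i := k)) x = e k (x i) * (\<Prod>j\<in>UNIV - {i}. g j (x j))"
    unfolding mix_def by (subst prod.remove[of _ i]) (simp_all only: 1 2 finite UNIV_I)
  qed
  have err: "integrable PM (\<lambda>x. (h (x i) * (\<Prod>j\<in>UNIV - {i}. g j (x j)))^2) \<and>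
    (LINT x|PM. (h (x i) * (\<Prod>j\<in>UNIV - {i}. g j (x j)))^2) = (LINT s|unit_density (w i). (h s)^2) * C"
   if hi: "integrable (unit_density (w i)) (\<lambda>s. (h s)^2)" for h
  proof -
   define G where "G = (\<lambda>j s. if j = i then (h s)\<^sup>2 else (g j s)\<^sup>2)"
   have Gi: "integrable (unit_density (w j)) (G j)" for j using hi gi[of j] by (cases "j = i") (simp_all add: G_def)
   have eq: "(h (x i) * (\<Prod>j\<in>UNIV - {i}. g j (x j)))^2 = (\<Prod>j\<in>UNIV. G j (x j))" for x
   proof -
    have "(\<Prod>j\<in>UNIV - {i}. G j (x j)) = (\<Prod>j\<in>UNIV - {i}. g j (x j))^2"
     unfolding prod_power_distrib by (rule prod.cong) (auto simp: G_def)
    thus ?thesis by (subst prod.remove[of _ i]) (simp_all add: G_def power_mult_distrib)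
   qed
   have "(LINT x|PM. (\<Prod>j\<in>UNIV. G j (x j))) = (\<Prod>j\<in>UNIV. LINT s|unit_density (w j). G j s)"
    unfolding PM_def using Gi by (intro P.product_integral_prod) auto
   also have "\<dots> = (LINT s|unit_density (w i). (h s)^2) * C"
   proof -
    have "(\<Prod>j\<in>UNIV - {i}. LINT s|unit_density (w j). G j s) = C"
     unfolding C_def by (rule prod.cong) (auto simp: G_def)
    thus ?thesis by (subst prod.remove[of _ i]) (simp_all add: G_def)
   qed
   finally have "(LINT x|PM. (\<Prod>j\<in>UNIV. G j (x j))) = (LINT s|unit_density (w i). (h s)^2) * C" .
   moreover have "integrable PM (\<lambda>x. \<Prod>j\<in>UNIV. G j (x j))"
    unfolding PM_def by (rule P.product_integrable_prod[OF finite Gi])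
   ultimately show ?thesis unfolding eq by blast
  qed
  show ?case
  proof (rule H.L2_approx_closed)
   have ind: "integrable (unit_density (w i)) (\<lambda>s. (indicator (A i) s :: real)^2)"
    using A[of i] by (intro finite_measure.integrable_const_bound[OF prob_space.finite_measure[OF m.prob_space_M], of _ 1])
     (auto simp: indicator_def intro!: borel_measurable_indicator)
   show "integrable PM (\<lambda>x. (mix (insert i S) A \<sigma> n x)^2)" unfolding split using err[OF ind] by simp
   show "mix (insert i S) A \<sigma> n \<in> borel_measurable PM"
    unfolding mix_def[abs_def] using A meas_fac[OF insert.prems]
    by (intro borel_measurable_prod measurable_coordinate) (auto split: if_splits)
   fix \<epsilon> :: real assume \<epsilon>: "0 < \<epsilon>"
   have tot: "L2_approx (unit_density (w i)) e {1..} (indicator (A i))"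
    using m.total_sets[OF A[of i], of "\<sigma> = Some i"] by (auto simp: e_def)
   \<comment> \<open>\<open>C + 1\<close> serves as divisor because the product of norms
     \<open>C\<close> may be 0.\<close>
   have "0 < \<epsilon> / (C + 1)" using \<epsilon> C0 by simp
   then obtain F a where F: "finite F" "F \<subseteq> {1..}"
    "(LINT s|unit_density (w i). (indicator (A i) s - (\<Sum>k\<in>F. a k * e k s))^2) < \<epsilon> / (C + 1)"
    using tot unfolding L2_approx_def by blast
   define h where "h = (\<lambda>s. indicator (A i) s - (\<Sum>k\<in>F. a k * e k s))"
   have idxk: "idx (n(i := k))" if "k \<in> F" for k using that F insert.prems by (auto simp: idx_def)
   interpret e: L2_family "unit_density (w i)" e "{1..}"
    by unfold_locales (use m.meas_f m.meas_f' m.integrable_f_f[of _ _ i] in \<open>auto simp: e_def power2_eq_square\<close>)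
   have hi: "integrable (unit_density (w i)) (\<lambda>s. (h s)^2)"
    unfolding h_def using A[of i] ind e.L2_lincomb[OF F(1,2)] by (intro integrable_square_diff) auto
   show "\<exists>g. L2_approx PM (H \<sigma>) (Collect idx) g \<and> (LINT x|PM. (mix (insert i S) A \<sigma> n x - g x)^2) < \<epsilon>"
   proof (intro exI conjI)
    show "L2_approx PM (H \<sigma>) (Collect idx) (\<lambda>x. \<Sum>k\<in>F. a k * mix S A \<sigma> (n(i := k)) x)"
     by (intro H.L2_approx_sum F H.L2_approx_cmult insert.IH idxk)
    have "(LINT x|PM. (mix (insert i S) A \<sigma> n x - (\<Sum>k\<in>F. a k * mix S A \<sigma> (n(i := k)) x))^2)
     = (LINT x|PM. (h (x i) * (\<Prod>j\<in>UNIV - {i}. g j (x j)))^2)"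
     unfolding split h_def by (simp add: left_diff_distrib sum_distrib_right mult.assoc)
    also have "\<dots> = (LINT s|unit_density (w i). (h s)^2) * C" using err[OF hi] by simp
    also have "\<dots> \<le> (\<epsilon> / (C + 1)) * C" using F(3) C0 by (intro mult_right_mono) (auto simp: h_def)
    also have "\<dots> < \<epsilon>" using \<epsilon> C0 by (simp add: field_simps)
    finally show "(LINT x|PM. (mix (insert i S) A \<sigma> n x - (\<Sum>k\<in>F. a k * mix S A \<sigma> (n(i := k)) x))^2) < \<epsilon>" .
   qed
  qed
 qed
qed

text \<open>Boxes are the hybrids with an indicator in every coordinate, and they form an
  intersection stable generator of the product sets.\<close>

theorem H_total:
 fixes h :: "('d \<Rightarrow> real) \<Rightarrow> real"
 assumes h: "h \<in> borel_measurable PM" "integrable PM (\<lambda>x. (h x)^2)"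
 shows "L2_approx PM (H \<sigma>) (Collect idx) h"
proof -
 interpret H: L2_family_prob PM "H \<sigma>" "Collect idx" by (rule H_family)
 define G where "G = prod_algebra UNIV (\<lambda>i. unit_density (w i))"
 have G: "X \<in> G \<longleftrightarrow> (\<exists>A. X = Pi\<^sub>E UNIV A \<and> A \<in> (\<Pi> j\<in>UNIV. sets (unit_density (w j))))" for X
  unfolding G_def prod_algebra_eq_finite[OF finite] mem_Collect_eq ..
 have box: "L2_approx PM (H \<sigma>) (Collect idx) (indicator X)" if "X \<in> G" for X
 proof -
  from that[unfolded G] obtain A where A1: "X = Pi\<^sub>E UNIV A" "A \<in> (\<Pi> j\<in>UNIV. sets (unit_density (w j)))" by (elim exE conjE)
  have A: "X = Pi\<^sub>E UNIV A" "\<And>j. A j \<in> sets (unit_density (w j))" using A1 by (simp_all only: Pi_iff UNIV_I simp_thms)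
  have eq: "indicator X = mix UNIV A \<sigma> (\<lambda>_. 1)"
  proof
   fix x
   have "mix UNIV A \<sigma> (\<lambda>_. 1) x = (\<Prod>j\<in>UNIV. indicator (A j) (x j))" unfolding mix_def by simp
   also have "\<dots> = indicator X x"
   proof (cases "\<forall>j. x j \<in> A j")
    case True
    hence "x \<in> X" unfolding A(1) by auto
    with True show ?thesis by simp
   next
    case False
    then obtain j where j: "x j \<notin> A j" by blast
    hence "x \<notin> X" unfolding A(1) by auto
    moreover have "(\<Prod>j\<in>UNIV. indicator (A j) (x j) :: real) = 0"
     using j by (intro prod_zero) (auto simp: indicator_def)
    ultimately show ?thesis by simp
   qed
   finally show "indicator X x = mix UNIV A \<sigma> (\<lambda>_. 1) x" ..
  qed
  show ?thesis unfolding eq by (rule total_mix[OF A(2)]) (simp add: idx_def)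
 qed
 have "L2_approx PM (H \<sigma>) (Collect idx) (indicator X)" if X: "X \<in> sets PM" for X
 proof (rule H.L2_approx_sets[OF _ _ _ _ box X])
  show "Int_stable G" unfolding G_def by (rule Int_stable_prod_algebra)
  show "G \<subseteq> Pow (space PM)" unfolding G_def PM_def space_PiM by (rule prod_algebra_sets_into_space)
  show "sets PM = sigma_sets (space PM) G" unfolding G_def PM_def space_PiM by (rule sets_PiM)
  show "space PM \<in> G" unfolding G PM_def space_PiM by (intro exI[of _ "\<lambda>i. space (unit_density (w i))"] conjI refl Pi_I sets.top)
 qed
 thus ?thesis by (rule H.L2_approx_total[OF _ h])
qed

end

section \<open>Lebesgue spaces\<close>

text \<open>Write a + b as the convex combination of a / l and b / m. Weights proportional to the
  norms turn the inequality into that of Minkowski.\<close>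

lemma powr_add_le_convex:
 fixes a b l m p :: real
 assumes "0 \<le> a" "0 \<le> b" "0 < l" "0 < m" "l + m = 1" "1 \<le> p"
 shows "(a + b) powr p \<le> l powr (1 - p) * a powr p + m powr (1 - p) * b powr p"
proof -
 have ge1: "1 \<le> r powr (1 - p)" if "0 < r" "r \<le> 1" for r
 proof -
  have "1 powr (1 - p) \<le> r powr (1 - p)" using that assms by (intro powr_mono2') auto
  thus ?thesis by simp
 qed
 consider "a = 0" | "b = 0" | "0 < a" "0 < b" using assms by fastforce
 thus ?thesis
 proof cases
  case 1
  thus ?thesis using ge1[of m] assms mult_right_mono[of 1 "m powr (1 - p)" "b powr p"] by simp
 next
  case 2
  thus ?thesis using ge1[of l] assms mult_right_mono[of 1 "l powr (1 - p)" "a powr p"] by simp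
 next
  case 3
  have "((1 - m) *\<^sub>R (a / l) + m *\<^sub>R (b / m)) powr p \<le> (1 - m) * (a / l) powr p + m * (b / m) powr p"
   using convex_onD[OF powr_convex[of p], of m "a / l" "b / m"] assms 3 by auto
  moreover have lm: "1 - m = l" using assms by simp
  have "(1 - m) *\<^sub>R (a / l) + m *\<^sub>R (b / m) = a + b" unfolding lm using assms by simp
  moreover have "r * (c / r) powr p = r powr (1 - p) * c powr p" if "0 < r" "0 < c" for r c
   using that by (simp add: powr_divide powr_diff)
  ultimately show ?thesis using assms 3 by (metis add_diff_cancel_right')
 qed
qed

abbreviation Lp_dist where "Lp_dist p M f g \<equiv> Lp_norm p M (\<lambda>x. f x - g x)"

lemma tendsto_0_squeeze:
 fixes f g :: "nat \<Rightarrow> real"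
 assumes "\<And>k. 0 \<le> f k" "\<And>k. f k \<le> g k" "g \<longlonglongrightarrow> 0" shows "f \<longlonglongrightarrow> 0"
 by (rule tendsto_sandwich[OF _ _ tendsto_const assms(3)]) (use assms(1,2) in \<open>simp_all add: always_eventually\<close>)

lemma Lp_norm_nonneg: "0 \<le> Lp_norm p M f" by (simp add: Lp_norm_def)

lemma Lp_norm_powr:
 assumes "0 < p" shows "Lp_norm p M f powr p = (LINT x|M. norm (f x) powr p)"
proof -
 have "0 \<le> (LINT x|M. norm (f x) powr p)" by (rule Bochner_Integration.integral_nonneg) simp
 thus ?thesis using assms by (simp add: Lp_norm_def powr_powr)
qed

lemma Lp_norm_le_iff:
 assumes "0 < p" "0 \<le> C" shows "Lp_norm p M f \<le> C \<longleftrightarrow> (LINT x|M. norm (f x) powr p) \<le> C powr p"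
 unfolding Lp_norm_powr[OF assms(1), symmetric] using assms
 by (metis Lp_norm_nonneg less_le_not_le linorder_le_less_linear powr_less_mono2 powr_mono2 less_imp_le)

lemma Lp_I: "f \<in> borel_measurable M \<Longrightarrow> integrable M (\<lambda>x. norm (f x) powr p) \<Longrightarrow> f \<in> Lp p M"
 by (simp add: Lp_def)

lemma Lp_meas: "f \<in> Lp p M \<Longrightarrow> f \<in> borel_measurable M" and Lp_int: "f \<in> Lp p M \<Longrightarrow> integrable M (\<lambda>x. norm (f x) powr p)"
 by (simp_all add: Lp_def)

lemma Lp_cmult:
 fixes f :: "'a \<Rightarrow> 'b::{real_normed_field, second_countable_topology}"
 assumes "f \<in> Lp p M" "0 < p"
 shows "(\<lambda>x. c * f x) \<in> Lp p M" "Lp_norm p M (\<lambda>x. c * f x) = norm c * Lp_norm p M f"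
proof -
 have eq: "(\<lambda>x. norm (c * f x) powr p) = (\<lambda>x. norm c powr p * norm (f x) powr p)"
  by (simp add: norm_mult powr_mult)
 show "(\<lambda>x. c * f x) \<in> Lp p M"
  using Lp_meas[OF assms(1)] Lp_int[OF assms(1)] by (intro Lp_I) (auto simp: eq)
 have "0 \<le> (LINT x|M. norm (f x) powr p)" by (rule Bochner_Integration.integral_nonneg) simp
 thus "Lp_norm p M (\<lambda>x. c * f x) = norm c * Lp_norm p M f"
  unfolding Lp_norm_def eq using assms(2) by (simp add: powr_mult powr_powr)
qed

lemma Lp_cong_AE:
 assumes "AE x in M. f x = g x" "f \<in> borel_measurable M" "g \<in> borel_measurable M"
 shows "f \<in> Lp p M \<longleftrightarrow> g \<in> Lp p M" "Lp_norm p M f = Lp_norm p M g"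
proof -
 have "AE x in M. norm (f x) powr p = norm (g x) powr p" using assms(1) by eventually_elim simp
 hence "integrable M (\<lambda>x. norm (f x) powr p) \<longleftrightarrow> integrable M (\<lambda>x. norm (g x) powr p)"
  "(LINT x|M. norm (f x) powr p) = (LINT x|M. norm (g x) powr p)"
  using assms(2,3) by (intro integrable_cong_AE integral_cong_AE; measurable)+
 thus "f \<in> Lp p M \<longleftrightarrow> g \<in> Lp p M" "Lp_norm p M f = Lp_norm p M g"
  using assms(2,3) by (auto simp: Lp_def Lp_norm_def)
qed

lemma Lp_dominated:
 assumes g: "g \<in> Lp p M" and f: "f \<in> borel_measurable M" and le: "AE x in M. norm (f x) \<le> norm (g x)" and p: "0 < p"
 shows "f \<in> Lp p M" "Lp_norm p M f \<le> Lp_norm p M g"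
proof -
 have ae: "AE x in M. norm (norm (f x) powr p) \<le> norm (norm (g x) powr p)"
  using le by eventually_elim (use p in \<open>auto intro: powr_mono2\<close>)
 show *: "f \<in> Lp p M" using Bochner_Integration.integrable_bound[OF Lp_int[OF g] _ ae] f by (intro Lp_I) auto
 have "(LINT x|M. norm (f x) powr p) \<le> (LINT x|M. norm (g x) powr p)"
  using ae by (intro integral_mono_AE Lp_int * g) auto
 thus "Lp_norm p M f \<le> Lp_norm p M g"
  unfolding Lp_norm_def using p by (intro powr_mono2) (auto intro: Bochner_Integration.integral_nonneg)
qed

lemma Lp_add:
 assumes f: "f \<in> Lp p M" and g: "g \<in> Lp p M" and p: "1 \<le> p"
 shows "(\<lambda>x. f x + g x) \<in> Lp p M" "Lp_norm p M (\<lambda>x. f x + g x) \<le> Lp_norm p M f + Lp_norm p M g"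
proof -
 note fm = Lp_meas[OF f] and gm = Lp_meas[OF g] and fi = Lp_int[OF f] and gi = Lp_int[OF g]
 have le: "norm (f x + g x) powr p \<le> l powr (1 - p) * norm (f x) powr p + m powr (1 - p) * norm (g x) powr p"
  if "0 < l" "0 < m" "l + m = 1" for l m x
 proof -
  have "norm (f x + g x) powr p \<le> (norm (f x) + norm (g x)) powr p"
   using p by (intro powr_mono2 norm_triangle_ineq) auto
  also have "\<dots> \<le> l powr (1 - p) * norm (f x) powr p + m powr (1 - p) * norm (g x) powr p"
   using that p by (intro powr_add_le_convex) auto
  finally show ?thesis .
 qed
 have ib: "integrable M (\<lambda>x. l powr (1 - p) * norm (f x) powr p + m powr (1 - p) * norm (g x) powr p)" for l m
  using fi gi by (intro Bochner_Integration.integrable_add integrable_mult_right)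
 have i: "integrable M (\<lambda>x. norm (f x + g x) powr p)"
 proof (rule Bochner_Integration.integrable_bound[OF ib[of "1 / 2" "1 / 2"]])
  show "(\<lambda>x. norm (f x + g x) powr p) \<in> borel_measurable M" using fm gm by measurable
  show "AE x in M. norm (norm (f x + g x) powr p)
   \<le> norm ((1 / 2) powr (1 - p) * norm (f x) powr p + (1 / 2) powr (1 - p) * norm (g x) powr p)"
  proof (rule AE_I2)
   fix x
   show "norm (norm (f x + g x) powr p)
    \<le> norm ((1 / 2) powr (1 - p) * norm (f x) powr p + (1 / 2) powr (1 - p) * norm (g x) powr p)"
    using le[of "1 / 2" "1 / 2" x] by simp
  qed
 qed
 thus "(\<lambda>x. f x + g x) \<in> Lp p M" using fm gm by (intro Lp_I) auto
 \<comment> \<open>Strict upper bounds \<open>X\<close>, \<open>Y\<close> of the norms are positive,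
   so the weights X / (X + Y) and Y / (X + Y) exist even if a norm vanishes.\<close>
 have "Lp_norm p M (\<lambda>x. f x + g x) \<le> X + Y" if X: "Lp_norm p M f < X" and Y: "Lp_norm p M g < Y" for X Y
 proof -
  have pos: "0 < X" "0 < Y" using X Y Lp_norm_nonneg[of p M f] Lp_norm_nonneg[of p M g] by auto
  define l where "l = X / (X + Y)"
  define m where "m = Y / (X + Y)"
  have lm: "0 < l" "0 < m" "l + m = 1" using pos by (simp_all add: l_def m_def add_divide_distrib[symmetric])
  have "(LINT x|M. norm (f x + g x) powr p) \<le> (LINT x|M. l powr (1 - p) * norm (f x) powr p + m powr (1 - p) * norm (g x) powr p)"
   by (rule integral_mono[OF i ib le[OF lm]])
  also have "\<dots> = l powr (1 - p) * Lp_norm p M f powr p + m powr (1 - p) * Lp_norm p M g powr p"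
   using fi gi p by (subst Bochner_Integration.integral_add) (auto simp: Lp_norm_powr intro: integrable_mult_right)
  also have "\<dots> \<le> l powr (1 - p) * X powr p + m powr (1 - p) * Y powr p"
   using X Y p by (intro add_mono mult_left_mono powr_mono2) (auto simp: Lp_norm_nonneg)
  also have "\<dots> = (X + Y) powr p"
  proof -
   have 1: "(Z / (X + Y)) powr (1 - p) * Z powr p = Z * (X + Y) powr (p - 1)" if Z: "0 < Z" for Z
   proof -
    have "Z powr (1 - p) * Z powr p = Z" using Z by (simp flip: powr_add)
    moreover have "(X + Y) powr (p - 1) = 1 / (X + Y) powr (1 - p)"
     using powr_minus_divide[of "X + Y" "1 - p"] by simp
    ultimately show ?thesis using Z pos by (simp add: powr_divide)
   qed
   have "l powr (1 - p) * X powr p + m powr (1 - p) * Y powr p = (X + Y) * (X + Y) powr (p - 1)"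
    unfolding l_def m_def 1[OF pos(1)] 1[OF pos(2)] by (simp add: distrib_right)
   thus ?thesis using pos by (simp add: powr_mult_base)
  qed
  finally show ?thesis using p pos by (subst Lp_norm_le_iff) auto
 qed
 hence half: "Lp_norm p M (\<lambda>x. f x + g x) \<le> (Lp_norm p M f + e / 2) + (Lp_norm p M g + e / 2)" if "0 < e" for e
  using that by (metis half_gt_zero less_add_same_cancel1)
 have "Lp_norm p M (\<lambda>x. f x + g x) \<le> Lp_norm p M f + Lp_norm p M g + e" if "0 < e" for e
  using half[OF that] by simp
 thus "Lp_norm p M (\<lambda>x. f x + g x) \<le> Lp_norm p M f + Lp_norm p M g" by (rule field_le_epsilon)
qed

lemma Lp_uminus: "f \<in> Lp p M \<Longrightarrow> (\<lambda>x. - f x) \<in> Lp p M" "Lp_norm p M (\<lambda>x. - f x) = Lp_norm p M f"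
 by (auto simp: Lp_def Lp_norm_def)

lemma Lp_diff:
 assumes "f \<in> Lp p M" "g \<in> Lp p M" "1 \<le> p"
 shows "(\<lambda>x. f x - g x) \<in> Lp p M" "Lp_dist p M f g \<le> Lp_norm p M f + Lp_norm p M g"
 using Lp_add[OF assms(1) Lp_uminus(1)[OF assms(2)] assms(3)] by (simp_all add: Lp_uminus(2))

lemma Lp_norm_triangle:
 assumes "f \<in> Lp p M" "g \<in> Lp p M" "h \<in> Lp p M" "1 \<le> p"
 shows "Lp_dist p M f h \<le> Lp_dist p M f g + Lp_dist p M g h"
 using Lp_add(2)[OF Lp_diff(1)[OF assms(1,2,4)] Lp_diff(1)[OF assms(2,3,4)] assms(4)] by simp

lemma Lp_norm_diff_commute: "Lp_dist p M f g = Lp_dist p M g f" by (simp add: Lp_norm_def norm_minus_commute)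

lemma Lp_norm_limit:
 assumes v: "\<And>k. v k \<in> Lp p M" "g \<in> Lp p M" "(\<lambda>k. Lp_dist p M (v k) g) \<longlonglongrightarrow> 0" and p: "1 \<le> p"
 shows "(\<lambda>k. Lp_norm p M (v k)) \<longlonglongrightarrow> Lp_norm p M g"
proof (rule LIM_zero_cancel, rule Lim_null_comparison[OF _ v(3)], intro always_eventually allI)
 fix k
 show "norm (Lp_norm p M (v k) - Lp_norm p M g) \<le> Lp_dist p M (v k) g"
  using Lp_add(2)[OF Lp_diff(1)[OF v(1,2) p] v(2) p, of k] Lp_add(2)[OF Lp_diff(1)[OF v(2,1) p] v(1) p, of k k]
   Lp_norm_diff_commute[of p M "v k" g] by (simp add: abs_le_iff)
qed

lemma Lp_zero: "(\<lambda>x. 0) \<in> Lp p M" "0 < p \<Longrightarrow> Lp_norm p M (\<lambda>x. 0) = 0"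
 by (simp_all add: Lp_def Lp_norm_def)

lemma Lp_sum:
 assumes "finite J" "\<And>j. j \<in> J \<Longrightarrow> f j \<in> Lp p M" "1 \<le> p" shows "(\<lambda>x. \<Sum>j\<in>J. f j x) \<in> Lp p M"
 using assms by (induction J rule: finite_induct) (auto intro: Lp_zero Lp_add)

lemma Lp_tendsto_AE_subseq:
 fixes f :: "nat \<Rightarrow> 'a \<Rightarrow> 'b::{banach, second_countable_topology}"
 assumes f: "\<And>k. (\<lambda>x. f k x - g x) \<in> Lp p M" and l: "(\<lambda>k. Lp_dist p M (f k) g) \<longlonglongrightarrow> 0" and p: "0 < p"
 shows "\<exists>r. strict_mono r \<and> (AE x in M. (\<lambda>k. f (r k) x) \<longlonglongrightarrow> g x)"
proof -
 have "(\<lambda>k. Lp_dist p M (f k) g powr p) \<longlonglongrightarrow> 0"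
  using tendsto_powr2[OF l tendsto_const, of p] p by (simp add: Lp_norm_nonneg)
 hence "(\<lambda>k. LINT x|M. norm (norm (f k x - g x) powr p)) \<longlonglongrightarrow> 0" by (simp add: Lp_norm_powr[OF p])
 then obtain r where r: "strict_mono r" "AE x in M. (\<lambda>k. norm (f (r k) x - g x) powr p) \<longlonglongrightarrow> 0"
  using tendsto_L1_AE_subseq[of M "\<lambda>k x. norm (f k x - g x) powr p"] Lp_int[OF f] by blast
 have "AE x in M. (\<lambda>k. f (r k) x) \<longlonglongrightarrow> g x" using r(2)
 proof eventually_elim
  case (elim x)
  have "(\<lambda>k. (norm (f (r k) x - g x) powr p) powr (1 / p)) \<longlonglongrightarrow> 0 powr (1 / p)"
   using p by (intro tendsto_powr' elim tendsto_const) auto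
  hence "(\<lambda>k. norm (f (r k) x - g x)) \<longlonglongrightarrow> 0" using p by (simp add: powr_powr)
  thus ?case by (metis LIM_zero_cancel tendsto_norm_zero_iff)
 qed
 with r(1) show ?thesis by blast
qed

text \<open>Both limits, possibly for different exponents, are almost everywhere limits of one
  common subsequence.\<close>

lemma Lp_limits_eq_AE:
 fixes f :: "nat \<Rightarrow> 'a \<Rightarrow> 'b::{banach, second_countable_topology}"
 assumes f: "\<And>k. (\<lambda>x. f k x - g x) \<in> Lp p M" "(\<lambda>k. Lp_dist p M (f k) g) \<longlonglongrightarrow> 0" "0 < p"
  and h: "\<And>k. (\<lambda>x. f k x - h x) \<in> Lp q M" "(\<lambda>k. Lp_dist q M (f k) h) \<longlonglongrightarrow> 0" "0 < q"
 shows "AE x in M. g x = h x"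
proof -
 obtain r where r: "strict_mono r" "AE x in M. (\<lambda>k. f (r k) x) \<longlonglongrightarrow> g x" using Lp_tendsto_AE_subseq[OF f] by blast
 have "(\<lambda>k. Lp_dist q M (f (r k)) h) \<longlonglongrightarrow> 0" using LIMSEQ_subseq_LIMSEQ[OF h(2) r(1)] by (simp add: comp_def)
 then obtain s where s: "strict_mono s" "AE x in M. (\<lambda>k. f (r (s k)) x) \<longlonglongrightarrow> h x"
  using Lp_tendsto_AE_subseq[of "\<lambda>k. f (r k)" h q M] h(1,3) by blast
 show ?thesis using r(2) s(2)
 proof eventually_elim
  case (elim x)
  have "(\<lambda>k. f (r (s k)) x) \<longlonglongrightarrow> g x" using LIMSEQ_subseq_LIMSEQ[OF elim(1) s(1)] by (simp add: comp_def)
  thus ?case using elim(2) LIMSEQ_unique by blast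
 qed
qed

section \<open>Lebesgue spaces over a probability space\<close>

context prob_space
begin

lemma Lp_const: "(\<lambda>x. c) \<in> Lp p M" by (simp add: Lp_def)

lemma Lp_bounded: assumes "f \<in> borel_measurable M" "\<And>x. x \<in> space M \<Longrightarrow> norm (f x) \<le> C" "0 < p" shows "f \<in> Lp p M"
 by (rule Lp_dominated(1)[OF Lp_const[of "C::real"] assms(1) _ assms(3)]) (use assms(2) in \<open>auto intro!: AE_I2 order_trans[OF _ abs_ge_self]\<close>)

text \<open>Young's inequality with the constant 1 as second factor; after division by a bound for
  the norm the two terms integrate to at most 1 / p and 1 - 1 / p because the total mass is
  1.\<close>

lemma Lp_1_le:
 fixes f :: "'a \<Rightarrow> 'b::{banach, second_countable_topology}"
 assumes f: "f \<in> Lp p M" and p: "1 < p"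
 shows "integrable M f" "(LINT x|M. norm (f x)) \<le> Lp_norm p M f"
proof -
 have y: "t \<le> t powr p / p + (1 - 1 / p)" if "0 \<le> t" for t :: real
 proof -
  have "1 / p + 1 / (p / (p - 1)) = 1" "p / (p - 1) > 1" using p by (auto simp: field_simps)
  from Youngs_inequality[OF p this(2,1) that, of 1] show ?thesis using p by (simp add: field_simps)
 qed
 have "integrable M (\<lambda>x. norm (f x) powr p / p + (1 - 1 / p))" using Lp_int[OF f] by simp
 thus i: "integrable M f"
  by (rule Bochner_Integration.integrable_bound) (use Lp_meas[OF f] y p in \<open>auto intro!: AE_I2 order_trans[OF y abs_ge_self]\<close>)
 have "(LINT x|M. norm (f x)) \<le> X" if X: "Lp_norm p M f < X" for X
 proof -
  have X0: "0 < X" using X Lp_norm_nonneg[of p M f] by linarith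
  have "(LINT x|M. norm (f x)) / X = (LINT x|M. norm (f x) / X)" by simp
  also have "\<dots> \<le> (LINT x|M. norm (f x) powr p / (X powr p * p) + (1 - 1 / p))"
  proof (rule integral_mono)
   show "norm (f x) / X \<le> norm (f x) powr p / (X powr p * p) + (1 - 1 / p)" for x
    using y[of "norm (f x) / X"] X0 by (simp add: powr_divide)
  qed (use i Lp_int[OF f] in auto)
  also have "\<dots> = Lp_norm p M f powr p / (X powr p * p) + (1 - 1 / p)"
   using Lp_int[OF f] p by (simp add: Lp_norm_powr prob_space)
  also have "\<dots> \<le> X powr p / (X powr p * p) + (1 - 1 / p)"
   using p X by (intro add_mono divide_right_mono powr_mono2 order_refl) (auto simp: Lp_norm_nonneg)
  also have "\<dots> = 1" using X0 by simp
  finally show ?thesis using X0 by (simp add: field_simps)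
 qed
 thus "(LINT x|M. norm (f x)) \<le> Lp_norm p M f" by (rule dense_ge)
qed

text \<open>The L^1 norm is dominated by the Lp norm, which yields an almost everywhere convergent
  subsequence. Fatou's lemma carries the Cauchy estimate over to its limit.\<close>

lemma Lp_complete:
 fixes f :: "nat \<Rightarrow> 'a \<Rightarrow> 'b::{banach, second_countable_topology}"
 assumes f: "\<And>k. f k \<in> Lp p M" and p: "1 < p"
  and c: "\<And>e. 0 < e \<Longrightarrow> \<exists>N. \<forall>i\<ge>N. \<forall>j\<ge>N. Lp_dist p M (f i) (f j) < e"
 shows "\<exists>h\<in>Lp p M. (\<lambda>k. Lp_dist p M (f k) h) \<longlonglongrightarrow> 0"
proof -
 have p0: "0 < p" "1 \<le> p" using p by auto
 have d: "(\<lambda>x. f i x - f j x) \<in> Lp p M" for i j by (rule Lp_diff(1)[OF f f p0(2)])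
 obtain r where r: "strict_mono r" "AE x in M. Cauchy (\<lambda>i. f (r i) x)"
 proof (rule cauchy_L1_AE_cauchy_subseq[where s = f and M = M])
  show "integrable M (f k)" for k by (rule Lp_1_le[OF f p])
  show "\<exists>N. \<forall>i\<ge>N. \<forall>j\<ge>N. (LINT x|M. norm (f i x - f j x)) < e" if "0 < e" for e
   using c[OF that] Lp_1_le(2)[OF d p] by (meson le_less_trans)
 qed
 define h where "h = (\<lambda>x. lim (\<lambda>i. f (r i) x))"
 have hm: "h \<in> borel_measurable M" unfolding h_def using Lp_meas[OF f] by (intro borel_measurable_lim_metric)
 have hl: "AE x in M. (\<lambda>i. f (r i) x) \<longlonglongrightarrow> h x"
  using r(2) by eventually_elim (simp add: h_def Cauchy_convergent_iff convergent_LIMSEQ_iff)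
 have key: "(\<lambda>x. f k x - h x) \<in> Lp p M \<and> Lp_dist p M (f k) h \<le> e"
  if e: "0 < e" and k: "\<And>i. i \<ge> k \<Longrightarrow> Lp_dist p M (f k) (f i) \<le> e" for e k
 proof -
  have fat: "(\<integral>\<^sup>+x. ennreal (norm (f k x - h x) powr p) \<partial>M) \<le> ennreal (e powr p)"
  proof -
   have "(\<integral>\<^sup>+x. ennreal (norm (f k x - h x) powr p) \<partial>M) = (\<integral>\<^sup>+x. liminf (\<lambda>i. ennreal (norm (f k x - f (r i) x) powr p)) \<partial>M)"
   proof (rule nn_integral_cong_AE)
    show "AE x in M. ennreal (norm (f k x - h x) powr p) = liminf (\<lambda>i. ennreal (norm (f k x - f (r i) x) powr p))"
     using hl
    proof eventually_elim
     case (elim x)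
     have "(\<lambda>i. ennreal (norm (f k x - f (r i) x) powr p)) \<longlonglongrightarrow> ennreal (norm (f k x - h x) powr p)"
      using p0 by (intro tendsto_ennrealI tendsto_powr' tendsto_norm tendsto_diff tendsto_const elim) auto
     thus ?case by (intro lim_imp_Liminf[symmetric]) auto
    qed
   qed
   also have "\<dots> \<le> liminf (\<lambda>i. \<integral>\<^sup>+x. ennreal (norm (f k x - f (r i) x) powr p) \<partial>M)"
    using Lp_meas[OF f] by (intro nn_integral_liminf) measurable
   also have "\<dots> \<le> ennreal (e powr p)"
   proof (rule Liminf_le)
    show "\<forall>\<^sub>F i in sequentially. (\<integral>\<^sup>+x. ennreal (norm (f k x - f (r i) x) powr p) \<partial>M) \<le> ennreal (e powr p)"
     using eventually_ge_at_top[of k]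
    proof eventually_elim
     case (elim i)
     have "k \<le> r i" using elim seq_suble[OF r(1), of i] by linarith
     from k[OF this] have "(LINT x|M. norm (f k x - f (r i) x) powr p) \<le> e powr p"
      using Lp_norm_le_iff[OF p0(1), of e M "\<lambda>x. f k x - f (r i) x"] e by simp
     thus ?case using Lp_int[OF d] by (subst nn_integral_eq_integral) (auto intro: ennreal_leI)
    qed
   qed simp
   finally show ?thesis .
  qed
  have m: "(\<lambda>x. norm (f k x - h x) powr p) \<in> borel_measurable M" using hm Lp_meas[OF f] by measurable
  have fin: "(\<integral>\<^sup>+x. ennreal (norm (f k x - h x) powr p) \<partial>M) < \<infinity>" using fat by (rule le_less_trans) simp
  have i: "integrable M (\<lambda>x. norm (f k x - h x) powr p)" using m fin by (intro integrableI_bounded) auto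
  hence L: "(\<lambda>x. f k x - h x) \<in> Lp p M" using hm Lp_meas[OF f] by (intro Lp_I) measurable
  have "ennreal (LINT x|M. norm (f k x - h x) powr p) \<le> ennreal (e powr p)"
   using fat i by (subst nn_integral_eq_integral[symmetric]) auto
  hence "(LINT x|M. norm (f k x - h x) powr p) \<le> e powr p" by (simp add: ennreal_le_iff)
  hence "Lp_dist p M (f k) h \<le> e" using Lp_norm_le_iff[OF p0(1), of e M "\<lambda>x. f k x - h x"] e by simp
  with L show ?thesis by blast
 qed
 have ev: "\<exists>N. \<forall>k\<ge>N. (\<lambda>x. f k x - h x) \<in> Lp p M \<and> Lp_dist p M (f k) h \<le> e" if e: "0 < e" for e
 proof -
  obtain N where "\<forall>i\<ge>N. \<forall>j\<ge>N. Lp_dist p M (f i) (f j) < e" using c[OF e] by blast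
  hence "(\<lambda>x. f k x - h x) \<in> Lp p M \<and> Lp_dist p M (f k) h \<le> e" if "k \<ge> N" for k
   using that by (intro key e) (meson le_trans less_imp_le)
  thus ?thesis by blast
 qed
 obtain N where "(\<lambda>x. f N x - h x) \<in> Lp p M" using ev[of 1] by auto
 from Lp_diff(1)[OF f[of N] this p0(2)] have hL: "h \<in> Lp p M" by simp
 have "(\<lambda>k. Lp_dist p M (f k) h) \<longlonglongrightarrow> 0"
 proof (rule LIMSEQ_I)
  fix e :: real assume e: "0 < e"
  obtain N where "\<forall>k\<ge>N. Lp_dist p M (f k) h \<le> e / 2" using ev[of "e / 2"] e by auto
  thus "\<exists>N. \<forall>k\<ge>N. norm (Lp_dist p M (f k) h - 0) < e"
  proof (intro exI[of _ N] allI impI)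
   fix k assume "N \<le> k" "\<forall>k\<ge>N. Lp_dist p M (f k) h \<le> e / 2"
   hence "Lp_dist p M (f k) h \<le> e / 2" by blast
   thus "norm (Lp_dist p M (f k) h - 0) < e" using e Lp_norm_nonneg[of p M "\<lambda>x. f k x - h x"] by simp
  qed
 qed
 with hL show ?thesis by blast
qed

text \<open>Bounded functions lie in every Lebesgue space here, so functions that are also square
  integrable are dense.\<close>

lemma Lp_truncation:
 fixes f :: "'a \<Rightarrow> 'b::{banach, second_countable_topology}"
 assumes f: "f \<in> Lp p M" and p: "0 < p"
 defines "t \<equiv> \<lambda>k x. if norm (f x) \<le> real k then f x else 0"
 shows "\<And>q k. 0 < q \<Longrightarrow> t k \<in> Lp q M" "(\<lambda>k. Lp_dist p M (t k) f) \<longlonglongrightarrow> 0"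
proof -
 have m: "t k \<in> borel_measurable M" for k unfolding t_def using Lp_meas[OF f] by measurable
 show "t k \<in> Lp q M" if "0 < q" for q k by (rule Lp_bounded[OF m _ that, of _ "real k"]) (auto simp: t_def)
 have "(\<lambda>k. LINT x|M. norm (t k x - f x) powr p) \<longlonglongrightarrow> (LINT x|M. 0)"
 proof (rule integral_dominated_convergence[OF _ _ Lp_int[OF f]])
  show "AE x in M. (\<lambda>k. norm (t k x - f x) powr p) \<longlonglongrightarrow> 0"
  proof (rule AE_I2)
   fix x
   obtain N where N: "norm (f x) \<le> real N" using real_arch_simple by blast
   have "\<forall>\<^sub>F k in sequentially. norm (t k x - f x) powr p = 0"
    using eventually_ge_at_top[of N] by eventually_elim (use N in \<open>auto simp: t_def\<close>)
   thus "(\<lambda>k. norm (t k x - f x) powr p) \<longlonglongrightarrow> 0" by (rule tendsto_eventually)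
  qed
  show "AE x in M. norm (norm (t k x - f x) powr p) \<le> norm (f x) powr p" for k by (rule AE_I2) (auto simp: t_def)
  show "(\<lambda>x. norm (t k x - f x) powr p) \<in> borel_measurable M" for k using m Lp_meas[OF f] by measurable
 qed simp
 hence "(\<lambda>k. Lp_dist p M (t k) f) \<longlonglongrightarrow> 0 powr (1 / p)"
  unfolding Lp_norm_def using p by (intro tendsto_powr' tendsto_const) auto
 thus "(\<lambda>k. Lp_dist p M (t k) f) \<longlonglongrightarrow> 0" by simp
qed

end

section \<open>Orthogonal series\<close>

lemma Lp_2_iff: "f \<in> Lp 2 M \<longleftrightarrow> f \<in> borel_measurable M \<and> integrable M (\<lambda>x. (norm (f x))^2)"
 by (simp add: Lp_def)

lemma Lp_norm_2_sq: "(Lp_norm 2 M f)^2 = (LINT x|M. (norm (f x))^2)"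
 using Lp_norm_powr[of 2 M f] Lp_norm_nonneg[of 2 M f] by simp

lemma borel_measurable_cnj [measurable (raw)]:
 "g \<in> borel_measurable M \<Longrightarrow> (\<lambda>x. cnj (g x)) \<in> borel_measurable M"
 by (rule borel_measurable_continuous_on[of cnj]) (intro continuous_intros)

lemma Lp_2_mult_integrable:
 fixes f g :: "'a \<Rightarrow> complex"
 assumes f: "f \<in> Lp 2 M" and g: "g \<in> Lp 2 M"
 shows "integrable M (\<lambda>x. f x * cnj (g x))"
  "norm (LINT x|M. f x * cnj (g x)) \<le> Lp_norm 2 M f * Lp_norm 2 M g"
proof -
 have fm: "f \<in> borel_measurable M" "g \<in> borel_measurable M" and
  fi: "integrable M (\<lambda>x. (norm (f x))^2)" "integrable M (\<lambda>x. (norm (g x))^2)"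
  using f g by (auto simp: Lp_2_iff)
 have am: "norm (f x * cnj (g x)) \<le> s / 2 * (norm (f x))^2 + 1 / (2 * s) * (norm (g x))^2" if s: "0 < s" for s x
 proof -
  have "0 \<le> (s * norm (f x) - norm (g x))^2 / (2 * s)" using s by simp
  also have "\<dots> = s / 2 * (norm (f x))^2 + 1 / (2 * s) * (norm (g x))^2 - norm (f x) * norm (g x)"
   using s by (simp add: field_simps power2_eq_square)
  finally show ?thesis by (simp add: norm_mult)
 qed
 have ib: "integrable M (\<lambda>x. s / 2 * (norm (f x))^2 + 1 / (2 * s) * (norm (g x))^2)" for s
  using fi by (intro Bochner_Integration.integrable_add integrable_mult_right)
 have m: "(\<lambda>x. f x * cnj (g x)) \<in> borel_measurable M" using fm by measurable
 show i: "integrable M (\<lambda>x. f x * cnj (g x))"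
 proof (rule Bochner_Integration.integrable_bound[OF ib[of 1] m], rule AE_I2)
  fix x
  show "norm (f x * cnj (g x)) \<le> norm (1 / 2 * (norm (f x))^2 + 1 / (2 * 1) * (norm (g x))^2)"
   using am[of 1 x] by simp
 qed
 define X where "X = Lp_norm 2 M f"
 define Y where "Y = Lp_norm 2 M g"
 have XY: "0 \<le> X" "0 \<le> Y" by (auto simp: X_def Y_def Lp_norm_nonneg)
 have main: "norm (LINT x|M. f x * cnj (g x)) \<le> s / 2 * X^2 + 1 / (2 * s) * Y^2" if s: "0 < s" for s
 proof -
  have "norm (LINT x|M. f x * cnj (g x)) \<le> (LINT x|M. norm (f x * cnj (g x)))" by (rule integral_norm_bound)
  also have "\<dots> \<le> (LINT x|M. s / 2 * (norm (f x))^2 + 1 / (2 * s) * (norm (g x))^2)"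
   using i by (intro integral_mono ib am[OF s]) simp
  also have "\<dots> = s / 2 * X^2 + 1 / (2 * s) * Y^2" unfolding X_def Y_def Lp_norm_2_sq
   using fi by (subst Bochner_Integration.integral_add) (auto intro: integrable_mult_right)
  finally show ?thesis .
 qed
 have "norm (LINT x|M. f x * cnj (g x)) \<le> (X + e) * (Y + e)" if e: "0 < e" for e
 proof -
  \<comment> \<open>The weight s = W / U is the optimal one for norms \<open>U\<close> and
    \<open>W\<close>; both are taken slightly larger than the norms so that it is well defined and
    positive.\<close>
  define U where "U = X + e"
  define W where "W = Y + e"
  have UW: "0 < U" "0 < W" "X \<le> U" "Y \<le> W" using XY e by (auto simp: U_def W_def)
  have "norm (LINT x|M. f x * cnj (g x)) \<le> W / U / 2 * X^2 + 1 / (2 * (W / U)) * Y^2"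
   by (rule main) (use UW in simp)
  also have "\<dots> \<le> W / U / 2 * U^2 + 1 / (2 * (W / U)) * W^2"
   using UW XY by (intro add_mono mult_left_mono power_mono) auto
  also have "\<dots> = U * W" using UW by (simp add: power2_eq_square)
  finally show ?thesis by (simp add: U_def W_def)
 qed
 moreover have "((\<lambda>e. (X + e) * (Y + e)) \<longlongrightarrow> (X + 0) * (Y + 0)) (at_right 0)" by (intro tendsto_intros)
 ultimately have "norm (LINT x|M. f x * cnj (g x)) \<le> (X + 0) * (Y + 0)"
  by (intro tendsto_lowerbound[where F = "at_right 0"]) (auto simp: eventually_at_right[of 0 1] intro!: exI[of _ 1])
 thus "norm (LINT x|M. f x * cnj (g x)) \<le> Lp_norm 2 M f * Lp_norm 2 M g" by (simp add: X_def Y_def)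
qed

lemma integral_norm_add_sq:
 fixes f g :: "'a \<Rightarrow> complex"
 assumes f: "f \<in> Lp 2 M" and g: "g \<in> Lp 2 M" and o: "(LINT x|M. f x * cnj (g x)) = 0"
 shows "(LINT x|M. (norm (f x + g x))^2) = (LINT x|M. (norm (f x))^2) + (LINT x|M. (norm (g x))^2)"
proof -
 have eq: "(norm (f x + g x))^2 = ((norm (f x))^2 + (norm (g x))^2) + 2 * Re (f x * cnj (g x))" for x
  unfolding cmod_power2 by (simp add: power2_eq_square algebra_simps)
 have fi: "integrable M (\<lambda>x. (norm (f x))^2)" "integrable M (\<lambda>x. (norm (g x))^2)"
  using f g by (auto simp: Lp_2_iff)
 note i = Lp_2_mult_integrable(1)[OF f g]
 have "(LINT x|M. Re (f x * cnj (g x))) = 0" using o i by (simp del: times_complex.sel)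
 moreover have "integrable M (\<lambda>x. Re (f x * cnj (g x)))" using i by (rule integrable_Re)
 ultimately show ?thesis unfolding eq
  using fi by (subst Bochner_Integration.integral_add; (intro Bochner_Integration.integrable_add integrable_mult_right)?)
   (auto simp del: times_complex.sel)
qed

lemma has_L2_sum_unique:
 assumes "has_L2_sum M u A g" "has_L2_sum M u A h"
 shows "AE x in M. g x = h x"
proof -
 have L: "g \<in> Lp 2 M" "h \<in> Lp 2 M" using assms by (auto simp: has_L2_sum_def)
 have "((\<lambda>F. Lp_norm 2 M (\<lambda>x. (\<Sum>n\<in>F. u n x) - g x) + Lp_norm 2 M (\<lambda>x. (\<Sum>n\<in>F. u n x) - h x)) \<longlongrightarrow> 0 + 0) (finite_subsets_at_top A)"
  using assms by (intro tendsto_add) (auto simp: has_L2_sum_def)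
 moreover have "\<forall>\<^sub>F F in finite_subsets_at_top A. Lp_dist 2 M g h
  \<le> Lp_norm 2 M (\<lambda>x. (\<Sum>n\<in>F. u n x) - g x) + Lp_norm 2 M (\<lambda>x. (\<Sum>n\<in>F. u n x) - h x)"
 proof (rule eventually_finite_subsets_at_top_weakI)
  fix F assume F: "finite F" "F \<subseteq> A"
  have S: "(\<lambda>x. \<Sum>n\<in>F. u n x) \<in> Lp 2 M" using assms(1) F by (intro Lp_sum) (auto simp: has_L2_sum_def)
  show "Lp_dist 2 M g h \<le> Lp_norm 2 M (\<lambda>x. (\<Sum>n\<in>F. u n x) - g x) + Lp_norm 2 M (\<lambda>x. (\<Sum>n\<in>F. u n x) - h x)"
   using Lp_norm_triangle[OF L(1) S L(2)] Lp_norm_diff_commute[of 2 M g "\<lambda>x. \<Sum>n\<in>F. u n x"] by simp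
 qed
 ultimately have "Lp_dist 2 M g h \<le> 0" using tendsto_lowerbound[of _ 0 "finite_subsets_at_top A"] by fastforce
 hence "Lp_dist 2 M g h = 0" using Lp_norm_nonneg[of 2 M "\<lambda>x. g x - h x"] by linarith
 hence "(LINT x|M. (norm (g x - h x))^2) = 0" by (simp flip: Lp_norm_2_sq)
 moreover have "integrable M (\<lambda>x. (norm (g x - h x))^2)" using Lp_diff(1)[OF L] by (simp add: Lp_2_iff)
 ultimately have "AE x in M. (norm (g x - h x))^2 = 0" by (subst (asm) integral_nonneg_eq_0_iff_AE) auto
 thus ?thesis by eventually_elim simp
qed

text \<open>\<open>N n\<close> is the squared norm and may be 0: the partial derivative of a product
  vanishes if the factor to be differentiated is the constant mode. \<open>E_zero\<close> says that
  such a member is zero at every point; its coefficient is a quotient by 0 and has the value 0,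
  which suits \<open>coef_N\<close>.\<close>

locale orth_system = prob_space M for M :: "'a measure" +
 fixes E :: "'n \<Rightarrow> 'a \<Rightarrow> real" and I :: "'n set" and N :: "'n \<Rightarrow> real"
 assumes E_meas: "\<And>n. n \<in> I \<Longrightarrow> E n \<in> borel_measurable M"
  and E_bdd: "\<And>n. n \<in> I \<Longrightarrow> \<exists>C. \<forall>x\<in>space M. \<bar>E n x\<bar> \<le> C"
  and E_orth: "\<And>n m. n \<in> I \<Longrightarrow> m \<in> I \<Longrightarrow> (LINT x|M. E n x * E m x) = (if n = m then N n else 0)"
  and E_zero: "\<And>n x. n \<in> I \<Longrightarrow> N n = 0 \<Longrightarrow> x \<in> space M \<Longrightarrow> E n x = 0"
  and E_total: "\<And>h. h \<in> borel_measurable M \<Longrightarrow> integrable M (\<lambda>x. (h x)^2) \<Longrightarrow> L2_approx M E I h"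
begin

definition csum :: "'n set \<Rightarrow> ('n \<Rightarrow> complex) \<Rightarrow> 'a \<Rightarrow> complex" where
 "csum F a x = (\<Sum>n\<in>F. a n * complex_of_real (E n x))"

definition coef :: "('a \<Rightarrow> complex) \<Rightarrow> 'n \<Rightarrow> complex" where
 "coef f n = (LINT x|M. f x * complex_of_real (E n x)) / complex_of_real (N n)"

lemma N_nonneg: "n \<in> I \<Longrightarrow> 0 \<le> N n"
 using E_orth[of n n] Bochner_Integration.integral_nonneg[of M "\<lambda>x. E n x * E n x"] by simp

lemma E_Lp: assumes "n \<in> I" "0 < r" shows "(\<lambda>x. c * complex_of_real (E n x)) \<in> Lp r M"
proof -
 obtain C where C: "\<And>x. x \<in> space M \<Longrightarrow> \<bar>E n x\<bar> \<le> C" using E_bdd[OF assms(1)] by blast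
 show ?thesis
 proof (rule Lp_bounded[OF _ _ assms(2)])
  show "(\<lambda>x. c * complex_of_real (E n x)) \<in> borel_measurable M" using E_meas[OF assms(1)] by measurable
  show "norm (c * complex_of_real (E n x)) \<le> norm c * C" if "x \<in> space M" for x
   using C[OF that] by (simp add: norm_mult mult_left_mono)
 qed
qed

lemma csum_Lp: assumes "finite F" "F \<subseteq> I" "1 \<le> r" shows "csum F a \<in> Lp r M"
 unfolding csum_def[abs_def] using assms by (intro Lp_sum E_Lp) auto

lemma integrable_mult_E:
 assumes "f \<in> Lp 2 M" "n \<in> I" shows "integrable M (\<lambda>x. f x * complex_of_real (E n x))"
 using Lp_2_mult_integrable(1)[OF assms(1) E_Lp[OF assms(2), of 2 1]] by simp

lemma coef_N:
 assumes "n \<in> I" shows "coef f n * complex_of_real (N n) = (LINT x|M. f x * complex_of_real (E n x))"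
proof (cases "N n = 0")
 case True
 have "(LINT x|M. f x * complex_of_real (E n x)) = (LINT x|M. 0)"
  by (rule Bochner_Integration.integral_cong) (auto simp: E_zero[OF assms True])
 thus ?thesis using True by simp
qed (simp add: coef_def)

lemma integral_csum_right:
 assumes f: "f \<in> Lp 2 M" and F: "finite F" "F \<subseteq> I"
 shows "(LINT x|M. f x * cnj (csum F a x)) = (\<Sum>n\<in>F. cnj (a n) * (LINT x|M. f x * complex_of_real (E n x)))"
proof -
 have "(LINT x|M. f x * cnj (csum F a x)) = (LINT x|M. (\<Sum>n\<in>F. cnj (a n) * (f x * complex_of_real (E n x))))"
  by (simp add: csum_def sum_distrib_left mult_ac)
 also have "\<dots> = (\<Sum>n\<in>F. (LINT x|M. cnj (a n) * (f x * complex_of_real (E n x))))"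
  using integrable_mult_E[OF f] F by (intro Bochner_Integration.integral_sum integrable_mult_right) auto
 finally show ?thesis by simp
qed

lemma integral_csum_E:
 assumes F: "finite F" "F \<subseteq> I" and n: "n \<in> I"
 shows "(LINT x|M. csum F a x * complex_of_real (E n x)) = (if n \<in> F then a n * complex_of_real (N n) else 0)"
proof -
 have "(LINT x|M. csum F a x * complex_of_real (E n x)) = (LINT x|M. (\<Sum>m\<in>F. a m * complex_of_real (E m x * E n x)))"
  by (simp add: csum_def sum_distrib_right sum_distrib_left mult_ac)
 also have "\<dots> = (\<Sum>m\<in>F. (LINT x|M. a m * complex_of_real (E m x * E n x)))"
 proof (rule Bochner_Integration.integral_sum)
  fix m assume "m \<in> F"
  thus "integrable M (\<lambda>x. a m * complex_of_real (E m x * E n x))"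
   using integrable_mult_E[OF E_Lp[of m 2 "a m"] n] F by (auto simp: mult_ac)
 qed
 also have "\<dots> = (\<Sum>m\<in>F. if m = n then a n * complex_of_real (N n) else 0)"
  using F n E_orth by (intro sum.cong refl) (auto simp: subset_iff simp del: of_real_mult)
 finally show ?thesis using F by simp
qed

lemma integral_csum_csum:
 assumes F: "finite F" "F \<subseteq> I"
 shows "(LINT x|M. csum F a x * cnj (csum F b x)) = (\<Sum>n\<in>F. a n * cnj (b n) * complex_of_real (N n))"
proof -
 have "(LINT x|M. csum F a x * complex_of_real (E n x)) = a n * complex_of_real (N n)" if "n \<in> F" for n
  using integral_csum_E[OF F, of n a] that F by auto
 thus ?thesis unfolding integral_csum_right[OF csum_Lp[OF F, of 2, simplified] F] by (intro sum.cong refl) simp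
qed

lemma norm_csum_sq:
 assumes F: "finite F" "F \<subseteq> I"
 shows "(LINT x|M. (norm (csum F a x))^2) = (\<Sum>n\<in>F. (norm (a n))^2 * N n)"
proof -
 have "complex_of_real (LINT x|M. (norm (csum F a x))^2) = (LINT x|M. csum F a x * cnj (csum F a x))"
  unfolding integral_complex_of_real[symmetric] by (rule arg_cong[of _ _ "integral\<^sup>L M"]) (simp only: fun_eq_iff complex_norm_square simp_thms)
 also have "\<dots> = complex_of_real (\<Sum>n\<in>F. (norm (a n))^2 * N n)"
  by (subst integral_csum_csum[OF F]) (simp only: complex_norm_square[symmetric] of_real_mult[symmetric] of_real_sum[symmetric])
 finally show ?thesis by (simp only: of_real_eq_iff)
qed

lemma residual_orth:
 assumes f: "f \<in> Lp 2 M" and F: "finite F" "F \<subseteq> I" and n: "n \<in> F"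
 shows "(LINT x|M. (f x - csum F (coef f) x) * complex_of_real (E n x)) = 0"
proof -
 have nI: "n \<in> I" using F n by auto
 have "(LINT x|M. (f x - csum F (coef f) x) * complex_of_real (E n x))
  = (LINT x|M. f x * complex_of_real (E n x)) - (LINT x|M. csum F (coef f) x * complex_of_real (E n x))"
  unfolding left_diff_distrib
  using integrable_mult_E[OF f nI] integrable_mult_E[OF csum_Lp[OF F] nI] by (intro Bochner_Integration.integral_diff) auto
 thus ?thesis using coef_N[OF nI, of f] n by (simp add: integral_csum_E[OF F nI])
qed

text \<open>One identity serves twice: with \<open>b\<close> the coefficients it contains Bessel's
  inequality, with \<open>b\<close> a difference of coefficients the best approximation
  property.\<close>

lemma pythagoras:
 assumes f: "f \<in> Lp 2 M" and F: "finite F" "F \<subseteq> I" and G: "G \<subseteq> F"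
 shows "(LINT x|M. (norm ((f x - csum F (coef f) x) + csum G b x))^2)
  = (LINT x|M. (norm (f x - csum F (coef f) x))^2) + (\<Sum>n\<in>G. (norm (b n))^2 * N n)"
proof -
 have G': "finite G" "G \<subseteq> I" using F G finite_subset by auto
 have r: "(\<lambda>x. f x - csum F (coef f) x) \<in> Lp 2 M" using f csum_Lp[OF F] by (intro Lp_diff) auto
 have "(LINT x|M. (f x - csum F (coef f) x) * cnj (csum G b x)) = 0"
  unfolding integral_csum_right[OF r G'] using residual_orth[OF f F] G by (intro sum.neutral) auto
 from integral_norm_add_sq[OF r csum_Lp[OF G'] this] show ?thesis by (simp add: norm_csum_sq[OF G'])
qed

lemma bessel:
 assumes f: "f \<in> Lp 2 M" and F: "finite F" "F \<subseteq> I"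
 shows "(\<Sum>n\<in>F. (norm (coef f n))^2 * N n) \<le> (LINT x|M. (norm (f x))^2)"
 using pythagoras[OF f F order_refl, of "coef f"]
  Bochner_Integration.integral_nonneg[of M "\<lambda>x. (norm (f x - csum F (coef f) x))^2"] by simp

lemma csum_diff: "finite F \<Longrightarrow> csum F a x - csum F b x = csum F (\<lambda>n. a n - b n) x"
 by (simp add: csum_def sum_subtractf left_diff_distrib)

lemma csum_Diff: "finite G \<Longrightarrow> F \<subseteq> G \<Longrightarrow> csum G a x - csum F a x = csum (G - F) a x"
 by (simp add: csum_def sum_diff)

lemma best_approx:
 assumes f: "f \<in> Lp 2 M" and G: "finite G" "G \<subseteq> I" and F: "F \<subseteq> G"
 shows "(LINT x|M. (norm (f x - csum G (coef f) x))^2) \<le> (LINT x|M. (norm (f x - csum F b x))^2)"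
proof -
 define c where "c = (\<lambda>n. coef f n - (if n \<in> F then b n else 0))"
 have "csum G (\<lambda>n. if n \<in> F then b n else 0) x = csum F b x" for x
  unfolding csum_def using G F by (subst sum.mono_neutral_right[of G F]) (auto intro!: sum.cong)
 hence "csum G c x = csum G (coef f) x - csum F b x" for x
  using csum_diff[OF G(1), of "coef f" x "\<lambda>n. if n \<in> F then b n else 0"] by (simp add: c_def)
 hence eq: "f x - csum F b x = (f x - csum G (coef f) x) + csum G c x" for x by simp
 have "0 \<le> (\<Sum>n\<in>G. (norm (c n))^2 * N n)" using G N_nonneg by (intro sum_nonneg mult_nonneg_nonneg) auto
 thus ?thesis unfolding eq pythagoras[OF f G order_refl] by simp
qed

lemma Re_Im_L2:
 assumes "f \<in> Lp 2 M" shows "integrable M (\<lambda>x. (Re (f x))^2)" "integrable M (\<lambda>x. (Im (f x))^2)"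
proof -
 have i: "integrable M (\<lambda>x. (norm (f x))^2)" and m: "f \<in> borel_measurable M" using assms by (auto simp: Lp_2_iff)
 show "integrable M (\<lambda>x. (Re (f x))^2)" "integrable M (\<lambda>x. (Im (f x))^2)"
  by (rule Bochner_Integration.integrable_bound[OF i]; use m in \<open>auto simp: cmod_power2\<close>)+
qed

text \<open>Totality is given for real functions. Real and imaginary part are approximated
  separately and merged into one complex combination \<open>b\<close>; by \<open>best_approx\<close>
  every partial sum over a larger set is at least as good.\<close>

theorem fourier_series:
 assumes f: "f \<in> Lp 2 M"
 shows "has_L2_sum M (\<lambda>n x. coef f n * complex_of_real (E n x)) I f" unfolding has_L2_sum_def
proof (intro conjI ballI)
 show "f \<in> Lp 2 M" by fact
 show "(\<lambda>x. coef f n * complex_of_real (E n x)) \<in> Lp 2 M" if "n \<in> I" for n using that by (intro E_Lp) auto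
 show "((\<lambda>F. Lp_norm 2 M (\<lambda>x. (\<Sum>n\<in>F. coef f n * complex_of_real (E n x)) - f x)) \<longlongrightarrow> 0) (finite_subsets_at_top I)"
 proof (rule tendstoI)
  fix e :: real assume e: "0 < e"
  have m: "f \<in> borel_measurable M" using f by (simp add: Lp_2_iff)
  have "0 < e\<^sup>2 / 2" using e by simp
  then obtain F1 a1 where 1: "finite F1" "F1 \<subseteq> I" "(LINT x|M. (Re (f x) - (\<Sum>n\<in>F1. a1 n * E n x))^2) < e\<^sup>2 / 2"
   using E_total[OF measurable_compose[OF m borel_measurable_Re] Re_Im_L2(1)[OF f]] unfolding L2_approx_def by blast
  have "0 < e\<^sup>2 / 2" using e by simp
  then obtain F2 a2 where 2: "finite F2" "F2 \<subseteq> I" "(LINT x|M. (Im (f x) - (\<Sum>n\<in>F2. a2 n * E n x))^2) < e\<^sup>2 / 2"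
   using E_total[OF measurable_compose[OF m borel_measurable_Im] Re_Im_L2(2)[OF f]] unfolding L2_approx_def by blast
  define F where "F = F1 \<union> F2"
  have F: "finite F" "F \<subseteq> I" using 1 2 by (auto simp: F_def)
  define b where "b = (\<lambda>n. Complex (if n \<in> F1 then a1 n else 0) (if n \<in> F2 then a2 n else 0))"
  have Reb: "Re (csum F b x) = (\<Sum>n\<in>F1. a1 n * E n x)" for x
  proof -
   have "Re (csum F b x) = (\<Sum>n\<in>F. if n \<in> F1 then a1 n * E n x else 0)"
    unfolding csum_def b_def Re_sum by (rule sum.cong) simp_all
   also have "\<dots> = (\<Sum>n\<in>F \<inter> F1. a1 n * E n x)" using F(1) by (simp add: sum.inter_restrict)
   also have "F \<inter> F1 = F1" by (auto simp: F_def)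
   finally show ?thesis .
  qed
  have Imb: "Im (csum F b x) = (\<Sum>n\<in>F2. a2 n * E n x)" for x
  proof -
   have "Im (csum F b x) = (\<Sum>n\<in>F. if n \<in> F2 then a2 n * E n x else 0)"
    unfolding csum_def b_def Im_sum by (rule sum.cong) simp_all
   also have "\<dots> = (\<Sum>n\<in>F \<inter> F2. a2 n * E n x)" using F(1) by (simp add: sum.inter_restrict)
   also have "F \<inter> F2 = F2" by (auto simp: F_def)
   finally show ?thesis .
  qed
  have d: "(\<lambda>x. f x - csum F b x) \<in> Lp 2 M" using f csum_Lp[OF F] by (intro Lp_diff) auto
  have "(LINT x|M. (norm (f x - csum F b x))^2)
   = (LINT x|M. (Re (f x) - (\<Sum>n\<in>F1. a1 n * E n x))^2 + (Im (f x) - (\<Sum>n\<in>F2. a2 n * E n x))^2)"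
   by (simp add: cmod_power2 Reb Imb)
  also have "\<dots> = (LINT x|M. (Re (f x) - (\<Sum>n\<in>F1. a1 n * E n x))^2) + (LINT x|M. (Im (f x) - (\<Sum>n\<in>F2. a2 n * E n x))^2)"
   using Re_Im_L2[OF d] by (intro Bochner_Integration.integral_add) (simp_all add: Reb Imb)
  also have "\<dots> < e\<^sup>2" using 1(3) 2(3) by simp
  finally have small: "(LINT x|M. (norm (f x - csum F b x))^2) < e\<^sup>2" .
  show "\<forall>\<^sub>F G in finite_subsets_at_top I. dist (Lp_norm 2 M (\<lambda>x. (\<Sum>n\<in>G. coef f n * complex_of_real (E n x)) - f x)) 0 < e"
   unfolding eventually_finite_subsets_at_top
  proof (intro exI[of _ F] conjI F allI impI)
   fix G assume G: "finite G \<and> F \<subseteq> G \<and> G \<subseteq> I"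
   have "(Lp_dist 2 M (csum G (coef f)) f)^2 = (LINT x|M. (norm (f x - csum G (coef f) x))^2)"
    unfolding Lp_norm_2_sq by (simp add: norm_minus_commute)
   also have "\<dots> \<le> (LINT x|M. (norm (f x - csum F b x))^2)" using G by (intro best_approx f) auto
   also note small
   finally have "Lp_dist 2 M (csum G (coef f)) f < e" by (rule power_less_imp_less_base) (use e in simp)
   thus "dist (Lp_norm 2 M (\<lambda>x. (\<Sum>n\<in>G. coef f n * complex_of_real (E n x)) - f x)) 0 < e"
    by (simp add: csum_def Lp_norm_nonneg)
  qed
 qed
qed

text \<open>Convergence is along finite sets, completeness concerns sequences. So finite sets are
  chosen whose sums come within 1 / (k + 1) of the supremum, and they are made increasing by unions.
  Any larger set adds less than 1 / (k + 1), which gives the Cauchy property and afterwards the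
  unconditional convergence to the same limit.\<close>

theorem riesz_fischer:
 assumes b: "\<And>F. finite F \<Longrightarrow> F \<subseteq> I \<Longrightarrow> (\<Sum>n\<in>F. (norm (b n))^2 * N n) \<le> C"
 shows "\<exists>g. has_L2_sum M (\<lambda>n x. b n * complex_of_real (E n x)) I g"
proof -
 define s where "s = (\<lambda>F. \<Sum>n\<in>F. (norm (b n))^2 * N n)"
 define FF where "FF = {F. finite F \<and> F \<subseteq> I}"
 define S where "S = (SUP F\<in>FF. s F)"
 have bdd: "bdd_above (s ` FF)" using b by (auto simp: s_def FF_def intro!: bdd_aboveI[of _ C])
 have ne: "s ` FF \<noteq> {}" by (auto simp: FF_def)
 have sS: "s F \<le> S" if "F \<in> FF" for F unfolding S_def by (rule cSUP_upper[OF that bdd])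
 have "\<exists>F\<in>FF. S - 1 / real (Suc k) < s F" for k
  using less_cSUP_iff[OF _ bdd, of "S - 1 / real (Suc k)"] ne unfolding S_def by auto
 then obtain F' where F': "\<And>k. F' k \<in> FF" "\<And>k. S - 1 / real (Suc k) < s (F' k)" by metis
 define F where "F = (\<lambda>k. \<Union>j\<le>k. F' j)"
 have F: "F k \<in> FF" for k using F'(1) by (auto simp: F_def FF_def)
 have smono: "s A \<le> s B" if "A \<subseteq> B" "B \<in> FF" for A B
  unfolding s_def using that N_nonneg by (intro sum_mono2) (auto simp: FF_def)
 have tail: "s (G - F k) < 1 / real (Suc k)" if G: "G \<in> FF" "F k \<subseteq> G" for G k
 proof -
  have "s G = s (G - F k) + s (F k)" unfolding s_def using G by (intro sum.subset_diff) (auto simp: FF_def)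
  moreover have "s (F' k) \<le> s (F k)" by (rule smono[OF _ F]) (auto simp: F_def)
  ultimately show ?thesis using sS[OF G(1)] F'(2)[of k] by linarith
 qed
 have near: "Lp_dist 2 M (csum G b) (csum (F k) b) < sqrt (1 / real (Suc k))" if G: "G \<in> FF" "F k \<subseteq> G" for G k
 proof -
  have "(Lp_dist 2 M (csum G b) (csum (F k) b))^2 = s (G - F k)"
   unfolding Lp_norm_2_sq using G norm_csum_sq[of "G - F k" b] by (auto simp: csum_Diff FF_def s_def)
  thus ?thesis using tail[OF G] by (metis real_less_rsqrt)
 qed
 have Fmono: "F j \<subseteq> F k" if "j \<le> k" for j k unfolding F_def by (rule UN_mono) (use that in auto)
 have cl: "csum G b \<in> Lp 2 M" if "G \<in> FF" for G using that by (intro csum_Lp) (auto simp: FF_def)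
 have lim0: "(\<lambda>k. sqrt (1 / real (Suc k))) \<longlonglongrightarrow> 0"
  using tendsto_real_sqrt[OF LIMSEQ_inverse_real_of_nat] by (simp add: inverse_eq_divide)
 obtain g where g: "g \<in> Lp 2 M" "(\<lambda>k. Lp_dist 2 M (csum (F k) b) g) \<longlonglongrightarrow> 0"
 proof -
  have "\<exists>h\<in>Lp 2 M. (\<lambda>k. Lp_dist 2 M (csum (F k) b) h) \<longlonglongrightarrow> 0"
  proof (rule Lp_complete)
   show "csum (F k) b \<in> Lp 2 M" for k by (rule cl[OF F])
   fix e :: real assume e: "0 < e"
   obtain n where n: "sqrt (1 / real (Suc n)) < e"
    using order_tendstoD(2)[OF lim0 e] by (auto simp: eventually_sequentially)
   have 1: "Lp_dist 2 M (csum (F i) b) (csum (F j) b) < e" if "n \<le> j" "j \<le> i" for i j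
   proof -
    have "Lp_dist 2 M (csum (F i) b) (csum (F j) b) < sqrt (1 / real (Suc j))" by (rule near[OF F Fmono[OF that(2)]])
    also have "\<dots> \<le> sqrt (1 / real (Suc n))" using that by (simp add: field_simps)
    finally show ?thesis using n by simp
   qed
   have "Lp_dist 2 M (csum (F i) b) (csum (F j) b) < e" if "n \<le> i" "n \<le> j" for i j
    using 1[of j i] 1[of i j] that Lp_norm_diff_commute[of 2 M "csum (F i) b" "csum (F j) b"] by (cases "j \<le> i") auto
   thus "\<exists>N. \<forall>i\<ge>N. \<forall>j\<ge>N. Lp_dist 2 M (csum (F i) b) (csum (F j) b) < e" by blast
  qed simp
  thus ?thesis using that by blast
 qed
 have "has_L2_sum M (\<lambda>n x. b n * complex_of_real (E n x)) I g" unfolding has_L2_sum_def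
 proof (intro conjI ballI g(1))
  show "(\<lambda>x. b n * complex_of_real (E n x)) \<in> Lp 2 M" if "n \<in> I" for n using that by (intro E_Lp) auto
  show "((\<lambda>F. Lp_norm 2 M (\<lambda>x. (\<Sum>n\<in>F. b n * complex_of_real (E n x)) - g x)) \<longlongrightarrow> 0) (finite_subsets_at_top I)"
  proof (rule tendstoI)
   fix e :: real assume e: "0 < e"
   have e2: "0 < e / 2" using e by simp
   obtain n where n: "sqrt (1 / real (Suc n)) < e / 2" "Lp_dist 2 M (csum (F n) b) g < e / 2"
    using eventually_conj[OF order_tendstoD(2)[OF lim0 e2] order_tendstoD(2)[OF g(2) e2]] by (auto simp: eventually_sequentially)
   show "\<forall>\<^sub>F G in finite_subsets_at_top I. dist (Lp_norm 2 M (\<lambda>x. (\<Sum>n\<in>G. b n * complex_of_real (E n x)) - g x)) 0 < e"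
    unfolding eventually_finite_subsets_at_top
   proof (intro exI[of _ "F n"] conjI allI impI)
    show "finite (F n)" "F n \<subseteq> I" using F[of n] by (auto simp: FF_def)
    fix G assume "finite G \<and> F n \<subseteq> G \<and> G \<subseteq> I"
    hence G: "G \<in> FF" "F n \<subseteq> G" by (auto simp: FF_def)
    have "Lp_dist 2 M (csum G b) g < e"
     using Lp_norm_triangle[OF cl[OF G(1)] cl[OF F] g(1), of n] near[OF G] n by simp
    thus "dist (Lp_norm 2 M (\<lambda>x. (\<Sum>n\<in>G. b n * complex_of_real (E n x)) - g x)) 0 < e"
     by (simp add: csum_def Lp_norm_nonneg)
   qed
  qed
 qed
 thus ?thesis by blast
qed

end

section \<open>The embedding for square integrable functions\<close>

lemma Lp_2_inner_tendsto:
 fixes a b :: "nat \<Rightarrow> 'a \<Rightarrow> complex"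
 assumes a: "\<And>k. a k \<in> Lp 2 M" "a0 \<in> Lp 2 M" "(\<lambda>k. Lp_dist 2 M (a k) a0) \<longlonglongrightarrow> 0"
  and b: "\<And>k. b k \<in> Lp 2 M" "b0 \<in> Lp 2 M" "(\<lambda>k. Lp_dist 2 M (b k) b0) \<longlonglongrightarrow> 0"
 shows "(\<lambda>k. LINT x|M. a k x * cnj (b k x)) \<longlonglongrightarrow> (LINT x|M. a0 x * cnj (b0 x))"
proof -
 have da: "(\<lambda>x. a k x - a0 x) \<in> Lp 2 M" and db: "(\<lambda>x. b k x - b0 x) \<in> Lp 2 M" for k
  using Lp_diff(1)[OF a(1)[of k] a(2)] Lp_diff(1)[OF b(1)[of k] b(2)] by simp_all
 have bb: "Lp_norm 2 M (b k) \<le> Lp_dist 2 M (b k) b0 + Lp_norm 2 M b0" for k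
  using Lp_add(2)[OF db[of k] b(2)] by simp
 have le: "norm ((LINT x|M. a k x * cnj (b k x)) - (LINT x|M. a0 x * cnj (b0 x)))
  \<le> Lp_dist 2 M (a k) a0 * (Lp_dist 2 M (b k) b0 + Lp_norm 2 M b0)
   + Lp_norm 2 M a0 * Lp_dist 2 M (b k) b0" for k
 proof -
  have eq: "a k x * cnj (b k x) - a0 x * cnj (b0 x) = (a k x - a0 x) * cnj (b k x) + a0 x * cnj (b k x - b0 x)" for x
   by (simp add: algebra_simps)
  note i1 = Lp_2_mult_integrable[OF da[of k] b(1)[of k]] and i2 = Lp_2_mult_integrable[OF a(2) db[of k]]
  have "(LINT x|M. a k x * cnj (b k x)) - (LINT x|M. a0 x * cnj (b0 x)) = (LINT x|M. a k x * cnj (b k x) - a0 x * cnj (b0 x))"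
   by (rule Bochner_Integration.integral_diff[OF Lp_2_mult_integrable(1)[OF a(1) b(1)] Lp_2_mult_integrable(1)[OF a(2) b(2)], symmetric])
  also have "\<dots> = (LINT x|M. (a k x - a0 x) * cnj (b k x)) + (LINT x|M. a0 x * cnj (b k x - b0 x))"
   unfolding eq by (rule Bochner_Integration.integral_add[OF i1(1) i2(1)])
  also have "norm \<dots> \<le> Lp_dist 2 M (a k) a0 * Lp_norm 2 M (b k) + Lp_norm 2 M a0 * Lp_dist 2 M (b k) b0"
   by (rule norm_triangle_le[OF add_mono[OF i1(2) i2(2)]])
  also have "\<dots> \<le> Lp_dist 2 M (a k) a0 * (Lp_dist 2 M (b k) b0 + Lp_norm 2 M b0)
   + Lp_norm 2 M a0 * Lp_dist 2 M (b k) b0" by (rule add_right_mono[OF mult_left_mono[OF bb Lp_norm_nonneg]])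
  finally show ?thesis .
 qed
 have "(\<lambda>k. Lp_dist 2 M (a k) a0 * (Lp_dist 2 M (b k) b0 + Lp_norm 2 M b0)
   + Lp_norm 2 M a0 * Lp_dist 2 M (b k) b0) \<longlonglongrightarrow> 0 * (0 + Lp_norm 2 M b0) + Lp_norm 2 M a0 * 0"
  by (rule tendsto_add[OF tendsto_mult[OF a(3) tendsto_add[OF b(3) tendsto_const]] tendsto_mult[OF tendsto_const b(3)]])
 hence "(\<lambda>k. Lp_dist 2 M (a k) a0 * (Lp_dist 2 M (b k) b0 + Lp_norm 2 M b0)
   + Lp_norm 2 M a0 * Lp_dist 2 M (b k) b0) \<longlonglongrightarrow> 0" by (simp only: mult_zero_left mult_zero_right add_0)
 hence "(\<lambda>k. (LINT x|M. a k x * cnj (b k x)) - (LINT x|M. a0 x * cnj (b0 x))) \<longlonglongrightarrow> 0"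
  by (rule Lim_null_comparison[OF always_eventually[OF allI[OF le]]])
 thus ?thesis by (rule LIM_zero_cancel)
qed

lemma L2_sum_has_L2_sum: "\<exists>g. has_L2_sum M u A g \<Longrightarrow> has_L2_sum M u A (L2_sum M u A)"
 unfolding L2_sum_def by (rule someI_ex[of "has_L2_sum M u A"])

text \<open>Fatou's lemma for the differences S k - b k. The majorants may vary with k as long as
  their integrals converge, and then lower bounds for the integrals of b k pass to the
  limit.\<close>

lemma (in prob_space) fatou_upper:
 fixes b S :: "nat \<Rightarrow> 'a \<Rightarrow> real"
 assumes i: "\<And>k. integrable M (b k)" "\<And>k. integrable M (S k)" "integrable M b0" "integrable M S0"
  and le: "\<And>k x. x \<in> space M \<Longrightarrow> b k x \<le> S k x" "\<And>x. x \<in> space M \<Longrightarrow> b0 x \<le> S0 x"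
  and ae: "AE x in M. (\<lambda>k. b k x) \<longlonglongrightarrow> b0 x \<and> (\<lambda>k. S k x) \<longlonglongrightarrow> S0 x"
  and S: "(\<lambda>k. integral\<^sup>L M (S k)) \<longlonglongrightarrow> integral\<^sup>L M S0"
  and I: "\<And>k. c k \<le> integral\<^sup>L M (b k)" "c \<longlonglongrightarrow> c0"
 shows "c0 \<le> integral\<^sup>L M b0"
proof -
 have nn: "0 \<le> (LINT x|M. S k x - b k x)" for k using le by (intro integral_nonneg_AE AE_I2) auto
 have eqk: "(LINT x|M. S k x - b k x) = integral\<^sup>L M (S k) - integral\<^sup>L M (b k)" for k
  by (rule Bochner_Integration.integral_diff[OF i(2,1)])
 have lim: "(\<lambda>k. integral\<^sup>L M (S k) - c k) \<longlonglongrightarrow> integral\<^sup>L M S0 - c0" by (intro tendsto_diff S I)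
 have ge: "0 \<le> integral\<^sup>L M S0 - c0"
 proof (rule tendsto_lowerbound[OF lim])
  show "\<forall>\<^sub>F k in sequentially. 0 \<le> integral\<^sup>L M (S k) - c k"
  proof (rule always_eventually, rule allI)
   fix k show "0 \<le> integral\<^sup>L M (S k) - c k" using nn[of k] eqk[of k] I(1)[of k] by linarith
  qed
 qed simp
 have "ennreal (LINT x|M. S0 x - b0 x) = (\<integral>\<^sup>+x. ennreal (S0 x - b0 x) \<partial>M)"
  using i le(2) by (intro nn_integral_eq_integral[symmetric] AE_I2) auto
 also have "\<dots> = (\<integral>\<^sup>+x. liminf (\<lambda>k. ennreal (S k x - b k x)) \<partial>M)"
 proof (rule nn_integral_cong_AE)
  show "AE x in M. ennreal (S0 x - b0 x) = liminf (\<lambda>k. ennreal (S k x - b k x))" using ae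
  proof eventually_elim
   case (elim x)
   hence "(\<lambda>k. ennreal (S k x - b k x)) \<longlonglongrightarrow> ennreal (S0 x - b0 x)" by (intro tendsto_ennrealI tendsto_diff) auto
   thus ?case by (intro lim_imp_Liminf[symmetric]) auto
  qed
 qed
 also have "\<dots> \<le> liminf (\<lambda>k. \<integral>\<^sup>+x. ennreal (S k x - b k x) \<partial>M)"
 proof (rule nn_integral_liminf)
  show "(\<lambda>x. ennreal (S k x - b k x)) \<in> borel_measurable M" for k
   using borel_measurable_integrable[OF i(2)[of k]] borel_measurable_integrable[OF i(1)[of k]] by measurable
 qed
 also have "\<dots> \<le> liminf (\<lambda>k. ennreal (integral\<^sup>L M (S k) - c k))"
 proof (rule Liminf_mono, rule always_eventually, rule allI)
  fix k
  have "(\<integral>\<^sup>+x. ennreal (S k x - b k x) \<partial>M) = ennreal (LINT x|M. S k x - b k x)"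
   using i le by (intro nn_integral_eq_integral AE_I2) auto
  also have "\<dots> \<le> ennreal (integral\<^sup>L M (S k) - c k)" using I(1)[of k] unfolding eqk by (intro ennreal_leI) simp
  finally show "(\<integral>\<^sup>+x. ennreal (S k x - b k x) \<partial>M) \<le> ennreal (integral\<^sup>L M (S k) - c k)" .
 qed
 also have "\<dots> = ennreal (integral\<^sup>L M S0 - c0)" by (intro lim_imp_Liminf tendsto_ennrealI lim) simp
 finally have "(LINT x|M. S0 x - b0 x) \<le> integral\<^sup>L M S0 - c0" using ge by (simp add: ennreal_le_iff)
 moreover have "(LINT x|M. S0 x - b0 x) = integral\<^sup>L M S0 - integral\<^sup>L M b0"
  by (rule Bochner_Integration.integral_diff[OF i(4,3)])
 ultimately show ?thesis by linarith
qed

context mode_family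
begin

definition NN :: "'d option \<Rightarrow> ('d \<Rightarrow> nat) \<Rightarrow> real" where
 "NN \<sigma> n = (case \<sigma> of None \<Rightarrow> 1 | Some i \<Rightarrow> L i (n i))"

lemma H_Some_zero:
 assumes "n i = 1" "x \<in> space PM" shows "H (Some i) n x = 0"
 unfolding H_remove[of "Some i" n x i] using assms m.f'_1[of "x i" i] by (simp add: fac_def space_PM)

sublocale O: orth_system PM "H \<sigma>" "Collect idx" "NN \<sigma>" for \<sigma>
proof
 fix n m assume n: "n \<in> Collect idx"
 show "H \<sigma> n \<in> borel_measurable PM" using n by (intro meas_H) simp
 obtain C where "\<And>(t::real) x. -1 < t \<Longrightarrow> x \<in> space PM \<Longrightarrow> \<bar>H \<sigma> n x\<bar> \<le> C * 1"
  using bnd_H[of n \<sigma>] n unfolding bnd_def by blast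
 from this[of 0] show "\<exists>C. \<forall>x\<in>space PM. \<bar>H \<sigma> n x\<bar> \<le> C" by auto
 show "H \<sigma> n x = 0" if z: "NN \<sigma> n = 0" and x: "x \<in> space PM" for x
 proof (cases \<sigma>)
  case None
  thus ?thesis using z by (simp add: NN_def)
 next
  case (Some i)
  have "1 \<le> n i" using n by (simp add: idx_def)
  hence "n i = 1" using m.L_pos[of "n i" i] z Some by (cases "2 \<le> n i") (auto simp: NN_def)
  thus ?thesis using H_Some_zero[OF _ x] Some by simp
 qed
 show "(LINT x|PM. H \<sigma> n x * H \<sigma> m x) = (if n = m then NN \<sigma> n else 0)" if "m \<in> Collect idx"
  using H_orthogonal(1)[of n m \<sigma>] n that by (auto simp: NN_def split: option.split)
qed (rule H_total)

definition mu :: "real \<Rightarrow> ('d \<Rightarrow> nat) \<Rightarrow> real" where "mu a n = sqrt (a + (\<Sum>i\<in>UNIV. L i (n i)))"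

definition rcoef :: "real \<Rightarrow> (('d \<Rightarrow> real) \<Rightarrow> complex) \<Rightarrow> ('d \<Rightarrow> nat) \<Rightarrow> complex" where
 "rcoef a \<phi> n = complex_of_real (1 / mu a n) * O.coef None \<phi> n"

text \<open>Both transforms in one: \<open>a\<close> is the sum of the squared first zeros for one
  of them and 0 for the other. For a = 0 the constant product has \<open>mu\<close> equal to 0, and
  division by zero deletes its term.\<close>

definition Riesz :: "real \<Rightarrow> 'd \<Rightarrow> (('d \<Rightarrow> real) \<Rightarrow> complex) \<Rightarrow> ('d \<Rightarrow> real) \<Rightarrow> complex" where
 "Riesz a i \<phi> = L2_sum PM (\<lambda>n x. rcoef a \<phi> n * complex_of_real (H (Some i) n x)) (Collect idx)"

lemma L_le_mu:
 assumes "0 \<le> a" "idx n" shows "L i (n i) \<le> (mu a n)^2" "(mu a n)^2 = a + (\<Sum>i\<in>UNIV. L i (n i))" "0 \<le> mu a n"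
proof -
 have L0: "0 \<le> L j (n j)" for j using m.L_nonneg[of "n j" j] assms(2) by (simp add: idx_def)
 hence s: "0 \<le> (\<Sum>i\<in>UNIV. L i (n i))" by (intro sum_nonneg) auto
 thus 1: "(mu a n)^2 = a + (\<Sum>i\<in>UNIV. L i (n i))" "0 \<le> mu a n" using assms(1) by (auto simp: mu_def)
 have "L i (n i) \<le> (\<Sum>i\<in>UNIV. L i (n i))" using L0 by (intro member_le_sum) auto
 thus "L i (n i) \<le> (mu a n)^2" using 1 assms(1) by simp
qed

text \<open>The squared norm \<open>L i (n i)\<close> of the derivative is at most the square of
  \<open>mu a n\<close>, so the squared terms are dominated by those in Bessel's inequality for
  \<phi>.\<close>

lemma Riesz_has_L2_sum:
 assumes a: "0 \<le> a" and \<phi>: "\<phi> \<in> Lp 2 PM"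
 shows "has_L2_sum PM (\<lambda>n x. rcoef a \<phi> n * complex_of_real (H (Some i) n x)) (Collect idx) (Riesz a i \<phi>)"
 unfolding Riesz_def
proof (rule L2_sum_has_L2_sum, rule O.riesz_fischer)
 fix F assume F: "finite F" "F \<subseteq> Collect idx"
 have "(\<Sum>n\<in>F. (norm (rcoef a \<phi> n))^2 * NN (Some i) n) \<le> (\<Sum>n\<in>F. (norm (O.coef None \<phi> n))^2 * NN None n)"
 proof (rule sum_mono)
  fix n assume "n \<in> F"
  hence n: "idx n" using F by auto
  have "1 / (mu a n)^2 * L i (n i) \<le> 1"
   using L_le_mu(1)[OF a n, of i] by (cases "mu a n = 0") (auto simp: divide_le_eq)
  hence "(norm (O.coef None \<phi> n))^2 * (1 / (mu a n)^2 * L i (n i)) \<le> (norm (O.coef None \<phi> n))^2 * 1"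
   by (intro mult_left_mono) auto
  thus "(norm (rcoef a \<phi> n))^2 * NN (Some i) n \<le> (norm (O.coef None \<phi> n))^2 * NN None n"
   by (simp add: rcoef_def NN_def norm_mult power_mult_distrib norm_divide power_divide)
 qed
 also have "\<dots> \<le> (LINT x|PM. (norm (\<phi> x))^2)" by (rule O.bessel[OF \<phi> F])
 finally show "(\<Sum>n\<in>F. (norm (rcoef a \<phi> n))^2 * NN (Some i) n) \<le> (LINT x|PM. (norm (\<phi> x))^2)" .
qed

lemma Riesz_Lp: assumes "0 \<le> a" "\<phi> \<in> Lp 2 PM" shows "Riesz a i \<phi> \<in> Lp 2 PM"
 using Riesz_has_L2_sum[OF assms] by (simp add: has_L2_sum_def)

text \<open>The real part of the pairing is \<open>4 * fl.Zt 0\<close>, hence \<kappa> / 2 in place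
  of 2 \<kappa>. The family \<open>cc\<close> lists real and imaginary parts of the complex
  coefficients as the flow expects them.\<close>

lemma finite_embedding:
 assumes bm: "bellman \<kappa> B Ba Bb Baa Bab Bbb" and e: "0 < \<epsilon>" and a: "0 \<le> a"
  and F: "finite F" "F \<subseteq> Collect idx"
 shows "\<kappa> / 2 * Re (\<Sum>i\<in>UNIV. LINT x|PM. O.csum (Some i) F (\<lambda>n. complex_of_real (1 / mu a n) * c n) x * cnj (O.csum (Some i) F (d i) x))
  \<le> (LINT x|PM. B (\<epsilon> + (norm (O.csum None F c x))^2) (\<epsilon> + (\<Sum>i\<in>UNIV. (norm (O.csum (Some i) F (d i) x))^2)))"
proof -
 define cc where "cc = (\<lambda>(q::'d option \<times> bool) n. case q of (None, s) \<Rightarrow> (if s then Re (c n) else Im (c n))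
  | (Some i, s) \<Rightarrow> (if s then Re (d i n) else Im (d i n)))"
 interpret fl: mode_flow w om V f f' L \<kappa> B Ba Bb Baa Bab Bbb F "mu a" cc \<epsilon> a
  by (intro mode_flow.intro mode_family_axioms bm mode_flow_axioms.intro)
   (use F e a L_le_mu[OF a] in auto)
 have yN: "(fl.y (None, True) 0 x)^2 + (fl.y (None, False) 0 x)^2 = (norm (O.csum None F c x))^2" for x
  unfolding fl.y_def O.csum_def unfolding cc_def by (simp add: cmod_power2)
 have yS: "(fl.y (Some i, True) 0 x)^2 + (fl.y (Some i, False) 0 x)^2 = (norm (O.csum (Some i) F (d i) x))^2" for x i
  unfolding fl.y_def O.csum_def unfolding cc_def by (simp add: cmod_power2)
 have S1: "fl.A fl.S1 0 x = \<epsilon> + (norm (O.csum None F c x))^2" for x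
 proof -
  have im: "{None} \<times> UNIV = {(None, True), (None, False)}" by (auto simp: UNIV_bool)
  show ?thesis unfolding fl.A_def yN[symmetric] fl.S1_def im by simp
 qed
 have S2: "fl.A fl.S2 0 x = \<epsilon> + (\<Sum>i\<in>UNIV. (norm (O.csum (Some i) F (d i) x))^2)" for x
 proof -
  have im: "(fl.S2 :: ('d option \<times> bool) set) = (\<lambda>(i, s). (Some i, s)) ` (UNIV \<times> UNIV)"
  proof (rule set_eqI)
   fix q :: "'d option \<times> bool"
   show "q \<in> fl.S2 \<longleftrightarrow> q \<in> (\<lambda>(i, s). (Some i, s)) ` (UNIV \<times> UNIV)"
    by (cases q; cases "fst q") (auto simp: fl.S2_def image_iff)
  qed
  have inj: "inj_on (\<lambda>(i, s). (Some i, s)) (UNIV \<times> UNIV :: ('d \<times> bool) set)" by (auto simp: inj_on_def)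
  have "(\<Sum>q\<in>fl.S2. (fl.y q 0 x)^2) = (\<Sum>p\<in>UNIV \<times> UNIV. (fl.y (case p of (i, s) \<Rightarrow> (Some i, s)) 0 x)^2)"
   unfolding im by (rule sum.reindex[OF inj, unfolded comp_def])
  also have "\<dots> = (\<Sum>i\<in>UNIV. \<Sum>s\<in>UNIV. (fl.y (Some i, s) 0 x)^2)"
   unfolding sum.cartesian_product by (rule sum.cong[OF refl]) (simp add: case_prod_beta)
  also have "\<dots> = (\<Sum>i\<in>UNIV. (fl.y (Some i, True) 0 x)^2 + (fl.y (Some i, False) 0 x)^2)" by (simp add: UNIV_bool add.commute)
  also have "\<dots> = (\<Sum>i\<in>UNIV. (norm (O.csum (Some i) F (d i) x))^2)" by (simp add: yS)
  finally show ?thesis by (simp add: fl.A_def)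
 qed
 have "Re (\<Sum>i\<in>UNIV. LINT x|PM. O.csum (Some i) F (\<lambda>n. complex_of_real (1 / mu a n) * c n) x * cnj (O.csum (Some i) F (d i) x))
  = (\<Sum>i\<in>UNIV. \<Sum>n\<in>F. (Re (c n) * Re (d i n) + Im (c n) * Im (d i n)) * L i (n i) / mu a n)"
  unfolding O.integral_csum_csum[OF F] Re_sum
  by (intro sum.cong refl) (simp add: NN_def algebra_simps add_divide_distrib)
 also have "\<dots> = 4 * fl.Zt 0" unfolding fl.Zt_def sum_distrib_left UNIV_bool
  by (intro sum.cong refl) (simp add: cc_def sum.distrib sum_distrib_left sum_divide_distrib algebra_simps add_divide_distrib)
 finally have "\<kappa> / 2 * Re (\<Sum>i\<in>UNIV. LINT x|PM. O.csum (Some i) F (\<lambda>n. complex_of_real (1 / mu a n) * c n) x * cnj (O.csum (Some i) F (d i) x)) = 2 * \<kappa> * fl.Zt 0"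
  by simp
 also have "\<dots> \<le> integral\<^sup>L PM (fl.b 0)" by (rule fl.bilinear_embedding)
 also have "fl.b 0 = (\<lambda>x. B (\<epsilon> + (norm (O.csum None F c x))^2) (\<epsilon> + (\<Sum>i\<in>UNIV. (norm (O.csum (Some i) F (d i) x))^2)))"
  by (simp add: fun_eq_iff fl.b_def S1 S2)
 finally show ?thesis .
qed

text \<open>The finite embedding uses one index set for \<phi>, its Riesz transforms and all g i.
  Finitely many unconditionally convergent series can be approximated along common finite
  sets.\<close>

lemma ex_approximating_sets:
 assumes fin: "finite J" and h: "\<And>j. j \<in> J \<Longrightarrow> has_L2_sum PM (u j) (Collect idx) (g j)"
 shows "\<exists>F. (\<forall>k. finite (F k) \<and> F k \<subseteq> Collect idx) \<and>
  (\<forall>j\<in>J. (\<lambda>k. Lp_norm 2 PM (\<lambda>x. (\<Sum>n\<in>F k. u j n x) - g j x)) \<longlonglongrightarrow> 0)"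
proof -
 define N where "N j F = Lp_norm 2 PM (\<lambda>x. (\<Sum>n\<in>F. u j n x) - g j x)" for j F
 have "\<exists>F. (finite F \<and> F \<subseteq> Collect idx) \<and> (\<forall>j\<in>J. N j F < 1 / real (Suc k))" for k
 proof -
  have "\<forall>\<^sub>F F in finite_subsets_at_top (Collect idx). \<forall>j\<in>J. N j F < 1 / real (Suc k)" using fin
  proof (rule eventually_ball_finite, intro ballI)
   fix j assume "j \<in> J"
   hence "(N j \<longlongrightarrow> 0) (finite_subsets_at_top (Collect idx))" using h by (simp add: has_L2_sum_def N_def[abs_def])
   thus "\<forall>\<^sub>F F in finite_subsets_at_top (Collect idx). N j F < 1 / real (Suc k)" by (rule order_tendstoD) simp
  qed
  then obtain X where X: "finite X" "X \<subseteq> Collect idx"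
   "\<And>Y. finite Y \<and> X \<subseteq> Y \<and> Y \<subseteq> Collect idx \<Longrightarrow> \<forall>j\<in>J. N j Y < 1 / real (Suc k)"
   unfolding eventually_finite_subsets_at_top by (elim exE conjE) simp
  show ?thesis by (rule exI[of _ X]) (use X(1,2) X(3)[of X] in simp)
 qed
 hence "\<exists>F. \<forall>k. (finite (F k) \<and> F k \<subseteq> Collect idx) \<and> (\<forall>j\<in>J. N j (F k) < 1 / real (Suc k))" by (intro choice allI)
 then obtain F where F: "\<forall>k. (finite (F k) \<and> F k \<subseteq> Collect idx) \<and> (\<forall>j\<in>J. N j (F k) < 1 / real (Suc k))" by (elim exE)
 have "(\<lambda>k. N j (F k)) \<longlonglongrightarrow> 0" if "j \<in> J" for j
  by (rule tendsto_0_squeeze[OF _ _ LIMSEQ_inverse_real_of_nat])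
   (use F that in \<open>simp_all add: N_def Lp_norm_nonneg less_imp_le inverse_eq_divide\<close>)
 thus ?thesis using F unfolding N_def by (intro exI[of _ F] conjI allI ballI) simp_all
qed

text \<open>Thanks to the linear growth the integrand is dominated by a multiple of 1 plus both
  arguments. The integrals of these majorants depend only on L^2 norms and therefore converge, so
  \<open>fatou_upper\<close> takes the finite embedding to the limit.\<close>

lemma embedding_L2:
 assumes bm: "bellman \<kappa> B Ba Bb Baa Bab Bbb" and e: "0 < \<epsilon>" and a: "0 \<le> a"
  and growth: "\<And>s t. 0 < s \<Longrightarrow> 0 < t \<Longrightarrow> B s t \<le> K * (1 + s + t)"
  and \<phi>: "\<phi> \<in> Lp 2 PM" and g: "\<And>i. g i \<in> Lp 2 PM"
 shows "\<kappa> / 2 * Re (\<Sum>i\<in>UNIV. LINT x|PM. Riesz a i \<phi> x * cnj (g i x))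
  \<le> (LINT x|PM. B (\<epsilon> + (norm (\<phi> x))^2) (\<epsilon> + (\<Sum>i\<in>UNIV. (norm (g i x))^2)))"
  and "integrable PM (\<lambda>x. B (\<epsilon> + (norm (\<phi> x))^2) (\<epsilon> + (\<Sum>i\<in>UNIV. (norm (g i x))^2)))"
proof -
 interpret bellman \<kappa> B Ba Bb Baa Bab Bbb by (rule bm)
 define p1 where "p1 = (\<lambda>(\<phi> :: ('d \<Rightarrow> real) \<Rightarrow> complex) x. \<epsilon> + (norm (\<phi> x :: complex))^2)"
 define p2 where "p2 = (\<lambda>(g :: 'd \<Rightarrow> ('d \<Rightarrow> real) \<Rightarrow> complex) x. \<epsilon> + (\<Sum>i\<in>UNIV. (norm (g i x))^2))"
 have pos: "0 < p1 \<phi> x" "0 < p2 g x" for \<phi> g x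
  using e by (auto simp: p1_def p2_def intro!: add_pos_nonneg sum_nonneg)
 define SS where "SS = (\<lambda>\<phi> g x. K * (1 + p1 \<phi> x + p2 g x))"
 have pint: "integrable PM (p1 \<phi>)" "integrable PM (p2 g)" if "\<phi> \<in> Lp 2 PM" "\<And>i. g i \<in> Lp 2 PM" for \<phi> g
  using that unfolding p1_def p2_def
  by (auto intro!: Bochner_Integration.integrable_add Bochner_Integration.integrable_sum simp: Lp_2_iff)
 have Sint: "integrable PM (SS \<phi> g)" if "\<phi> \<in> Lp 2 PM" "\<And>i. g i \<in> Lp 2 PM" for \<phi> g
  unfolding SS_def using pint[OF that] by (intro integrable_mult_right Bochner_Integration.integrable_add) auto
 have Bint: "integrable PM (\<lambda>x. B (p1 \<phi> x) (p2 g x))" if fg: "\<phi> \<in> Lp 2 PM" "\<And>i. g i \<in> Lp 2 PM" for \<phi> g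
 proof (rule Bochner_Integration.integrable_bound[OF Sint[OF fg]])
  have m: "(\<lambda>p. indicator ({0<..} \<times> {0<..}) p *\<^sub>R (case p of (a, b) \<Rightarrow> B a b)) \<in> borel_measurable borel"
   by (intro borel_measurable_continuous_on_indicator cont(1)) (auto intro!: borel_open open_Times)
  have "(\<lambda>x. (p1 \<phi> x, p2 g x)) \<in> borel_measurable PM"
   using pint[OF fg] by (intro borel_measurable_Pair) auto
  from measurable_compose[OF this m] show "(\<lambda>x. B (p1 \<phi> x) (p2 g x)) \<in> borel_measurable PM"
   using pos by (simp add: indicator_def)
  show "AE x in PM. norm (B (p1 \<phi> x) (p2 g x)) \<le> norm (SS \<phi> g x)"
  proof (rule AE_I2)
   fix x
   have "0 \<le> B (p1 \<phi> x) (p2 g x)" "B (p1 \<phi> x) (p2 g x) \<le> SS \<phi> g x"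
    unfolding SS_def using nonneg(1) growth pos by auto
   thus "norm (B (p1 \<phi> x) (p2 g x)) \<le> norm (SS \<phi> g x)" by simp
  qed
 qed
 show "integrable PM (\<lambda>x. B (\<epsilon> + (norm (\<phi> x))^2) (\<epsilon> + (\<Sum>i\<in>UNIV. (norm (g i x))^2)))"
  using Bint[OF \<phi> g] by (simp add: p1_def p2_def)
 define c where "c = O.coef None \<phi>"
 define d where "d = (\<lambda>i. O.coef (Some i) (g i))"
 \<comment> \<open>\<open>None\<close> stands for \<phi>, \<open>Inl i\<close> for its i-th Riesz
   transform and \<open>Inr i\<close> for \<open>g i\<close>.\<close>
 define u where "u = (\<lambda>(j :: ('d + 'd) option) n x. case j of None \<Rightarrow> c n * complex_of_real (H None n x)
  | Some (Inl i) \<Rightarrow> rcoef a \<phi> n * complex_of_real (H (Some i) n x) | Some (Inr i) \<Rightarrow> d i n * complex_of_real (H (Some i) n x))"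
 define h where "h = (\<lambda>(j :: ('d + 'd) option). case j of None \<Rightarrow> \<phi> | Some (Inl i) \<Rightarrow> Riesz a i \<phi> | Some (Inr i) \<Rightarrow> g i)"
 have "has_L2_sum PM (u j) (Collect idx) (h j)" for j
  using O.fourier_series[OF \<phi>, of None] Riesz_has_L2_sum[OF a \<phi>] O.fourier_series[OF g]
  by (auto simp: u_def h_def c_def d_def split: option.split sum.split)
 then obtain F where F: "\<And>k. finite (F k)" "\<And>k. F k \<subseteq> Collect idx"
  and lim: "\<And>j. (\<lambda>k. Lp_norm 2 PM (\<lambda>x. (\<Sum>n\<in>F k. u j n x) - h j x)) \<longlonglongrightarrow> 0"
  using ex_approximating_sets[of UNIV u h] by auto
 define fk where "fk = (\<lambda>k. O.csum None (F k) c)"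
 define rk where "rk = (\<lambda>i k. O.csum (Some i) (F k) (rcoef a \<phi>))"
 define gk where "gk = (\<lambda>k i. O.csum (Some i) (F k) (d i))"
 have L: "fk k \<in> Lp 2 PM" "rk i k \<in> Lp 2 PM" "gk k i \<in> Lp 2 PM" for k i
  unfolding fk_def rk_def gk_def using F by (intro O.csum_Lp; simp)+
 have lf: "(\<lambda>k. Lp_dist 2 PM (fk k) \<phi>) \<longlonglongrightarrow> 0"
  using lim[of None] by (simp add: u_def h_def fk_def O.csum_def)
 have lr: "(\<lambda>k. Lp_dist 2 PM (rk i k) (Riesz a i \<phi>)) \<longlonglongrightarrow> 0" for i
  using lim[of "Some (Inl i)"] by (simp add: u_def h_def rk_def O.csum_def)
 have lg: "(\<lambda>k. Lp_dist 2 PM (gk k i) (g i)) \<longlonglongrightarrow> 0" for i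
  using lim[of "Some (Inr i)"] by (simp add: u_def h_def gk_def O.csum_def)
 define err where "err = (\<lambda>k x. (norm (fk k x - \<phi> x))^2 + (\<Sum>i\<in>UNIV. (norm (gk k i x - g i x))^2))"
 have di: "integrable PM (\<lambda>x. (norm (fk k x - \<phi> x))^2)" "integrable PM (\<lambda>x. (norm (gk k i x - g i x))^2)" for k i
  using Lp_diff(1)[OF L(1) \<phi>] Lp_diff(1)[OF L(3) g] by (auto simp: Lp_2_iff)
 have ei: "integrable PM (err k)" for k
  unfolding err_def using di by (intro Bochner_Integration.integrable_add Bochner_Integration.integrable_sum)
 have "(LINT x|PM. norm (err k x)) = (Lp_dist 2 PM (fk k) \<phi>)^2 + (\<Sum>i\<in>UNIV. (Lp_dist 2 PM (gk k i) (g i))^2)" for k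
 proof -
  have "norm (err k x) = err k x" for x by (auto simp: err_def intro!: abs_of_nonneg add_nonneg_nonneg sum_nonneg)
  hence "(LINT x|PM. norm (err k x)) = integral\<^sup>L PM (err k)" by simp
  also have "\<dots> = (LINT x|PM. (norm (fk k x - \<phi> x))^2) + (\<Sum>i\<in>UNIV. (LINT x|PM. (norm (gk k i x - g i x))^2))"
   unfolding err_def using di
   by (subst Bochner_Integration.integral_add) (auto intro!: Bochner_Integration.integrable_sum simp: Bochner_Integration.integral_sum)
  finally show ?thesis by (simp add: Lp_norm_2_sq)
 qed
 moreover have "(\<lambda>k. (Lp_dist 2 PM (fk k) \<phi>)^2 + (\<Sum>i\<in>UNIV. (Lp_dist 2 PM (gk k i) (g i))^2)) \<longlonglongrightarrow> 0\<^sup>2 + (\<Sum>i\<in>(UNIV::'d set). 0\<^sup>2)"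
  by (intro tendsto_add tendsto_power tendsto_sum lf lg)
 ultimately have "(\<lambda>k. LINT x|PM. norm (err k x)) \<longlonglongrightarrow> 0" by simp
 \<comment> \<open>The total error is a sum of squares, so one subsequence makes all components
   converge almost everywhere.\<close>
 from tendsto_L1_AE_subseq[OF ei this] obtain r where r: "strict_mono r" and ae: "AE x in PM. (\<lambda>k. err (r k) x) \<longlonglongrightarrow> 0" by blast
 have sub: "(\<lambda>k. X (r k)) \<longlonglongrightarrow> l" if "X \<longlonglongrightarrow> l" for X and l :: "'z::topological_space"
  using LIMSEQ_subseq_LIMSEQ[OF that r] by (simp add: comp_def)
 define I where "I = (\<lambda>k. Re (\<Sum>i\<in>UNIV. LINT x|PM. rk i (r k) x * cnj (gk (r k) i x)))"
 define I0 where "I0 = Re (\<Sum>i\<in>UNIV. LINT x|PM. Riesz a i \<phi> x * cnj (g i x))"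
 have Ilim: "I \<longlonglongrightarrow> I0" unfolding I_def I0_def
  by (intro tendsto_Re tendsto_sum Lp_2_inner_tendsto L Riesz_Lp[OF a \<phi>] g sub[OF lr] sub[OF lg])
 have "\<kappa> / 2 * I0 \<le> (LINT x|PM. B (p1 \<phi> x) (p2 g x))"
 proof (rule PM.fatou_upper[where b = "\<lambda>k x. B (p1 (fk (r k)) x) (p2 (gk (r k)) x)" and S = "\<lambda>k. SS (fk (r k)) (gk (r k))"
   and ?S0.0 = "SS \<phi> g" and c = "\<lambda>k. \<kappa> / 2 * I k"])
  show "integrable PM (\<lambda>x. B (p1 (fk (r k)) x) (p2 (gk (r k)) x))" "integrable PM (SS (fk (r k)) (gk (r k)))" for k
   by (intro Bint Sint L)+
  show "integrable PM (\<lambda>x. B (p1 \<phi> x) (p2 g x))" "integrable PM (SS \<phi> g)" by (intro Bint Sint \<phi> g)+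
  show "B (p1 (fk (r k)) x) (p2 (gk (r k)) x) \<le> SS (fk (r k)) (gk (r k)) x" "B (p1 \<phi> x) (p2 g x) \<le> SS \<phi> g x" for k x
   unfolding SS_def using growth pos by auto
  show "AE x in PM. (\<lambda>k. B (p1 (fk (r k)) x) (p2 (gk (r k)) x)) \<longlonglongrightarrow> B (p1 \<phi> x) (p2 g x)
   \<and> (\<lambda>k. SS (fk (r k)) (gk (r k)) x) \<longlonglongrightarrow> SS \<phi> g x" using ae
  proof eventually_elim
   case (elim x)
   have z: "(\<lambda>k. norm (fk (r k) x - \<phi> x)) \<longlonglongrightarrow> 0" "(\<lambda>k. norm (gk (r k) i x - g i x)) \<longlonglongrightarrow> 0" for i
   proof -
    have le: "(norm (fk (r k) x - \<phi> x))^2 \<le> err (r k) x" "(norm (gk (r k) i x - g i x))^2 \<le> err (r k) x" for k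
    proof -
     have "(norm (gk (r k) i x - g i x))^2 \<le> (\<Sum>i\<in>UNIV. (norm (gk (r k) i x - g i x))^2)"
      by (rule member_le_sum) auto
     thus "(norm (gk (r k) i x - g i x))^2 \<le> err (r k) x" unfolding err_def by (simp add: add_increasing)
     show "(norm (fk (r k) x - \<phi> x))^2 \<le> err (r k) x" unfolding err_def by (simp add: sum_nonneg)
    qed
    have sq: "X \<longlonglongrightarrow> 0" if "\<And>k. (X k)^2 \<le> err (r k) x" "\<And>k. 0 \<le> X k" for X :: "nat \<Rightarrow> real"
    proof -
     have "(\<lambda>k. (X k)^2) \<longlonglongrightarrow> 0"
      by (rule tendsto_sandwich[OF _ _ tendsto_const elim]) (use that in \<open>auto intro!: always_eventually\<close>)
     from tendsto_real_sqrt[OF this] show ?thesis using that(2) by simp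
    qed
    show "(\<lambda>k. norm (fk (r k) x - \<phi> x)) \<longlonglongrightarrow> 0" "(\<lambda>k. norm (gk (r k) i x - g i x)) \<longlonglongrightarrow> 0"
     by (rule sq[OF le(1)], simp, rule sq[OF le(2)], simp)
   qed
   have z1: "(\<lambda>k. fk (r k) x) \<longlonglongrightarrow> \<phi> x" "(\<lambda>k. gk (r k) i x) \<longlonglongrightarrow> g i x" for i
    using z(1) z(2)[of i] LIM_zero_cancel tendsto_norm_zero_iff by blast+
   have pl: "(\<lambda>k. p1 (fk (r k)) x) \<longlonglongrightarrow> p1 \<phi> x" "(\<lambda>k. p2 (gk (r k)) x) \<longlonglongrightarrow> p2 g x"
    unfolding p1_def p2_def by (intro tendsto_intros z1)+
   have "(\<lambda>k. (p1 (fk (r k)) x, p2 (gk (r k)) x)) \<longlonglongrightarrow> (p1 \<phi> x, p2 g x)" by (intro tendsto_Pair pl)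
   from continuous_on_tendsto_compose[OF cont(1) this]
   have "(\<lambda>k. B (p1 (fk (r k)) x) (p2 (gk (r k)) x)) \<longlonglongrightarrow> B (p1 \<phi> x) (p2 g x)" using pos by simp
   moreover have "(\<lambda>k. SS (fk (r k)) (gk (r k)) x) \<longlonglongrightarrow> SS \<phi> g x" unfolding SS_def by (intro tendsto_intros pl)
   ultimately show ?case by simp
  qed
  have Sval: "integral\<^sup>L PM (SS \<phi> g) = K * (1 + (\<epsilon> + (Lp_norm 2 PM \<phi>)^2) + (\<epsilon> + (\<Sum>i\<in>UNIV. (Lp_norm 2 PM (g i))^2)))"
   if fg: "\<phi> \<in> Lp 2 PM" "\<And>i. g i \<in> Lp 2 PM" for \<phi> g
  proof -
   have i2: "integrable PM (\<lambda>x. (norm (\<phi> x))^2)" "integrable PM (\<lambda>x. (norm (g i x))^2)" for i using fg by (auto simp: Lp_2_iff)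
   have v1: "integral\<^sup>L PM (p1 \<phi>) = \<epsilon> + (Lp_norm 2 PM \<phi>)^2"
    unfolding p1_def Lp_norm_2_sq using i2 by (simp add: PM.prob_space)
   have v2: "integral\<^sup>L PM (p2 g) = \<epsilon> + (\<Sum>i\<in>UNIV. (Lp_norm 2 PM (g i))^2)"
    unfolding p2_def Lp_norm_2_sq using i2 by (simp add: PM.prob_space)
   show ?thesis unfolding SS_def using pint[OF fg] by (simp add: v1 v2 PM.prob_space)
  qed
  show "(\<lambda>k. integral\<^sup>L PM (SS (fk (r k)) (gk (r k)))) \<longlonglongrightarrow> integral\<^sup>L PM (SS \<phi> g)"
   unfolding Sval[OF L(1) L(3)] Sval[OF \<phi> g] by (intro tendsto_intros Lp_norm_limit L \<phi> g sub[OF lf] sub[OF lg]) simp_all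
  show "\<kappa> / 2 * I k \<le> (LINT x|PM. B (p1 (fk (r k)) x) (p2 (gk (r k)) x))" for k
   using finite_embedding[OF bm e a F(1)[of "r k"] F(2)[of "r k"], of c d]
   by (simp add: I_def rk_def gk_def fk_def p1_def p2_def rcoef_def[abs_def] c_def)
  show "(\<lambda>k. \<kappa> / 2 * I k) \<longlonglongrightarrow> \<kappa> / 2 * I0" by (intro tendsto_intros Ilim)
 qed
 thus "\<kappa> / 2 * Re (\<Sum>i\<in>UNIV. LINT x|PM. Riesz a i \<phi> x * cnj (g i x))
  \<le> (LINT x|PM. B (\<epsilon> + (norm (\<phi> x))^2) (\<epsilon> + (\<Sum>i\<in>UNIV. (norm (g i x))^2)))"
  by (simp add: I0_def p1_def p2_def)
qed

end

section \<open>Extension to \<open>L\<^sup>p\<close>\<close>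

lemma Lp_sum_norm_le:
 fixes f :: "'j \<Rightarrow> 'a \<Rightarrow> 'b::{real_normed_vector, second_countable_topology}"
 assumes "finite J" "\<And>j. j \<in> J \<Longrightarrow> f j \<in> Lp p M" "1 \<le> p"
 shows "(\<lambda>x. \<Sum>j\<in>J. norm (f j x)) \<in> Lp p M" "Lp_norm p M (\<lambda>x. \<Sum>j\<in>J. norm (f j x)) \<le> (\<Sum>j\<in>J. Lp_norm p M (f j))"
proof -
 have *: "(\<lambda>x. norm (f j x)) \<in> Lp p M" "Lp_norm p M (\<lambda>x. norm (f j x)) = Lp_norm p M (f j)" if "j \<in> J" for j
  using Lp_dominated(1)[OF assms(2)[OF that], of "\<lambda>x. norm (f j x)"] Lp_meas[OF assms(2)[OF that]] assms(3)
  by (auto simp: Lp_norm_def)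
 show "(\<lambda>x. \<Sum>j\<in>J. norm (f j x)) \<in> Lp p M" by (rule Lp_sum[OF assms(1) *(1) assms(3)])
 show "Lp_norm p M (\<lambda>x. \<Sum>j\<in>J. norm (f j x)) \<le> (\<Sum>j\<in>J. Lp_norm p M (f j))"
  using assms(1) subset_refl[of J]
 proof (induction rule: finite_subset_induct')
  case empty
  thus ?case using assms(3) by (simp add: Lp_norm_def)
 next
  case (insert j F)
  have "(\<lambda>x. \<Sum>j\<in>F. norm (f j x)) \<in> Lp p M" using insert by (intro Lp_sum[OF _ *(1) assms(3)]) auto
  from Lp_add(2)[OF *(1)[OF insert(2)] this assms(3)] show ?case using insert *(2)[OF insert(2)] by simp
 qed
qed

lemma l2_vec_eq_L2_set: "l2_vec T f x = L2_set (\<lambda>i. norm (T i f x)) UNIV" by (simp add: l2_vec_def L2_set_def)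

lemma l2_vec_nonneg: "0 \<le> l2_vec T f x" by (simp add: l2_vec_def sum_nonneg)

lemma norm_le_l2_vec: "norm (T i f x) \<le> l2_vec T f x" unfolding l2_vec_eq_L2_set by (rule member_le_L2_set) auto

lemma l2_vec_diff_le:
 fixes S T :: "'d::finite \<Rightarrow> ('a \<Rightarrow> complex) \<Rightarrow> 'a \<Rightarrow> complex"
 shows "\<bar>l2_vec S f x - l2_vec T g x\<bar> \<le> (\<Sum>i\<in>UNIV. norm (S i f x - T i g x))"
proof -
 have *: "l2_vec S f x \<le> l2_vec T g x + (\<Sum>i\<in>UNIV. norm (S i f x - T i g x))" for S T :: "'d \<Rightarrow> ('a \<Rightarrow> complex) \<Rightarrow> 'a \<Rightarrow> complex" and f g
 proof -
  have "l2_vec S f x \<le> L2_set (\<lambda>i. norm (T i g x) + norm (S i f x - T i g x)) UNIV"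
   unfolding l2_vec_eq_L2_set by (intro L2_set_mono) (auto intro: norm_triangle_sub)
  also have "\<dots> \<le> l2_vec T g x + L2_set (\<lambda>i. norm (S i f x - T i g x)) UNIV"
   unfolding l2_vec_eq_L2_set by (rule L2_set_triangle_ineq)
  also have "L2_set (\<lambda>i. norm (S i f x - T i g x)) UNIV \<le> (\<Sum>i\<in>UNIV. norm (S i f x - T i g x))"
   by (rule L2_set_le_sum) simp
  finally show ?thesis by simp
 qed
 have sw: "(\<Sum>i\<in>UNIV. norm (S i f x - T i g x)) = (\<Sum>i\<in>UNIV. norm (T i g x - S i f x))"
  by (simp only: norm_minus_commute)
 show ?thesis using *[of S f T g] *[of T g S f] sw by linarith
qed

lemma l2_vec_measurable:
 assumes "\<And>i. T i f \<in> borel_measurable M" shows "l2_vec T f \<in> borel_measurable M"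
 unfolding l2_vec_def[abs_def] using assms by measurable

text \<open>Operators on L^2 with a joint estimate for the vector of all components on the
  intersection with L^p. Linearity is assumed almost everywhere only, since the operators pick
  representatives of series.\<close>

locale Lp_bounded_on_L2 = prob_space M for M :: "'a measure" +
 fixes R :: "'d::finite \<Rightarrow> ('a \<Rightarrow> complex) \<Rightarrow> ('a \<Rightarrow> complex)" and p C :: real
 assumes p: "1 < p" and C: "0 \<le> C"
  and R_L2: "\<And>i \<phi>. \<phi> \<in> Lp 2 M \<Longrightarrow> R i \<phi> \<in> Lp 2 M"
  and R_add: "\<And>i \<phi> \<psi>. \<phi> \<in> Lp 2 M \<Longrightarrow> \<psi> \<in> Lp 2 M \<Longrightarrow> AE x in M. R i (\<lambda>x. \<phi> x + \<psi> x) x = R i \<phi> x + R i \<psi> x"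
  and R_cmult: "\<And>i c \<phi>. \<phi> \<in> Lp 2 M \<Longrightarrow> AE x in M. R i (\<lambda>x. c * \<phi> x) x = c * R i \<phi> x"
  and R_bound: "\<And>\<phi>. \<phi> \<in> Lp 2 M \<Longrightarrow> \<phi> \<in> Lp p M \<Longrightarrow>
   l2_vec R \<phi> \<in> Lp p M \<and> Lp_norm p M (l2_vec R \<phi>) \<le> C * Lp_norm p M \<phi>"
begin

lemma p0: "0 < p" "1 \<le> p" using p by auto

lemma R_Lp:
 assumes "\<phi> \<in> Lp 2 M" "\<phi> \<in> Lp p M"
 shows "R i \<phi> \<in> Lp p M" "Lp_norm p M (R i \<phi>) \<le> C * Lp_norm p M \<phi>"
proof -
 note b = R_bound[OF assms]
 have ae: "AE x in M. norm (R i \<phi> x) \<le> norm (l2_vec R \<phi> x)"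
  by (intro AE_I2) (simp add: l2_vec_nonneg norm_le_l2_vec)
 note d = Lp_dominated[OF b[THEN conjunct1] Lp_meas[OF R_L2[OF assms(1)]] ae p0(1)]
 show "R i \<phi> \<in> Lp p M" by (rule d(1))
 show "Lp_norm p M (R i \<phi>) \<le> C * Lp_norm p M \<phi>" using d(2) b by linarith
qed

lemma R_diff:
 assumes "\<phi> \<in> Lp 2 M" "\<psi> \<in> Lp 2 M"
 shows "AE x in M. R i (\<lambda>x. \<phi> x - \<psi> x) x = R i \<phi> x - R i \<psi> x"
proof -
 have m: "(\<lambda>x. - 1 * \<psi> x) \<in> Lp 2 M" by (rule Lp_cmult(1)[OF assms(2)]) simp
 show ?thesis using R_add[OF assms(1) m, of i] R_cmult[OF assms(2), of i "- 1"]
  by eventually_elim (simp del: mult_minus_left)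
qed

lemma R_diff_norm:
 assumes "\<phi> \<in> Lp 2 M" "\<phi> \<in> Lp p M" "\<psi> \<in> Lp 2 M" "\<psi> \<in> Lp p M"
 shows "Lp_dist p M (R i \<phi>) (R i \<psi>) \<le> C * Lp_dist p M \<phi> \<psi>"
proof -
 have d: "(\<lambda>x. \<phi> x - \<psi> x) \<in> Lp 2 M" "(\<lambda>x. \<phi> x - \<psi> x) \<in> Lp p M"
  using assms p0 by (auto intro!: Lp_diff)
 note mm = Lp_meas[OF R_L2[OF assms(1), of i]] Lp_meas[OF R_L2[OF assms(3), of i]]
 have "Lp_norm p M (R i (\<lambda>x. \<phi> x - \<psi> x)) = Lp_dist p M (R i \<phi>) (R i \<psi>)"
  by (rule Lp_cong_AE(2)[OF R_diff[OF assms(1,3)] Lp_meas[OF R_L2[OF d(1)]]]) (intro borel_measurable_diff mm)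
 thus ?thesis using R_Lp(2)[OF d, of i] by simp
qed

definition tr :: "('a \<Rightarrow> complex) \<Rightarrow> nat \<Rightarrow> 'a \<Rightarrow> complex" where
 "tr \<phi> k x = (if norm (\<phi> x) \<le> real k then \<phi> x else 0)"

lemma tr:
 assumes "\<phi> \<in> Lp p M"
 shows "tr \<phi> k \<in> Lp 2 M" "tr \<phi> k \<in> Lp p M" "(\<lambda>k. Lp_dist p M (tr \<phi> k) \<phi>) \<longlonglongrightarrow> 0"
 using Lp_truncation[OF assms p0(1), folded tr_def] p0 by auto

text \<open>The limit is taken along truncations; \<open>ext_limit\<close> shows that every
  approximation from the intersection leads to it.\<close>

definition ext :: "'d \<Rightarrow> ('a \<Rightarrow> complex) \<Rightarrow> ('a \<Rightarrow> complex)" where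
 "ext i \<phi> = (SOME h. h \<in> Lp p M \<and> (\<lambda>k. Lp_dist p M (R i (tr \<phi> k)) h) \<longlonglongrightarrow> 0)"

lemma ext:
 assumes \<phi>: "\<phi> \<in> Lp p M"
 shows "ext i \<phi> \<in> Lp p M" "(\<lambda>k. Lp_dist p M (R i (tr \<phi> k)) (ext i \<phi>)) \<longlonglongrightarrow> 0"
proof -
 have "\<exists>h\<in>Lp p M. (\<lambda>k. Lp_dist p M (R i (tr \<phi> k)) h) \<longlonglongrightarrow> 0"
 proof (rule Lp_complete[OF _ p])
  show "R i (tr \<phi> k) \<in> Lp p M" for k by (rule R_Lp(1)[OF tr(1,2)[OF \<phi>]])
  fix e :: real assume e: "0 < e"
  have "\<forall>\<^sub>F k in sequentially. Lp_dist p M (tr \<phi> k) \<phi> < e / (2 * (C + 1))"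
   by (rule order_tendstoD(2)[OF tr(3)[OF \<phi>]]) (use e C in simp)
  then obtain N where N: "\<And>k. N \<le> k \<Longrightarrow> Lp_dist p M (tr \<phi> k) \<phi> < e / (2 * (C + 1))"
   unfolding eventually_sequentially by meson
  have "Lp_dist p M (R i (tr \<phi> k)) (R i (tr \<phi> l)) < e" if "N \<le> k" "N \<le> l" for k l
  proof -
   have "Lp_dist p M (tr \<phi> k) (tr \<phi> l) \<le> Lp_dist p M (tr \<phi> k) \<phi> + Lp_dist p M (tr \<phi> l) \<phi>"
    using Lp_norm_triangle[OF tr(2)[OF \<phi>, of k] \<phi> tr(2)[OF \<phi>, of l] p0(2)]
     Lp_norm_diff_commute[of p M \<phi> "tr \<phi> l"] by simp
   hence "Lp_dist p M (tr \<phi> k) (tr \<phi> l) < e / (C + 1)"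
   proof -
    have "e / (2 * (C + 1)) + e / (2 * (C + 1)) = e / (C + 1)"
     unfolding add_divide_distrib[symmetric] mult_2[symmetric, of e] by (rule mult_divide_mult_cancel_left) simp
    thus ?thesis
     using order_le_less_trans[OF \<open>Lp_dist p M (tr \<phi> k) (tr \<phi> l) \<le> _\<close> add_strict_mono[OF N[OF that(1)] N[OF that(2)]]] by (simp only:)
   qed
   hence "(C + 1) * Lp_dist p M (tr \<phi> k) (tr \<phi> l) < e" using C by (simp add: field_simps)
   moreover have "C * Lp_dist p M (tr \<phi> k) (tr \<phi> l) \<le> (C + 1) * Lp_dist p M (tr \<phi> k) (tr \<phi> l)"
    by (intro mult_right_mono Lp_norm_nonneg) simp
   ultimately show ?thesis using R_diff_norm[OF tr(1,2)[OF \<phi>, of k] tr(1,2)[OF \<phi>, of l], of i] by linarith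
  qed
  thus "\<exists>N. \<forall>k\<ge>N. \<forall>l\<ge>N. Lp_dist p M (R i (tr \<phi> k)) (R i (tr \<phi> l)) < e"
   by (intro exI[of _ N]) simp
 qed
 hence "\<exists>h. h \<in> Lp p M \<and> (\<lambda>k. Lp_dist p M (R i (tr \<phi> k)) h) \<longlonglongrightarrow> 0" by (simp only: Bex_def)
 from someI_ex[OF this] show "ext i \<phi> \<in> Lp p M" "(\<lambda>k. Lp_dist p M (R i (tr \<phi> k)) (ext i \<phi>)) \<longlonglongrightarrow> 0"
  unfolding ext_def by simp_all
qed

lemma ext_limit:
 assumes \<phi>: "\<phi> \<in> Lp p M" and u: "\<And>k. u k \<in> Lp 2 M" "\<And>k. u k \<in> Lp p M"
  and l: "(\<lambda>k. Lp_dist p M (u k) \<phi>) \<longlonglongrightarrow> 0"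
 shows "(\<lambda>k. Lp_dist p M (R i (u k)) (ext i \<phi>)) \<longlonglongrightarrow> 0"
proof (rule tendsto_0_squeeze[OF Lp_norm_nonneg])
 show "Lp_dist p M (R i (u k)) (ext i \<phi>)
  \<le> C * (Lp_dist p M (u k) \<phi> + Lp_dist p M (tr \<phi> k) \<phi>) + Lp_dist p M (R i (tr \<phi> k)) (ext i \<phi>)" for k
 proof -
  have "Lp_dist p M (u k) (tr \<phi> k) \<le> Lp_dist p M (u k) \<phi> + Lp_dist p M (tr \<phi> k) \<phi>"
   using Lp_norm_triangle[OF u(2)[of k] \<phi> tr(2)[OF \<phi>, of k] p0(2)]
    Lp_norm_diff_commute[of p M \<phi> "tr \<phi> k"] by simp
  from mult_left_mono[OF this C] show ?thesis
   using Lp_norm_triangle[OF R_Lp(1)[OF u(1)[of k] u(2)[of k]] R_Lp(1)[OF tr(1,2)[OF \<phi>, of k]] ext(1)[OF \<phi>] p0(2), of i i i]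
    R_diff_norm[OF u(1)[of k] u(2)[of k] tr(1,2)[OF \<phi>, of k], of i] by linarith
 qed
 show "(\<lambda>k. C * (Lp_dist p M (u k) \<phi> + Lp_dist p M (tr \<phi> k) \<phi>) + Lp_dist p M (R i (tr \<phi> k)) (ext i \<phi>)) \<longlonglongrightarrow> 0"
  using tendsto_add[OF tendsto_mult[OF tendsto_const tendsto_add[OF l tr(3)[OF \<phi>]]] ext(2)[OF \<phi>]] by simp
qed

lemma limits_eq:
 assumes "\<And>k. (v k :: 'a \<Rightarrow> complex) \<in> Lp p M" "g \<in> Lp p M" "h \<in> Lp p M"
  "(\<lambda>k. Lp_dist p M (v k) g) \<longlonglongrightarrow> 0" "(\<lambda>k. Lp_dist p M (v k) h) \<longlonglongrightarrow> 0"
 shows "AE x in M. g x = h x"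
 by (rule Lp_limits_eq_AE[OF Lp_diff(1)[OF assms(1,2) p0(2)] assms(4) p0(1) Lp_diff(1)[OF assms(1,3) p0(2)] assms(5) p0(1)])

lemma ext_extends:
 assumes "\<phi> \<in> Lp 2 M" "\<phi> \<in> Lp p M" shows "AE x in M. ext i \<phi> x = R i \<phi> x"
proof -
 have z: "Lp_dist p M \<phi> \<phi> = 0" by (simp add: Lp_norm_def)
 have "(\<lambda>k. Lp_dist p M (R i \<phi>) (ext i \<phi>)) \<longlonglongrightarrow> 0"
  by (rule ext_limit[OF assms(2) assms(1) assms(2)]) (simp only: z tendsto_const)
 moreover have "(\<lambda>k::nat. Lp_dist p M (R i \<phi>) (R i \<phi>)) \<longlonglongrightarrow> 0" by (simp add: Lp_norm_def)
 ultimately show ?thesis by (intro limits_eq[where v = "\<lambda>k. R i \<phi>"] R_Lp ext assms)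
qed

text \<open>Truncation is not linear. Therefore the combination of the truncations, rather than the
  truncation of the combination, is used as the approximating sequence in
  \<open>ext_limit\<close>.\<close>

lemma ext_linear:
 assumes \<phi>: "\<phi> \<in> Lp p M" and \<psi>: "\<psi> \<in> Lp p M"
 shows "AE x in M. ext i (\<lambda>x. c * \<phi> x + \<psi> x) x = c * ext i \<phi> x + ext i \<psi> x"
proof (rule limits_eq[where v = "\<lambda>k x. R i (\<lambda>x. c * tr \<phi> k x + tr \<psi> k x) x"])
 have c: "(\<lambda>x. c * tr \<phi> k x) \<in> Lp 2 M" "(\<lambda>x. c * tr \<phi> k x) \<in> Lp p M" for k
  using Lp_cmult(1)[OF tr(1)[OF \<phi>]] Lp_cmult(1)[OF tr(2)[OF \<phi>]] p0 by auto
 have u: "(\<lambda>x. c * tr \<phi> k x + tr \<psi> k x) \<in> Lp 2 M" "(\<lambda>x. c * tr \<phi> k x + tr \<psi> k x) \<in> Lp p M" for k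
  using Lp_add(1)[OF c(1) tr(1)[OF \<psi>]] Lp_add(1)[OF c(2) tr(2)[OF \<psi>]] p0 by auto
 have c\<phi>: "(\<lambda>x. c * \<phi> x) \<in> Lp p M" by (rule Lp_cmult(1)[OF \<phi> p0(1)])
 have lim: "(\<lambda>x. c * \<phi> x + \<psi> x) \<in> Lp p M" by (rule Lp_add(1)[OF c\<phi> \<psi> p0(2)])
 have ce: "(\<lambda>x. c * ext i \<phi> x) \<in> Lp p M" by (rule Lp_cmult(1)[OF ext(1)[OF \<phi>] p0(1)])
 show "R i (\<lambda>x. c * tr \<phi> k x + tr \<psi> k x) \<in> Lp p M" for k by (rule R_Lp(1)[OF u])
 show "ext i (\<lambda>x. c * \<phi> x + \<psi> x) \<in> Lp p M" by (rule ext(1)[OF lim])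
 show ce2: "(\<lambda>x. c * ext i \<phi> x + ext i \<psi> x) \<in> Lp p M" by (rule Lp_add(1)[OF ce ext(1)[OF \<psi>] p0(2)])
 have tri: "Lp_norm p M (\<lambda>x. (c * a x + b x) - (c * a' x + b' x)) \<le> norm c * Lp_dist p M a a' + Lp_dist p M b b'"
  if "a \<in> Lp p M" "a' \<in> Lp p M" "b \<in> Lp p M" "b' \<in> Lp p M" for a a' b b' :: "'a \<Rightarrow> complex"
 proof -
  have eq: "(\<lambda>x. (c * a x + b x) - (c * a' x + b' x)) = (\<lambda>x. c * (a x - a' x) + (b x - b' x))"
   by (simp add: fun_eq_iff algebra_simps)
  note d = Lp_diff(1)[OF that(1,2) p0(2)] and d' = Lp_diff(1)[OF that(3,4) p0(2)]
  show ?thesis unfolding eq using Lp_add(2)[OF Lp_cmult(1)[OF d p0(1), of c] d' p0(2)] Lp_cmult(2)[OF d p0(1), of c] by simp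
 qed
 have sq: "f \<longlonglongrightarrow> 0" if "g \<longlonglongrightarrow> 0" "h \<longlonglongrightarrow> 0" "\<And>k. 0 \<le> f k" "\<And>k. f k \<le> norm c * g k + h k" for f g h :: "nat \<Rightarrow> real"
  by (rule tendsto_0_squeeze[OF that(3,4)])
   (use tendsto_add[OF tendsto_mult[OF tendsto_const[of "norm c"] that(1)] that(2)] in simp)
 show "(\<lambda>k. Lp_norm p M (\<lambda>x. R i (\<lambda>x. c * tr \<phi> k x + tr \<psi> k x) x - ext i (\<lambda>x. c * \<phi> x + \<psi> x) x)) \<longlonglongrightarrow> 0"
 proof (rule ext_limit[OF lim u])
  show "(\<lambda>k. Lp_norm p M (\<lambda>x. c * tr \<phi> k x + tr \<psi> k x - (c * \<phi> x + \<psi> x))) \<longlonglongrightarrow> 0"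
   by (rule sq[OF tr(3)[OF \<phi>] tr(3)[OF \<psi>] Lp_norm_nonneg tri[OF tr(2)[OF \<phi>] \<phi> tr(2)[OF \<psi>] \<psi>]])
 qed
 show "(\<lambda>k. Lp_norm p M (\<lambda>x. R i (\<lambda>x. c * tr \<phi> k x + tr \<psi> k x) x - (c * ext i \<phi> x + ext i \<psi> x))) \<longlonglongrightarrow> 0"
 proof (rule sq[OF ext(2)[OF \<phi>, of i] ext(2)[OF \<psi>, of i] Lp_norm_nonneg])
  fix k
  note R\<phi> = R_Lp(1)[OF tr(1,2)[OF \<phi>, of k], of i] and R\<psi> = R_Lp(1)[OF tr(1,2)[OF \<psi>, of k], of i]
  have ae: "AE x in M. R i (\<lambda>x. c * tr \<phi> k x + tr \<psi> k x) x - (c * ext i \<phi> x + ext i \<psi> x)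
   = c * R i (tr \<phi> k) x + R i (tr \<psi> k) x - (c * ext i \<phi> x + ext i \<psi> x)"
   using R_add[OF c(1)[of k] tr(1)[OF \<psi>, of k], of i] R_cmult[OF tr(1)[OF \<phi>, of k], of i c] by eventually_elim simp
  have "Lp_norm p M (\<lambda>x. R i (\<lambda>x. c * tr \<phi> k x + tr \<psi> k x) x - (c * ext i \<phi> x + ext i \<psi> x))
   = Lp_norm p M (\<lambda>x. c * R i (tr \<phi> k) x + R i (tr \<psi> k) x - (c * ext i \<phi> x + ext i \<psi> x))"
   by (rule Lp_cong_AE(2)[OF ae borel_measurable_diff[OF Lp_meas[OF R_Lp(1)[OF u]] Lp_meas[OF ce2]]
     borel_measurable_diff[OF Lp_meas[OF Lp_add(1)[OF Lp_cmult(1)[OF R\<phi> p0(1)] R\<psi> p0(2)]] Lp_meas[OF ce2]]])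
  also have "\<dots> \<le> norm c * Lp_dist p M (R i (tr \<phi> k)) (ext i \<phi>) + Lp_dist p M (R i (tr \<psi> k)) (ext i \<psi>)"
   by (rule tri[OF R\<phi> ext(1)[OF \<phi>] R\<psi> ext(1)[OF \<psi>]])
  finally show "Lp_norm p M (\<lambda>x. R i (\<lambda>x. c * tr \<phi> k x + tr \<psi> k x) x - (c * ext i \<phi> x + ext i \<psi> x))
   \<le> norm c * Lp_dist p M (R i (tr \<phi> k)) (ext i \<phi>) + Lp_dist p M (R i (tr \<psi> k)) (ext i \<psi>)" .
 qed
qed

lemma ext_zero: "AE x in M. ext i (\<lambda>x. 0) x = 0"
proof -
 have "AE x in M. ext i (\<lambda>x. 0) x = R i (\<lambda>x. 0) x" by (rule ext_extends) (rule Lp_zero)+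
 moreover have "AE x in M. R i (\<lambda>x. 0) x = 0" using R_cmult[OF Lp_zero(1), of i 0] by simp
 ultimately show ?thesis by eventually_elim simp
qed

lemma ext_bound: assumes \<phi>: "\<phi> \<in> Lp p M" shows "Lp_norm p M (ext i \<phi>) \<le> C * Lp_norm p M \<phi>"
proof (rule LIMSEQ_le)
 show "(\<lambda>k. Lp_norm p M (R i (tr \<phi> k))) \<longlonglongrightarrow> Lp_norm p M (ext i \<phi>)"
  by (rule Lp_norm_limit[OF R_Lp(1)[OF tr(1,2)[OF \<phi>]] ext[OF \<phi>] p0(2)])
 show "(\<lambda>k. C * Lp_norm p M (tr \<phi> k)) \<longlonglongrightarrow> C * Lp_norm p M \<phi>"
  by (rule tendsto_mult[OF tendsto_const Lp_norm_limit[OF tr(2)[OF \<phi>] \<phi> tr(3)[OF \<phi>] p0(2)]])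
 show "\<exists>N. \<forall>n\<ge>N. Lp_norm p M (R i (tr \<phi> n)) \<le> C * Lp_norm p M (tr \<phi> n)"
  using R_Lp(2)[OF tr(1,2)[OF \<phi>]] by simp
qed

lemma ext_Lp_extension: "Lp_extension p M (R i) (ext i)"
proof -
 have a: "AE x in M. ext i (\<lambda>y. \<phi> y + \<psi> y) x = ext i \<phi> x + ext i \<psi> x" if "\<phi> \<in> Lp p M" "\<psi> \<in> Lp p M" for \<phi> \<psi>
  using ext_linear[OF that, of i 1] by simp
 have c: "AE x in M. ext i (\<lambda>y. c * \<phi> y) x = c * ext i \<phi> x" if "\<phi> \<in> Lp p M" for \<phi> c
  using ext_linear[OF that Lp_zero(1), of i c] ext_zero[of i] unfolding add_0_right by eventually_elim simp
 show ?thesis unfolding Lp_extension_def bounded_linear_Lp_def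
  by (intro conjI ballI allI a c ext ext_extends exI[of _ C] ext_bound) auto
qed

text \<open>An extension is continuous and agrees with \<open>R i\<close> on truncations. Uniqueness
  and the norm estimate for arbitrary extensions both rest on this.\<close>

lemma Lp_extension_limit:
 assumes T: "Lp_extension p M (R i) T" and \<phi>: "(\<phi> :: 'a \<Rightarrow> complex) \<in> Lp p M"
 shows "T \<phi> \<in> Lp p M" "(\<lambda>k. Lp_dist p M (R i (tr \<phi> k)) (T \<phi>)) \<longlonglongrightarrow> 0"
proof -
 have bl: "bounded_linear_Lp p M T" using T by (simp add: Lp_extension_def)
 have agree: "AE x in M. T g x = R i g x" if "g \<in> Lp 2 M" "g \<in> Lp p M" for g
  using T that by (simp add: Lp_extension_def)
 have T_Lp: "T g \<in> Lp p M" if "g \<in> Lp p M" for g using bl that by (simp add: bounded_linear_Lp_def)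
 have T_add: "AE x in M. T (\<lambda>y. g y + h y) x = T g x + T h x" if "g \<in> Lp p M" "h \<in> Lp p M" for g h
  using bl that by (simp add: bounded_linear_Lp_def)
 obtain K where K: "\<forall>f\<in>Lp p M. Lp_norm p M (T f) \<le> K * Lp_norm p M f"
  using bl unfolding bounded_linear_Lp_def by (elim conjE exE)
 show "T \<phi> \<in> Lp p M" by (rule T_Lp[OF \<phi>])
 show "(\<lambda>k. Lp_dist p M (R i (tr \<phi> k)) (T \<phi>)) \<longlonglongrightarrow> 0"
 proof (rule tendsto_0_squeeze[OF Lp_norm_nonneg])
  show "(\<lambda>k. K * Lp_dist p M (tr \<phi> k) \<phi>) \<longlonglongrightarrow> 0"
   using tendsto_mult[OF tendsto_const[of K] tr(3)[OF \<phi>]] by simp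
  fix k
  have d: "(\<lambda>x. tr \<phi> k x - \<phi> x) \<in> Lp p M" by (rule Lp_diff(1)[OF tr(2)[OF \<phi>] \<phi> p0(2)])
  have "AE x in M. R i (tr \<phi> k) x - T \<phi> x = T (\<lambda>x. tr \<phi> k x - \<phi> x) x"
   using T_add[OF d \<phi>] agree[OF tr(1,2)[OF \<phi>, of k]] by eventually_elim simp
  from Lp_cong_AE(2)[OF this borel_measurable_diff[OF Lp_meas[OF R_Lp(1)[OF tr(1,2)[OF \<phi>]]] Lp_meas[OF T_Lp[OF \<phi>]]] Lp_meas[OF T_Lp[OF d]], of p]
  show "Lp_dist p M (R i (tr \<phi> k)) (T \<phi>) \<le> K * Lp_dist p M (tr \<phi> k) \<phi>" using bspec[OF K d] by simp
 qed
qed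

theorem extends_uniquely: "extends_uniquely_Lp p M (R i)" unfolding extends_uniquely_Lp_def
proof (intro exI[of _ "ext i"] conjI allI impI ballI ext_Lp_extension)
 fix T and \<phi> :: "'a \<Rightarrow> complex" assume T: "Lp_extension p M (R i) T" and \<phi>: "(\<phi> :: 'a \<Rightarrow> complex) \<in> Lp p M"
 show "AE x in M. T \<phi> x = ext i \<phi> x"
  by (rule limits_eq[OF R_Lp(1)[OF tr(1,2)[OF \<phi>]] Lp_extension_limit(1)[OF T \<phi>] ext(1)[OF \<phi>] Lp_extension_limit(2)[OF T \<phi>] ext(2)[OF \<phi>]])
qed

text \<open>For any extensions \<open>T i\<close>, the square function of T at \<phi> differs from
  that of R at a truncation by at most the sum of the componentwise differences, which tends to 0 in
  norm. The joint constant \<open>C\<close> is thus preserved.\<close>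

theorem op_norm_le:
 assumes T: "\<And>i. Lp_extension p M (R i) (T i)"
 shows "Lp_op_norm p M (l2_vec T) \<le> ennreal C" unfolding Lp_op_norm_def
proof (rule Inf_lower, rule CollectI, intro exI[of _ C] conjI C refl ballI)
 fix \<phi> :: "'a \<Rightarrow> complex" assume \<phi>: "\<phi> \<in> Lp p M"
 let ?D = "\<lambda>k x. l2_vec T \<phi> x - l2_vec R (tr \<phi> k) x" and ?S = "\<lambda>k. \<Sum>i\<in>UNIV. Lp_dist p M (R i (tr \<phi> k)) (T i \<phi>)"
  and ?s = "\<lambda>k x. \<Sum>i\<in>UNIV. norm (R i (tr \<phi> k) x - T i \<phi> x)"
 note TL = Lp_extension_limit[OF T \<phi>]
 have m: "l2_vec T \<phi> \<in> borel_measurable M" by (intro l2_vec_measurable Lp_meas[OF TL(1)])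
 have diff: "?D k \<in> Lp p M"
  "Lp_dist p M (l2_vec T \<phi>) (l2_vec R (tr \<phi> k)) \<le> ?S k" for k
 proof -
  have l: "(\<lambda>x. R i (tr \<phi> k) x - T i \<phi> x) \<in> Lp p M" for i
   by (rule Lp_diff(1)[OF R_Lp(1)[OF tr(1,2)[OF \<phi>]] TL(1) p0(2)])
  note s = Lp_sum_norm_le[where f = "\<lambda>i x. R i (tr \<phi> k) x - T i \<phi> x", OF finite_class.finite_UNIV l p0(2)]
  have ae: "AE x in M. norm (l2_vec T \<phi> x - l2_vec R (tr \<phi> k) x) \<le> norm (?s k x)"
  proof (rule AE_I2)
   fix x
   have "0 \<le> (?s k x)" by (intro sum_nonneg norm_ge_zero)
   thus "norm (l2_vec T \<phi> x - l2_vec R (tr \<phi> k) x) \<le> norm (?s k x)"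
    using l2_vec_diff_le[of T \<phi> x R "tr \<phi> k"] by (simp add: norm_minus_commute)
  qed
  have mm: "?D k \<in> borel_measurable M"
   by (intro borel_measurable_diff m l2_vec_measurable Lp_meas[OF R_L2[OF tr(1)[OF \<phi>]]])
  note d = Lp_dominated[OF s(1) mm ae p0(1)]
  show "?D k \<in> Lp p M" by (rule d(1))
  show "Lp_dist p M (l2_vec T \<phi>) (l2_vec R (tr \<phi> k)) \<le> ?S k"
   using d(2) s(2) by linarith
 qed
 note b = R_bound[OF tr(1,2)[OF \<phi>]]
 show "l2_vec T \<phi> \<in> Lp p M" using Lp_add(1)[OF diff(1)[of 0] b[of 0, THEN conjunct1] p0(2)] by simp
 show "Lp_norm p M (l2_vec T \<phi>) \<le> C * Lp_norm p M \<phi>"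
 proof (rule LIMSEQ_le_const)
  have "(\<lambda>k. ?S k + C * Lp_norm p M (tr \<phi> k)) \<longlonglongrightarrow> (\<Sum>i\<in>(UNIV::'d set). 0) + C * Lp_norm p M \<phi>"
   by (rule tendsto_add[OF tendsto_sum[OF TL(2)] tendsto_mult[OF tendsto_const Lp_norm_limit[OF tr(2)[OF \<phi>] \<phi> tr(3)[OF \<phi>] p0(2)]]])
  thus "(\<lambda>k. ?S k + C * Lp_norm p M (tr \<phi> k)) \<longlonglongrightarrow> C * Lp_norm p M \<phi>" by simp
  have "Lp_norm p M (l2_vec T \<phi>) \<le> ?S k + C * Lp_norm p M (tr \<phi> k)" for k
  proof -
   have "Lp_norm p M (l2_vec T \<phi>) \<le> Lp_dist p M (l2_vec T \<phi>) (l2_vec R (tr \<phi> k)) + Lp_norm p M (l2_vec R (tr \<phi> k))"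
    using Lp_add(2)[OF diff(1)[of k] b[of k, THEN conjunct1] p0(2)] by simp
   thus ?thesis using diff(2)[of k] b[of k, THEN conjunct2] by linarith
  qed
  thus "\<exists>N. \<forall>k\<ge>N. Lp_norm p M (l2_vec T \<phi>) \<le> ?S k + C * Lp_norm p M (tr \<phi> k)"
   by (intro exI[of _ 0]) simp
 qed
qed

end

section \<open>The \<open>L\<^sup>p\<close> estimate\<close>

text \<open>The null sequence used for the shift \<epsilon> and for the cap k at the same
  time.\<close>

definition ep :: "nat \<Rightarrow> real" where "ep m = 1 / real (Suc m)"

lemma ep: "0 < ep m" "ep m \<le> 1" "ep \<longlonglongrightarrow> 0"
 using LIMSEQ_inverse_real_of_nat by (auto simp: ep_def[abs_def] inverse_eq_divide field_simps)

lemma powr_ep_tendsto: assumes "0 \<le> t" "0 < r" shows "(\<lambda>m. (ep m + t^2) powr (r / 2)) \<longlonglongrightarrow> t powr r"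
proof -
 have "(\<lambda>m. (ep m + t^2) powr (r / 2)) \<longlonglongrightarrow> (0 + t^2) powr (r / 2)"
  by (rule tendsto_powr2[OF tendsto_add[OF ep(3) tendsto_const] tendsto_const])
   (use assms less_imp_le[OF ep(1)] in \<open>auto intro!: always_eventually add_nonneg_nonneg\<close>)
 moreover have "(0 + t^2) powr (r / 2) = t powr r" using assms powr_powr[of t 2 "r / 2"] by simp
 ultimately show ?thesis by simp
qed

text \<open>In the form of \<open>pw_D_eq\<close> no negative power occurs, so the limit is also
  available at t = 0.\<close>

lemma pw_D_tendsto:
 assumes p: "2 \<le> p" and t: "0 \<le> t"
 shows "(\<lambda>m. pw_D p (ep m) (ep m + t^2)) \<longlonglongrightarrow> t powr (1 + 1 / (p - 1))"
proof -
 define g where "g = 1 / (p - 1)"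
 have g: "0 < g" using p by (simp add: g_def)
 have pos: "0 < ep m + t^2" for m using ep(1)[of m] by (intro add_pos_nonneg) auto
 have "(\<lambda>m. (ep m + t^2) powr ((1 + g) / 2) * (1 + ep m * (ep m + t^2) powr (g / 2)) powr (p - 2))
  \<longlonglongrightarrow> t powr (1 + g) * (1 + 0 * t powr g) powr (p - 2)"
  using g by (intro tendsto_mult tendsto_powr[OF tendsto_add[OF tendsto_const tendsto_mult[OF ep(3)]] tendsto_const] powr_ep_tendsto t) auto
 thus ?thesis using pw_D_eq[OF pos less_imp_le[OF ep(1)] p] by (simp add: g_def)
qed

text \<open>\<open>U\<close> is the upper bound of the Bellman function that will be used; without
  shift and cap it consists of pure powers. Both parameters are at most 1, so \<open>W\<close>
  dominates for all m, which uses that s is in L^p and t in L^2.\<close>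

lemma (in prob_space) bellman_limit:
 fixes s t :: "'a \<Rightarrow> real"
 assumes p: "2 \<le> p" and s: "s \<in> borel_measurable M" "\<And>x. 0 \<le> s x" "integrable M (\<lambda>x. s x powr p)"
  and t: "t \<in> borel_measurable M" "\<And>x. 0 \<le> t x" "integrable M (\<lambda>x. (t x)^2)"
 defines "g \<equiv> 1 / (p - 1)"
 defines "U \<equiv> \<lambda>m x. pw_D p (ep m) (ep m + (t x)^2) + g / 22 * ((ep m + (s x)^2) powr (p / 2) + (ep m + (t x)^2) powr ((1 + g) / 2))"
 shows "(\<lambda>m. LINT x|M. U m x) \<longlonglongrightarrow> (1 + g / 22) * (LINT x|M. t x powr (1 + g)) + g / 22 * (LINT x|M. s x powr p)"
  "integrable M (U m)" "integrable M (\<lambda>x. t x powr (1 + g))"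
proof -
 have g: "0 < g" "g \<le> 1" using p by (auto simp: g_def)
 define W where "W = (\<lambda>x. 2 powr (p - 2) * (2 + (t x)^2) + g / 22 * (2 powr (p / 2) * (1 + s x powr p) + (2 + (t x)^2)))"
 have W: "integrable M W" unfolding W_def
  by (intro Bochner_Integration.integrable_add integrable_mult_right integrable_const s(3) t(3))
 have pos: "0 < ep m + (y::real)^2" for m y using ep(1)[of m] by (intro add_pos_nonneg) auto
 have le1: "b powr ((1 + g) / 2) \<le> 1 + b" if "0 < b" for b :: real
 proof (cases "b \<le> 1")
  case True
  hence "b powr ((1 + g) / 2) \<le> 1 powr ((1 + g) / 2)" using that g by (intro powr_mono2) auto
  thus ?thesis using that by simp
 next
  case False
  hence "b powr ((1 + g) / 2) \<le> b powr 1" using g by (intro powr_mono) auto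
  thus ?thesis using that by simp
 qed
 have le2: "(ep m + y^2) powr (p / 2) \<le> 2 powr (p / 2) * (1 + y powr p)" if "0 \<le> y" for m y
 proof -
  have "(ep m + y^2) \<le> 2 * max 1 (y^2)" using ep(2)[of m] by (auto simp: max_def)
  hence "(ep m + y^2) powr (p / 2) \<le> (2 * max 1 (y^2)) powr (p / 2)" using p pos[of m y] by (intro powr_mono2) auto
  also have "\<dots> = 2 powr (p / 2) * max 1 (y^2) powr (p / 2)" by (simp add: powr_mult)
  also have "max 1 (y^2) powr (p / 2) \<le> 1 + y powr p" using powr_powr[of y 2 "p / 2"] that by (auto simp: max_def)
  finally show ?thesis by simp
 qed
 have U0: "0 \<le> U m x" for m x
  unfolding U_def using g pos[of m "t x"] by (intro add_nonneg_nonneg mult_nonneg_nonneg) (auto simp: pw_D_def)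
 have UW: "norm (U m x) \<le> W x" for m x
 proof -
  have "pw_D p (ep m) (ep m + (t x)^2) \<le> (1 + ep m) powr (p - 2) * (1 + (ep m + (t x)^2))" by (rule pw_D_le[OF pos ep(1) p])
  also have "\<dots> \<le> 2 powr (p - 2) * (2 + (t x)^2)" using ep(1,2)[of m] p by (intro mult_mono powr_mono2) auto
  finally have "pw_D p (ep m) (ep m + (t x)^2) \<le> 2 powr (p - 2) * (2 + (t x)^2)" .
  moreover have "(ep m + (t x)^2) powr ((1 + g) / 2) \<le> 2 + (t x)^2" using le1[OF pos[of m "t x"]] ep(2)[of m] by simp
  ultimately have "U m x \<le> W x" unfolding U_def W_def using g le2[OF s(2)[of x], of m] by (intro add_mono mult_left_mono) auto
  thus ?thesis using U0[of m x] by simp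
 qed
 have Um: "U m \<in> borel_measurable M" for m unfolding U_def pw_D_def using s(1) t(1) by measurable
 show "integrable M (U m)" by (rule Bochner_Integration.integrable_bound[OF W Um AE_I2]) (use UW in \<open>auto intro: order_trans[OF _ abs_ge_self]\<close>)
 define U0 where "U0 = (\<lambda>x. t x powr (1 + g) + g / 22 * (s x powr p + t x powr (1 + g)))"
 have U0m: "U0 \<in> borel_measurable M" unfolding U0_def using s(1) t(1) by measurable
 have lim: "(\<lambda>m. U m x) \<longlonglongrightarrow> U0 x" for x unfolding U_def U0_def using p g
  by (intro tendsto_add tendsto_mult tendsto_const powr_ep_tendsto s(2) t(2) pw_D_tendsto[OF p t(2), folded g_def]) auto
 have "(\<lambda>m. LINT x|M. U m x) \<longlonglongrightarrow> (LINT x|M. U0 x)"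
  by (rule integral_dominated_convergence[OF U0m Um W]) (use lim UW in auto)
 moreover show ti: "integrable M (\<lambda>x. t x powr (1 + g))"
 proof (rule Bochner_Integration.integrable_bound[where f = "\<lambda>x. 1 + (t x)^2"])
  show "integrable M (\<lambda>x. 1 + (t x)^2)" using t(3) by simp
  show "AE x in M. norm (t x powr (1 + g)) \<le> norm (1 + (t x)^2)"
  proof (rule AE_I2)
   fix x
   have "t x powr (1 + g) \<le> 1 + (t x)^2"
   proof (cases "t x = 0")
    case False
    hence "0 < (t x)\<^sup>2" by simp
    from le1[OF this] show ?thesis using powr_powr[of "t x" 2 "(1 + g) / 2"] t(2)[of x] by (simp del: distrib_left_numeral)
   qed (use g in simp)
   thus "norm (t x powr (1 + g)) \<le> norm (1 + (t x)^2)" by simp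
  qed
 qed (use t(1) in measurable)
 moreover have "(LINT x|M. U0 x) = (1 + g / 22) * (LINT x|M. t x powr (1 + g)) + g / 22 * (LINT x|M. s x powr p)"
  unfolding U0_def using ti s(3) by (simp add: algebra_simps)
 ultimately show "(\<lambda>m. LINT x|M. U m x) \<longlonglongrightarrow> (1 + g / 22) * (LINT x|M. t x powr (1 + g)) + g / 22 * (LINT x|M. s x powr p)" by simp
qed

text \<open>Two bounds for two purposes: the first one survives the limit k to 0, the second one is
  the linear growth needed in L^2 and has a constant that may blow up in this limit.\<close>

lemma bellman_upper:
 fixes p k a b :: real
 assumes p: "2 \<le> p" and k: "0 < k" and ab: "0 < a" "0 < b"
 defines "g \<equiv> 1 / (p - 1)"
 defines "N \<equiv> a powr (p / 2) + b powr ((1 + g) / 2)"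
 shows "pw_D p k b + g / 22 * (a * pw_T p k N) \<le> pw_D p k b + g / 22 * (a powr (p / 2) + b powr ((1 + g) / 2))"
  "pw_D p k b + g / 22 * (a * pw_T p k N) \<le> ((1 + k) powr (p - 2) + g / 22 * k powr (2 - p)) * (1 + a + b)"
proof -
 have g: "0 < g" using p by (auto simp: g_def)
 have N: "0 < N" "a powr (p / 2) \<le> N" using ab by (auto simp: N_def intro: add_pos_nonneg)
 show "pw_D p k b + g / 22 * (a * pw_T p k N) \<le> pw_D p k b + g / 22 * (a powr (p / 2) + b powr ((1 + g) / 2))"
  using pw_T_le[OF N ab(1) k p] g unfolding N_def[symmetric] by (intro add_left_mono mult_left_mono) (auto simp: mult.commute)
 have D: "pw_D p k b \<le> (1 + k) powr (p - 2) * (1 + a + b)"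
  using pw_D_le[OF ab(2) k p] ab by (elim order_trans) (intro mult_left_mono, auto)
 have "a * pw_T p k N \<le> (1 + a + b) * k powr (2 - p)"
  using pw_T_bounds(1,6)[OF N(1) k p] ab by (intro mult_mono) auto
 hence T: "g / 22 * (a * pw_T p k N) \<le> g / 22 * ((1 + a + b) * k powr (2 - p))" using g by (intro mult_left_mono) auto
 have ring: "X * S + c * (S * K) = (X + c * K) * S" for X S c K :: real by (simp add: algebra_simps)
 have "pw_D p k b + g / 22 * (a * pw_T p k N) \<le> (1 + k) powr (p - 2) * (1 + a + b) + g / 22 * ((1 + a + b) * k powr (2 - p))"
  by (rule add_mono[OF D T])
 thus "pw_D p k b + g / 22 * (a * pw_T p k N) \<le> ((1 + k) powr (p - 2) + g / 22 * k powr (2 - p)) * (1 + a + b)"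
  unfolding ring .
qed

context mode_family
begin

definition pairing :: "real \<Rightarrow> (('d \<Rightarrow> real) \<Rightarrow> complex) \<Rightarrow> ('d \<Rightarrow> ('d \<Rightarrow> real) \<Rightarrow> complex) \<Rightarrow> complex" where
 "pairing a \<phi> g = (\<Sum>i\<in>UNIV. LINT x|PM. Riesz a i \<phi> x * cnj (g i x))"

definition gnorm :: "('d \<Rightarrow> ('d \<Rightarrow> real) \<Rightarrow> complex) \<Rightarrow> ('d \<Rightarrow> real) \<Rightarrow> real" where
 "gnorm g x = sqrt (\<Sum>i\<in>UNIV. (norm (g i x))^2)"

lemma gnorm: "0 \<le> gnorm g x" "(gnorm g x)^2 = (\<Sum>i\<in>UNIV. (norm (g i x))^2)"
 by (auto simp: gnorm_def sum_nonneg)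

lemma gnorm_measurable: "(\<And>i. g i \<in> borel_measurable PM) \<Longrightarrow> gnorm g \<in> borel_measurable PM"
 unfolding gnorm_def[abs_def] by measurable

lemma gnorm_L2:
 assumes "\<And>i. g i \<in> Lp 2 PM" shows "integrable PM (\<lambda>x. (gnorm g x)^2)" "gnorm g \<in> borel_measurable PM"
 using assms gnorm_measurable[of g] by (auto simp: gnorm(2) Lp_2_iff)

text \<open>The two parts differ in who carries the large exponent p \<ge> 2: first \<phi>, then the
  vector g. In both, shift and cap are removed after the embedding on L^2, and 1 + \<gamma> is the
  conjugate exponent.\<close>

lemma embedding_powr:
 fixes p :: real
 assumes p: "2 \<le> p" and a: "0 \<le> a" and \<phi>: "\<phi> \<in> Lp 2 PM" and g: "\<And>i. g i \<in> Lp 2 PM"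
 defines "\<gamma> \<equiv> 1 / (p - 1)"
 shows "integrable PM (\<lambda>x. norm (\<phi> x) powr p) \<Longrightarrow> \<gamma> / 16 * Re (pairing a \<phi> g)
   \<le> (1 + \<gamma> / 22) * (LINT x|PM. gnorm g x powr (1 + \<gamma>)) + \<gamma> / 22 * (LINT x|PM. norm (\<phi> x) powr p)"
  and "integrable PM (\<lambda>x. gnorm g x powr p) \<Longrightarrow> \<gamma> / 16 * Re (pairing a \<phi> g)
   \<le> (1 + \<gamma> / 22) * (LINT x|PM. norm (\<phi> x) powr (1 + \<gamma>)) + \<gamma> / 22 * (LINT x|PM. gnorm g x powr p)"
proof -
 have nm: "(\<lambda>x. norm (\<phi> x)) \<in> borel_measurable PM" using Lp_meas[OF \<phi>] by measurable
 have n2: "integrable PM (\<lambda>x. (norm (\<phi> x))^2)" using \<phi> by (simp add: Lp_2_iff)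
 note gm = gnorm_L2[of g, OF g]
 define B where "B = (\<lambda>k a b. pw_D p k b + \<gamma> / 22 * (a * pw_T p k (a powr (p / 2) + b powr ((1 + \<gamma>) / 2))))"
 have pos: "0 < ep m + (y::real)^2" for m y using ep(1)[of m] by (intro add_pos_nonneg) auto
 have B_eq: "pw_D p k b + \<gamma> / 22 * (a * pw_T p k (a powr (p / 2) + b powr ((1 + \<gamma>) / 2))) = B k a b" for k a b
  by (simp add: B_def)
 note up = bellman_upper[OF p, folded \<gamma>_def, unfolded B_eq]
 {
  assume i: "integrable PM (\<lambda>x. norm (\<phi> x) powr p)"
  note bl = PM.bellman_limit[OF p nm norm_ge_zero i gm(2) gnorm(1) gm(1), folded \<gamma>_def]
  show "\<gamma> / 16 * Re (pairing a \<phi> g) \<le> (1 + \<gamma> / 22) * (LINT x|PM. gnorm g x powr (1 + \<gamma>)) + \<gamma> / 22 * (LINT x|PM. norm (\<phi> x) powr p)"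
  proof (rule tendsto_lowerbound[OF bl(1)], intro always_eventually allI)
   fix m
   obtain Ba Bb Baa Bab Bbb where bm: "bellman (\<gamma> / 8) (B (ep m)) Ba Bb Baa Bab Bbb"
    using bellman_function[OF p ep(1)[of m]] unfolding B_def \<gamma>_def by (elim exE)
   note e = embedding_L2[where g = g, OF bm ep(1)[of m] a up(2)[OF ep(1)] \<phi> g, folded gnorm(2)]
   have "\<gamma> / 16 * Re (pairing a \<phi> g) \<le> (LINT x|PM. B (ep m) (ep m + (norm (\<phi> x))^2) (ep m + (gnorm g x)^2))"
    using e(1) unfolding pairing_def by linarith
   also have "\<dots> \<le> (LINT x|PM. pw_D p (ep m) (ep m + (gnorm g x)^2) + \<gamma> / 22 * ((ep m + (norm (\<phi> x))^2) powr (p / 2) + (ep m + (gnorm g x)^2) powr ((1 + \<gamma>) / 2)))"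
    by (rule integral_mono[OF e(2) bl(2) up(1)[OF ep(1) pos pos]])
   finally show "\<gamma> / 16 * Re (pairing a \<phi> g) \<le> \<dots>" .
  qed simp
 next
  assume i: "integrable PM (\<lambda>x. gnorm g x powr p)"
  note bl = PM.bellman_limit[OF p gm(2) gnorm(1) i nm norm_ge_zero n2, folded \<gamma>_def]
  show "\<gamma> / 16 * Re (pairing a \<phi> g) \<le> (1 + \<gamma> / 22) * (LINT x|PM. norm (\<phi> x) powr (1 + \<gamma>)) + \<gamma> / 22 * (LINT x|PM. gnorm g x powr p)"
  proof (rule tendsto_lowerbound[OF bl(1)], intro always_eventually allI)
   fix m
   obtain Ba Bb Baa Bab Bbb where bm: "bellman (\<gamma> / 8) (B (ep m)) Ba Bb Baa Bab Bbb"
    using bellman_function[OF p ep(1)[of m]] unfolding B_def \<gamma>_def by (elim exE)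
   have up2: "B (ep m) t s \<le> ((1 + ep m) powr (p - 2) + \<gamma> / 22 * (ep m) powr (2 - p)) * (1 + s + t)" if "0 < s" "0 < t" for s t
    using up(2)[OF ep(1) that(2,1), of m] by (simp only: add.commute add.left_commute)
   \<comment> \<open>Exchanged arguments: the slot with exponent p now receives
     \<open>gnorm g\<close>.\<close>
   note e = embedding_L2[where g = g, OF bellman.flip[OF bm] ep(1)[of m] a up2 \<phi> g, folded gnorm(2)]
   have "\<gamma> / 16 * Re (pairing a \<phi> g) \<le> (LINT x|PM. B (ep m) (ep m + (gnorm g x)^2) (ep m + (norm (\<phi> x))^2))"
    using e(1) unfolding pairing_def by linarith
   also have "\<dots> \<le> (LINT x|PM. pw_D p (ep m) (ep m + (norm (\<phi> x))^2) + \<gamma> / 22 * ((ep m + (gnorm g x)^2) powr (p / 2) + (ep m + (norm (\<phi> x))^2) powr ((1 + \<gamma>) / 2)))"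
    by (rule integral_mono[OF e(2) bl(2) up(1)[OF ep(1) pos pos]])
   finally show "\<gamma> / 16 * Re (pairing a \<phi> g) \<le> \<dots>" .
  qed simp
 }
qed

end

text \<open>Terms that vanish may be left out of the index set. This removes the index (1, ..., 1),
  at which every partial derivative is zero.\<close>

lemma has_L2_sum_transfer:
 assumes u: "has_L2_sum M u A g" and B: "B \<subseteq> A" "finite (A - B)"
  and eq: "\<And>n x. n \<in> B \<Longrightarrow> x \<in> space M \<Longrightarrow> v n x = u n x"
  and z: "\<And>n x. n \<in> A - B \<Longrightarrow> x \<in> space M \<Longrightarrow> u n x = 0"
 shows "has_L2_sum M v B g" unfolding has_L2_sum_def
proof (intro conjI ballI)
 show "g \<in> Lp 2 M" using u by (simp add: has_L2_sum_def)
 show "v n \<in> Lp 2 M" if n: "n \<in> B" for n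
 proof -
  have un: "u n \<in> Lp 2 M" using u n B by (auto simp: has_L2_sum_def)
  have m: "v n \<in> borel_measurable M" using measurable_cong[of M "v n" "u n" borel] eq[OF n] Lp_meas[OF un] by simp
  have "AE x in M. v n x = u n x" by (rule AE_I2[OF eq[OF n]])
  from Lp_cong_AE(1)[OF this m Lp_meas[OF un], of 2] show ?thesis using un by simp
 qed
 \<comment> \<open>Adding the finitely many dropped indices maps large finite subsets of
   \<open>B\<close> to large finite subsets of \<open>A\<close>.\<close>
 have flt: "filterlim (\<lambda>F. F \<union> (A - B)) (finite_subsets_at_top A) (finite_subsets_at_top B)"
  unfolding filterlim_iff
 proof (intro allI impI)
  fix P assume "eventually P (finite_subsets_at_top A)"
  then obtain X where X: "finite X" "X \<subseteq> A" "\<forall>Y. finite Y \<and> X \<subseteq> Y \<and> Y \<subseteq> A \<longrightarrow> P Y"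
   unfolding eventually_finite_subsets_at_top by (elim exE conjE) simp
  show "\<forall>\<^sub>F F in finite_subsets_at_top B. P (F \<union> (A - B))"
   unfolding eventually_finite_subsets_at_top
  proof (intro exI[of _ "X \<inter> B"] conjI allI impI)
   fix Y assume "finite Y \<and> X \<inter> B \<subseteq> Y \<and> Y \<subseteq> B"
   hence "finite (Y \<union> (A - B)) \<and> X \<subseteq> Y \<union> (A - B) \<and> Y \<union> (A - B) \<subseteq> A" using B X(2) by auto
   thus "P (Y \<union> (A - B))" using X(3) by simp
  qed (use X in auto)
 qed
 have lim: "((\<lambda>F. Lp_norm 2 M (\<lambda>x. (\<Sum>n\<in>F. u n x) - g x)) \<longlongrightarrow> 0) (finite_subsets_at_top A)"
  using u by (simp add: has_L2_sum_def)
 have "\<forall>\<^sub>F F in finite_subsets_at_top B. Lp_norm 2 M (\<lambda>x. (\<Sum>n\<in>F \<union> (A - B). u n x) - g x) = Lp_norm 2 M (\<lambda>x. (\<Sum>n\<in>F. v n x) - g x)"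
 proof (rule eventually_finite_subsets_at_top_weakI)
  fix F assume F: "finite F" "F \<subseteq> B"
  have "(\<Sum>n\<in>F \<union> (A - B). u n x) = (\<Sum>n\<in>F. v n x)" if x: "x \<in> space M" for x
  proof -
   have "(\<Sum>n\<in>F. v n x) = (\<Sum>n\<in>F. u n x)" by (rule sum.cong) (use F eq x in auto)
   also have "\<dots> = (\<Sum>n\<in>F \<union> (A - B). u n x)"
    by (rule sum.mono_neutral_left) (use F B z x in auto)
   finally show ?thesis by simp
  qed
  thus "Lp_norm 2 M (\<lambda>x. (\<Sum>n\<in>F \<union> (A - B). u n x) - g x) = Lp_norm 2 M (\<lambda>x. (\<Sum>n\<in>F. v n x) - g x)"
   unfolding Lp_norm_def by (intro arg_cong[where f = "\<lambda>t. t powr (1 / 2)"] Bochner_Integration.integral_cong) auto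
 qed
 from Lim_transform_eventually[OF filterlim_compose[OF lim flt] this]
 show "((\<lambda>F. Lp_norm 2 M (\<lambda>x. (\<Sum>n\<in>F. v n x) - g x)) \<longlongrightarrow> 0) (finite_subsets_at_top B)" .
qed

lemma has_L2_sum_linear:
 assumes u: "has_L2_sum M u A g" and v: "has_L2_sum M v A h"
 shows "has_L2_sum M (\<lambda>n x. c * u n x + v n x) A (\<lambda>x. c * g x + h x)"
proof -
 have L: "g \<in> Lp 2 M" "h \<in> Lp 2 M" "\<And>n. n \<in> A \<Longrightarrow> u n \<in> Lp 2 M" "\<And>n. n \<in> A \<Longrightarrow> v n \<in> Lp 2 M"
  using u v by (auto simp: has_L2_sum_def)
 have lin: "(\<lambda>x. c * a x + b x) \<in> Lp 2 M" "Lp_norm 2 M (\<lambda>x. c * a x + b x) \<le> norm c * Lp_norm 2 M a + Lp_norm 2 M b"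
  if "a \<in> Lp 2 M" "b \<in> Lp 2 M" for a b :: "'a \<Rightarrow> complex"
  using Lp_add[OF Lp_cmult(1)[OF that(1), of c] that(2)] Lp_cmult(2)[OF that(1), of c] by simp_all
 have lim: "((\<lambda>F. norm c * Lp_norm 2 M (\<lambda>x. (\<Sum>n\<in>F. u n x) - g x) + Lp_norm 2 M (\<lambda>x. (\<Sum>n\<in>F. v n x) - h x)) \<longlongrightarrow> 0) (finite_subsets_at_top A)"
 proof -
  have "((\<lambda>F. norm c * Lp_norm 2 M (\<lambda>x. (\<Sum>n\<in>F. u n x) - g x) + Lp_norm 2 M (\<lambda>x. (\<Sum>n\<in>F. v n x) - h x)) \<longlongrightarrow> norm c * 0 + 0) (finite_subsets_at_top A)"
   using u v unfolding has_L2_sum_def by (intro tendsto_add tendsto_mult tendsto_const) auto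
  thus ?thesis by simp
 qed
 have "((\<lambda>F. Lp_norm 2 M (\<lambda>x. (\<Sum>n\<in>F. c * u n x + v n x) - (c * g x + h x))) \<longlongrightarrow> 0) (finite_subsets_at_top A)"
 proof (rule tendsto_sandwich[OF _ _ tendsto_const lim])
  show "\<forall>\<^sub>F F in finite_subsets_at_top A. 0 \<le> Lp_norm 2 M (\<lambda>x. (\<Sum>n\<in>F. c * u n x + v n x) - (c * g x + h x))"
   by (intro always_eventually allI Lp_norm_nonneg)
  show "\<forall>\<^sub>F F in finite_subsets_at_top A. Lp_norm 2 M (\<lambda>x. (\<Sum>n\<in>F. c * u n x + v n x) - (c * g x + h x))
   \<le> norm c * Lp_norm 2 M (\<lambda>x. (\<Sum>n\<in>F. u n x) - g x) + Lp_norm 2 M (\<lambda>x. (\<Sum>n\<in>F. v n x) - h x)"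
  proof (rule eventually_finite_subsets_at_top_weakI)
   fix F assume F: "finite F" "F \<subseteq> A"
   have eq: "(\<lambda>x. (\<Sum>n\<in>F. c * u n x + v n x) - (c * g x + h x)) = (\<lambda>x. c * ((\<Sum>n\<in>F. u n x) - g x) + ((\<Sum>n\<in>F. v n x) - h x))"
    by (simp add: fun_eq_iff sum.distrib sum_distrib_left algebra_simps)
   show "Lp_norm 2 M (\<lambda>x. (\<Sum>n\<in>F. c * u n x + v n x) - (c * g x + h x))
    \<le> norm c * Lp_norm 2 M (\<lambda>x. (\<Sum>n\<in>F. u n x) - g x) + Lp_norm 2 M (\<lambda>x. (\<Sum>n\<in>F. v n x) - h x)"
    unfolding eq using F L by (intro lin(2) Lp_diff(1) Lp_sum) auto
  qed
 qed
 thus ?thesis unfolding has_L2_sum_def using L lin(1) by simp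
qed

lemma (in orth_system) coef_linear:
 assumes "f \<in> Lp 2 M" "h \<in> Lp 2 M" "n \<in> I"
 shows "coef (\<lambda>x. c * f x + h x) n = c * coef f n + coef h n"
proof -
 have "(LINT x|M. (c * f x + h x) * complex_of_real (E n x)) = (LINT x|M. c * (f x * complex_of_real (E n x)) + h x * complex_of_real (E n x))"
  by (simp add: algebra_simps)
 also have "\<dots> = c * (LINT x|M. f x * complex_of_real (E n x)) + (LINT x|M. h x * complex_of_real (E n x))"
  using integrable_mult_E[OF assms(1,3)] integrable_mult_E[OF assms(2,3)] by simp
 finally show ?thesis by (simp add: coef_def add_divide_distrib)
qed

section \<open>Linearity, scaling and duality for the Riesz vector\<close>

context mode_family
begin

text \<open>The coefficients are linear, so both sides are sums of the same series; such sums agree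
  almost everywhere.\<close>

lemma Riesz_linear:
 assumes a: "0 \<le> a" and \<phi>: "\<phi> \<in> Lp 2 PM" "\<psi> \<in> Lp 2 PM"
 shows "AE x in PM. Riesz a i (\<lambda>x. c * \<phi> x + \<psi> x) x = c * Riesz a i \<phi> x + Riesz a i \<psi> x"
proof -
 have s: "(\<lambda>x. c * \<phi> x + \<psi> x) \<in> Lp 2 PM" by (rule Lp_add(1)[OF Lp_cmult(1)[OF \<phi>(1)] \<phi>(2)]) simp_all
 note h = has_L2_sum_linear[OF Riesz_has_L2_sum[OF a \<phi>(1), of i] Riesz_has_L2_sum[OF a \<phi>(2), of i], of c]
 have "has_L2_sum PM (\<lambda>n x. rcoef a (\<lambda>x. c * \<phi> x + \<psi> x) n * complex_of_real (H (Some i) n x)) (Collect idx) (\<lambda>x. c * Riesz a i \<phi> x + Riesz a i \<psi> x)"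
  by (rule has_L2_sum_transfer[OF h]) (auto simp: rcoef_def O.coef_linear[OF \<phi>], simp add: algebra_simps add_divide_distrib)
 from has_L2_sum_unique[OF Riesz_has_L2_sum[OF a s, of i] this] show ?thesis .
qed

lemma Riesz_zero: assumes a: "0 \<le> a" shows "AE x in PM. Riesz a i (\<lambda>x. 0) x = 0"
 using Riesz_linear[OF a Lp_zero(1) Lp_zero(1), of i 1] by eventually_elim simp

lemma Riesz_cmult:
 assumes a: "0 \<le> a" and \<phi>: "\<phi> \<in> Lp 2 PM" shows "AE x in PM. Riesz a i (\<lambda>x. c * \<phi> x) x = c * Riesz a i \<phi> x"
 using Riesz_linear[OF a \<phi> Lp_zero(1), of i c] Riesz_zero[OF a, of i] unfolding add_0_right by eventually_elim simp

lemma Riesz_add: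
 assumes a: "0 \<le> a" and \<phi>: "\<phi> \<in> Lp 2 PM" "\<psi> \<in> Lp 2 PM"
 shows "AE x in PM. Riesz a i (\<lambda>x. \<phi> x + \<psi> x) x = Riesz a i \<phi> x + Riesz a i \<psi> x"
 using Riesz_linear[OF a \<phi>, of i 1] by simp

lemma pairing_scale:
 assumes a: "0 \<le> a" and \<phi>: "\<phi> \<in> Lp 2 PM" and g: "\<And>i. g i \<in> Lp 2 PM"
 shows "pairing a (\<lambda>x. complex_of_real \<alpha> * \<phi> x) (\<lambda>i x. complex_of_real \<beta> * g i x) = complex_of_real (\<alpha> * \<beta>) * pairing a \<phi> g"
 unfolding pairing_def sum_distrib_left
proof (rule sum.cong[OF refl])
 fix i
 have c: "(\<lambda>x. complex_of_real \<alpha> * \<phi> x) \<in> Lp 2 PM" by (rule Lp_cmult(1)[OF \<phi>]) simp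
 have m: "Riesz a i (\<lambda>x. complex_of_real \<alpha> * \<phi> x) \<in> borel_measurable PM" "Riesz a i \<phi> \<in> borel_measurable PM" "g i \<in> borel_measurable PM"
  using Lp_meas[OF Riesz_Lp[OF a c]] Lp_meas[OF Riesz_Lp[OF a \<phi>]] Lp_meas[OF g] by auto
 have "(LINT x|PM. Riesz a i (\<lambda>x. complex_of_real \<alpha> * \<phi> x) x * cnj (complex_of_real \<beta> * g i x))
  = (LINT x|PM. complex_of_real (\<alpha> * \<beta>) * (Riesz a i \<phi> x * cnj (g i x)))"
 proof (rule integral_cong_AE)
  show "AE x in PM. Riesz a i (\<lambda>x. complex_of_real \<alpha> * \<phi> x) x * cnj (complex_of_real \<beta> * g i x)
   = complex_of_real (\<alpha> * \<beta>) * (Riesz a i \<phi> x * cnj (g i x))"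
   using Riesz_cmult[OF a \<phi>, of i "complex_of_real \<alpha>"] by eventually_elim simp
 qed (use m in measurable)
 also have "\<dots> = complex_of_real (\<alpha> * \<beta>) * (LINT x|PM. Riesz a i \<phi> x * cnj (g i x))" by (rule integral_mult_right_zero)
 finally show "(LINT x|PM. Riesz a i (\<lambda>x. complex_of_real \<alpha> * \<phi> x) x * cnj (complex_of_real \<beta> * g i x))
  = complex_of_real (\<alpha> * \<beta>) * (LINT x|PM. Riesz a i \<phi> x * cnj (g i x))" .
qed

lemma gnorm_scale: "gnorm (\<lambda>i x. complex_of_real (\<beta> x) * g i x) x = \<bar>\<beta> x\<bar> * gnorm g x"
 unfolding gnorm_def by (simp add: norm_mult power_mult_distrib sum_distrib_left[symmetric] real_sqrt_mult)

lemma dual_estimate_unit: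
 fixes p :: real
 assumes p: "1 < p" and a: "0 \<le> a" and \<phi>: "\<phi> \<in> Lp 2 PM" "\<phi> \<in> Lp p PM" and g: "\<And>i. g i \<in> Lp 2 PM" "gnorm g \<in> Lp (p / (p - 1)) PM"
  and n: "Lp_norm p PM \<phi> \<le> 1" "Lp_norm (p / (p - 1)) PM (gnorm g) \<le> 1"
 shows "Re (pairing a \<phi> g) \<le> 18 * (max p (p / (p - 1)) - 1)"
proof -
 have q: "1 < p / (p - 1)" using p by (simp add: field_simps)
 have I: "integrable PM (\<lambda>x. norm (\<phi> x) powr p)" "integrable PM (\<lambda>x. gnorm g x powr (p / (p - 1)))"
  using Lp_int[OF \<phi>(2)] Lp_int[OF g(2)] gnorm(1)[of g] by simp_all
 have i: "(LINT x|PM. norm (\<phi> x) powr p) \<le> 1" "(LINT x|PM. gnorm g x powr (p / (p - 1))) \<le> 1"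
  using n Lp_norm_le_iff[of p 1 PM \<phi>] Lp_norm_le_iff[of "p / (p - 1)" 1 PM "gnorm g"] p q gnorm(1)[of g] by simp_all
 have fin: "Re (pairing a \<phi> g) \<le> 18 * (P - 1)"
  if "2 \<le> P" "1 / (P - 1) / 16 * Re (pairing a \<phi> g) \<le> (1 + 1 / (P - 1) / 22) * A + 1 / (P - 1) / 22 * A'" "A \<le> 1" "A' \<le> 1" for P A A'
 proof -
  define \<gamma> where "\<gamma> = 1 / (P - 1)"
  have \<gamma>: "0 < \<gamma>" "\<gamma> \<le> 1" "P - 1 = 1 / \<gamma>" using that(1) by (auto simp: \<gamma>_def)
  have "(1 + \<gamma> / 22) * A \<le> (1 + \<gamma> / 22) * 1" "\<gamma> / 22 * A' \<le> \<gamma> / 22 * 1" using that \<gamma> by (intro mult_left_mono; simp)+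
  from order_trans[OF that(2)[folded \<gamma>_def] add_mono[OF this]]
  \<comment> \<open>The two right-hand sides add up to 1 + \<gamma> / 11, and 16 * (1 + 1 / 11) is
    below 18.\<close>
  have "\<gamma> * Re (pairing a \<phi> g) \<le> 18" using \<gamma>(2) by simp
  thus ?thesis unfolding \<gamma>(3) using \<gamma>(1) by (simp add: field_simps)
 qed
 show ?thesis
 proof (cases "2 \<le> p")
  case True
  have e: "1 + 1 / (p - 1) = p / (p - 1)" using p by (simp add: field_simps)
  have mx: "max p (p / (p - 1)) = p" using True by (simp add: max_def field_simps)
  show ?thesis unfolding mx by (rule fin[OF True embedding_powr(1)[OF True a \<phi>(1) g(1) I(1), unfolded e] i(2,1)])
 next
  case False
  \<comment> \<open>For p < 2 the conjugate exponent exceeds 2 and plays the large exponent; 1 + 1 /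
    (P - 1) gives back p.\<close>
  define P where "P = p / (p - 1)"
  have P: "2 \<le> P" using False p by (simp add: P_def field_simps)
  have e: "1 + 1 / (P - 1) = p" using p by (simp add: P_def field_simps)
  have mx: "max p (p / (p - 1)) = P" using False p by (simp add: max_def field_simps P_def)
  show ?thesis unfolding mx
   by (rule fin[OF P embedding_powr(2)[OF P a \<phi>(1) g(1) I(2)[folded P_def], unfolded e] i(1) i(2)[folded P_def]])
 qed
qed

text \<open>The pairing is homogeneous in both arguments. Normalizing by the norms plus
  \<open>ep m\<close> avoids a division by 0.\<close>

lemma dual_estimate:
 fixes p :: real
 assumes p: "1 < p" and a: "0 \<le> a" and \<phi>: "\<phi> \<in> Lp 2 PM" "\<phi> \<in> Lp p PM" and g: "\<And>i. g i \<in> Lp 2 PM" "gnorm g \<in> Lp (p / (p - 1)) PM"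
 shows "Re (pairing a \<phi> g) \<le> 18 * (max p (p / (p - 1)) - 1) * (Lp_norm p PM \<phi> * Lp_norm (p / (p - 1)) PM (gnorm g))"
proof -
 define X where "X = (\<lambda>m. Lp_norm p PM \<phi> + ep m)"
 define Y where "Y = (\<lambda>m. Lp_norm (p / (p - 1)) PM (gnorm g) + ep m)"
 define K where "K = 18 * (max p (p / (p - 1)) - 1)"
 have q: "0 < p / (p - 1)" "0 < p" using p by simp_all
 have XY: "0 < X m" "Lp_norm p PM \<phi> \<le> X m" "0 < Y m" "Lp_norm (p / (p - 1)) PM (gnorm g) \<le> Y m" for m
  using ep(1)[of m] Lp_norm_nonneg[of p PM \<phi>] Lp_norm_nonneg[of "p / (p - 1)" PM "gnorm g"] by (auto simp: X_def Y_def)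
 have le: "Re (pairing a \<phi> g) \<le> K * (X m * Y m)" for m
 proof -
  let ?\<phi> = "\<lambda>x. complex_of_real (1 / X m) * \<phi> x" and ?g = "\<lambda>i x. complex_of_real (1 / Y m) * g i x"
  have gn: "gnorm ?g = (\<lambda>x. 1 / Y m * gnorm g x)" using gnorm_scale[of "\<lambda>_. 1 / Y m" g] XY(3)[of m] by (simp add: fun_eq_iff)
  have gL: "gnorm ?g \<in> Lp (p / (p - 1)) PM" "Lp_norm (p / (p - 1)) PM (gnorm ?g) = 1 / Y m * Lp_norm (p / (p - 1)) PM (gnorm g)"
   unfolding gn using Lp_cmult[OF g(2) q(1), of "1 / Y m"] XY(3)[of m] by simp_all
  have \<phi>L: "?\<phi> \<in> Lp 2 PM" "?\<phi> \<in> Lp p PM" "Lp_norm p PM ?\<phi> = 1 / X m * Lp_norm p PM \<phi>"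
   using Lp_cmult(1)[OF \<phi>(1), of "complex_of_real (1 / X m)"] Lp_cmult[OF \<phi>(2) q(2), of "complex_of_real (1 / X m)"] XY(1)[of m]
   by (simp_all add: norm_divide)
  have "Re (pairing a ?\<phi> ?g) \<le> K" unfolding K_def
  proof (rule dual_estimate_unit[OF p a \<phi>L(1,2) _ gL(1)])
   show "Lp_norm p PM ?\<phi> \<le> 1" unfolding \<phi>L(3) using XY(1,2)[of m] by simp
   show "Lp_norm (p / (p - 1)) PM (gnorm ?g) \<le> 1" unfolding gL(2) using XY(3,4)[of m] by simp
   show "?g i \<in> Lp 2 PM" for i by (rule Lp_cmult(1)[OF g(1)]) simp
  qed
  moreover have "Re (pairing a ?\<phi> ?g) = Re (pairing a \<phi> g) / (X m * Y m)"
   unfolding pairing_scale[OF a \<phi>(1) g(1)] Re_complex_of_real by simp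
  ultimately show ?thesis using XY(1,3)[of m] by (simp add: divide_le_eq)
 qed
 have "(\<lambda>m. K * (X m * Y m)) \<longlonglongrightarrow> K * ((Lp_norm p PM \<phi> + 0) * (Lp_norm (p / (p - 1)) PM (gnorm g) + 0))"
  unfolding X_def Y_def by (intro tendsto_mult tendsto_add tendsto_const ep(3))
 from LIMSEQ_le_const[OF this] le show ?thesis unfolding K_def by simp
qed

text \<open>Duality with the extremal function |h|^(p - 2) h for the Riesz vector h, cut off where
  |h| exceeds m. The cut-off keeps the integral A of |h|^p over |h| \<le> m finite, so that A \<le>
  K * A powr (1 - 1 / p) can be divided by the power of A; monotone convergence then removes
  it.\<close>

theorem Riesz_bound:
 fixes p :: real
 assumes p: "1 < p" and a: "0 \<le> a" and \<phi>: "\<phi> \<in> Lp 2 PM" "\<phi> \<in> Lp p PM"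
 shows "l2_vec (Riesz a) \<phi> \<in> Lp p PM"
  "Lp_norm p PM (l2_vec (Riesz a) \<phi>) \<le> 18 * (max p (p / (p - 1)) - 1) * Lp_norm p PM \<phi>"
proof -
 define h where "h = (\<lambda>i. Riesz a i \<phi>)"
 define G where "G = gnorm h"
 define C where "C = 18 * (max p (p / (p - 1)) - 1)"
 define K where "K = C * Lp_norm p PM \<phi>"
 have K0: "0 \<le> K" unfolding K_def C_def using p Lp_norm_nonneg by (intro mult_nonneg_nonneg) auto
 have hi: "Riesz a i \<phi> = h i" for i by (simp add: h_def)
 have hL: "h i \<in> Lp 2 PM" for i unfolding h_def by (rule Riesz_Lp[OF a \<phi>(1)])
 have GG: "l2_vec (Riesz a) \<phi> = G" by (simp add: fun_eq_iff l2_vec_def G_def gnorm_def h_def)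
 have G0: "0 \<le> G x" for x by (simp add: G_def gnorm(1))
 have Gm: "G \<in> borel_measurable PM" unfolding G_def by (rule gnorm_measurable[OF Lp_meas[OF hL]])
 \<comment> \<open>For p < 2 this factor may be large where \<open>G\<close> is small, but
   \<open>c m x * G x\<close> equals a power of \<open>G x\<close> with positive exponent, and at G
   x = 0 the value of \<open>powr\<close> is 0.\<close>
 define c where "c = (\<lambda>m x. if G x \<le> real m then G x powr (p - 2) else 0)"
 have cm: "c m \<in> borel_measurable PM" for m unfolding c_def using Gm by measurable
 have c0: "0 \<le> c m x" for m x by (simp add: c_def)
 define u where "u = (\<lambda>(m::nat) x. if G x \<le> real m then G x powr p else 0)"
 have um: "u m \<in> borel_measurable PM" for m unfolding u_def using Gm by measurable
 define g where "g = (\<lambda>m i x. complex_of_real (c m x) * h i x)"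
 have cG: "c m x * G x = (if G x \<le> real m then G x powr (p - 1) else 0)" for m x
 proof (cases "G x = 0")
  case False
  hence "G x powr (p - 2) * G x = G x powr (p - 2) * G x powr 1" using G0[of x] by simp
  also have "\<dots> = G x powr (p - 1)" unfolding powr_add[symmetric] by simp
  finally show ?thesis by (simp add: c_def)
 qed (simp add: c_def)
 have gn: "gnorm (g m) x = c m x * G x" for m x
  unfolding g_def gnorm_scale[of "c m" h] G_def[symmetric] using c0[of m x] by simp
 have gb: "gnorm (g m) x \<le> real m powr (p - 1)" for m x unfolding gn cG using p G0[of x] by (auto intro: powr_mono2)
 have gm: "g m i \<in> borel_measurable PM" for m i unfolding g_def using Lp_meas[OF hL[of i]] cm[of m] by measurable
 have gi: "norm (g m i x) \<le> gnorm (g m) x" for m i x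
  using norm_le_l2_vec[of "\<lambda>i _. g m i" i "\<lambda>x. 0" x] by (simp add: l2_vec_def gnorm_def)
 have gL: "g m i \<in> Lp 2 PM" for m i by (rule PM.Lp_bounded[OF gm order_trans[OF gi gb]]) simp
 have q: "0 < p / (p - 1)" "0 < p" using p by simp_all
 have gnL: "gnorm (g m) \<in> Lp (p / (p - 1)) PM" for m
  by (rule PM.Lp_bounded[OF gnorm_measurable[OF gm] _ q(1)]) (use gb gnorm(1) in simp)
 have gnp: "gnorm (g m) x powr (p / (p - 1)) = u m x" for m x unfolding gn cG u_def using p by (simp add: powr_powr)
 have ui: "integrable PM (u m)" for m using Lp_int[OF gnL[of m]] gnorm(1)[of "g m"] by (simp add: gnp)
 have pr: "pairing a \<phi> (g m) = complex_of_real (LINT x|PM. u m x)" for m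
 proof -
  have "pairing a \<phi> (g m) = (LINT x|PM. (\<Sum>i\<in>UNIV. h i x * cnj (g m i x)))" unfolding pairing_def hi
   by (rule Bochner_Integration.integral_sum[symmetric]) (rule Lp_2_mult_integrable(1)[OF hL gL])
  also have "(\<lambda>x. \<Sum>i\<in>UNIV. h i x * cnj (g m i x)) = (\<lambda>x. complex_of_real (u m x))"
  proof
   fix x
   have "(\<Sum>i\<in>UNIV. h i x * cnj (g m i x)) = complex_of_real (c m x * (\<Sum>i\<in>UNIV. (norm (h i x))^2))"
    unfolding g_def of_real_mult of_real_sum complex_norm_square sum_distrib_left by (simp add: mult_ac)
   also have "c m x * (\<Sum>i\<in>UNIV. (norm (h i x))^2) = c m x * G x * G x"
    unfolding gnorm(2)[symmetric] G_def[symmetric] by (simp add: power2_eq_square)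
   also have "\<dots> = u m x"
   proof (cases "G x = 0")
    case False
    hence "G x powr (p - 1) * G x = G x powr (p - 1) * G x powr 1" using G0[of x] by simp
    also have "\<dots> = G x powr p" unfolding powr_add[symmetric] by simp
    finally show ?thesis by (simp add: cG u_def)
   qed (simp add: u_def)
   finally show "(\<Sum>i\<in>UNIV. h i x * cnj (g m i x)) = complex_of_real (u m x)" .
  qed
  finally show ?thesis by simp
 qed
 have bound: "(LINT x|PM. u m x) \<le> K powr p" for m
 proof -
  define A where "A = (LINT x|PM. u m x)"
  have A0: "0 \<le> A" unfolding A_def by (rule Bochner_Integration.integral_nonneg) (simp add: u_def)
  have "Lp_norm (p / (p - 1)) PM (gnorm (g m)) = A powr (1 - 1 / p)"
   using p gnorm(1)[of "g m"] by (simp add: Lp_norm_def gnp A_def diff_divide_distrib)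
  hence le: "A \<le> K * A powr (1 - 1 / p)"
   using dual_estimate[OF p a \<phi> gL gnL, of m] by (simp add: pr A_def K_def C_def mult.assoc)
  show ?thesis
  proof (cases "A = 0")
   case False
   hence A: "0 < A" using A0 by simp
   have "A = A powr (1 / p) * A powr (1 - 1 / p)" using A by (simp add: powr_add[symmetric])
   with le have "A powr (1 / p) * A powr (1 - 1 / p) \<le> K * A powr (1 - 1 / p)" by simp
   hence "A powr (1 / p) \<le> K" using A by simp
   hence "(A powr (1 / p)) powr p \<le> K powr p" using p by (intro powr_mono2) auto
   thus ?thesis using A p by (simp add: powr_powr A_def)
  qed (simp add: A_def)
 qed
 have mono: "mono (\<lambda>m. u m x)" for x by (rule monoI) (auto simp: u_def)
 have lim: "(\<lambda>m. u m x) \<longlonglongrightarrow> G x powr p" for x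
 proof (rule tendsto_eventually, unfold eventually_sequentially)
  obtain N where N: "G x \<le> real N" using real_arch_simple by auto
  show "\<exists>N. \<forall>m\<ge>N. u m x = G x powr p" by (rule exI[of _ N]) (use N in \<open>auto simp: u_def\<close>)
 qed
 have inc: "incseq (\<lambda>m. LINT x|PM. u m x)"
  by (intro monoI integral_mono ui) (use mono in \<open>auto simp: mono_def\<close>)
 obtain l where l: "(\<lambda>m. LINT x|PM. u m x) \<longlonglongrightarrow> l"
  by (rule incseq_convergent[OF inc]) (use bound in auto)
 have Gp: "(\<lambda>x. G x powr p) \<in> borel_measurable PM" using Gm by measurable
 have int: "integrable PM (\<lambda>x. G x powr p)"
  by (rule integrable_monotone_convergence[OF ui _ _ l Gp]) (use mono lim in auto)
 have "(LINT x|PM. G x powr p) = l" by (rule integral_monotone_convergence[OF ui _ _ l Gp]) (use mono lim in auto)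
 moreover have "l \<le> K powr p" by (rule LIMSEQ_le_const2[OF l]) (use bound in auto)
 ultimately have le: "(LINT x|PM. G x powr p) \<le> K powr p" by simp
 show "l2_vec (Riesz a) \<phi> \<in> Lp p PM" unfolding GG by (rule Lp_I[OF Gm]) (use int G0 in simp)
 show "Lp_norm p PM (l2_vec (Riesz a) \<phi>) \<le> 18 * (max p (p / (p - 1)) - 1) * Lp_norm p PM \<phi>"
  unfolding GG C_def[symmetric] K_def[symmetric] Lp_norm_le_iff[OF q(2) K0] using le G0 by simp
qed

end

section \<open>Zeros and modes of the Bessel equation\<close>

text \<open>For \<alpha> = 2 \<nu> + 1, \<open>G\<close> will be a multiple of x powr (- \<nu>)
  J_\<nu>(x), continued to an even entire function, and \<open>K\<close> is - G' / x. The two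
  equations amount to G'' + (\<alpha> / x) G' + G = 0; the use of \<open>K\<close> avoids dividing
  by x at 0.\<close>

locale bessel_ode =
 fixes \<alpha> :: real and G K :: "real \<Rightarrow> real"
 assumes \<alpha>: "0 \<le> \<alpha>"
  and G_deriv: "\<And>x. DERIV G x :> - (x * K x)"
  and xK_deriv: "\<And>x. DERIV (\<lambda>x. x * K x) x :> G x - \<alpha> * K x"
  and K_cont: "\<And>x. isCont K x"
  and G_0: "0 < G 0"
begin

lemma G_cont: "isCont G x" by (rule DERIV_isCont[OF G_deriv])

lemma G_continuous: "continuous_on S G" and K_continuous: "continuous_on S K"
 by (auto intro!: continuous_at_imp_continuous_on G_cont K_cont)

text \<open>The energy \<open>E = G^2 + (x K)^2\<close> satisfies \<open>E' \<ge> - (2 \<alpha> / x) E\<close>, so \<open>x powr (2 \<alpha>) * E\<close> is nondecreasing.\<close>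
lemma zero_simple:
 assumes x: "0 < x" and G: "G x = 0" shows "K x \<noteq> 0"
proof
 assume K: "K x = 0"
 define m where "m y = y * K y" for y
 have m: "DERIV m y :> G y - \<alpha> * K y" for y using xK_deriv[of y] by (simp add: m_def[abs_def])
 have G': "DERIV G y :> - m y" for y using G_deriv[of y] by (simp add: m_def)
 define F where "F y = y powr (2 * \<alpha>) * ((G y)^2 + (m y)^2)" for y
 have F: "DERIV F y :> 2 * \<alpha> * y powr (2 * \<alpha> - 1) * (G y)^2" if "0 < y" for y
 proof -
  have p: "y powr (2 * \<alpha>) = y powr (2 * \<alpha> - 1) * y" using that powr_add[of y "2 * \<alpha> - 1" 1] by simp
  have "DERIV F y :> 2 * \<alpha> * y powr (2 * \<alpha> - 1) * ((G y)^2 + (m y)^2)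
   + y powr (2 * \<alpha>) * (2 * G y * (- m y) + 2 * m y * (G y - \<alpha> * K y))"
   unfolding F_def using that by (auto intro!: derivative_eq_intros G' m has_real_derivative_powr)
  thus ?thesis unfolding p by (simp add: m_def algebra_simps power2_eq_square)
 qed
 have "F y = 0" if y: "0 < y" "y \<le> x" for y
 proof -
  have "F y \<le> F x"
  proof (rule DERIV_nonneg_imp_nondecreasing[OF y(2)])
   fix t assume "y \<le> t" "t \<le> x"
   hence "0 < t" using y(1) by simp
   thus "\<exists>d. DERIV F t :> d \<and> 0 \<le> d" using F[OF \<open>0 < t\<close>] \<alpha> by (intro exI[of _ "2 * \<alpha> * t powr (2 * \<alpha> - 1) * (G t)^2"] conjI) simp_all
  qed
  moreover have "0 \<le> F y" by (simp add: F_def)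
  moreover have "F x = 0" using G K by (simp add: F_def m_def)
  ultimately show ?thesis by linarith
 qed
 hence "G y = 0" if "0 < y" "y \<le> x" for y using that by (auto simp: F_def add_nonneg_eq_0_iff)
 hence "(G \<longlongrightarrow> 0) (at_right 0)"
  using x by (intro tendsto_eventually) (auto simp: eventually_at_right[OF x])
 moreover have "(G \<longlongrightarrow> G 0) (at_right 0)" using G_cont[of 0] by (simp add: isCont_def filterlim_at_split)
 ultimately have "G 0 = 0" using tendsto_unique[OF trivial_limit_at_right_real] by metis
 thus False using G_0 by simp
qed

text \<open>At an accumulation point of zeros both \<open>G\<close> and its derivative would vanish,
  contrary to \<open>zero_simple\<close>; the point is not 0 because G 0 > 0.\<close>

lemma finite_zeros: "finite {x. 0 \<le> x \<and> x \<le> b \<and> G x = 0}"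
proof (rule ccontr)
 let ?Z = "{x. 0 \<le> x \<and> x \<le> b \<and> G x = 0}"
 assume inf: "infinite ?Z"
 obtain z where z: "z \<in> {0..b}" "z islimpt ?Z"
  using compact_eq_Bolzano_Weierstrass[of "{0..b}"] inf by (metis (no_types, lifting) atLeastAtMost_iff compact_Icc mem_Collect_eq subsetI)
 obtain s where s: "\<And>n. s n \<in> ?Z - {z}" "s \<longlonglongrightarrow> z"
  using z(2) unfolding islimpt_sequential by blast
 have "(\<lambda>n. G (s n)) \<longlonglongrightarrow> G z" by (rule isCont_tendsto_compose[OF G_cont s(2)])
 hence Gz: "G z = 0" using s(1) by (simp add: LIMSEQ_const_iff)
 have "z \<noteq> 0" using Gz G_0 by auto
 hence z0: "0 < z" using z(1) by simp
 have "filterlim s (at z) sequentially" using s by (auto simp: filterlim_at)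
 from filterlim_compose[OF G_deriv[of z, unfolded has_field_derivative_iff] this]
 have "(\<lambda>n. (G (s n) - G z) / (s n - z)) \<longlonglongrightarrow> - (z * K z)" .
 hence "- (z * K z) = 0" using s(1) Gz by (simp add: LIMSEQ_const_iff)
 thus False using zero_simple[OF z0 Gz] z0 by simp
qed

text \<open>Sturm comparison of \<open>u = x powr (\<alpha> / 2) * G x\<close>, which solves
 \<open>u'' + (1 - \<alpha> / 2 * (\<alpha> / 2 - 1) / x^2) u = 0\<close>, with a solution of \<open>v'' + v / 4 = 0\<close>.\<close>
lemma ex_zero: "\<exists>x>X. G x = 0"
proof -
 define \<beta> where "\<beta> = \<alpha> / 2"
 have al: "\<alpha> = 2 * \<beta>" by (simp add: \<beta>_def)
 \<comment> \<open>From \<open>a\<close> on the coefficient in the equation for u is at least 1 / 4,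
   as \<open>Q\<close> states. The interval up to \<open>b\<close> is one half period of the
   comparison function sin ((x - a) / 2).\<close>
 define a where "a = max (max X 0 + 1) (2 * \<bar>\<beta>\<bar> + 2)"
 define b where "b = a + 2 * pi"
 have a: "X < a" "0 < a" "2 * \<beta> \<le> a" using \<alpha> by (auto simp: a_def)
 have ab: "a < b" by (simp add: b_def)
 have Q: "0 \<le> 3 / 4 - \<beta> * (\<beta> - 1) / x^2" if "a \<le> x" for x
 proof -
  have "2 * \<beta> \<le> x" "0 < x" "0 \<le> \<beta>" using a that \<alpha> by (auto simp: \<beta>_def)
  hence "(2 * \<beta>)^2 \<le> x^2" by (intro power_mono) auto
  hence "\<beta> * (\<beta> - 1) \<le> x^2 / 4" using \<open>0 \<le> \<beta>\<close> by (simp add: power2_eq_square algebra_simps)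
  moreover have "0 \<le> x^2" by simp
  ultimately have "\<beta> * (\<beta> - 1) \<le> 3 / 4 * x^2" by linarith
  thus ?thesis using \<open>0 < x\<close> by (simp add: divide_le_eq)
 qed
 define u where "u x = x powr \<beta> * G x" for x
 define m where "m x = x * K x" for x
 have mD: "DERIV m x :> G x - \<alpha> * K x" for x using xK_deriv[of x] by (simp add: m_def[abs_def])
 have GD: "DERIV G x :> - m x" for x using G_deriv[of x] by (simp add: m_def)
 define u' where "u' x = \<beta> * x powr (\<beta> - 1) * G x - x powr \<beta> * m x" for x
 have u: "DERIV u x :> u' x" if "0 < x" for x
  unfolding u_def u'_def using that by (auto intro!: derivative_eq_intros has_real_derivative_powr GD)
 have u': "DERIV u' x :> - (1 - \<beta> * (\<beta> - 1) / x^2) * u x" if x: "0 < x" for x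
 proof -
  have p: "x powr (\<beta> - 1) = x powr \<beta> / x" "x powr (\<beta> - 1 - 1) = x powr \<beta> / x^2"
   using x by (simp_all add: powr_diff power2_eq_square)
  have "DERIV u' x :> \<beta> * ((\<beta> - 1) * x powr (\<beta> - 1 - 1)) * G x + \<beta> * x powr (\<beta> - 1) * (- m x)
   - (\<beta> * x powr (\<beta> - 1) * m x + x powr \<beta> * (G x - \<alpha> * K x))"
   unfolding u'_def using x by (auto intro!: derivative_eq_intros has_real_derivative_powr GD mD)
  also have "\<beta> * ((\<beta> - 1) * x powr (\<beta> - 1 - 1)) * G x + \<beta> * x powr (\<beta> - 1) * (- m x)
   - (\<beta> * x powr (\<beta> - 1) * m x + x powr \<beta> * (G x - \<alpha> * K x)) = - (1 - \<beta> * (\<beta> - 1) / x^2) * u x"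
   unfolding p u_def m_def al using x by (simp add: field_simps power2_eq_square)
  finally show ?thesis .
 qed
 \<comment> \<open>\<open>s\<close> makes the sign of \<open>G\<close> positive and will be
   \<open>G a\<close>. The Wronskian \<open>W\<close> is nonincreasing on the interval, yet negative
   at \<open>a\<close> and positive at \<open>b\<close>.\<close>
 have False if nz: "\<And>x. a \<le> x \<Longrightarrow> x \<le> b \<Longrightarrow> 0 < s * G x" for s
 proof -
  have su: "s * u x = x powr \<beta> * (s * G x)" for x by (simp add: u_def)
  define v where "v x = sin ((x - a) / 2)" for x
  define v' where "v' x = cos ((x - a) / 2) / 2" for x
  have v: "DERIV v x :> v' x" "DERIV v' x :> - v x / 4" for x
   unfolding v_def v'_def by (auto intro!: derivative_eq_intros)
  define W where "W x = s * (u' x * v x - u x * v' x)" for x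
  have "W b \<le> W a"
  proof (rule DERIV_nonpos_imp_nonincreasing[where f = W and a = a and b = b])
   show "a \<le> b" using ab by simp
   fix x assume x: "a \<le> x" "x \<le> b"
   hence x0: "0 < x" using a by simp
   have "DERIV W x :> s * ((- (1 - \<beta> * (\<beta> - 1) / x^2) * u x * v x + u' x * v' x) - (u' x * v' x + u x * (- v x / 4)))"
    unfolding W_def using u[OF x0] u'[OF x0] v[of x] by (auto intro!: derivative_eq_intros)
   also have "s * ((- (1 - \<beta> * (\<beta> - 1) / x^2) * u x * v x + u' x * v' x) - (u' x * v' x + u x * (- v x / 4)))
    = - ((3 / 4 - \<beta> * (\<beta> - 1) / x^2) * (s * u x) * v x)" by (simp add: algebra_simps)
   finally have D: "DERIV W x :> - ((3 / 4 - \<beta> * (\<beta> - 1) / x^2) * (s * u x) * v x)" .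
   have "0 \<le> s * u x" using nz[OF x] unfolding su by simp
   moreover have "0 \<le> v x" unfolding v_def using x by (intro sin_ge_zero) (auto simp: b_def)
   ultimately have "0 \<le> (3 / 4 - \<beta> * (\<beta> - 1) / x^2) * (s * u x) * v x"
    by (rule mult_nonneg_nonneg[OF mult_nonneg_nonneg[OF Q[OF x(1)]]])
   thus "\<exists>d. DERIV W x :> d \<and> d \<le> 0"
    by (intro exI[of _ "- ((3 / 4 - \<beta> * (\<beta> - 1) / x^2) * (s * u x) * v x)"] conjI D) (simp only: neg_le_0_iff_le)
  qed
  moreover have "W a = - (s * u a / 2)" "W b = s * u b / 2" by (simp_all add: W_def v_def v'_def b_def)
  moreover have "0 < s * u a" "0 < s * u b" using nz[of a] nz[of b] ab a unfolding su by simp_all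
  ultimately show False by linarith
 qed
 note no = this
 have "\<exists>x\<ge>a. G x = 0"
 proof (rule ccontr)
  assume "\<not> (\<exists>x\<ge>a. G x = 0)"
  hence nz: "G x \<noteq> 0" if "a \<le> x" for x using that by auto
  have same: "0 < G a * G x" if "a \<le> x" for x
  proof (rule ccontr)
   assume "\<not> 0 < G a * G x"
   hence neg: "G a * G x < 0" using nz[of a] nz[OF that] by (simp add: not_less less_le)
   have "\<exists>t\<ge>a. t \<le> x \<and> G t = 0"
   proof (cases "G a < 0")
    case True
    hence "0 < G x" using neg by (simp add: mult_less_0_iff)
    thus ?thesis using IVT'[of G a 0 x] True that G_continuous by auto
   next
    case False
    hence "0 < G a" "G x < 0" using neg by (auto simp: mult_less_0_iff)
    thus ?thesis using IVT2'[of G x 0 a] that G_continuous by auto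
   qed
   thus False using nz by auto
  qed
  show False by (rule no[of "G a", OF same])
 qed
 then obtain x where "a \<le> x" "G x = 0" by auto
 thus ?thesis using a(1) by (intro exI[of _ x]) auto
qed

text \<open>The recursion of \<open>bessel_zero\<close> with \<open>G\<close> in place of the Bessel
  function.\<close>

primrec z :: "nat \<Rightarrow> real" where
 "z 0 = 0"
| "z (Suc n) = (LEAST x. z n < x \<and> G x = 0)"

lemma z_Suc: assumes "0 \<le> z n"
 shows "z n < z (Suc n)" "G (z (Suc n)) = 0" "\<And>x. z n < x \<Longrightarrow> G x = 0 \<Longrightarrow> z (Suc n) \<le> x"
proof -
 obtain y where y: "z n < y" "G y = 0" using ex_zero by blast
 define S where "S = {x. z n < x \<and> x \<le> y \<and> G x = 0}"
 have fin: "finite S" by (rule finite_subset[OF _ finite_zeros[of y]]) (use assms in \<open>auto simp: S_def\<close>)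
 have ne: "S \<noteq> {}" using y by (auto simp: S_def)
 have m: "Min S \<in> S" by (rule Min_in[OF fin ne])
 have le: "Min S \<le> x" if "z n < x" "G x = 0" for x
 proof (cases "x \<le> y")
  case True thus ?thesis using that fin by (intro Min_le) (auto simp: S_def)
 next
  case False thus ?thesis using m by (auto simp: S_def)
 qed
 have eq: "z (Suc n) = Min S" unfolding z.simps by (rule Least_equality) (use m le in \<open>auto simp: S_def\<close>)
 show "z n < z (Suc n)" "G (z (Suc n)) = 0" "\<And>x. z n < x \<Longrightarrow> G x = 0 \<Longrightarrow> z (Suc n) \<le> x"
  unfolding eq using m le by (auto simp: S_def)
qed

lemma z_nonneg: "0 \<le> z n"
proof (induction n)
 case (Suc n) thus ?case using z_Suc(1)[OF Suc] by linarith
qed simp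

lemma z_mono: "strict_mono z" unfolding strict_mono_Suc_iff using z_Suc(1)[OF z_nonneg] by simp

lemma z_pos: "1 \<le> n \<Longrightarrow> 0 < z n" using strict_monoD[OF z_mono, of 0 n] by simp

lemma G_z: "1 \<le> n \<Longrightarrow> G (z n) = 0" using z_Suc(2)[OF z_nonneg, of "n - 1"] by simp

lemma z_unbounded: "\<exists>n. b < z n"
proof (rule ccontr)
 assume "\<not> (\<exists>n. b < z n)"
 hence "z ` {1..} \<subseteq> {x. 0 \<le> x \<and> x \<le> b \<and> G x = 0}" using z_nonneg G_z by (auto simp: not_less)
 hence "finite (z ` {1..})" by (rule finite_subset[OF _ finite_zeros])
 moreover have "inj_on z {1..}" by (rule inj_on_subset[OF strict_mono_imp_inj_on[OF z_mono] subset_UNIV])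
 ultimately have "finite {1::nat..}" by (rule finite_imageD)
 thus False by (simp add: infinite_Ici)
qed

lemma z_tendsto: "filterlim z at_top sequentially"
proof (rule filterlim_at_top_mono[where f = z, OF _ always_eventually[OF allI[OF order_refl]]], unfold filterlim_at_top, intro allI)
 fix b
 obtain n where "b < z n" using z_unbounded by blast
 hence "b \<le> z m" if "n \<le> m" for m using strict_mono_less_eq[OF z_mono, of n m] that by simp
 thus "\<forall>\<^sub>F m in sequentially. b \<le> z m" by (auto simp: eventually_sequentially)
qed

lemma zero_is_z: assumes "0 < x" "G x = 0" shows "\<exists>n\<ge>1. x = z n"
proof -
 obtain N where N: "x < z N" using z_unbounded by blast
 define n where "n = (LEAST n. x \<le> z n)"
 have n: "x \<le> z n" unfolding n_def by (rule LeastI[of _ N]) (use N in simp)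
 have "n \<noteq> 0" using n assms(1) by (cases n) auto
 then obtain k where k: "n = Suc k" by (cases n) auto
 have "\<not> x \<le> z k" using not_less_Least[of k "\<lambda>n. x \<le> z n"] k unfolding n_def by simp
 hence "z n \<le> x" unfolding k using assms(2) by (intro z_Suc(3)[OF z_nonneg]) auto
 thus ?thesis using n k by (intro exI[of _ n]) simp
qed

lemma G_pos: assumes "0 \<le> x" "x < z 1" shows "0 < G x"
proof (rule ccontr)
 assume "\<not> 0 < G x"
 then obtain t where t: "0 \<le> t" "t \<le> x" "G t = 0" using IVT2'[of G x 0 0] G_0 assms(1) G_continuous by (auto simp: not_less)
 hence "0 < t" using G_0 by (cases "t = 0") auto
 from zero_is_z[OF this t(3)] obtain n where "1 \<le> n" "t = z n" by blast
 hence "z 1 \<le> t" using strict_mono_less_eq[OF z_mono, of 1 n] by simp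
 thus False using t assms by simp
qed

section \<open>The modes attached to the zeros, their weight and their potential\<close>

declare One_nat_def [simp del] z.simps(2) [simp del]

text \<open>\<open>\<psi> n\<close> is the rescaled solution with derivative - x
  \<open>\<kappa> n\<close>, and \<open>amp n\<close> its normalization. \<open>Wr n\<close> is the
  Wronskian \<psi>_n' \<psi>_1 - \<psi>_n \<psi>_1', \<open>Zl\<close> the logarithmic derivative of
  \<open>\<psi> 1\<close>, \<open>om\<close> that of \<open>wt\<close>, and \<open>V\<close> is -
  om' with the Riccati equation \<open>Zl_deriv\<close> inserted.\<close>

definition \<psi> :: "nat \<Rightarrow> real \<Rightarrow> real" where "\<psi> n x = G (z n * x)"
definition \<kappa> :: "nat \<Rightarrow> real \<Rightarrow> real" where "\<kappa> n x = (z n)^2 * K (z n * x)"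
definition amp :: "nat \<Rightarrow> real" where "amp n = sqrt 2 / (z n * \<bar>K (z n)\<bar>)"
definition Wr :: "nat \<Rightarrow> real \<Rightarrow> real" where "Wr n x = x * (\<kappa> 1 x * \<psi> n x - \<kappa> n x * \<psi> 1 x)"
definition Zl :: "real \<Rightarrow> real" where "Zl x = - (x * \<kappa> 1 x) / \<psi> 1 x"
definition wt :: "real \<Rightarrow> real" where "wt x = x powr \<alpha> * (amp 1 * \<psi> 1 x)^2"
definition om :: "real \<Rightarrow> real" where "om x = \<alpha> / x + 2 * Zl x"
definition V :: "real \<Rightarrow> real" where "V x = \<alpha> / x^2 + 2 * (\<alpha> * Zl x / x + (z 1)^2 + (Zl x)^2)"
definition f :: "nat \<Rightarrow> real \<Rightarrow> real" where "f n x = amp n * \<psi> n x / (amp 1 * \<psi> 1 x)"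
definition f' :: "nat \<Rightarrow> real \<Rightarrow> real" where "f' n x = amp n / amp 1 * (Wr n x / (\<psi> 1 x)^2)"
definition L :: "nat \<Rightarrow> real" where "L n = (z n)^2 - (z 1)^2"

lemma \<psi>_deriv: "DERIV (\<psi> n) x :> - (x * \<kappa> n x)"
proof -
 have "DERIV (\<lambda>x. G (z n * x)) x :> - (z n * x * K (z n * x)) * z n"
  by (rule DERIV_chain2[OF G_deriv]) (auto intro!: derivative_eq_intros)
 thus ?thesis by (simp add: \<psi>_def[abs_def] \<kappa>_def power2_eq_square mult_ac)
qed

lemma x\<kappa>_deriv: "DERIV (\<lambda>x. x * \<kappa> n x) x :> (z n)\<^sup>2 * \<psi> n x - \<alpha> * \<kappa> n x"
proof -
 have "DERIV (\<lambda>x. z n * ((z n * x) * K (z n * x))) x :> z n * ((G (z n * x) - \<alpha> * K (z n * x)) * z n)"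
  by (rule DERIV_cmult, rule DERIV_chain2[OF xK_deriv]) (auto intro!: derivative_eq_intros)
 moreover have "(\<lambda>x. z n * ((z n * x) * K (z n * x))) = (\<lambda>x. x * \<kappa> n x)"
  by (simp add: fun_eq_iff \<kappa>_def power2_eq_square mult_ac)
 ultimately show ?thesis by (simp add: \<psi>_def \<kappa>_def power2_eq_square algebra_simps)
qed

lemma \<kappa>_cont: "isCont (\<kappa> n) x"
 unfolding \<kappa>_def[abs_def] by (intro continuous_intros isCont_o2[OF _ K_cont])

lemma \<psi>_continuous: "continuous_on S (\<psi> n)" and \<kappa>_continuous: "continuous_on S (\<kappa> n)"
 by (auto intro!: continuous_at_imp_continuous_on \<kappa>_cont DERIV_isCont[OF \<psi>_deriv])

lemma \<kappa>_deriv: assumes "x \<noteq> 0" shows "DERIV (\<kappa> n) x :> ((z n)^2 * \<psi> n x - (\<alpha> + 1) * \<kappa> n x) / x"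
proof -
 define m where "m y = y * \<kappa> n y" for y
 have m: "DERIV m x :> (z n)\<^sup>2 * \<psi> n x - \<alpha> * \<kappa> n x" using x\<kappa>_deriv[of n x] by (simp add: m_def[abs_def])
 have eq: "(((z n)^2 * \<psi> n x - \<alpha> * \<kappa> n x) * x - m x * 1) / (x * x) = ((z n)^2 * \<psi> n x - (\<alpha> + 1) * \<kappa> n x) / x"
  using assms by (simp add: divide_simps m_def) (simp add: algebra_simps)
 have "DERIV (\<lambda>x. m x / x) x :> (((z n)^2 * \<psi> n x - \<alpha> * \<kappa> n x) * x - m x * 1) / (x * x)"
  using assms by (intro DERIV_divide m DERIV_ident) auto
 note this[unfolded eq]
 moreover have "\<forall>\<^sub>F y in nhds x. m y / y = \<kappa> n y"
  using t1_space_nhds[OF assms] by eventually_elim (simp add: m_def)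
 ultimately show ?thesis using DERIV_cong_ev[OF refl _ refl, of "\<lambda>x. m x / x" "\<kappa> n" x] by simp
qed

lemma bounded_on_Icc:
 fixes h :: "real \<Rightarrow> real"
 assumes "continuous_on {0..1} h" shows "\<exists>C\<ge>0. \<forall>x\<in>{0..1}. \<bar>h x\<bar> \<le> C"
proof -
 have "bounded (h ` {0..1})" by (intro compact_imp_bounded compact_continuous_image assms compact_Icc)
 then obtain C where C: "\<forall>y\<in>h ` {0..1}. norm y \<le> C" unfolding bounded_iff by (elim exE)
 have "\<bar>h x\<bar> \<le> C" if "x \<in> {0..1}" for x using bspec[OF C imageI[OF that]] by simp
 moreover have "0 \<le> C" using calculation[of 0] by simp
 ultimately show ?thesis by (intro exI[of _ C]) simp
qed

lemma \<psi>_0: "\<psi> n 0 = G 0" by (simp add: \<psi>_def)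

lemma \<psi>_1: "1 \<le> n \<Longrightarrow> \<psi> n 1 = 0" by (simp add: \<psi>_def G_z)

lemma \<psi>_pos: assumes "0 \<le> x" "x < 1" shows "0 < \<psi> 1 x"
 unfolding \<psi>_def using assms z_pos[of 1] by (intro G_pos) auto

lemma \<psi>_zero: assumes "1 \<le> n" "0 < x" "\<psi> n x = 0" shows "\<kappa> n x \<noteq> 0"
 using zero_simple[of "z n * x"] assms z_pos[of n] by (simp add: \<psi>_def \<kappa>_def)

lemma \<kappa>_1: "1 \<le> n \<Longrightarrow> \<kappa> n 1 \<noteq> 0" by (rule \<psi>_zero[OF _ _ \<psi>_1]) auto

lemma amp_pos: "1 \<le> n \<Longrightarrow> 0 < amp n"
 using zero_simple[OF z_pos G_z, of n] z_pos[of n] by (simp add: amp_def)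

text \<open>The function x powr (\<alpha> + 1) * \<kappa>_1 starts at 0 and its derivative is a
  nonnegative multiple of \<psi>_1, which is positive before its first zero.\<close>

lemma \<kappa>_nonneg: assumes x: "0 < x" "x < 1" shows "0 \<le> \<kappa> 1 x"
proof -
 let ?F = "\<lambda>x. x powr (\<alpha> + 1) * \<kappa> 1 x"
 have "?F 0 \<le> ?F x"
 proof (rule DERIV_nonneg_imp_increasing_open[where f = ?F])
  show "continuous_on {0..x} ?F"
   using \<alpha> by (intro continuous_intros \<kappa>_continuous continuous_on_powr') auto
  fix y assume y: "0 < y" "y < x"
  have p: "y powr (\<alpha> + 1) = y powr \<alpha> * y" using y by (simp add: powr_add)
  have "DERIV (?F) y :> (\<alpha> + 1) * y powr (\<alpha> + 1 - 1) * \<kappa> 1 y + y powr (\<alpha> + 1) * (((z 1)^2 * \<psi> 1 y - (\<alpha> + 1) * \<kappa> 1 y) / y)"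
   using y by (auto intro!: derivative_eq_intros \<kappa>_deriv has_real_derivative_powr)
  also have "(\<alpha> + 1) * y powr (\<alpha> + 1 - 1) * \<kappa> 1 y + y powr (\<alpha> + 1) * (((z 1)^2 * \<psi> 1 y - (\<alpha> + 1) * \<kappa> 1 y) / y) = y powr \<alpha> * ((z 1)^2 * \<psi> 1 y)"
   unfolding p using y by (simp add: field_simps)
  finally have D: "DERIV (?F) y :> y powr \<alpha> * ((z 1)^2 * \<psi> 1 y)" .
  have "0 \<le> \<psi> 1 y" using \<psi>_pos[of y] y x by simp
  thus "\<exists>d. DERIV (?F) y :> d \<and> 0 \<le> d"
   by (intro exI[of _ "y powr \<alpha> * ((z 1)^2 * \<psi> 1 y)"] conjI D) simp
 qed (use x in simp)
 hence "0 \<le> x powr (\<alpha> + 1) * \<kappa> 1 x" by simp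
 thus ?thesis using x by (simp add: zero_le_mult_iff not_le)
qed

text \<open>The quotient of \<open>\<psi> 1\<close> by 1 - x, continued by
  \<open>\<kappa> 1 1\<close> at the simple zero x = 1, is continuous and positive on a compact
  interval.\<close>

lemma \<psi>_lower: "\<exists>c>0. \<forall>x\<in>{0..1}. c * (1 - x) \<le> \<psi> 1 x"
proof -
 define h where "h x = (if x = 1 then \<kappa> 1 1 else \<psi> 1 x / (1 - x))" for x
 have "((\<lambda>y. (\<psi> 1 y - \<psi> 1 1) / (y - 1)) \<longlongrightarrow> - (1 * \<kappa> 1 1)) (at 1)"
  using \<psi>_deriv[of 1 1] unfolding has_field_derivative_iff .
 hence "((\<lambda>y. - ((\<psi> 1 y - \<psi> 1 1) / (y - 1))) \<longlongrightarrow> \<kappa> 1 1) (at 1)" using tendsto_minus by fastforce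
 moreover have "\<forall>\<^sub>F y in at 1. - ((\<psi> 1 y - \<psi> 1 1) / (y - 1)) = h y"
  unfolding eventually_at_filter by (intro always_eventually) (auto simp: h_def \<psi>_1 field_simps)
 ultimately have lim: "(h \<longlongrightarrow> h 1) (at 1)" by (subst (asm) filterlim_cong[OF refl refl]) (auto simp: h_def)
 have cont: "continuous_on {0..1} h"
 proof (rule continuous_at_imp_continuous_on, rule ballI)
  fix x :: real assume x: "x \<in> {0..1}"
  show "isCont h x"
  proof (cases "x = 1")
   case True thus ?thesis using lim by (simp add: isCont_def)
  next
   case False
   have "isCont (\<lambda>x. \<psi> 1 x / (1 - x)) x" using False
    by (intro continuous_intros DERIV_isCont[OF \<psi>_deriv]) simp
   moreover have "\<forall>\<^sub>F y in nhds x. \<psi> 1 y / (1 - y) = h y"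
    using t1_space_nhds[OF False] by eventually_elim (simp add: h_def)
   ultimately show ?thesis using isCont_cong[of "\<lambda>x. \<psi> 1 x / (1 - x)" h x] by simp
  qed
 qed
 obtain x0 where x0: "x0 \<in> {0..1}" "\<forall>x\<in>{0..1}. h x0 \<le> h x"
  using continuous_attains_inf[OF compact_Icc _ cont] by auto
 have hpos: "0 < h x" if "0 \<le> x" "x < 1" for x using \<psi>_pos[OF that] that by (simp add: h_def)
 have "0 \<le> h 1"
 proof (rule tendsto_lowerbound)
  show "(h \<longlongrightarrow> h 1) (at_left 1)" using lim by (simp add: filterlim_at_split)
  show "\<forall>\<^sub>F x in at_left 1. 0 \<le> h x" unfolding eventually_at_left[OF zero_less_one]
   by (rule exI[of _ 0]) (auto intro!: less_imp_le[OF hpos])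
 qed simp
 hence "0 < h 1" using \<kappa>_1[of 1] by (simp add: h_def less_le)
 hence "0 < h x0" using hpos x0(1) by (cases "x0 = 1") auto
 moreover have "h x0 * (1 - x) \<le> \<psi> 1 x" if "x \<in> {0..1}" for x
 proof (cases "x = 1")
  case False
  have "h x0 \<le> h x" using x0(2) that by blast
  hence "h x0 \<le> \<psi> 1 x / (1 - x)" using False by (simp add: h_def[of x])
  thus ?thesis using that False by (simp add: field_simps)
 qed (simp add: \<psi>_1)
 ultimately show ?thesis by blast
qed

lemma \<psi>_upper: assumes n: "1 \<le> n" shows "\<exists>C\<ge>0. \<forall>x\<in>{0..1}. \<bar>\<psi> n x\<bar> \<le> C * (1 - x)"
proof -
 obtain C where C: "0 \<le> C" "\<And>x. x \<in> {0..1} \<Longrightarrow> \<bar>x * \<kappa> n x\<bar> \<le> C"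
  using bounded_on_Icc[of "\<lambda>x. x * \<kappa> n x", OF continuous_on_mult[OF continuous_on_id \<kappa>_continuous]] by blast
 have "\<bar>\<psi> n x\<bar> \<le> C * (1 - x)" if x: "x \<in> {0..1}" for x
 proof (cases "x = 1")
  case False
  hence "x < 1" using x by simp
  from MVT2[OF this \<psi>_deriv[of n]] obtain t where t: "x < t" "t < 1" "\<psi> n 1 - \<psi> n x = (1 - x) * - (t * \<kappa> n t)" by auto
  hence "\<psi> n x = (1 - x) * (t * \<kappa> n t)" using \<psi>_1[OF n] by simp
  hence "\<bar>\<psi> n x\<bar> = (1 - x) * \<bar>t * \<kappa> n t\<bar>" using x by (simp add: abs_mult)
  also have "\<dots> \<le> (1 - x) * C" using C(2)[of t] t x by (intro mult_left_mono) auto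
  finally show ?thesis by (simp add: mult.commute)
 qed (simp add: \<psi>_1[OF n])
 thus ?thesis using C(1) by (intro exI[of _ C]) simp
qed

lemma Wr_deriv: assumes "x \<noteq> 0"
 shows "DERIV (Wr n) x :> - (\<alpha> / x) * Wr n x - L n * (\<psi> n x * \<psi> 1 x)"
proof -
 define m where "m n y = y * \<kappa> n y" for n y
 have m: "DERIV (m n) x :> (z n)\<^sup>2 * \<psi> n x - \<alpha> * \<kappa> n x" for n x using x\<kappa>_deriv[of n x] by (simp add: m_def[abs_def])
 have \<psi>': "DERIV (\<psi> n) x :> - m n x" for n x using \<psi>_deriv[of n x] by (simp add: m_def)
 have W: "Wr n = (\<lambda>x. m 1 x * \<psi> n x - m n x * \<psi> 1 x)" by (simp add: fun_eq_iff Wr_def m_def algebra_simps)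
 have "DERIV (Wr n) x :> (((z 1)^2 * \<psi> 1 x - \<alpha> * \<kappa> 1 x) * \<psi> n x + m 1 x * - m n x)
  - (((z n)^2 * \<psi> n x - \<alpha> * \<kappa> n x) * \<psi> 1 x + m n x * - m 1 x)"
  unfolding W by (auto intro!: derivative_eq_intros m \<psi>')
 also have "(((z 1)^2 * \<psi> 1 x - \<alpha> * \<kappa> 1 x) * \<psi> n x + m 1 x * - m n x)
  - (((z n)^2 * \<psi> n x - \<alpha> * \<kappa> n x) * \<psi> 1 x + m n x * - m 1 x) = - (\<alpha> / x) * Wr n x - L n * (\<psi> n x * \<psi> 1 x)"
  unfolding Wr_def L_def m_def using assms by (simp add: algebra_simps)
 finally show ?thesis .
qed

lemma Zl_deriv: assumes "0 < x" "x < 1" shows "DERIV Zl x :> - (\<alpha> / x) * Zl x - (z 1)^2 - (Zl x)^2"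
proof -
 define m where "m y = y * \<kappa> 1 y" for y
 have m: "DERIV m x :> (z 1)\<^sup>2 * \<psi> 1 x - \<alpha> * \<kappa> 1 x" for x using x\<kappa>_deriv[of 1 x] by (simp add: m_def[abs_def])
 have \<psi>': "DERIV (\<psi> 1) x :> - m x" for x using \<psi>_deriv[of 1 x] by (simp add: m_def)
 have p: "\<psi> 1 x \<noteq> 0" using \<psi>_pos[of x] assms by simp
 have Z: "Zl = (\<lambda>x. - m x / \<psi> 1 x)" by (simp add: fun_eq_iff Zl_def m_def)
 have "DERIV Zl x :> (- ((z 1)^2 * \<psi> 1 x - \<alpha> * \<kappa> 1 x) * \<psi> 1 x - (- m x) * (- m x)) / (\<psi> 1 x * \<psi> 1 x)"
  unfolding Z using p by (intro DERIV_divide DERIV_minus m \<psi>')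
 also have "(- ((z 1)^2 * \<psi> 1 x - \<alpha> * \<kappa> 1 x) * \<psi> 1 x - (- m x) * (- m x)) / (\<psi> 1 x * \<psi> 1 x) = - (\<alpha> / x) * Zl x - (z 1)^2 - (Zl x)^2"
  using p assms unfolding Zl_def m_def by (simp add: field_simps power2_eq_square)
 finally show ?thesis .
qed

text \<open>The factor x stems from \<psi>' = - x \<kappa>, the factor 1 - x from
  \<open>\<psi>_lower\<close>.\<close>

lemma Zl_bound: "\<exists>C\<ge>0. \<forall>x\<in>{0<..<1}. \<bar>Zl x\<bar> * (1 - x) \<le> C * x"
proof -
 obtain c where c: "0 < c" "\<And>x. x \<in> {0..1} \<Longrightarrow> c * (1 - x) \<le> \<psi> 1 x" using \<psi>_lower by blast
 obtain D where D0: "0 \<le> D" and D: "\<And>x. x \<in> {0..1} \<Longrightarrow> \<bar>\<kappa> 1 x\<bar> \<le> D"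
  using bounded_on_Icc[of "\<kappa> 1", OF \<kappa>_continuous] by blast
 have "\<bar>Zl x\<bar> * (1 - x) \<le> (D / c) * x" if x: "x \<in> {0<..<1}" for x
 proof -
  have p: "0 < \<psi> 1 x" using \<psi>_pos[of x] x by simp
  have "\<bar>Zl x\<bar> * (1 - x) = x * (\<bar>\<kappa> 1 x\<bar> * ((1 - x) / \<psi> 1 x))" using p x by (simp add: Zl_def abs_mult)
  also have "\<dots> \<le> x * (D * (1 / c))"
  proof (intro mult_left_mono mult_mono)
   show "(1 - x) / \<psi> 1 x \<le> 1 / c" using c(2)[of x] c(1) p x by (simp add: field_simps)
  qed (use D[of x] D0 x p in auto)
  finally show ?thesis by (simp add: mult_ac)
 qed
 thus ?thesis using D0 c(1) by (intro exI[of _ "D / c"]) simp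
qed

text \<open>Up to the positive factor x powr \<alpha> * \<psi>_1^2, the bracket in \<open>V\<close>
  is - E. For \<alpha> > 0, E vanishes at 0 and has the derivative - \<alpha> x powr (\<alpha> - 1)
  \<kappa>_1 \<psi>_1 \<le> 0 by \<open>\<kappa>_nonneg\<close>. The case \<alpha> = 0 is separate
  because x powr \<alpha> then jumps at 0; there \<open>V\<close> is a sum of squares.\<close>

lemma V_nonneg: assumes x: "0 < x" "x < 1" shows "0 \<le> V x"
proof (cases "\<alpha> = 0")
 case False
 hence \<alpha>0: "0 < \<alpha>" using \<alpha> by simp
 define E where "E y = y powr \<alpha> * (\<alpha> * \<kappa> 1 y * \<psi> 1 y - (z 1)^2 * (\<psi> 1 y)^2 - (y * \<kappa> 1 y)^2)" for y
 have "E x \<le> E 0"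
 proof (rule DERIV_nonpos_imp_decreasing_open[where f = E])
  show "continuous_on {0..x} E"
   unfolding E_def using \<alpha>0 by (intro continuous_intros \<kappa>_continuous \<psi>_continuous continuous_on_powr') auto
  fix y assume y: "0 < y" "y < x"
  define k where "k = \<kappa> 1 y"
  define s where "s = \<psi> 1 y"
  define l where "l = (z 1)^2"
  define m where "m y = y * \<kappa> 1 y" for y
  have m: "DERIV m y :> l * s - \<alpha> * k" using x\<kappa>_deriv[of 1 y] by (simp add: m_def[abs_def] l_def s_def k_def)
  have \<psi>': "DERIV (\<psi> 1) y :> - (y * k)" using \<psi>_deriv[of 1 y] by (simp add: k_def)
  have \<kappa>': "DERIV (\<kappa> 1) y :> (l * s - (\<alpha> + 1) * k) / y" using \<kappa>_deriv[of y 1] y by (simp add: k_def l_def s_def)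
  have kk: "\<kappa> 1 y = k" "\<psi> 1 y = s" "m y = y * k" by (simp_all add: k_def s_def m_def)
  have p: "y powr \<alpha> = y powr (\<alpha> - 1) * y" using y powr_add[of y "\<alpha> - 1" 1] by simp
  have E: "E = (\<lambda>y. y powr \<alpha> * (\<alpha> * \<kappa> 1 y * \<psi> 1 y - l * (\<psi> 1 y)^2 - (m y)^2))" by (simp add: E_def m_def fun_eq_iff l_def)
  have "DERIV E y :> \<alpha> * y powr (\<alpha> - 1) * (\<alpha> * k * s - l * s^2 - (y * k)^2)
   + y powr \<alpha> * (\<alpha> * ((l * s - (\<alpha> + 1) * k) / y) * s + \<alpha> * k * - (y * k) - l * (2 * s * - (y * k)) - 2 * (y * k) * (l * s - \<alpha> * k))"
   unfolding E using y by (auto intro!: derivative_eq_intros \<kappa>' \<psi>' m has_real_derivative_powr simp: kk)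
  also have "\<alpha> * y powr (\<alpha> - 1) * (\<alpha> * k * s - l * s^2 - (y * k)^2)
   + y powr \<alpha> * (\<alpha> * ((l * s - (\<alpha> + 1) * k) / y) * s + \<alpha> * k * - (y * k) - l * (2 * s * - (y * k)) - 2 * (y * k) * (l * s - \<alpha> * k))
   = - (y powr (\<alpha> - 1) * (\<alpha> * (k * s)))"
   unfolding p using y by (simp add: field_simps power2_eq_square)
  finally have D: "DERIV E y :> - (y powr (\<alpha> - 1) * (\<alpha> * (k * s)))" .
  have "0 \<le> k" "0 \<le> s" using \<kappa>_nonneg[of y] \<psi>_pos[of y] y x by (auto simp: k_def s_def)
  hence "0 \<le> y powr (\<alpha> - 1) * (\<alpha> * (k * s))" using \<alpha> by simp
  thus "\<exists>d. DERIV E y :> d \<and> d \<le> 0"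
   by (intro exI[of _ "- (y powr (\<alpha> - 1) * (\<alpha> * (k * s)))"] conjI D) simp
 qed (use x in simp)
 hence "E x \<le> 0" by (simp add: E_def)
 hence le: "\<alpha> * \<kappa> 1 x * \<psi> 1 x - (z 1)^2 * (\<psi> 1 x)^2 - (x * \<kappa> 1 x)^2 \<le> 0"
  using x by (simp add: E_def mult_le_0_iff)
 have p: "0 < \<psi> 1 x" using \<psi>_pos[of x] x by simp
 have "\<alpha> * Zl x / x + (z 1)^2 + (Zl x)^2 = - (\<alpha> * \<kappa> 1 x * \<psi> 1 x - (z 1)^2 * (\<psi> 1 x)^2 - (x * \<kappa> 1 x)^2) / (\<psi> 1 x)^2"
  unfolding Zl_def using p x by (simp add: field_simps power2_eq_square)
 hence "0 \<le> \<alpha> * Zl x / x + (z 1)^2 + (Zl x)^2" using le by simp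
 thus ?thesis unfolding V_def using \<alpha> by simp
next
 case True
 hence *: "\<alpha> / x^2 = 0" "\<alpha> * Zl x / x = 0" by simp_all
 show ?thesis unfolding V_def * by simp
qed

lemma x_powr_le_1: "x \<in> {0..1} \<Longrightarrow> x powr \<alpha> \<le> 1"
 using \<alpha> powr_mono2[of \<alpha> x 1] by simp

lemma weighted_interval_wt: "weighted_interval wt om V"
proof
 show "0 < wt x" if "0 < x" "x < 1" for x using \<psi>_pos[of x] amp_pos[of 1] that by (simp add: wt_def)
 obtain C where C: "0 \<le> C" "\<And>x. x \<in> {0..1} \<Longrightarrow> \<bar>(amp 1 * \<psi> 1 x)\<^sup>2\<bar> \<le> C"
  using bounded_on_Icc[of "\<lambda>x. (amp 1 * \<psi> 1 x)^2", OF continuous_on_power[OF continuous_on_mult[OF continuous_on_const \<psi>_continuous]]] by blast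
 have "wt x \<le> C" if "x \<in> {0<..<1}" for x
 proof -
  have "wt x \<le> 1 * C" unfolding wt_def using C(2)[of x] x_powr_le_1[of x] that by (intro mult_mono) auto
  thus ?thesis by simp
 qed
 thus "\<exists>C. \<forall>x\<in>{0<..<1}. wt x \<le> C" by (intro exI[of _ C] ballI)
 show "DERIV wt x :> om x * wt x" if x: "0 < x" "x < 1" for x
 proof -
  have p: "\<psi> 1 x \<noteq> 0" using \<psi>_pos[of x] x by simp
  have q: "x powr (\<alpha> - 1) = x powr \<alpha> / x" using x by (simp add: powr_diff)
  have "DERIV wt x :> \<alpha> * x powr (\<alpha> - 1) * (amp 1 * \<psi> 1 x)^2 + x powr \<alpha> * (2 * (amp 1 * \<psi> 1 x) * (amp 1 * - (x * \<kappa> 1 x)))"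
   unfolding wt_def using x by (auto intro!: derivative_eq_intros \<psi>_deriv has_real_derivative_powr)
  also have "\<alpha> * x powr (\<alpha> - 1) * (amp 1 * \<psi> 1 x)^2 + x powr \<alpha> * (2 * (amp 1 * \<psi> 1 x) * (amp 1 * - (x * \<kappa> 1 x))) = om x * wt x"
   unfolding q om_def wt_def Zl_def using x p by (simp add: field_simps power2_eq_square)
  finally show ?thesis .
 qed
 show "DERIV om x :> - V x" if x: "0 < x" "x < 1" for x
 proof -
  have "DERIV om x :> - \<alpha> / x^2 + 2 * (- (\<alpha> / x) * Zl x - (z 1)^2 - (Zl x)^2)"
   unfolding om_def using x by (auto intro!: derivative_eq_intros Zl_deriv simp: power2_eq_square)
  thus ?thesis by (simp add: V_def algebra_simps)
 qed
 show "0 \<le> V x" if "0 < x" "x < 1" for x by (rule V_nonneg[OF that])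
 have Zc: "continuous_on {0<..<1} Zl" by (auto intro!: continuous_at_imp_continuous_on DERIV_isCont Zl_deriv)
 show "continuous_on {0<..<1} V" unfolding V_def by (intro continuous_intros Zc) auto
 obtain D where D: "0 \<le> D" "\<And>x. x \<in> {0<..<1} \<Longrightarrow> \<bar>Zl x\<bar> * (1 - x) \<le> D * x" using Zl_bound by blast
 show "\<exists>C. \<forall>x\<in>{0<..<1}. \<bar>om x\<bar> * (x * (1 - x)) \<le> C"
 proof (intro exI ballI)
  fix x :: real assume x: "x \<in> {0<..<1}"
  have x2: "x * x \<le> 1" "x * (1 - x) \<le> 1" using x mult_mono[of x 1 x 1] mult_mono[of x 1 "1 - x" 1] by auto
  have "\<bar>om x\<bar> * (x * (1 - x)) \<le> (\<alpha> / x + 2 * \<bar>Zl x\<bar>) * (x * (1 - x))"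
   using x \<alpha> by (intro mult_right_mono order_trans[OF abs_triangle_ineq[of "\<alpha> / x" "2 * Zl x", folded om_def]]) (auto simp: abs_mult)
  also have "\<dots> = \<alpha> * (1 - x) + 2 * x * (\<bar>Zl x\<bar> * (1 - x))" using x by (simp add: field_simps)
  also have "\<dots> \<le> \<alpha> * 1 + 2 * x * (D * x)" using x \<alpha> D(2)[OF x] by (intro add_mono mult_left_mono) auto
  also have "2 * x * (D * x) = 2 * D * (x * x)" by simp
  also have "\<dots> \<le> 2 * D * 1" using x2 D(1) by (intro mult_left_mono) auto
  finally show "\<bar>om x\<bar> * (x * (1 - x)) \<le> \<alpha> * 1 + 2 * D * 1" by simp
 qed
 show "\<exists>C. \<forall>x\<in>{0<..<1}. V x * (x * (1 - x))^2 \<le> C"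
 proof (intro exI ballI)
  fix x :: real assume x: "x \<in> {0<..<1}"
  have a: "\<bar>Zl x\<bar> * (1 - x) \<le> D" using D(2)[OF x] D(1) x mult_left_mono[of x 1 D] by auto
  have b: "x * (1 - x) \<le> 1" "0 \<le> x * (1 - x)" "1 - x \<le> 1" "0 \<le> 1 - x" using x mult_mono[of x 1 "1 - x" 1] by auto
  have "V x * (x * (1 - x))^2 = \<alpha> * (1 - x)^2 + 2 * (\<alpha> * (Zl x * (1 - x)) * (x * (1 - x)) + (z 1)^2 * (x * (1 - x))^2 + (Zl x * (1 - x))^2 * x^2)"
   unfolding V_def using x by (simp add: field_simps power2_eq_square)
  also have "\<dots> \<le> \<alpha> * 1 + 2 * (\<alpha> * D * 1 + (z 1)^2 * 1 + D^2 * 1)"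
  proof (intro add_mono mult_left_mono)
   show "(1 - x)^2 \<le> 1" using b by (simp add: power_le_one)
   have "Zl x * (1 - x) \<le> \<bar>Zl x\<bar> * (1 - x)" using b by (intro mult_right_mono) auto
   hence "Zl x * (1 - x) \<le> D" using a by linarith
   thus "\<alpha> * (Zl x * (1 - x)) * (x * (1 - x)) \<le> \<alpha> * D * 1" using b \<alpha> D(1)
    by (intro order_trans[OF mult_right_mono[OF mult_left_mono[of "Zl x * (1 - x)" D \<alpha>] b(2)] mult_left_mono[OF b(1)]]) auto
   show "(x * (1 - x))^2 \<le> 1" using b by (simp add: power_le_one)
   have "\<bar>Zl x * (1 - x)\<bar> \<le> \<bar>D\<bar>" using a b D(1) by (simp add: abs_mult)
   hence "(Zl x * (1 - x))^2 \<le> D^2" by (simp add: abs_le_square_iff)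
   thus "(Zl x * (1 - x))^2 * x^2 \<le> D^2 * 1" using x by (intro mult_mono) (auto simp: power_le_one)
  qed (use \<alpha> in auto)
  finally show "V x * (x * (1 - x))^2 \<le> \<alpha> * 1 + 2 * (\<alpha> * D * 1 + (z 1)^2 * 1 + D^2 * 1)" .
 qed
qed

lemma f_deriv: assumes x: "0 < x" "x < 1" shows "DERIV (f n) x :> f' n x"
proof -
 have p: "\<psi> 1 x \<noteq> 0" "amp 1 \<noteq> 0" using \<psi>_pos[of x] amp_pos[of 1] x by auto
 have "DERIV (f n) x :> (amp n * - (x * \<kappa> n x) * (amp 1 * \<psi> 1 x) - amp n * \<psi> n x * (amp 1 * - (x * \<kappa> 1 x))) / ((amp 1 * \<psi> 1 x) * (amp 1 * \<psi> 1 x))"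
  unfolding f_def using p by (intro DERIV_divide DERIV_cmult \<psi>_deriv) auto
 also have "(amp n * - (x * \<kappa> n x) * (amp 1 * \<psi> 1 x) - amp n * \<psi> n x * (amp 1 * - (x * \<kappa> 1 x))) / ((amp 1 * \<psi> 1 x) * (amp 1 * \<psi> 1 x)) = f' n x"
  unfolding f'_def Wr_def using p by (simp add: field_simps power2_eq_square)
 finally show ?thesis .
qed

lemma f'_deriv: assumes x: "0 < x" "x < 1" shows "DERIV (f' n) x :> - om x * f' n x - L n * f n x"
proof -
 have p: "\<psi> 1 x \<noteq> 0" "amp 1 \<noteq> 0" "x \<noteq> 0" using \<psi>_pos[of x] amp_pos[of 1] x by auto
 have "DERIV (f' n) x :> amp n / amp 1 * (((- (\<alpha> / x) * Wr n x - L n * (\<psi> n x * \<psi> 1 x)) * (\<psi> 1 x)^2 - Wr n x * (2 * \<psi> 1 x * - (x * \<kappa> 1 x))) / ((\<psi> 1 x)^2 * (\<psi> 1 x)^2))"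
  unfolding f'_def using p by (intro DERIV_cmult DERIV_divide Wr_deriv) (auto intro!: derivative_eq_intros \<psi>_deriv)
 also have "amp n / amp 1 * (((- (\<alpha> / x) * Wr n x - L n * (\<psi> n x * \<psi> 1 x)) * (\<psi> 1 x)^2 - Wr n x * (2 * \<psi> 1 x * - (x * \<kappa> 1 x))) / ((\<psi> 1 x)^2 * (\<psi> 1 x)^2))
  = - om x * f' n x - L n * f n x"
  unfolding f'_def f_def om_def Zl_def using p by (simp add: field_simps power2_eq_square)
 finally show ?thesis .
qed

lemma f_bdd: assumes n: "1 \<le> n" shows "\<exists>C. \<forall>x\<in>{0<..<1}. \<bar>f n x\<bar> \<le> C"
proof -
 obtain c where c: "0 < c" "\<And>x. x \<in> {0..1} \<Longrightarrow> c * (1 - x) \<le> \<psi> 1 x" using \<psi>_lower by blast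
 obtain C where C: "0 \<le> C" "\<And>x. x \<in> {0..1} \<Longrightarrow> \<bar>\<psi> n x\<bar> \<le> C * (1 - x)" using \<psi>_upper[OF n] by blast
 have "\<bar>f n x\<bar> \<le> amp n / amp 1 * (C / c)" if x: "x \<in> {0<..<1}" for x
 proof -
  have p: "0 < \<psi> 1 x" using \<psi>_pos[of x] x by simp
  have "\<bar>\<psi> n x\<bar> / \<psi> 1 x \<le> (C * (1 - x)) / (c * (1 - x))" using C(2)[of x] c(2)[of x] C(1) c(1) x p by (intro frac_le) auto
  also have "\<dots> = C / c" using x by simp
  finally have "amp n / amp 1 * (\<bar>\<psi> n x\<bar> / \<psi> 1 x) \<le> amp n / amp 1 * (C / c)" using amp_pos[OF n] amp_pos[of 1] by (intro mult_left_mono) auto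
  moreover have "\<bar>f n x\<bar> = amp n / amp 1 * (\<bar>\<psi> n x\<bar> / \<psi> 1 x)" using amp_pos[OF n] amp_pos[of 1] p by (simp add: f_def abs_mult)
  ultimately show ?thesis by simp
 qed
 thus ?thesis by blast
qed

text \<open>Near \<open>1\<close> the Wronskian vanishes to third order since \<open>(x powr \<alpha> * Wr)' = - L n * x powr \<alpha> * \<psi> n * \<psi> 1\<close>.\<close>
lemma Wr_bound:
 assumes n: "1 \<le> n" shows "\<exists>C\<ge>0. \<forall>x\<in>{0..1}. \<bar>Wr n x\<bar> \<le> C * (x * (1 - x) * (1 - x)^2)"
proof -
 obtain C1 where C1: "0 \<le> C1" "\<And>x. x \<in> {0..1} \<Longrightarrow> \<bar>\<psi> 1 x\<bar> \<le> C1 * (1 - x)" using \<psi>_upper[of 1] by blast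
 obtain C where C: "0 \<le> C" "\<And>x. x \<in> {0..1} \<Longrightarrow> \<bar>\<psi> n x\<bar> \<le> C * (1 - x)" using \<psi>_upper[OF n] by blast
 obtain D where D: "0 \<le> D" "\<And>x. x \<in> {0..1} \<Longrightarrow> \<bar>\<kappa> 1 x * \<psi> n x - \<kappa> n x * \<psi> 1 x\<bar> \<le> D"
  using bounded_on_Icc[of "\<lambda>x. \<kappa> 1 x * \<psi> n x - \<kappa> n x * \<psi> 1 x", OF continuous_on_diff[OF continuous_on_mult[OF \<kappa>_continuous \<psi>_continuous] continuous_on_mult[OF \<kappa>_continuous \<psi>_continuous]]] by blast
 \<comment> \<open>On the left half (1 - x)^3 \<ge> 1 / 8 explains the factor 8. On the right half 2
   x \<ge> 1 supplies the factor x, and (2 x) powr \<alpha> \<ge> 1 removes the weight.\<close>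
 define E where "E = max (8 * D) (2 * 2 powr \<alpha> * (\<bar>L n\<bar> * (C * C1)))"
 have "\<bar>Wr n x\<bar> \<le> E * (x * (1 - x) * (1 - x)^2)" if x: "x \<in> {0..1}" for x
 proof (cases "x \<le> 1 / 2")
  case True
  have h: "1 / 8 \<le> (1 - x) ^ 3" using power_mono[of "1/2" "1 - x" 3] True by (simp add: power_divide)
  have "\<bar>Wr n x\<bar> \<le> x * D" unfolding Wr_def using x D(2)[OF x] by (simp add: abs_mult mult_left_mono)
  also have "\<dots> \<le> x * (8 * D * (1 - x) ^ 3)" using mult_left_mono[OF h, of "8 * D"] D(1) x by (intro mult_left_mono) auto
  also have "\<dots> \<le> x * (E * (1 - x) ^ 3)" using x unfolding E_def by (intro mult_left_mono mult_right_mono) auto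
  finally show ?thesis by (simp add: power2_eq_square power3_eq_cube mult_ac)
 next
  case False
  show ?thesis
  proof (cases "x = 1")
   case True thus ?thesis by (simp add: Wr_def \<psi>_1 n)
  next
   case False
   hence x1: "x < 1" "1 / 2 < x" using x \<open>\<not> x \<le> 1 / 2\<close> by auto
   have der: "DERIV (\<lambda>t. t powr \<alpha> * Wr n t) t :> - (t powr \<alpha> * (L n * (\<psi> n t * \<psi> 1 t)))" if "0 < t" for t
   proof -
    have q: "t powr (\<alpha> - 1) = t powr \<alpha> / t" using that by (simp add: powr_diff)
    have "DERIV (\<lambda>t. t powr \<alpha> * Wr n t) t :> \<alpha> * t powr (\<alpha> - 1) * Wr n t + t powr \<alpha> * (- (\<alpha> / t) * Wr n t - L n * (\<psi> n t * \<psi> 1 t))"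
     using that by (auto intro!: derivative_eq_intros Wr_deriv has_real_derivative_powr)
    thus ?thesis unfolding q by (simp add: algebra_simps)
   qed
   from MVT2[OF x1(1), of "\<lambda>t. t powr \<alpha> * Wr n t" "\<lambda>t. - (t powr \<alpha> * (L n * (\<psi> n t * \<psi> 1 t)))"] der x1
   obtain t where t: "x < t" "t < 1" "1 powr \<alpha> * Wr n 1 - x powr \<alpha> * Wr n x = (1 - x) * - (t powr \<alpha> * (L n * (\<psi> n t * \<psi> 1 t)))" by auto
   have "x powr \<alpha> * \<bar>Wr n x\<bar> = (1 - x) * (t powr \<alpha> * (\<bar>L n\<bar> * (\<bar>\<psi> n t\<bar> * \<bar>\<psi> 1 t\<bar>)))"
   proof -
    have "x powr \<alpha> * Wr n x = (1 - x) * (t powr \<alpha> * (L n * (\<psi> n t * \<psi> 1 t)))" using t(3) by (simp add: Wr_def \<psi>_1 n)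
    hence "\<bar>x powr \<alpha> * Wr n x\<bar> = \<bar>(1 - x) * (t powr \<alpha> * (L n * (\<psi> n t * \<psi> 1 t)))\<bar>" by simp
    thus ?thesis using x1 by (simp add: abs_mult)
   qed
   also have "\<dots> \<le> (1 - x) * (1 * (\<bar>L n\<bar> * ((C * (1 - x)) * (C1 * (1 - x)))))"
   proof (intro mult_left_mono mult_mono)
    show "t powr \<alpha> \<le> 1" using t x1 by (intro x_powr_le_1) auto
    show "\<bar>\<psi> n t\<bar> \<le> C * (1 - x)" using C(2)[of t] mult_left_mono[of "1 - t" "1 - x" C] C(1) t x1 by auto
    show "\<bar>\<psi> 1 t\<bar> \<le> C1 * (1 - x)" using C1(2)[of t] mult_left_mono[of "1 - t" "1 - x" C1] C1(1) t x1 by auto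
   qed (use C(1) C1(1) x1 in auto)
   finally have le: "x powr \<alpha> * \<bar>Wr n x\<bar> \<le> (\<bar>L n\<bar> * (C * C1)) * ((1 - x) * (1 - x)^2)" by (simp add: power2_eq_square mult_ac)
   have "1 \<le> (2 * x) powr \<alpha>" using x1 \<alpha> by (intro ge_one_powr_ge_zero) auto
   hence one: "1 \<le> 2 powr \<alpha> * x powr \<alpha>" by (simp add: powr_mult)
   have "\<bar>Wr n x\<bar> \<le> 2 powr \<alpha> * (x powr \<alpha> * \<bar>Wr n x\<bar>)" using mult_right_mono[OF one, of "\<bar>Wr n x\<bar>"] by (simp add: mult.assoc)
   also have "\<dots> \<le> 2 powr \<alpha> * ((\<bar>L n\<bar> * (C * C1)) * ((1 - x) * (1 - x)^2))" using le by (intro mult_left_mono) auto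
   also have "\<dots> \<le> 2 powr \<alpha> * ((\<bar>L n\<bar> * (C * C1)) * ((1 - x) * (1 - x)^2)) * (2 * x)"
    using mult_left_mono[of 1 "2 * x" "2 powr \<alpha> * ((\<bar>L n\<bar> * (C * C1)) * ((1 - x) * (1 - x)^2))"] x1 C(1) C1(1) by simp
   also have "\<dots> = (2 * 2 powr \<alpha> * (\<bar>L n\<bar> * (C * C1))) * (x * (1 - x) * (1 - x)^2)" by (simp add: mult_ac)
   also have "\<dots> \<le> E * (x * (1 - x) * (1 - x)^2)" using x unfolding E_def by (intro mult_right_mono) auto
   finally show ?thesis .
  qed
 qed
 moreover have "0 \<le> E" using D(1) by (simp add: E_def le_max_iff_disj)
 ultimately show ?thesis by blast
qed

text \<open>At 1 the Wronskian vanishes to third order against the second order of \<psi>_1^2; at 0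
  it carries the factor x.\<close>

lemma f'_bdd: assumes n: "1 \<le> n" shows "\<exists>C. \<forall>x\<in>{0<..<1}. \<bar>f' n x\<bar> \<le> C * (x * (1 - x))"
proof -
 obtain c where c: "0 < c" "\<And>x. x \<in> {0..1} \<Longrightarrow> c * (1 - x) \<le> \<psi> 1 x" using \<psi>_lower by blast
 obtain E where E: "0 \<le> E" "\<And>x. x \<in> {0..1} \<Longrightarrow> \<bar>Wr n x\<bar> \<le> E * (x * (1 - x) * (1 - x)^2)" using Wr_bound[OF n] by blast
 have "\<bar>f' n x\<bar> \<le> amp n / amp 1 * (E / c^2) * (x * (1 - x))" if x: "x \<in> {0<..<1}" for x
 proof -
  have p: "0 < \<psi> 1 x" using \<psi>_pos[of x] x by simp
  have sq: "(c * (1 - x))^2 \<le> (\<psi> 1 x)^2" using c(2)[of x] c(1) x by (intro power_mono) auto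
  have "\<bar>Wr n x\<bar> / (\<psi> 1 x)^2 \<le> (E * (x * (1 - x) * (1 - x)^2)) / (c * (1 - x))^2"
   using E(2)[of x] sq E(1) c(1) x p by (intro frac_le) auto
  also have "\<dots> = E / c^2 * (x * (1 - x))" using x c(1) unfolding power_mult_distrib by (simp add: divide_simps)
  finally have "amp n / amp 1 * (\<bar>Wr n x\<bar> / (\<psi> 1 x)^2) \<le> amp n / amp 1 * (E / c^2 * (x * (1 - x)))" using amp_pos[OF n] amp_pos[of 1] by (intro mult_left_mono) auto
  moreover have "\<bar>f' n x\<bar> = amp n / amp 1 * (\<bar>Wr n x\<bar> / (\<psi> 1 x)^2)" using amp_pos[OF n] amp_pos[of 1] p by (simp add: f'_def abs_mult)
  ultimately show ?thesis by (simp add: mult.assoc)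
 qed
 thus ?thesis by blast
qed

text \<open>Lommel's integral: \<open>F\<close> is an explicit antiderivative of 2 l x powr \<alpha>
  \<psi>_n^2 with F 0 = 0 and F 1 the square of \<open>\<kappa> n 1\<close>, since \<psi>_n vanishes
  at 1. The constant \<open>amp n\<close> is read off from it.\<close>

lemma norm_integral:
 assumes n: "1 \<le> n" shows "((\<lambda>x. x powr \<alpha> * (amp n * \<psi> n x)^2) has_integral 1) {0<..<1}"
proof -
 define l where "l = (z n)^2"
 have l: "0 < l" using z_pos[OF n] by (simp add: l_def)
 define F where "F x = x powr (\<alpha> + 1) * ((x * \<kappa> n x)^2 + l * (\<psi> n x)^2 - (\<alpha> - 1) * \<psi> n x * \<kappa> n x)" for x
 have "((\<lambda>x. 2 * l * (x powr \<alpha> * (\<psi> n x)^2)) has_integral F 1 - F 0) {0..1}"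
 proof (rule fundamental_theorem_of_calculus_interior)
  show "continuous_on {0..1} F"
   unfolding F_def using \<alpha> by (intro continuous_intros \<kappa>_continuous \<psi>_continuous continuous_on_powr') auto
  fix x :: real assume x: "x \<in> {0<..<1}"
  define k where "k = \<kappa> n x"
  define s where "s = \<psi> n x"
  define m where "m y = y * \<kappa> n y" for y
  have kk: "\<kappa> n x = k" "\<psi> n x = s" "m x = x * k" by (simp_all add: k_def s_def m_def)
  have m: "DERIV m x :> l * s - \<alpha> * k" using x\<kappa>_deriv[of n x] by (simp add: m_def[abs_def] l_def s_def k_def)
  have \<psi>': "DERIV (\<psi> n) x :> - (x * k)" using \<psi>_deriv[of n x] by (simp add: k_def)
  have \<kappa>': "DERIV (\<kappa> n) x :> (l * s - (\<alpha> + 1) * k) / x" using \<kappa>_deriv[of x n] x by (simp add: k_def l_def s_def)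
  have p: "x powr (\<alpha> + 1) = x powr \<alpha> * x" using x by (simp add: powr_add)
  have F: "F = (\<lambda>x. x powr (\<alpha> + 1) * ((m x)^2 + l * (\<psi> n x)^2 - (\<alpha> - 1) * \<psi> n x * \<kappa> n x))" by (simp add: F_def m_def fun_eq_iff)
  have "DERIV F x :> (\<alpha> + 1) * x powr (\<alpha> + 1 - 1) * ((x * k)^2 + l * s^2 - (\<alpha> - 1) * s * k)
   + x powr (\<alpha> + 1) * (2 * (x * k) * (l * s - \<alpha> * k) + l * (2 * s * - (x * k)) - (\<alpha> - 1) * (- (x * k) * k + s * ((l * s - (\<alpha> + 1) * k) / x)))"
   unfolding F using x by (auto intro!: derivative_eq_intros \<kappa>' \<psi>' m has_real_derivative_powr simp: kk field_simps)
  also have "(\<alpha> + 1) * x powr (\<alpha> + 1 - 1) * ((x * k)^2 + l * s^2 - (\<alpha> - 1) * s * k)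
   + x powr (\<alpha> + 1) * (2 * (x * k) * (l * s - \<alpha> * k) + l * (2 * s * - (x * k)) - (\<alpha> - 1) * (- (x * k) * k + s * ((l * s - (\<alpha> + 1) * k) / x)))
   = 2 * l * (x powr \<alpha> * s^2)" unfolding p using x by (simp add: field_simps power2_eq_square)
  finally show "(F has_vector_derivative 2 * l * (x powr \<alpha> * (\<psi> n x)^2)) (at x)"
   by (simp add: has_real_derivative_iff_has_vector_derivative s_def)
 qed simp
 hence "((\<lambda>x. 2 * l * (x powr \<alpha> * (\<psi> n x)^2)) has_integral (\<kappa> n 1)\<^sup>2) {0<..<1}"
  by (simp add: F_def \<psi>_1[OF n] has_integral_Icc_iff_Ioo)
 hence "((\<lambda>x. (amp n)^2 / (2 * l) * (2 * l * (x powr \<alpha> * (\<psi> n x)^2))) has_integral (amp n)\<^sup>2 / (2 * l) * (\<kappa> n 1)^2) {0<..<1}"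
  by (rule has_integral_mult_right)
 moreover have "(amp n)^2 / (2 * l) * (\<kappa> n 1)^2 = 1" using z_pos[OF n] zero_simple[OF z_pos[OF n] G_z[OF n]]
  by (simp add: amp_def l_def \<kappa>_def power_divide power_mult_distrib)
 moreover have "(\<lambda>x. (amp n)^2 / (2 * l) * (2 * l * (x powr \<alpha> * (\<psi> n x)^2))) = (\<lambda>x. x powr \<alpha> * (amp n * \<psi> n x)^2)"
  using l by (simp add: fun_eq_iff power_mult_distrib)
 ultimately show ?thesis by (simp only:)
qed

text \<open>The denominator has no interior zero, and z (n + 1) * x is a zero of G below z (n + 1)
  exactly when it is one of the first n zeros.\<close>

lemma f_zeros:
 shows "finite {x \<in> {0<..<1}. f (Suc n) x = 0}" "card {x \<in> {0<..<1}. f (Suc n) x = 0} = n"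
proof -
 have zs: "0 < z (Suc n)" by (rule z_pos) simp
 have eq: "{x \<in> {0<..<1}. f (Suc n) x = 0} = (\<lambda>j. z j / z (Suc n)) ` {1..n}"
 proof (rule set_eqI, rule iffI)
  fix x assume x: "x \<in> {x \<in> {0<..<1}. f (Suc n) x = 0}"
  hence "G (z (Suc n) * x) = 0" using \<psi>_pos[of x] amp_pos[of "Suc n"] amp_pos[of 1] by (auto simp: f_def \<psi>_def)
  then obtain j where j: "1 \<le> j" "z (Suc n) * x = z j" using zero_is_z[of "z (Suc n) * x"] x zs by auto
  have "z (Suc n) * x < z (Suc n) * 1" using x zs by (intro mult_strict_left_mono) auto
  hence "j < Suc n" using j strict_mono_less[OF z_mono] by simp
  thus "x \<in> (\<lambda>j. z j / z (Suc n)) ` {1..n}" using j zs by (intro image_eqI[of _ _ j]) (auto simp: field_simps)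
 next
  fix x assume "x \<in> (\<lambda>j. z j / z (Suc n)) ` {1..n}"
  then obtain j where j: "1 \<le> j" "j \<le> n" "x = z j / z (Suc n)" by auto
  have "z j < z (Suc n)" using j strict_mono_less[OF z_mono, of j "Suc n"] by simp
  thus "x \<in> {x \<in> {0<..<1}. f (Suc n) x = 0}" using z_pos[OF j(1)] zs G_z[OF j(1)] by (simp add: j(3) f_def \<psi>_def)
 qed
 have inj: "inj_on (\<lambda>j. z j / z (Suc n)) {1..n}" using zs strict_mono_eq[OF z_mono] by (intro inj_onI) simp
 show "finite {x \<in> {0<..<1}. f (Suc n) x = 0}" "card {x \<in> {0<..<1}. f (Suc n) x = 0} = n"
  unfolding eq card_image[OF inj] by simp_all
qed

lemma f_end_0: assumes "1 \<le> n" shows "\<exists>l. l \<noteq> 0 \<and> (f n \<longlongrightarrow> l) (at_right 0)"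
proof -
 have c: "(\<psi> n \<longlongrightarrow> G 0) (at_right 0)" for n
  using DERIV_isCont[OF \<psi>_deriv[of n 0]] by (simp add: isCont_def filterlim_at_split \<psi>_0)
 have "(f n \<longlongrightarrow> amp n * G 0 / (amp 1 * G 0)) (at_right 0)"
  unfolding f_def using G_0 amp_pos[of 1] by (intro tendsto_intros c) auto
 moreover have "amp n * G 0 / (amp 1 * G 0) \<noteq> 0" using G_0 amp_pos[of 1] amp_pos[OF assms] by simp
 ultimately show ?thesis by blast
qed

text \<open>Numerator and denominator vanish simply at 1, so the limit is the quotient of the
  derivatives.\<close>

lemma f_end_1: assumes n: "1 \<le> n" shows "\<exists>l. l \<noteq> 0 \<and> (f n \<longlongrightarrow> l) (at_left 1)"
proof -
 have c: "((\<lambda>y. \<psi> n y / (y - 1)) \<longlongrightarrow> - \<kappa> n 1) (at_left 1)" if "1 \<le> n" for n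
  using \<psi>_deriv[of n 1] by (simp add: has_field_derivative_iff filterlim_at_split \<psi>_1[OF that])
 have "((\<lambda>y. amp n * (\<psi> n y / (y - 1)) / (amp 1 * (\<psi> 1 y / (y - 1)))) \<longlongrightarrow> amp n * - \<kappa> n 1 / (amp 1 * - \<kappa> 1 1)) (at_left 1)"
  using \<kappa>_1[of 1] amp_pos[of 1] by (intro tendsto_intros c n) auto
 moreover have "\<forall>\<^sub>F y in at_left 1. amp n * (\<psi> n y / (y - 1)) / (amp 1 * (\<psi> 1 y / (y - 1))) = f n y"
  unfolding eventually_at_filter by (intro always_eventually) (auto simp: f_def)
 ultimately have "(f n \<longlongrightarrow> amp n * - \<kappa> n 1 / (amp 1 * - \<kappa> 1 1)) (at_left 1)" by (rule Lim_transform_eventually)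
 moreover have "amp n * - \<kappa> n 1 / (amp 1 * - \<kappa> 1 1) \<noteq> 0" using \<kappa>_1[of 1] \<kappa>_1[OF n] amp_pos[of 1] amp_pos[OF n] by simp
 ultimately show ?thesis by blast
qed

theorem weighted_modes_bessel: "weighted_modes wt om V f f' L"
proof (intro weighted_modes.intro weighted_interval_wt weighted_modes_axioms.intro)
 show "((\<lambda>x. wt x * (f n x)^2) has_integral 1) {0<..<1}" if n: "1 \<le> n" for n
 proof (rule has_integral_eq[OF _ norm_integral[OF n]])
  fix x :: real assume "x \<in> {0<..<1}"
  hence "\<psi> 1 x \<noteq> 0" using \<psi>_pos[of x] by simp
  thus "x powr \<alpha> * (amp n * \<psi> n x)^2 = wt x * (f n x)^2"
   using amp_pos[of 1] by (simp add: wt_def f_def power_divide power_mult_distrib)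
 qed
 show "f 1 x = 1" if "0 < x" "x < 1" for x using \<psi>_pos[of x] amp_pos[of 1] that by (simp add: f_def)
 show "L m < L n" if "1 \<le> m" "m < n" for m n
  using strict_monoD[OF z_mono that(2)] z_nonneg[of m] unfolding L_def by (simp add: power_strict_mono)
 show "filterlim L at_top sequentially"
 proof (rule filterlim_at_top_mono[OF filterlim_tendsto_add_at_top[OF tendsto_const[of "- (z 1)\<^sup>2 - 1"] z_tendsto]], rule always_eventually, rule allI)
  fix n
  have "z n - 1 \<le> (z n)^2" using zero_le_power2[of "z n - 1 / 2"] by (simp add: power2_eq_square algebra_simps)
  thus "- (z 1)\<^sup>2 - 1 + z n \<le> L n" by (simp add: L_def)
 qed
 show "f' n x \<noteq> 0" if n: "1 \<le> n" and x: "0 < x" "x < 1" "f n x = 0" for n x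
 proof -
  have p: "0 < \<psi> 1 x" using \<psi>_pos[of x] x by simp
  hence "\<psi> n x = 0" using x(3) amp_pos[OF n] amp_pos[of 1] by (auto simp: f_def)
  thus ?thesis using \<psi>_zero[OF n x(1)] p x amp_pos[OF n] amp_pos[of 1] by (simp add: f'_def Wr_def)
 qed
qed (use f_deriv f'_deriv f_bdd f'_bdd f_zeros f_end_0 f_end_1 in \<open>simp_all add: L_def\<close>)

end

section \<open>Bessel functions\<close>

text \<open>The coefficients of (x / 2) powr (- \<nu>) J_\<nu>(x) as a power series in y = x^2 /
  4.\<close>

definition bcoef :: "real \<Rightarrow> nat \<Rightarrow> real" where
 "bcoef \<nu> m = (-1) ^ m / (fact m * Gamma (real m + \<nu> + 1))"

definition bser :: "real \<Rightarrow> real \<Rightarrow> real" where "bser \<nu> y = (\<Sum>m. bcoef \<nu> m * y ^ m)"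

text \<open>\<open>bg \<nu>\<close> is the entire even function \<open>(x / 2) powr (- \<nu>) * J\<^sub>\<nu> x\<close>.\<close>
definition bg :: "real \<Rightarrow> real \<Rightarrow> real" where "bg \<nu> x = bser \<nu> (x^2 / 4)"

definition bk :: "real \<Rightarrow> real \<Rightarrow> real" where "bk \<nu> x = bg (\<nu> + 1) x / 2"

lemma bcoef_Suc:
 assumes "-1 < \<nu>"
 shows "bcoef \<nu> (Suc m) * (real (Suc m) * (real m + \<nu> + 1)) = - bcoef \<nu> m"
  and "bcoef (\<nu> + 1) m * (real m + \<nu> + 1) = bcoef \<nu> m"
  and "bcoef \<nu> (Suc m) * real (Suc m) = - bcoef (\<nu> + 1) m"
proof -
 have p: "0 < real m + \<nu> + 1" using assms by (simp add: add_nonneg_pos)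
 have G: "Gamma (real m + \<nu> + 1 + 1) = (real m + \<nu> + 1) * Gamma (real m + \<nu> + 1)"
  by (rule Gamma_plus1) (use p in \<open>auto elim!: nonpos_Ints_cases\<close>)
 have e: "real (Suc m) + \<nu> + 1 = real m + \<nu> + 1 + 1" "real m + (\<nu> + 1) + 1 = real m + \<nu> + 1 + 1" by simp_all
 have g: "Gamma (real m + \<nu> + 1) \<noteq> 0" using Gamma_real_pos[OF p] by simp
 have r: "A / (F * (q * h)) * q = A / (F * h)" if "q \<noteq> 0" for A F q h :: real using that by simp
 show 2: "bcoef (\<nu> + 1) m * (real m + \<nu> + 1) = bcoef \<nu> m"
  unfolding bcoef_def e G by (rule r) (use p in simp)
 have r': "A / (q * F * h) * q = A / (F * h)" if "q \<noteq> 0" for A F q h :: real using that by simp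
 have "(-1) ^ Suc m / (fact (Suc m) * Gamma (real (Suc m) + \<nu> + 1)) * real (Suc m) = (-1) ^ Suc m / (fact m * Gamma (real (Suc m) + \<nu> + 1))"
  unfolding fact_Suc by (rule r') simp
 thus 3: "bcoef \<nu> (Suc m) * real (Suc m) = - bcoef (\<nu> + 1) m" unfolding bcoef_def e by simp
 show "bcoef \<nu> (Suc m) * (real (Suc m) * (real m + \<nu> + 1)) = - bcoef \<nu> m"
  unfolding mult.assoc[symmetric] 3 using 2 by simp
qed

lemma bser_summable: assumes "-1 < \<nu>" shows "summable (\<lambda>m. bcoef \<nu> m * y ^ m)"
proof (rule summable_ratio_test[of "1 / 2" "nat \<lceil>2 * \<bar>y\<bar>\<rceil> + 1"])
 fix m assume m: "nat \<lceil>2 * \<bar>y\<bar>\<rceil> + 1 \<le> m"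
 hence m1: "2 * \<bar>y\<bar> \<le> real m" "1 \<le> real m" by linarith+
 define a where "a = real (Suc m) * (real m + \<nu> + 1)"
 have "1 * real m \<le> a" unfolding a_def using assms m1 by (intro mult_mono) auto
 hence a: "2 * \<bar>y\<bar> \<le> a" "0 < a" using m1 by linarith+
 have "bcoef \<nu> (Suc m) = - bcoef \<nu> m / a" using bcoef_Suc(1)[OF assms, of m] a(2) unfolding a_def[symmetric] by (simp add: field_simps)
 hence "norm (bcoef \<nu> (Suc m) * y ^ Suc m) = norm (bcoef \<nu> m * y ^ m) * (\<bar>y\<bar> / a)" using a by (simp add: abs_mult)
 also have "\<dots> \<le> norm (bcoef \<nu> m * y ^ m) * (1 / 2)" using a by (intro mult_left_mono) (auto simp: divide_le_eq)
 finally show "norm (bcoef \<nu> (Suc m) * y ^ Suc m) \<le> 1 / 2 * norm (bcoef \<nu> m * y ^ m)" by simp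
qed simp

lemma bser_deriv: assumes "-1 < \<nu>" shows "DERIV (bser \<nu>) y :> - bser (\<nu> + 1) y"
proof -
 have "DERIV (\<lambda>y. \<Sum>m. bcoef \<nu> m * y ^ m) y :> (\<Sum>m. diffs (bcoef \<nu>) m * y ^ m)"
  by (rule termdiffs_strong_converges_everywhere[OF bser_summable[OF assms]])
 also have "(\<Sum>m. diffs (bcoef \<nu>) m * y ^ m) = (\<Sum>m. - (bcoef (\<nu> + 1) m * y ^ m))"
  using bcoef_Suc(3)[OF assms] by (simp add: diffs_def mult.commute)
 also have "\<dots> = - bser (\<nu> + 1) y" unfolding bser_def using assms by (intro suminf_minus bser_summable) simp
 finally show ?thesis by (simp add: bser_def[abs_def])
qed

text \<open>Comparison of coefficients, where the series for \<nu> + 2 is shifted by one place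
  through its factor y. This is the three term recurrence of the Bessel functions; with
  \<open>bser_deriv\<close> it becomes the Bessel equation.\<close>

lemma bser_recurrence: assumes "-1 < \<nu>" shows "y * bser (\<nu> + 2) y - (\<nu> + 1) * bser (\<nu> + 1) y + bser \<nu> y = 0"
proof -
 have s: "summable (\<lambda>m. bcoef \<nu> m * y ^ m)" "summable (\<lambda>m. bcoef (\<nu> + 1) m * y ^ m)" "summable (\<lambda>m. bcoef (\<nu> + 2) m * y ^ m)"
  using assms by (auto intro!: bser_summable)
 have h: "(\<lambda>m. bcoef \<nu> (Suc m) * y ^ Suc m) sums (bser \<nu> y - bcoef \<nu> 0)"
  "(\<lambda>m. bcoef (\<nu> + 1) (Suc m) * y ^ Suc m) sums (bser (\<nu> + 1) y - bcoef (\<nu> + 1) 0)"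
  using sums_Suc_iff[of "\<lambda>m. bcoef \<nu> m * y ^ m" "bser \<nu> y - bcoef \<nu> 0"] summable_sums[OF s(1)]
   sums_Suc_iff[of "\<lambda>m. bcoef (\<nu> + 1) m * y ^ m" "bser (\<nu> + 1) y - bcoef (\<nu> + 1) 0"] summable_sums[OF s(2)]
  by (simp_all add: bser_def)
 have t: "(\<lambda>m. y * (bcoef (\<nu> + 2) m * y ^ m)) sums (y * bser (\<nu> + 2) y)"
  unfolding bser_def by (intro sums_mult summable_sums s(3))
 have "(\<lambda>m. y * (bcoef (\<nu> + 2) m * y ^ m) - (\<nu> + 1) * (bcoef (\<nu> + 1) (Suc m) * y ^ Suc m) + bcoef \<nu> (Suc m) * y ^ Suc m)
  sums (y * bser (\<nu> + 2) y - (\<nu> + 1) * (bser (\<nu> + 1) y - bcoef (\<nu> + 1) 0) + (bser \<nu> y - bcoef \<nu> 0))"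
  by (intro sums_add sums_diff sums_mult h t)
 moreover have "y * (bcoef (\<nu> + 2) m * y ^ m) - (\<nu> + 1) * (bcoef (\<nu> + 1) (Suc m) * y ^ Suc m) + bcoef \<nu> (Suc m) * y ^ Suc m = 0" for m
 proof -
  have a: "bcoef (\<nu> + 2) m = - (bcoef (\<nu> + 1) (Suc m) * real (Suc m))"
   using bcoef_Suc(3)[of "\<nu> + 1" m] assms by (simp add: add.assoc)
  have b: "bcoef \<nu> (Suc m) = bcoef (\<nu> + 1) (Suc m) * (real (Suc m) + \<nu> + 1)"
   using bcoef_Suc(2)[OF assms, of "Suc m"] by simp
  show ?thesis unfolding a b by (simp add: algebra_simps)
 qed
 ultimately have "(\<lambda>m::nat. 0) sums (y * bser (\<nu> + 2) y - (\<nu> + 1) * (bser (\<nu> + 1) y - bcoef (\<nu> + 1) 0) + (bser \<nu> y - bcoef \<nu> 0))" by simp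
 hence "y * bser (\<nu> + 2) y - (\<nu> + 1) * (bser (\<nu> + 1) y - bcoef (\<nu> + 1) 0) + (bser \<nu> y - bcoef \<nu> 0) = 0"
  using sums_unique2[OF _ sums_zero] by blast
 moreover have "(\<nu> + 1) * bcoef (\<nu> + 1) 0 = bcoef \<nu> 0" using bcoef_Suc(2)[OF assms, of 0] by (simp add: mult.commute)
 ultimately show ?thesis by (simp add: algebra_simps)
qed

lemma bg_deriv: assumes "-1 < \<nu>" shows "DERIV (bg \<nu>) x :> - (x * bk \<nu> x)"
proof -
 have "DERIV (\<lambda>x. bser \<nu> (x^2 / 4)) x :> - bser (\<nu> + 1) (x^2 / 4) * (2 * x / 4)"
  by (rule DERIV_chain2[OF bser_deriv[OF assms]]) (auto intro!: derivative_eq_intros)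
 thus ?thesis by (simp add: bg_def[abs_def] bk_def mult_ac)
qed

lemma bessel_ode_bg: assumes "-1/2 \<le> \<nu>" shows "bessel_ode (2 * \<nu> + 1) (bg \<nu>) (bk \<nu>)"
proof
 have \<nu>: "-1 < \<nu>" using assms by simp
 show "0 \<le> 2 * \<nu> + 1" using assms by simp
 show "DERIV (bg \<nu>) x :> - (x * bk \<nu> x)" for x by (rule bg_deriv[OF \<nu>])
 have k: "DERIV (bk \<nu>) x :> - (x * bk (\<nu> + 1) x) / 2" for x
 proof -
  have "bk \<nu> = (\<lambda>x. bg (\<nu> + 1) x / 2)" by (simp add: fun_eq_iff bk_def)
  moreover have "DERIV (\<lambda>x. bg (\<nu> + 1) x / 2) x :> - (x * bk (\<nu> + 1) x) / 2"
   by (rule DERIV_cdivide[OF bg_deriv]) (use \<nu> in simp)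
  ultimately show ?thesis by (simp only:)
 qed
 show "isCont (bk \<nu>) x" for x by (rule DERIV_isCont[OF k])
 show "DERIV (\<lambda>x. x * bk \<nu> x) x :> bg \<nu> x - (2 * \<nu> + 1) * bk \<nu> x" for x
 proof -
  have "DERIV (\<lambda>x. x * bk \<nu> x) x :> x * (- (x * bk (\<nu> + 1) x) / 2) + 1 * bk \<nu> x"
   by (rule DERIV_mult'[OF DERIV_ident k])
  moreover have "x * (- (x * bk (\<nu> + 1) x) / 2) + 1 * bk \<nu> x = bg \<nu> x - (2 * \<nu> + 1) * bk \<nu> x"
   using bser_recurrence[OF \<nu>, of "x^2 / 4"] unfolding bk_def bg_def by (simp add: add.assoc field_simps power2_eq_square)
  ultimately show ?thesis by simp
 qed
 show "0 < bg \<nu> 0"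
  using \<nu> Gamma_real_pos[of "\<nu> + 1"] powser_zero[of "bcoef \<nu>"] by (simp add: bg_def bser_def bcoef_def[of _ 0])
qed

lemma bessel_J_bg: assumes "-1 < \<nu>" "0 < x" shows "bessel_J \<nu> x = (x / 2) powr \<nu> * bg \<nu> x"
proof -
 have "(-1) ^ m / (fact m * Gamma (real m + \<nu> + 1)) * (x / 2) powr (2 * real m + \<nu>) = (x / 2) powr \<nu> * (bcoef \<nu> m * (x^2 / 4) ^ m)" for m
 proof -
  have "(x / 2) powr (2 * real m + \<nu>) = (x / 2) powr \<nu> * (x / 2) powr (real (2 * m))" by (simp add: powr_add)
  also have "(x / 2) powr (real (2 * m)) = (x^2 / 4) ^ m"
   using assms(2) by (subst powr_realpow) (simp_all add: power_mult power_divide)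
  finally show ?thesis by (simp add: bcoef_def)
 qed
 thus ?thesis unfolding bessel_J_def bg_def bser_def using suminf_mult[OF bser_summable[OF assms(1)]] by simp
qed

section \<open>Identification with the Bessel objects of the statement\<close>

locale bessel_param =
 fixes \<nu> :: real
 assumes \<nu>: "-1/2 \<le> \<nu>"
begin

sublocale b: bessel_ode "2 * \<nu> + 1" "bg \<nu>" "bk \<nu>" by (rule bessel_ode_bg[OF \<nu>])

text \<open>The recursion searches only x > 0, where the power in \<open>bessel_J_bg\<close> has no
  zeros.\<close>

lemma bessel_zero_eq: "bessel_zero \<nu> n = b.z n"
proof (induction n)
 case (Suc n)
 have "b.z n < x \<and> bessel_J \<nu> x = 0 \<longleftrightarrow> b.z n < x \<and> bg \<nu> x = 0" for x
  using bessel_J_bg[of \<nu> x] \<nu> b.z_nonneg[of n] by auto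
 thus ?case by (simp only: bessel_zero.simps b.z.simps Suc)
qed simp

text \<open>The powers of l / 2 and of x cancel. From J_(\<nu> + 1) at l only l *
  \<open>bk \<nu> l\<close> remains, which is the origin of \<open>amp\<close>.\<close>

lemma bessel_phi_eq: assumes n: "1 \<le> n" and x: "0 < x" shows "bessel_phi \<nu> n x = b.amp n * b.\<psi> n x"
proof -
 define l where "l = b.z n"
 have l: "0 < l" using b.z_pos[OF n] by (simp add: l_def)
 have J1: "bessel_J (\<nu> + 1) l = (l / 2) powr \<nu> * (l * bk \<nu> l)"
 proof -
  have "bessel_J (\<nu> + 1) l = (l / 2) powr (\<nu> + 1) * bg (\<nu> + 1) l" using \<nu> l by (intro bessel_J_bg) auto
  also have "(l / 2) powr (\<nu> + 1) = (l / 2) powr \<nu> * (l / 2)" using l by (simp add: powr_add)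
  finally show ?thesis by (simp add: bk_def)
 qed
 have J: "bessel_J \<nu> (l * x) = (l / 2) powr \<nu> * x powr \<nu> * bg \<nu> (l * x)"
 proof -
  have "bessel_J \<nu> (l * x) = (l * x / 2) powr \<nu> * bg \<nu> (l * x)" using \<nu> l x by (intro bessel_J_bg) auto
  also have "(l * x / 2) powr \<nu> = (l / 2 * x) powr \<nu>" by simp
  also have "\<dots> = (l / 2) powr \<nu> * x powr \<nu>" by (rule powr_mult)
  finally show ?thesis .
 qed
 have xx: "x powr - \<nu> * x powr \<nu> = 1" using x by (simp add: powr_add[symmetric])
 have "bessel_phi \<nu> n x = sqrt 2 / \<bar>(l / 2) powr \<nu> * (l * bk \<nu> l)\<bar> * ((l / 2) powr \<nu> * (x powr - \<nu> * x powr \<nu>) * bg \<nu> (l * x))"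
  unfolding bessel_phi_def bessel_zero_eq l_def[symmetric] J1 J by (simp only: mult_ac)
 also have "\<dots> = sqrt 2 / (l * \<bar>bk \<nu> l\<bar>) * bg \<nu> (l * x)"
  unfolding xx using l by (simp add: abs_mult)
 finally show ?thesis by (simp add: b.amp_def b.\<psi>_def l_def)
qed

lemma bessel_varphi_eq: "1 \<le> n \<Longrightarrow> 0 < x \<Longrightarrow> bessel_varphi \<nu> n x = b.f n x"
 by (simp add: bessel_varphi_def b.f_def bessel_phi_eq)

text \<open>\<open>bessel_phi_eq\<close> equates the densities for x > 0, which covers the whole
  space of the underlying measure.\<close>

lemma bessel_eta_eq: "bessel_eta \<nu> = unit_density b.wt" unfolding bessel_eta_def unit_density_def
 unfolding density_def by (rule measure_of_eq[OF sets.space_closed], rule nn_integral_cong)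
  (auto simp: space_restrict_space b.wt_def bessel_phi_eq)

end

text \<open>The transforms of the statement and \<open>Riesz a\<close> may be different
  representatives of the same sums. All requirements are stable under changes on null sets, given
  measurability.\<close>

lemma (in mode_family) Lp_bounded_on_L2_Riesz:
 assumes p: "1 < p" and a: "0 \<le> a"
  and R: "\<And>i \<phi>. \<phi> \<in> Lp 2 PM \<Longrightarrow> R i \<phi> \<in> Lp 2 PM"
   "\<And>i \<phi>. \<phi> \<in> Lp 2 PM \<Longrightarrow> AE x in PM. R i \<phi> x = Riesz a i \<phi> x"
 shows "Lp_bounded_on_L2 PM R p (18 * (max p (p / (p - 1)) - 1))"
proof
 show "1 < p" "0 \<le> 18 * (max p (p / (p - 1)) - 1)" using p by auto
 show "R i \<phi> \<in> Lp 2 PM" if "\<phi> \<in> Lp 2 PM" for i \<phi> by (rule R(1)[OF that])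
 show "AE x in PM. R i (\<lambda>x. \<phi> x + \<psi> x) x = R i \<phi> x + R i \<psi> x" if "\<phi> \<in> Lp 2 PM" "\<psi> \<in> Lp 2 PM" for i \<phi> \<psi>
 proof -
  have "(\<lambda>x. \<phi> x + \<psi> x) \<in> Lp 2 PM" by (rule Lp_add(1)[OF that]) simp
  from R(2)[OF this, of i] R(2)[OF that(1), of i] R(2)[OF that(2), of i] Riesz_add[OF a that, of i]
  show ?thesis by eventually_elim simp
 qed
 show "AE x in PM. R i (\<lambda>x. c * \<phi> x) x = c * R i \<phi> x" if "\<phi> \<in> Lp 2 PM" for i c \<phi>
 proof -
  have "(\<lambda>x. c * \<phi> x) \<in> Lp 2 PM" by (rule Lp_cmult(1)[OF that]) simp
  from R(2)[OF this, of i] R(2)[OF that, of i] Riesz_cmult[OF a that, of i c]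
  show ?thesis by eventually_elim simp
 qed
 show "l2_vec R \<phi> \<in> Lp p PM \<and> Lp_norm p PM (l2_vec R \<phi>) \<le> 18 * (max p (p / (p - 1)) - 1) * Lp_norm p PM \<phi>"
  if \<phi>: "\<phi> \<in> Lp 2 PM" "\<phi> \<in> Lp p PM" for \<phi>
 proof -
  have "AE x in PM. \<forall>i\<in>UNIV. R i \<phi> x = Riesz a i \<phi> x" by (rule AE_finite_allI) (use R(2)[OF \<phi>(1)] in auto)
  hence ae: "AE x in PM. l2_vec R \<phi> x = l2_vec (Riesz a) \<phi> x" by eventually_elim (simp add: l2_vec_def)
  have m: "l2_vec R \<phi> \<in> borel_measurable PM" "l2_vec (Riesz a) \<phi> \<in> borel_measurable PM"
   by (intro l2_vec_measurable Lp_meas[OF R(1)[OF \<phi>(1)]], intro l2_vec_measurable Lp_meas[OF Riesz_Lp[OF a \<phi>(1)]])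
  show ?thesis using Lp_cong_AE[OF ae m, of p] Riesz_bound[OF p a \<phi>] by simp
 qed
qed

locale bessel_family =
 fixes \<nu> :: "'d::finite \<Rightarrow> real"
 assumes \<nu>: "\<And>i. -1/2 \<le> \<nu> i"
begin

sublocale p: bessel_param "\<nu> i" for i by unfold_locales (rule \<nu>)

sublocale mf: mode_family "\<lambda>i. p.b.wt i" "\<lambda>i. p.b.om i" "\<lambda>i. p.b.V i" "\<lambda>i. p.b.f i" "\<lambda>i. p.b.f' i" "\<lambda>i. p.b.L i"
 by (rule mode_family.intro) (rule p.b.weighted_modes_bessel)

lemma eta_prod_eq: "eta_prod \<nu> = mf.PM" unfolding eta_prod_def mf.PM_def p.bessel_eta_eq ..

lemma multi_indices_eq: "multi_indices = Collect mf.idx" by (auto simp: multi_indices_def mf.idx_def)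

lemma varphi_prod_eq:
 assumes "mf.idx n" "x \<in> space mf.PM" shows "varphi_prod \<nu> n x = mf.H None n x"
 unfolding varphi_prod_def mf.H_def mf.fac_def using assms
 by (intro prod.cong refl) (auto simp: p.bessel_varphi_eq mf.idx_def mf.space_PM)

text \<open>The two product functions agree on the open cube, hence near the given point along
  direction i.\<close>

lemma partial_deriv_eq:
 assumes n: "mf.idx n" and x: "x \<in> space mf.PM" shows "partial_deriv i (varphi_prod \<nu> n) x = mf.H (Some i) n x"
proof -
 have xi: "0 < x i" "x i < 1" using x by (auto simp: mf.space_PM)
 have "DERIV (\<lambda>t. mf.H None n (x(i := t))) (x i) :> mf.H1 i None n x"
  using mf.H_deriv[OF n xi, of None x i] by simp
 hence "DERIV (\<lambda>t. varphi_prod \<nu> n (x(i := t))) (x i) :> mf.H (Some i) n x" unfolding mf.H1_None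
 proof (rule has_field_derivative_transform_within_open)
  show "open {0<..<1::real}" "x i \<in> {0<..<1}" using xi by auto
  fix t :: real assume "t \<in> {0<..<1}"
  hence "x(i := t) \<in> space mf.PM" using x by (auto simp: mf.space_PM)
  from varphi_prod_eq[OF n this] show "mf.H None n (x(i := t)) = varphi_prod \<nu> n (x(i := t))" by simp
 qed
 thus ?thesis unfolding partial_deriv_def by (rule DERIV_imp_deriv)
qed

lemma fourier_coeff_eq:
 assumes n: "mf.idx n" shows "fourier_coeff \<nu> \<phi> n = mf.O.coef None \<phi> n"
proof -
 have "fourier_coeff \<nu> \<phi> n = (LINT x|mf.PM. \<phi> x * complex_of_real (mf.H None n x))"
  unfolding fourier_coeff_def eta_prod_eq by (rule Bochner_Integration.integral_cong) (simp_all add: varphi_prod_eq[OF n])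
 thus ?thesis by (simp add: mf.O.coef_def mf.NN_def)
qed

text \<open>With this \<open>a\<close> the shifts in the eigenvalues \<open>L\<close> cancel, and
  \<open>mu\<close> becomes the root of the sum of the squared zeros.\<close>

lemma riesz_AE:
 assumes \<phi>: "\<phi> \<in> Lp 2 mf.PM" and a: "a = (\<Sum>j\<in>UNIV. (p.b.z j 1)^2)"
 shows "riesz \<nu> i \<phi> \<in> Lp 2 mf.PM" "AE x in mf.PM. riesz \<nu> i \<phi> x = mf.Riesz a i \<phi> x"
proof -
 have a0: "0 \<le> a" unfolding a by (intro sum_nonneg) simp
 let ?v = "\<lambda>n x. complex_of_real ((\<Sum>j\<in>UNIV. (bessel_zero (\<nu> j) (n j))^2) powr (-1/2)) *
      fourier_coeff \<nu> \<phi> n * complex_of_real (partial_deriv i (varphi_prod \<nu> n) x)"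
 have mu: "(\<Sum>j\<in>UNIV. (bessel_zero (\<nu> j) (n j))^2) powr (-1/2) = 1 / mf.mu a n" for n
 proof -
  have "(\<Sum>j\<in>UNIV. (bessel_zero (\<nu> j) (n j))^2) = a + (\<Sum>i\<in>UNIV. p.b.L i (n i))"
   by (simp add: a p.bessel_zero_eq p.b.L_def sum_subtractf)
  moreover have "0 \<le> (\<Sum>j\<in>UNIV. (bessel_zero (\<nu> j) (n j))^2)" by (intro sum_nonneg) simp
  ultimately show ?thesis by (simp add: mf.mu_def powr_minus powr_half_sqrt inverse_eq_divide)
 qed
 have h: "has_L2_sum mf.PM ?v multi_indices (mf.Riesz a i \<phi>)" unfolding multi_indices_eq
 proof (rule has_L2_sum_transfer[OF mf.Riesz_has_L2_sum[OF a0 \<phi>, of i]])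
  fix n x assume "n \<in> Collect mf.idx" and x: "x \<in> space mf.PM"
  hence n: "mf.idx n" by simp
  show "?v n x = mf.rcoef a \<phi> n * complex_of_real (mf.H (Some i) n x)"
   unfolding mu fourier_coeff_eq[OF n] partial_deriv_eq[OF n x] mf.rcoef_def ..
 qed auto
 hence h': "has_L2_sum mf.PM ?v multi_indices (riesz \<nu> i \<phi>)"
  unfolding riesz_def eta_prod_eq by (intro L2_sum_has_L2_sum exI)
 thus "riesz \<nu> i \<phi> \<in> Lp 2 mf.PM" by (simp add: has_L2_sum_def)
 show "AE x in mf.PM. riesz \<nu> i \<phi> x = mf.Riesz a i \<phi> x" by (rule has_L2_sum_unique[OF h' h])
qed

text \<open>Here \<open>a\<close> is 0. The index (1, ..., 1), absent from this series, contributes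
  nothing to the full one since its derivatives vanish.\<close>

lemma riesz_M_AE:
 assumes \<phi>: "\<phi> \<in> Lp 2 mf.PM"
 shows "riesz_M \<nu> i \<phi> \<in> Lp 2 mf.PM" "AE x in mf.PM. riesz_M \<nu> i \<phi> x = mf.Riesz 0 i \<phi> x"
proof -
 let ?v = "\<lambda>n x. complex_of_real ((\<Sum>j\<in>UNIV. (bessel_zero (\<nu> j) (n j))^2 - (bessel_zero (\<nu> j) 1)^2) powr (-1/2)) *
      fourier_coeff \<nu> \<phi> n * complex_of_real (partial_deriv i (varphi_prod \<nu> n) x)"
 have mu: "(\<Sum>j\<in>UNIV. (bessel_zero (\<nu> j) (n j))^2 - (bessel_zero (\<nu> j) 1)^2) powr (-1/2) = 1 / mf.mu 0 n" if n: "mf.idx n" for n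
 proof -
  have "(\<Sum>j\<in>UNIV. (bessel_zero (\<nu> j) (n j))^2 - (bessel_zero (\<nu> j) 1)^2) = (\<Sum>i\<in>UNIV. p.b.L i (n i))"
   by (simp only: p.bessel_zero_eq p.b.L_def)
  moreover have "0 \<le> (\<Sum>i\<in>UNIV. p.b.L i (n i))"
   using mf.L_le_mu(2)[OF order_refl n] zero_le_power2[of "mf.mu 0 n"] by simp
  ultimately show ?thesis by (simp add: mf.mu_def powr_minus powr_half_sqrt inverse_eq_divide)
 qed
 have h: "has_L2_sum mf.PM ?v (multi_indices - {\<lambda>_. 1}) (mf.Riesz 0 i \<phi>)" unfolding multi_indices_eq
 proof (rule has_L2_sum_transfer[OF mf.Riesz_has_L2_sum[OF order_refl \<phi>, of i]])
  show "finite (Collect mf.idx - (Collect mf.idx - {\<lambda>_. 1}))" by (rule finite_subset[of _ "{\<lambda>_. 1}"]) auto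
  fix n x assume n: "n \<in> Collect mf.idx - (Collect mf.idx - {\<lambda>_. 1})" and x: "x \<in> space mf.PM"
  hence "n = (\<lambda>_. 1)" by auto
  moreover have "mf.H (Some i) (\<lambda>_. 1) x = 0" by (rule mf.H_Some_zero[OF refl x])
  ultimately show "mf.rcoef 0 \<phi> n * complex_of_real (mf.H (Some i) n x) = 0" by simp
 next
  fix n x assume "n \<in> Collect mf.idx - {\<lambda>_. 1}" and x: "x \<in> space mf.PM"
  hence n: "mf.idx n" by simp
  show "?v n x = mf.rcoef 0 \<phi> n * complex_of_real (mf.H (Some i) n x)"
   unfolding mu[OF n] fourier_coeff_eq[OF n] partial_deriv_eq[OF n x] mf.rcoef_def ..
 qed auto
 hence h': "has_L2_sum mf.PM ?v (multi_indices - {\<lambda>_. 1}) (riesz_M \<nu> i \<phi>)"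
  unfolding riesz_M_def eta_prod_eq by (intro L2_sum_has_L2_sum exI)
 thus "riesz_M \<nu> i \<phi> \<in> Lp 2 mf.PM" by (simp add: has_L2_sum_def)
 show "AE x in mf.PM. riesz_M \<nu> i \<phi> x = mf.Riesz 0 i \<phi> x" by (rule has_L2_sum_unique[OF h' h])
qed

lemma Lp_bounded_riesz:
 assumes p: "1 < p"
 shows "Lp_bounded_on_L2 (eta_prod \<nu>) (riesz \<nu>) p (18 * (max p (p / (p - 1)) - 1))"
  and "Lp_bounded_on_L2 (eta_prod \<nu>) (riesz_M \<nu>) p (18 * (max p (p / (p - 1)) - 1))"
proof -
 have "0 \<le> (\<Sum>j\<in>UNIV. (p.b.z j 1)^2)" by (intro sum_nonneg) simp
 from mf.Lp_bounded_on_L2_Riesz[OF p this riesz_AE(1)[OF _ refl] riesz_AE(2)[OF _ refl]]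
 show "Lp_bounded_on_L2 (eta_prod \<nu>) (riesz \<nu>) p (18 * (max p (p / (p - 1)) - 1))" unfolding eta_prod_eq .
 from mf.Lp_bounded_on_L2_Riesz[OF p order_refl riesz_M_AE]
 show "Lp_bounded_on_L2 (eta_prod \<nu>) (riesz_M \<nu>) p (18 * (max p (p / (p - 1)) - 1))" unfolding eta_prod_eq .
qed

end

theorem theorem6p5:
 fixes \<nu> :: "'d::finite \<Rightarrow> real" and p :: real
 assumes "\<And>i. -1/2 \<le> \<nu> i" and "1 < p"
 shows "(\<forall>i. extends_uniquely_Lp p (eta_prod \<nu>) (riesz \<nu> i)) \<and>
  (\<forall>i. extends_uniquely_Lp p (eta_prod \<nu>) (riesz_M \<nu> i)) \<and>
  (\<forall>T. (\<forall>i. Lp_extension p (eta_prod \<nu>) (riesz \<nu> i) (T i)) \<longrightarrow>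
   Lp_op_norm p (eta_prod \<nu>) (l2_vec T) \<le> ennreal (48 * (max p (p / (p - 1)) - 1))) \<and>
  (\<forall>T. (\<forall>i. Lp_extension p (eta_prod \<nu>) (riesz_M \<nu> i) (T i)) \<longrightarrow>
   Lp_op_norm p (eta_prod \<nu>) (l2_vec T) \<le> ennreal (48 * (max p (p / (p - 1)) - 1)))"
proof -
 interpret bessel_family \<nu> by unfold_locales (rule assms(1))
 interpret R: Lp_bounded_on_L2 "eta_prod \<nu>" "riesz \<nu>" p "18 * (max p (p / (p - 1)) - 1)"
  by (rule Lp_bounded_riesz(1)[OF assms(2)])
 interpret RM: Lp_bounded_on_L2 "eta_prod \<nu>" "riesz_M \<nu>" p "18 * (max p (p / (p - 1)) - 1)"
  by (rule Lp_bounded_riesz(2)[OF assms(2)])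
 \<comment> \<open>The constant 18 of the embedding lies below the asserted 48.\<close>
 have le: "ennreal (18 * (max p (p / (p - 1)) - 1)) \<le> ennreal (48 * (max p (p / (p - 1)) - 1))"
  using R.C by (intro ennreal_leI) simp
 show ?thesis
  by (intro conjI allI impI R.extends_uniquely RM.extends_uniquely order_trans[OF R.op_norm_le le] order_trans[OF RM.op_norm_le le]) auto
qed

end
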